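(* Let $n\ge 2$ be an integer, $(a,b)\subset\mathbb{R}$ an open interval and $f:(a,b)\to\mathbb{R}$. Then the following are equivalent: (1) $f$ is $n$-monotone. (2) For any $a<x_0<x_1<\cdots<x_{2n-1}<b$ and $q\in\mathbb{R}_{n-1}[x]$, $[x_0,x_1,\ldots,x_{2n-1}]_{fq^2}\ge 0$. (3) For any $a<x_0<x_1<\cdots<x_{2n-1}<b$ and $q\in\mathbb{C}_{n-1}[x]$, $[x_0,x_1,\ldots,x_{2n-1}]_{fN(q)}\ge 0$. (4) $f\in C^1(a,b)$ and for any $a<x_1<x_2<\cdots<x_n<b$ and $q\in\mathbb{C}_{n-1}[x]$, $[x_1,x_1,x_2,x_2,\ldots,x_n,x_n]_{fN(q)}\ge 0$. (5) $f\in C^1(a,b)$ and for any $a<x_1<x_2<\cdots<x_n<b$ the Loewner matrix $([x_i,x_j]_f)_{1\le i,j\le n}$ is positive semidefinite. (6) $f\in C^1(a,b)$ and for any $a<x_1<x_2<\cdots<x_n<b$ the extended Loewner matrix $([x_1,x_2,\ldots,x_i,x_1,x_2,\ldots,x_j]_f)_{1\le i,j\le n}$ is positive semidefinite. (7) $f\in C^{2n-3}(a,b)$, $f^{(2n-3)}$ is convex, and for every $q\in\mathbb{C}_{n-1}[x]$ the derivative $(fN(q))^{(2n-1)}$ exists almost everywhere and is non-negative. (8) $f\in C^{2n-3}(a,b)$, $f^{(2n-3)}$ is convex, and the matrix $$\left(\frac{f^{(i+j-1)}(t)}{(i+j-1)!}\right)_{1\le i,j\le n}$$ exists and is positive semidefinite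 for almost every $t\in(a,b)$.
   Context: Matrices are ordered by the Loewner order: $A\le B$ iff $B-A$ is positive semidefinite. $f:(a,b)\to\mathbb{R}$ is $n$-monotone if for all $n\times n$ (complex) Hermitian matrices $A\le B$ with all eigenvalues in $(a,b)$ one has $f(A)\le f(B)$ (functional calculus). $\mathbb{R}_m[x]$, $\mathbb{C}_m[x]$ denote real, resp. complex, polynomials of degree at most $m$. For $q\in\mathbb{C}[x]$, $q^*$ is the polynomial with complex-conjugated coefficients and $N(q)=qq^*$ (which has real coefficients and satisfies $N(q)(x)=|q(x)|^2$ for real $x$). For pairwise distinct points, $[\lambda_0,\ldots,\lambda_m]_g=\sum_{i=0}^{m}\frac{g(\lambda_i)}{\prod_{j\ne i}(\lambda_i-\lambda_j)}$. With repeated points: define $\langle g,\frac{1}{(\cdot-c)^{k+1}}\rangle_L=\frac{g^{(k)}(c)}{k!}$ for $g$ that is $k$ times differentiable at $c$, extend linearly (via partial fractions) to rational functions vanishing at infinity, and set $[\lambda_0,\ldots,\lambda_m]_g=\langle g,\frac{1}{(\cdot-\lambda_0)\cdots(\cdot-\lambda_m)}\rangle_L$; this agrees with the previous formula for distinct points, and e.g. $[x,x]_g=g'(x)$. In the conditions using $f\in C^1$ each point occurs at most twice, so only first derivatives are needed. When $f^{(2n-3)}$ is convex, its derivative $f^{(2n-2)}$ exists off a countable set and is non-decreasing where it exists; $f^{(2n-1)}(t)$ means the derivative at $t$ of this almost everywhere defined function (and similarly for $(fN(q))^{(2n-1)}$), which exists for almost every $t$. "Almost everywhere" refers to Lebesgue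 measure. *)

theory Defs
  imports "HOL-Analysis.Analysis" "Jordan_Normal_Form.Spectral_Radius"
begin

section \<open>Loewner order, functional calculus, matrix monotonicity\<close>

definition hermitian_mat :: "'a :: conjugatable_field mat \<Rightarrow> bool" where
  "hermitian_mat A \<longleftrightarrow> square_mat A \<and> mat_adjoint A = A"

text \<open>On \<^typ>\<open>real\<close> conjugation is the identity, so this covers real symmetric matrices (tested
  on real vectors) as well as complex Hermitian ones. On \<^typ>\<open>complex\<close>, \<open>0 \<le> z\<close> means that
  \<open>z\<close> is real and non-negative.\<close>
definition psd_mat :: "'a :: conjugatable_ordered_field mat \<Rightarrow> bool" where
  "psd_mat A \<longleftrightarrow> hermitian_mat A \<and> (\<forall>v \<in> carrier_vec (dim_row A). 0 \<le> (A *\<^sub>v v) \<bullet>c v)"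

definition loewner_le :: "complex mat \<Rightarrow> complex mat \<Rightarrow> bool" where
  "loewner_le A B \<longleftrightarrow> psd_mat (B - A)"

definition unitary_mat :: "complex mat \<Rightarrow> bool" where
  "unitary_mat U \<longleftrightarrow> square_mat U \<and> U * mat_adjoint U = 1\<^sub>m (dim_row U)"

text \<open>\<open>f(A)\<close> for Hermitian \<open>A\<close>: apply \<open>f\<close> to the diagonal of a unitary diagonalisation. The
  result does not depend on the diagonalisation chosen.\<close>
definition mat_fun :: "(real \<Rightarrow> real) \<Rightarrow> complex mat \<Rightarrow> complex mat" where
  "mat_fun f A = (let n = dim_row A in
     THE F. \<exists>U d. U \<in> carrier_mat n n \<and> unitary_mat U \<and>
       A = U * mat_diag n (\<lambda>i. complex_of_real (d i)) * mat_adjoint U \<and>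
       F = U * mat_diag n (\<lambda>i. complex_of_real (f (d i))) * mat_adjoint U)"

definition n_monotone :: "nat \<Rightarrow> real set \<Rightarrow> (real \<Rightarrow> real) \<Rightarrow> bool" where
  "n_monotone n I f \<longleftrightarrow>
     (\<forall>A \<in> carrier_mat n n. \<forall>B \<in> carrier_mat n n.
        hermitian_mat A \<and> hermitian_mat B \<and>
        spectrum A \<subseteq> complex_of_real ` I \<and> spectrum B \<subseteq> complex_of_real ` I \<and>
        loewner_le A B \<longrightarrow> loewner_le (mat_fun f A) (mat_fun f B))"


section \<open>Divided differences\<close>

text \<open>The coefficients \<open>\<alpha> c k\<close> of \<open>1 / (t - c)^(k+1)\<close> in the partial fraction decomposition
  of \<open>1 / \<Prod>c\<leftarrow>xs. (t - c)\<close>; unique once the meaningless indices are set to zero.\<close>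
definition partial_fraction_coeff :: "real list \<Rightarrow> real \<Rightarrow> nat \<Rightarrow> real" where
  "partial_fraction_coeff xs = (THE \<alpha>.
     (\<forall>c k. count_list xs c \<le> k \<longrightarrow> \<alpha> c k = 0) \<and>
     (\<forall>t. t \<notin> set xs \<longrightarrow>
        1 / (\<Prod>c\<leftarrow>xs. t - c) = (\<Sum>c\<in>set xs. \<Sum>k<count_list xs c. \<alpha> c k / (t - c) ^ (k + 1))))"

text \<open>The pairing of \<open>g\<close> with \<open>1 / \<Prod>c\<leftarrow>xs. (\<cdot> - c)\<close>, where \<open>1 / (\<cdot> - c)^(k+1)\<close> pairs with
  \<open>g\<close> to \<open>g\<^sup>(\<^sup>k\<^sup>)(c) / k!\<close>. Only the multiset of points in the list \<open>xs\<close> matters, and for pairwise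
  distinct points no derivative of \<open>g\<close> occurs.\<close>
definition divdiff :: "real list \<Rightarrow> (real \<Rightarrow> real) \<Rightarrow> real" where
  "divdiff xs g = (\<Sum>c\<in>set xs. \<Sum>k<count_list xs c.
     partial_fraction_coeff xs c k * ((deriv ^^ k) g c / fact k))"


section \<open>Polynomials and derivatives\<close>

text \<open>\<open>N(q) = q q\<^sup>*\<close> as a real polynomial: the coefficients of the product are real.\<close>
definition poly_N :: "complex poly \<Rightarrow> real poly" where
  "poly_N q = map_poly Re (q * map_poly cnj q)"

definition C_k_on :: "nat \<Rightarrow> real set \<Rightarrow> (real \<Rightarrow> real) \<Rightarrow> bool" where
  "C_k_on k I f \<longleftrightarrow> (\<forall>j<k. \<forall>t\<in>I. (deriv ^^ j) f differentiable (at t)) \<and>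
     continuous_on I ((deriv ^^ k) f)"

text \<open>Derivative of a partial function: difference quotients are taken inside the domain, and the
  result is defined at those points of the domain where their limit exists. The accumulation point
  requirement makes the limit unique.\<close>
definition partial_deriv :: "(real \<rightharpoonup> real) \<Rightarrow> (real \<rightharpoonup> real)" where
  "partial_deriv g = (\<lambda>t.
     if t \<in> dom g \<and> t islimpt dom g \<and>
        (\<exists>D. ((\<lambda>s. the (g s)) has_real_derivative D) (at t within dom g))
     then Some (THE D. ((\<lambda>s. the (g s)) has_real_derivative D) (at t within dom g))
     else None)"

text \<open>The \<open>k\<close>-th derivative of \<open>f\<close> on \<open>I\<close> as a partial function. For open \<open>I\<close> this is the
  ordinary derivative as long as the previous derivative exists on all of \<open>I\<close>; beyond that it is
  the derivative of an (almost everywhere defined) partial function.\<close>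
definition nth_deriv :: "nat \<Rightarrow> real set \<Rightarrow> (real \<Rightarrow> real) \<Rightarrow> (real \<rightharpoonup> real)" where
  "nth_deriv k I f = (partial_deriv ^^ k) ((\<lambda>t. Some (f t)) |` I)"

end

theory Submission
  imports Defs
begin

text \<open>
  All conditions are compared with the statement that \<open>f q\<^sup>2\<close> has non-negative divided
  differences of order \<open>2n - 1\<close> for every real polynomial \<open>q\<close> of degree less than \<open>n\<close>.

  Let \<open>D = diag \<lambda>\<close> and let \<open>D + v v\<^sup>T\<close> have the eigenvalues \<open>\<mu>\<close>. By the secular equation
  \<open>\<Sum> v\<^sub>i\<^sup>2 / (\<mu>\<^sub>k - \<lambda>\<^sub>i) = 1\<close>, the quadratic form of \<open>f(D + v v\<^sup>T) - f(D)\<close> at \<open>a\<close> is the divided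
  difference of \<open>f q\<^sup>2\<close> at the \<open>2n\<close> points \<open>\<lambda>\<close>, \<open>\<mu>\<close>, where \<open>q = \<Sum> a\<^sub>i v\<^sub>i \<Prod>\<^sub>j\<^sub>\<noteq>\<^sub>i (x - \<lambda>\<^sub>j)\<close>. Since any
  interlacing points are the eigenvalues of such a pair, monotonicity yields the divided differences;
  conversely, every inequality \<open>A \<le> B\<close> splits into rank-one steps, which are limits of generic ones.

  Coalescing points in pairs gives the conditions with doubled points, and the Loewner matrices are
  the quadratic form of \<open>q\<close> in the Lagrange and the Newton basis. For the way back, with \<open>g = f q\<^sup>2\<close>,
  \<open>P = \<Prod> (x - \<lambda>\<^sub>i)\<close> and \<open>Q = \<Prod> (x - \<mu>\<^sub>i)\<close>, the divided difference of \<open>g / (P - Q)\<close> at the roots of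
  \<open>(1 - t) P + t Q\<close> has as its derivative in \<open>t\<close> the divided difference of \<open>g\<close> with each root doubled.

  Taking \<open>q = 1\<close> shows that \<open>f\<^sup>(\<^sup>2\<^sup>n\<^sup>-\<^sup>3\<^sup>)\<close> is convex; its right derivative is non-decreasing, hence
  differentiable almost everywhere. In the other direction, a locally Lipschitz-from-below function
  with non-negative derivative almost everywhere is non-decreasing.
\<close>

section \<open>Divided differences at distinct points\<close>

text \<open>A complex \<open>q\<close> is reduced to real ones because \<open>N(q)\<close> is the
  sum of the squares of two real polynomials. The way back from doubled points works because at a
  root of one member of the pencil every other member is a multiple of \<open>P - Q\<close>. A
  divided difference at the roots of two members therefore splits into two, each at the roots of one
  of them. The obstacle in the conditions with almost everywhere derivatives is that a non-negative
  derivative almost everywhere does not make a function non-decreasing, as a downward jump shows.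
  The function in question is the right derivative of the derivative of order \<open>2n - 3\<close>
  of \<open>f q\<^sup>2\<close>. By Leibniz' rule its only term that may fail to be Lipschitz is a
  non-decreasing function times \<open>q\<^sup>2\<close>, so it can jump only upwards. Eigenvectors
  do not depend continuously on a matrix. The passage from generic rank-one steps to all of them
  therefore uses only the convergence of the entries: powers, polynomials and, by Weierstrass
  approximation, continuous functions of the matrices converge.\<close>

definition dd :: "real set \<Rightarrow> (real \<Rightarrow> real) \<Rightarrow> real" where
  "dd X g = (\<Sum>x\<in>X. g x / (\<Prod>y\<in>X - {x}. x - y))"

lemma dd_cong: "(\<And>x. x \<in> X \<Longrightarrow> g x = h x) \<Longrightarrow> dd X g = dd X h"
  by (simp add: dd_def)

lemma dd_add: "dd X (\<lambda>x. g x + h x) = dd X g + dd X h"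
  by (simp add: dd_def add_divide_distrib sum.distrib)

lemma dd_diff: "dd X (\<lambda>x. g x - h x) = dd X g - dd X h"
  by (simp add: dd_def diff_divide_distrib sum_subtractf)

lemma dd_cmult: "dd X (\<lambda>x. c * g x) = c * dd X g"
  by (simp add: dd_def sum_distrib_left)

lemma dd_divide: "dd X (\<lambda>x. g x / c) = dd X g / c"
  by (simp add: dd_def sum_divide_distrib field_simps)

text \<open>The factor vanishes at \<open>c\<close>, and at every other point it cancels the factor
  \<open>x - c\<close> that the new point adds to the denominator.\<close>

lemma dd_insert_mult:
  assumes "finite X" "c \<notin> X"
  shows "dd (insert c X) (\<lambda>t. (t - c) * g t) = dd X g"
proof -
  have "(x - c) * g x / (\<Prod>y\<in>insert c X - {x}. x - y) = g x / (\<Prod>y\<in>X - {x}. x - y)" if "x \<in> X" for x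
  proof -
    have "insert c X - {x} = insert c (X - {x})" using that assms by auto
    moreover have "x \<noteq> c" using that assms by auto
    ultimately show ?thesis using assms by simp
  qed
  then show ?thesis unfolding dd_def using assms by simp
qed

text \<open>Both terms on the left are written over all the points by inserting a linear factor; the
  two factors differ by the constant \<open>c - d\<close>.\<close>

lemma dd_rec:
  assumes "finite X" "c \<notin> X" "d \<notin> X" "c \<noteq> d"
  shows "dd (insert c X) g - dd (insert d X) g = (c - d) * dd (insert c (insert d X)) g"
proof -
  have "dd (insert c X) g = dd (insert d (insert c X)) (\<lambda>t. (t - d) * g t)"
    using dd_insert_mult[of "insert c X" d g] assms by auto
  moreover have "dd (insert d X) g = dd (insert c (insert d X)) (\<lambda>t. (t - c) * g t)"
    using dd_insert_mult[of "insert d X" c g] assms by auto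
  ultimately have "dd (insert c X) g - dd (insert d X) g
      = dd (insert c (insert d X)) (\<lambda>t. (t - d) * g t - (t - c) * g t)"
    by (simp add: dd_diff insert_commute)
  also have "(\<lambda>t. (t - d) * g t - (t - c) * g t) = (\<lambda>t. (c - d) * g t)"
    by (simp add: algebra_simps)
  finally show ?thesis by (simp add: dd_cmult)
qed

lemma dd_single: "dd {c} g = g c"
  by (simp add: dd_def)

lemma dd_pair: "c \<noteq> d \<Longrightarrow> dd {c, d} g = (g c - g d) / (c - d)"
  using dd_rec[of "{}" c d g] by (simp add: dd_single field_simps)

lemma dd_one:
  assumes "finite X" "card X \<ge> 2"
  shows "dd X (\<lambda>_. 1) = 0"
  using assms
proof (induction "card X" arbitrary: X rule: less_induct)
  case less
  obtain c where c: "c \<in> X" using less.prems by fastforce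
  obtain d where d: "d \<in> X - {c}"
    using less.prems c by (metis One_nat_def Suc_1 card.empty card.insert_remove card_Diff_singleton
        equals0I finite_Diff le_zero_eq nat.distinct(1) not_less_eq_eq insert_Diff_single card_1_singleton_iff card_Suc_Diff1)
  define Y where "Y = X - {c, d}"
  have X: "X = insert c (insert d Y)" and Y: "finite Y" "c \<notin> Y" "d \<notin> Y" "c \<noteq> d"
    using c d less.prems by (auto simp: Y_def)
  have "dd (insert c Y) (\<lambda>_. 1) = dd (insert d Y) (\<lambda>_. 1)"
  proof (cases "Y = {}")
    case True
    then show ?thesis by (simp add: dd_single)
  next
    case False
    then have "card Y \<ge> 1" using Y by (simp add: Suc_leI card_gt_0_iff)
    then show ?thesis
      using less.hyps[of "insert c Y"] less.hyps[of "insert d Y"] Y X by simp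
  qed
  then show ?case using dd_rec[OF Y, of "\<lambda>_. 1"] Y X by simp
qed

text \<open>Division by \<open>t - c\<close> removes one point and one degree and keeps the top
  coefficient; the constant remainder is annihilated.\<close>

lemma dd_poly:
  assumes "finite X" "card X = Suc m" "degree p \<le> m"
  shows "dd X (poly p) = coeff p m"
  using assms
proof (induction m arbitrary: X p)
  case 0
  then obtain c where "X = {c}" by (metis One_nat_def card_1_singletonE)
  moreover obtain a where "p = [:a:]" using 0 by (metis degree_eq_zeroE le_zero_eq)
  ultimately show ?case by (simp add: dd_single)
next
  case (Suc m)
  obtain c Y where X: "X = insert c Y" "c \<notin> Y" "card Y = Suc m" "finite Y"
    using Suc.prems by (metis card_Suc_eq finite_insert)
  define q where "q = synthetic_div p c"
  have p: "p = [:-c, 1:] * q + [:poly p c:]" unfolding q_def using synthetic_div_correct'[of c p] by simp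
  have dq: "degree q \<le> m" using Suc.prems by (simp add: q_def degree_synthetic_div)
  have "dd X (poly p) = dd X (\<lambda>t. (t - c) * poly q t + poly p c * 1)"
  proof (rule dd_cong)
    fix t
    show "poly p t = (t - c) * poly q t + poly p c * 1"
      using arg_cong[OF p, of "\<lambda>r. poly r t"] by (simp add: algebra_simps)
  qed
  also have "\<dots> = dd X (\<lambda>t. (t - c) * poly q t)"
    using dd_one[of X] Suc.prems by (subst dd_add, subst dd_cmult) simp
  also have "\<dots> = dd Y (poly q)" using dd_insert_mult[of Y c "poly q"] X by simp
  also have "\<dots> = coeff q m" using Suc.IH[of Y q] X dq by simp
  also have "\<dots> = coeff p (Suc m)"
  proof -
    have "coeff p (Suc m) = coeff q m - c * coeff q (Suc m)"
      using arg_cong[OF p, of "\<lambda>r. coeff r (Suc m)"] by (simp add: coeff_pCons)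
    moreover have "coeff q (Suc m) = 0" using dq by (simp add: coeff_eq_0)
    ultimately show ?thesis by simp
  qed
  finally show ?case .
qed

text \<open>Expanding the left side by the definition of \<open>dd\<close> gives the partial
  fraction decomposition of the right side in \<open>t\<close>. The induction uses that
  \<open>(x - c) / (t - x)\<close> and \<open>(t - c) / (t - x)\<close> differ by a
  constant.\<close>

lemma dd_resolvent:
  assumes "finite X" "X \<noteq> {}" "t \<notin> X"
  shows "dd X (\<lambda>x. 1 / (t - x)) = 1 / (\<Prod>x\<in>X. t - x)"
  using assms
proof (induction X rule: finite_ne_induct)
  case (singleton x)
  then show ?case by (simp add: dd_single)
next
  case (insert c X)
  have "dd X (\<lambda>x. 1 / (t - x)) = dd (insert c X) (\<lambda>x. (x - c) * (1 / (t - x)))"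
    using dd_insert_mult[of X c "\<lambda>x. 1 / (t - x)"] insert by simp
  also have "\<dots> = dd (insert c X) (\<lambda>x. (t - c) * (1 / (t - x)) - 1)"
  proof (rule dd_cong)
    fix x assume "x \<in> insert c X"
    then have "t - x \<noteq> 0" using insert by auto
    then show "(x - c) * (1 / (t - x)) = (t - c) * (1 / (t - x)) - 1"
      by (simp add: divide_simps)
  qed
  also have "\<dots> = (t - c) * dd (insert c X) (\<lambda>x. 1 / (t - x)) - dd (insert c X) (\<lambda>_. 1)"
    by (subst dd_diff, subst dd_cmult) simp
  also have "dd (insert c X) (\<lambda>_. 1) = 0"
    using insert by (intro dd_one) (auto simp: Suc_le_eq card_gt_0_iff)
  finally have e: "1 / (\<Prod>x\<in>X. t - x) = (t - c) * dd (insert c X) (\<lambda>x. 1 / (t - x))"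
    using insert by simp
  have "dd (insert c X) (\<lambda>x. 1 / (t - x)) = 1 / (\<Prod>x\<in>X. t - x) / (t - c)"
    unfolding e using insert by simp
  then show ?case using insert by (simp add: mult.commute)
qed

section \<open>Divided differences with doubled points\<close>

text \<open>The condition under the definite description in \<open>partial_fraction_coeff\<close>,
  named so that uniqueness and existence can be treated apart.\<close>

definition is_partial_fraction :: "real list \<Rightarrow> (real \<Rightarrow> nat \<Rightarrow> real) \<Rightarrow> bool" where
  "is_partial_fraction xs \<alpha> \<longleftrightarrow>
     (\<forall>c k. count_list xs c \<le> k \<longrightarrow> \<alpha> c k = 0) \<and>
     (\<forall>t. t \<notin> set xs \<longrightarrow>
        1 / (\<Prod>c\<leftarrow>xs. t - c) = (\<Sum>c\<in>set xs. \<Sum>k<count_list xs c. \<alpha> c k / (t - c) ^ (k + 1)))"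

text \<open>Multiplying by the highest power of \<open>t - c\<close> that can occur and letting \<open>t\<close> tend to \<open>c\<close>
  isolates the leading coefficient at \<open>c\<close>.\<close>

lemma partial_fraction_zero:
  fixes \<beta> :: "real \<Rightarrow> nat \<Rightarrow> real"
  assumes S: "finite S" and c: "c \<in> S"
    and zero: "\<And>t. t \<notin> S \<Longrightarrow> (\<Sum>c\<in>S. \<Sum>k<m c. \<beta> c k / (t - c) ^ (k + 1)) = 0"
    and j: "j < m c"
  shows "\<beta> c j = 0"
  using j
\<comment> \<open>Downward induction on the order of the pole: the coefficients above
  \<open>j\<close> are known to vanish, so the one at \<open>j\<close> is leading.\<close>
proof (induction "m c - j" arbitrary: j rule: less_induct)
  case less
  have hi: "\<beta> c k = 0" if "j < k" "k < m c" for k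
    using less.hyps[of k] that less.prems by linarith
  define rest where "rest t = (\<Sum>c'\<in>S - {c}. \<Sum>k<m c'. \<beta> c' k / (t - c') ^ (k + 1))" for t
  define low where "low t = (\<Sum>k<j. \<beta> c k * (t - c) ^ (j - k))" for t
  have "\<forall>\<^sub>F t in at c. \<forall>x\<in>S - {c}. t \<noteq> x"
    using S by (intro eventually_ball_finite) (auto intro: eventually_neq_at_within)
  then have ev: "\<forall>\<^sub>F t in at c. t \<notin> S"
    using eventually_neq_at_within[of c c UNIV] by eventually_elim auto
  have eq: "\<beta> c j + low t + (t - c) ^ (j + 1) * rest t = 0" if t: "t \<notin> S" for t
  proof -
    have tc: "t \<noteq> c" using t c by auto
    have "0 = (t - c) ^ (j + 1) * (\<Sum>c\<in>S. \<Sum>k<m c. \<beta> c k / (t - c) ^ (k + 1))"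
      using zero[OF t] by simp
    also have "\<dots> = (t - c) ^ (j + 1) * (\<Sum>k<m c. \<beta> c k / (t - c) ^ (k + 1)) + (t - c) ^ (j + 1) * rest t"
      unfolding rest_def using S c by (simp add: sum.remove[of S c] distrib_left)
    also have "(\<Sum>k<m c. \<beta> c k / (t - c) ^ (k + 1)) = (\<Sum>k<Suc j. \<beta> c k / (t - c) ^ (k + 1))"
      using less.prems hi by (intro sum.mono_neutral_right) auto
    also have "(t - c) ^ (j + 1) * \<dots> = (\<Sum>k<Suc j. \<beta> c k * (t - c) ^ (j - k))"
      unfolding sum_distrib_left
    proof (rule sum.cong[OF refl])
      fix k assume "k \<in> {..<Suc j}"
      then have "j + 1 = (j - k) + (k + 1)" by auto
      then have "(t - c) ^ (j + 1) = (t - c) ^ (j - k) * (t - c) ^ (k + 1)"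
        using power_add by metis
      then show "(t - c) ^ (j + 1) * (\<beta> c k / (t - c) ^ (k + 1)) = \<beta> c k * (t - c) ^ (j - k)"
        using tc by simp
    qed
    also have "\<dots> = \<beta> c j + low t" by (simp add: low_def)
    finally show ?thesis by simp
  qed
  have "((\<lambda>t. \<beta> c j + low t + (t - c) ^ (j + 1) * rest t) \<longlongrightarrow> \<beta> c j + low c + (c - c) ^ (j + 1) * rest c) (at c)"
    unfolding low_def rest_def by (intro tendsto_intros) auto
  moreover have "low c = 0" unfolding low_def by (intro sum.neutral) auto
  ultimately have "((\<lambda>t. 0) \<longlongrightarrow> \<beta> c j) (at c)"
    using ev eq by (auto elim!: Lim_transform_eventually eventually_mono)
  then show ?case by (simp add: tendsto_const_iff)
qed

lemma is_partial_fraction_unique: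
  assumes "is_partial_fraction xs \<alpha>" "is_partial_fraction xs \<alpha>'"
  shows "\<alpha> = \<alpha>'"
proof (intro ext)
  fix c k
  show "\<alpha> c k = \<alpha>' c k"
  proof (cases "k < count_list xs c")
    case True
    then have c: "c \<in> set xs" by (metis count_notin not_less0)
    have "(\<lambda>c k. \<alpha> c k - \<alpha>' c k) c k = 0"
    proof (rule partial_fraction_zero[where m = "count_list xs", OF _ c _ True])
      fix t assume "t \<notin> set xs"
      then show "(\<Sum>c\<in>set xs. \<Sum>k<count_list xs c. (\<alpha> c k - \<alpha>' c k) / (t - c) ^ (k + 1)) = 0"
        using assms unfolding is_partial_fraction_def
        by (simp add: diff_divide_distrib sum_subtractf)
    qed auto
    then show ?thesis by simp
  qed (use assms in \<open>auto simp: is_partial_fraction_def\<close>)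
qed

lemma partial_fraction_coeff_eqI:
  "is_partial_fraction xs \<alpha> \<Longrightarrow> partial_fraction_coeff xs = \<alpha>"
  unfolding partial_fraction_coeff_def is_partial_fraction_def[symmetric]
  by (rule the_equality) (auto intro: is_partial_fraction_unique)

text \<open>A derivative along a filter. Two functions \<open>u\<close> and \<open>v\<close> are
  compared instead of two values of one function, because the other points of a divided difference
  move together with the step \<open>h\<close>.\<close>

definition diff_quot_tendsto ::
    "('s \<Rightarrow> real) \<Rightarrow> ('s \<Rightarrow> real) \<Rightarrow> ('s \<Rightarrow> real) \<Rightarrow> real \<Rightarrow> real \<Rightarrow> 's filter \<Rightarrow> bool" where
  "diff_quot_tendsto h u v l d F \<longleftrightarrow>
     (u \<longlongrightarrow> l) F \<and> (v \<longlongrightarrow> l) F \<and> ((\<lambda>s. (u s - v s) / h s) \<longlongrightarrow> d) F"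

lemma diff_quot_tendsto_mult:
  assumes "diff_quot_tendsto h u v l d F" "diff_quot_tendsto h u' v' l' d' F"
  shows "diff_quot_tendsto h (\<lambda>s. u s * u' s) (\<lambda>s. v s * v' s) (l * l') (d * l' + l * d') F"
proof -
  have "((\<lambda>s. (u s - v s) / h s * u' s + v s * ((u' s - v' s) / h s)) \<longlongrightarrow> d * l' + l * d') F"
    using assms unfolding diff_quot_tendsto_def by (intro tendsto_add tendsto_mult) simp_all
  moreover have "(u s - v s) / h s * u' s + v s * ((u' s - v' s) / h s)
      = (u s * u' s - v s * v' s) / h s" for s
    by (simp add: field_simps diff_divide_distrib)
  ultimately show ?thesis
    using assms unfolding diff_quot_tendsto_def by (auto intro!: tendsto_intros)
qed

lemma diff_quot_tendsto_prod:
  assumes "finite S" "\<And>i. i \<in> S \<Longrightarrow> diff_quot_tendsto h (u i) (v i) (l i) (d i) F"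
  shows "diff_quot_tendsto h (\<lambda>s. \<Prod>i\<in>S. u i s) (\<lambda>s. \<Prod>i\<in>S. v i s) (\<Prod>i\<in>S. l i)
    (\<Sum>i\<in>S. d i * (\<Prod>j\<in>S - {i}. l j)) F"
  using assms
proof (induction S rule: finite_induct)
  case empty
  then show ?case by (simp add: diff_quot_tendsto_def)
next
  case (insert i S)
  have "(\<Sum>k\<in>S. d k * (\<Prod>j\<in>insert i S - {k}. l j)) = l i * (\<Sum>k\<in>S. d k * (\<Prod>j\<in>S - {k}. l j))"
    unfolding sum_distrib_left
  proof (rule sum.cong[OF refl])
    fix k assume "k \<in> S"
    then have "insert i S - {k} = insert i (S - {k})" using insert by auto
    then show "d k * (\<Prod>j\<in>insert i S - {k}. l j) = l i * (d k * (\<Prod>j\<in>S - {k}. l j))"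
      using insert by simp
  qed
  then have "(\<Sum>k\<in>insert i S. d k * (\<Prod>j\<in>insert i S - {k}. l j))
      = d i * (\<Prod>j\<in>S. l j) + l i * (\<Sum>k\<in>S. d k * (\<Prod>j\<in>S - {k}. l j))"
    using insert by simp
  then show ?case
    using diff_quot_tendsto_mult[of h "u i" "v i" "l i" "d i" F] insert by simp
qed

text \<open>The value at \<open>c\<close> and the derivative at \<open>c\<close> of the reciprocal of
  \<open>\<Prod>a\<in>A - {c}. (t - a)\<^sup>2\<close> times \<open>\<Prod>b\<in>B - {c}. t - b\<close>.\<close>

definition val_coeff :: "real set \<Rightarrow> real set \<Rightarrow> real \<Rightarrow> real" where
  "val_coeff A B c = (\<Prod>a\<in>A - {c}. 1 / (c - a)\<^sup>2) * (\<Prod>b\<in>B - {c}. 1 / (c - b))"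

definition der_coeff :: "real set \<Rightarrow> real set \<Rightarrow> real \<Rightarrow> real" where
  "der_coeff A B c =
     (\<Sum>a\<in>A - {c}. - 2 / (c - a) ^ 3 * (\<Prod>a'\<in>A - {c} - {a}. 1 / (c - a')\<^sup>2)) * (\<Prod>b\<in>B - {c}. 1 / (c - b))
   + (\<Prod>a\<in>A - {c}. 1 / (c - a)\<^sup>2) * (\<Sum>b\<in>B - {c}. - 1 / (c - b)\<^sup>2 * (\<Prod>b'\<in>B - {c} - {b}. 1 / (c - b')))"

text \<open>The points of \<open>A\<close> count twice and those of \<open>B\<close> once. At a
  double point the reciprocal of the remaining factors has to be expanded to first order, which is
  why its value accompanies \<open>deriv g c\<close> and its derivative accompanies
  \<open>g c\<close>.\<close>

definition dd2 :: "real set \<Rightarrow> real set \<Rightarrow> (real \<Rightarrow> real) \<Rightarrow> real" where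
  "dd2 A B g = (\<Sum>c\<in>A. val_coeff A B c * deriv g c + der_coeff A B c * g c)
             + (\<Sum>b\<in>B. val_coeff A B b * g b)"

lemma prod_Un3:
  fixes g :: "'a \<Rightarrow> 'b :: comm_monoid_mult"
  assumes "finite S" "finite T" "finite R" "S \<inter> T = {}" "S \<inter> R = {}" "T \<inter> R = {}"
  shows "prod g (S \<union> T \<union> R) = prod g S * prod g T * prod g R"
proof -
  have "(S \<union> T) \<inter> R = {}" using assms by auto
  then show ?thesis using assms by (simp add: prod.union_disjoint)
qed

text \<open>The denominators at \<open>c\<close> and at \<open>y c\<close> contain the factors
  \<open>c - y c\<close> and \<open>y c - c\<close>, so the two terms of such a pair combine into
  one difference quotient.\<close>

lemma dd_doubled:
  assumes fin: "finite A" "finite B" and disj: "A \<inter> B = {}"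
    and inj: "inj_on y A" and yA: "y ` A \<inter> (A \<union> B) = {}"
  shows "dd (A \<union> y ` A \<union> B) g =
     (\<Sum>c\<in>A. (g (y c) * ((\<Prod>a\<in>A - {c}. 1 / ((y c - a) * (y c - y a))) * (\<Prod>b\<in>B. 1 / (y c - b)))
            - g c * ((\<Prod>a\<in>A - {c}. 1 / ((c - a) * (c - y a))) * (\<Prod>b\<in>B. 1 / (c - b)))) / (y c - c))
   + (\<Sum>b\<in>B. g b * ((\<Prod>a\<in>A. 1 / ((b - a) * (b - y a))) * (\<Prod>b'\<in>B - {b}. 1 / (b - b'))))"
proof -
  let ?X = "A \<union> y ` A \<union> B"
  let ?W = "\<lambda>x. (\<Prod>z\<in>?X - {x}. x - z)"
  have 1: "?W c = (c - y c) * ((\<Prod>a\<in>A - {c}. (c - a) * (c - y a)) * (\<Prod>b\<in>B. c - b))" if c: "c \<in> A" for c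
  proof -
    have "?X - {c} = (A - {c}) \<union> y ` A \<union> B" using c disj yA by auto
    then have "?W c = (\<Prod>a\<in>A - {c}. c - a) * (\<Prod>a\<in>A. c - y a) * (\<Prod>b\<in>B. c - b)"
      using fin disj yA prod_Un3[of "A - {c}" "y ` A" B "\<lambda>z. c - z"]
      by (auto simp: prod.reindex[OF inj] o_def)
    also have "(\<Prod>a\<in>A. c - y a) = (c - y c) * (\<Prod>a\<in>A - {c}. c - y a)"
      using c fin by (simp add: prod.remove)
    finally show ?thesis by (simp add: prod.distrib mult_ac)
  qed
  have 2: "?W (y c) = (y c - c) * ((\<Prod>a\<in>A - {c}. (y c - a) * (y c - y a)) * (\<Prod>b\<in>B. y c - b))" if c: "c \<in> A" for c
  proof -
    have "?X - {y c} = A \<union> y ` (A - {c}) \<union> B" using c disj yA inj by (auto simp: inj_on_def)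
    then have "?W (y c) = (\<Prod>a\<in>A. y c - a) * (\<Prod>a\<in>y ` (A - {c}). y c - a) * (\<Prod>b\<in>B. y c - b)"
      using fin disj yA prod_Un3[of A "y ` (A - {c})" B "\<lambda>z. y c - z"] by auto
    also have "(\<Prod>a\<in>y ` (A - {c}). y c - a) = (\<Prod>a\<in>A - {c}. y c - y a)"
      using inj by (subst prod.reindex) (auto simp: inj_on_def)
    also have "(\<Prod>a\<in>A. y c - a) = (y c - c) * (\<Prod>a\<in>A - {c}. y c - a)"
      using c fin by (simp add: prod.remove)
    finally show ?thesis by (simp add: prod.distrib mult_ac)
  qed
  have 3: "?W b = (\<Prod>a\<in>A. (b - a) * (b - y a)) * (\<Prod>b'\<in>B - {b}. b - b')" if b: "b \<in> B" for b
  proof -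
    have "?X - {b} = A \<union> y ` A \<union> (B - {b})" using b disj yA by auto
    then have "?W b = (\<Prod>a\<in>A. b - a) * (\<Prod>a\<in>A. b - y a) * (\<Prod>b'\<in>B - {b}. b - b')"
      using fin disj yA prod_Un3[of A "y ` A" "B - {b}" "\<lambda>z. b - z"]
      by (auto simp: prod.reindex[OF inj] o_def)
    then show ?thesis by (simp add: prod.distrib)
  qed
  have "dd ?X g = (\<Sum>c\<in>A. g c / ?W c) + (\<Sum>c\<in>A. g (y c) / ?W (y c)) + (\<Sum>b\<in>B. g b / ?W b)"
  proof -
    have "dd ?X g = (\<Sum>x\<in>A \<union> y ` A. g x / ?W x) + (\<Sum>b\<in>B. g b / ?W b)"
      unfolding dd_def using fin disj yA by (subst sum.union_disjoint[of "A \<union> y ` A" B]) auto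
    also have "(\<Sum>x\<in>A \<union> y ` A. g x / ?W x) = (\<Sum>c\<in>A. g c / ?W c) + (\<Sum>x\<in>y ` A. g x / ?W x)"
      using fin disj yA by (subst sum.union_disjoint) auto
    also have "(\<Sum>x\<in>y ` A. g x / ?W x) = (\<Sum>c\<in>A. g (y c) / ?W (y c))"
      using inj by (subst sum.reindex) auto
    finally show ?thesis .
  qed
  also have "(\<Sum>c\<in>A. g c / ?W c) + (\<Sum>c\<in>A. g (y c) / ?W (y c)) =
     (\<Sum>c\<in>A. (g (y c) * ((\<Prod>a\<in>A - {c}. 1 / ((y c - a) * (y c - y a))) * (\<Prod>b\<in>B. 1 / (y c - b)))
            - g c * ((\<Prod>a\<in>A - {c}. 1 / ((c - a) * (c - y a))) * (\<Prod>b\<in>B. 1 / (c - b)))) / (y c - c))"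
    unfolding sum.distrib[symmetric]
  proof (rule sum.cong[OF refl])
    fix c assume c: "c \<in> A"
    define k where "k = y c - c"
    have h: "c - y c = - k" by (simp add: k_def)
    show "g c / ?W c + g (y c) / ?W (y c) =
       (g (y c) * ((\<Prod>a\<in>A - {c}. 1 / ((y c - a) * (y c - y a))) * (\<Prod>b\<in>B. 1 / (y c - b)))
            - g c * ((\<Prod>a\<in>A - {c}. 1 / ((c - a) * (c - y a))) * (\<Prod>b\<in>B. 1 / (c - b)))) / (y c - c)"
      unfolding 1[OF c] 2[OF c] h prod_dividef k_def[symmetric]
      by (simp add: diff_divide_distrib mult.commute)
  qed
  also have "(\<Sum>b\<in>B. g b / ?W b)
      = (\<Sum>b\<in>B. g b * ((\<Prod>a\<in>A. 1 / ((b - a) * (b - y a))) * (\<Prod>b'\<in>B - {b}. 1 / (b - b'))))"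
    using 3 by (intro sum.cong) (simp_all add: prod_dividef)
  finally show ?thesis .
qed

lemma eventually_distinct_near:
  fixes y :: "'s \<Rightarrow> real \<Rightarrow> real"
  assumes "finite A" "finite B" "A \<inter> B = {}"
    and lim: "\<And>c. c \<in> A \<Longrightarrow> ((\<lambda>s. y s c) \<longlongrightarrow> c) F"
    and ne: "\<And>c. c \<in> A \<Longrightarrow> \<forall>\<^sub>F s in F. y s c \<noteq> c"
  shows "\<forall>\<^sub>F s in F. inj_on (y s) A \<and> y s ` A \<inter> (A \<union> B) = {}"
proof -
  have "\<forall>\<^sub>F s in F. y s c \<noteq> y s c'" if "c \<in> A" "c' \<in> A" "c \<noteq> c'" for c c'
  proof -
    have "((\<lambda>s. y s c - y s c') \<longlongrightarrow> c - c') F" using lim that by (intro tendsto_intros) auto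
    then have "\<forall>\<^sub>F s in F. y s c - y s c' \<noteq> 0" using that by (intro tendsto_imp_eventually_ne) auto
    then show ?thesis by eventually_elim auto
  qed
  then have 1: "\<forall>\<^sub>F s in F. \<forall>c\<in>A. \<forall>c'\<in>A. c \<noteq> c' \<longrightarrow> y s c \<noteq> y s c'"
    using assms by (intro eventually_ball_finite ballI) (auto intro!: eventually_ball_finite)
  have "\<forall>\<^sub>F s in F. y s c \<noteq> x" if "c \<in> A" "x \<in> A \<union> B" for c x
    using ne[of c] tendsto_imp_eventually_ne[OF lim[of c], of x] that by (cases "x = c") auto
  then have 2: "\<forall>\<^sub>F s in F. \<forall>c\<in>A. \<forall>x\<in>A \<union> B. y s c \<noteq> x"
    using assms by (intro eventually_ball_finite ballI) auto
  from 1 2 show ?thesis by eventually_elim (auto simp: inj_on_def)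
qed

text \<open>By \<open>dd_doubled\<close> each pair contributes a difference quotient of
  \<open>g\<close> times the reciprocal of the other factors, and the product rule applies in the
  limit. The filter is left arbitrary because the partner of \<open>c\<close> is the translate
  \<open>c + s\<close> in some places and a moving root of a pencil in another.\<close>

lemma dd_tendsto_dd2:
  fixes y :: "'s \<Rightarrow> real \<Rightarrow> real"
  assumes fin: "finite A" "finite B" and disj: "A \<inter> B = {}"
    and lim: "\<And>c. c \<in> A \<Longrightarrow> ((\<lambda>s. y s c) \<longlongrightarrow> c) F"
    and ne: "\<And>c. c \<in> A \<Longrightarrow> \<forall>\<^sub>F s in F. y s c \<noteq> c"
    and diff: "\<And>c. c \<in> A \<Longrightarrow> g differentiable (at c)"
  shows "((\<lambda>s. dd (A \<union> y s ` A \<union> B) g) \<longlongrightarrow> dd2 A B g) F"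
proof -
  \<comment> \<open>For \<open>c\<close> in \<open>A\<close> the set \<open>B - {c}\<close> is
    \<open>B\<close>; it is written this way to match \<open>val_coeff\<close>.\<close>
  define u where "u c s = (\<Prod>a\<in>A - {c}. 1 / ((y s c - a) * (y s c - y s a))) * (\<Prod>b\<in>B - {c}. 1 / (y s c - b))" for c s
  define v where "v c s = (\<Prod>a\<in>A - {c}. 1 / ((c - a) * (c - y s a))) * (\<Prod>b\<in>B - {c}. 1 / (c - b))" for c s
  define h where "h c s = y s c - c" for c s
  have uv: "diff_quot_tendsto (h c) (u c) (v c) (val_coeff A B c) (der_coeff A B c) F" if c: "c \<in> A" for c
    unfolding u_def[abs_def] v_def[abs_def] val_coeff_def der_coeff_def
  proof (intro diff_quot_tendsto_mult diff_quot_tendsto_prod)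
    show "finite (A - {c})" "finite (B - {c})" using fin by auto
  next
    fix a assume a: "a \<in> A - {c}"
    then have ya: "((\<lambda>s. y s a) \<longlongrightarrow> a) F" and yc: "((\<lambda>s. y s c) \<longlongrightarrow> c) F" and ac: "c - a \<noteq> 0"
      using lim c by auto
    have 1: "((\<lambda>s. 1 / ((y s c - a) * (y s c - y s a))) \<longlongrightarrow> 1 / ((c - a) * (c - a))) F"
      using ac by (intro tendsto_intros ya yc) auto
    have 2: "((\<lambda>s. 1 / ((c - a) * (c - y s a))) \<longlongrightarrow> 1 / ((c - a) * (c - a))) F"
      using ac by (intro tendsto_intros ya yc) auto
    \<comment> \<open>The difference of the two reciprocals contains the factor
      \<open>h c s\<close>. This is the limit of what remains after dividing by it;
      \<open>l5\<close> performs the division.\<close>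
    have l4: "((\<lambda>s. - ((c - a) + (y s c - y s a)) / ((y s c - a) * (y s c - y s a) * ((c - a) * (c - y s a)))) \<longlongrightarrow>
        - ((c - a) + (c - a)) / ((c - a) * (c - a) * ((c - a) * (c - a)))) F"
      using ac by (intro tendsto_intros ya yc) auto
    have l3: "- ((c - a) + (c - a)) / ((c - a) * (c - a) * ((c - a) * (c - a))) = - 2 / (c - a) ^ 3"
    proof -
      have "- (k + k) / (k * k * (k * k)) = - 2 / k ^ 3" if "k \<noteq> 0" for k :: real
        using that by (simp add: field_simps power3_eq_cube)
      from this[OF ac] show ?thesis .
    qed
    have l5: "\<forall>\<^sub>F s in F. - ((c - a) + (y s c - y s a)) / ((y s c - a) * (y s c - y s a) * ((c - a) * (c - y s a)))
       = (1 / ((y s c - a) * (y s c - y s a)) - 1 / ((c - a) * (c - y s a))) / h c s"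
    proof -
      have e1: "\<forall>\<^sub>F s in F. y s c - a \<noteq> 0"
        using ac by (intro tendsto_imp_eventually_ne[where c = "c - a"] tendsto_intros yc) auto
      have e2: "\<forall>\<^sub>F s in F. y s c - y s a \<noteq> 0"
        using ac by (intro tendsto_imp_eventually_ne[where c = "c - a"] tendsto_intros yc ya) auto
      have e3: "\<forall>\<^sub>F s in F. c - y s a \<noteq> 0"
        using ac by (intro tendsto_imp_eventually_ne[where c = "c - a"] tendsto_intros ya) auto
      from e1 e2 e3 ne[OF c] show ?thesis
      proof eventually_elim
        case (elim s)
        have "1 / ((y s c - a) * (y s c - y s a)) - 1 / ((c - a) * (c - y s a))
            = ((c - a) * (c - y s a) - (y s c - a) * (y s c - y s a)) / ((y s c - a) * (y s c - y s a) * ((c - a) * (c - y s a)))"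
          using elim ac by (subst diff_frac_eq) (auto simp: mult_ac)
        also have "(c - a) * (c - y s a) - (y s c - a) * (y s c - y s a) = - ((c - a) + (y s c - y s a)) * h c s"
          unfolding h_def by (simp add: algebra_simps)
        finally show ?case using elim by (simp add: h_def)
      qed
    qed
    have "((\<lambda>s. (1 / ((y s c - a) * (y s c - y s a)) - 1 / ((c - a) * (c - y s a))) / h c s) \<longlongrightarrow> - 2 / (c - a) ^ 3) F"
      using Lim_transform_eventually[OF l4 l5] unfolding l3 .
    with 1 2 show "diff_quot_tendsto (h c) (\<lambda>s. 1 / ((y s c - a) * (y s c - y s a)))
        (\<lambda>s. 1 / ((c - a) * (c - y s a))) (1 / (c - a)\<^sup>2) (- 2 / (c - a) ^ 3) F"
      by (simp add: diff_quot_tendsto_def power2_eq_square)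
  next
    fix b assume b: "b \<in> B - {c}"
    then have cb: "c - b \<noteq> 0" using disj c by auto
    have yc: "((\<lambda>s. y s c) \<longlongrightarrow> c) F" using lim c by auto
    have 1: "((\<lambda>s. 1 / (y s c - b)) \<longlongrightarrow> 1 / (c - b)) F"
      using cb by (intro tendsto_intros yc) auto
    have "((\<lambda>s. - 1 / ((y s c - b) * (c - b))) \<longlongrightarrow> - 1 / ((c - b) * (c - b))) F"
      using cb by (intro tendsto_intros yc) auto
    moreover have "\<forall>\<^sub>F s in F. - 1 / ((y s c - b) * (c - b)) = (1 / (y s c - b) - 1 / (c - b)) / h c s"
    proof -
      have e1: "\<forall>\<^sub>F s in F. y s c - b \<noteq> 0"
        using cb by (intro tendsto_imp_eventually_ne[where c = "c - b"] tendsto_intros yc) auto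
      from e1 ne[OF c] show ?thesis
        by eventually_elim (use cb in \<open>auto simp: h_def divide_simps\<close>)
    qed
    ultimately have "((\<lambda>s. (1 / (y s c - b) - 1 / (c - b)) / h c s) \<longlongrightarrow> - 1 / ((c - b) * (c - b))) F"
      by (rule Lim_transform_eventually)
    with 1 show "diff_quot_tendsto (h c) (\<lambda>s. 1 / (y s c - b)) (\<lambda>s. 1 / (c - b)) (1 / (c - b)) (- 1 / (c - b)\<^sup>2) F"
      by (simp add: diff_quot_tendsto_def power2_eq_square)
  qed
  have doubled: "((\<lambda>s. (g (y s c) * u c s - g c * v c s) / h c s) \<longlongrightarrow>
      val_coeff A B c * deriv g c + der_coeff A B c * g c) F" if c: "c \<in> A" for c
  proof -
    have "(g has_real_derivative deriv g c) (at c)"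
      using diff[OF c] by (simp add: DERIV_deriv_iff_real_differentiable)
    then have "((\<lambda>x. (g x - g c) / (x - c)) \<longlongrightarrow> deriv g c) (at c)"
      by (simp add: has_field_derivative_iff)
    moreover have "filterlim (\<lambda>s. y s c) (at c) F"
      using lim[OF c] ne[OF c] by (simp add: filterlim_at)
    ultimately have 1: "((\<lambda>s. (g (y s c) - g c) / (y s c - c)) \<longlongrightarrow> deriv g c) F"
      by (rule filterlim_compose)
    have "((\<lambda>s. u c s * ((g (y s c) - g c) / (y s c - c)) + ((u c s - v c s) / h c s) * g c) \<longlongrightarrow>
        val_coeff A B c * deriv g c + der_coeff A B c * g c) F"
      using uv[OF c] 1 unfolding diff_quot_tendsto_def by (intro tendsto_intros) auto
    moreover have "u c s * ((g (y s c) - g c) / (y s c - c)) + ((u c s - v c s) / h c s) * g c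
        = (g (y s c) * u c s - g c * v c s) / h c s" for s
      unfolding h_def by (simp add: diff_divide_distrib add_divide_distrib algebra_simps)
    ultimately show ?thesis by simp
  qed
  have single: "((\<lambda>s. g b * ((\<Prod>a\<in>A. 1 / ((b - a) * (b - y s a))) * (\<Prod>b'\<in>B - {b}. 1 / (b - b'))))
      \<longlongrightarrow> val_coeff A B b * g b) F" if b: "b \<in> B" for b
  proof -
    have "A - {b} = A" using b disj by auto
    then have "val_coeff A B b * g b = g b * ((\<Prod>a\<in>A. 1 / ((b - a) * (b - a))) * (\<Prod>b'\<in>B - {b}. 1 / (b - b')))"
      by (simp add: val_coeff_def power2_eq_square)
    moreover have "b - a \<noteq> 0" if "a \<in> A" for a using that b disj by auto
    then have "((\<lambda>s. g b * ((\<Prod>a\<in>A. 1 / ((b - a) * (b - y s a))) * (\<Prod>b'\<in>B - {b}. 1 / (b - b')))) \<longlongrightarrow>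
        g b * ((\<Prod>a\<in>A. 1 / ((b - a) * (b - a))) * (\<Prod>b'\<in>B - {b}. 1 / (b - b')))) F"
      by (intro tendsto_intros lim) auto
    ultimately show ?thesis by (simp only:)
  qed
  have BA: "B - {c} = B" if "c \<in> A" for c using that disj by auto
  have "((\<lambda>s. (\<Sum>c\<in>A. (g (y s c) * u c s - g c * v c s) / h c s)
      + (\<Sum>b\<in>B. g b * ((\<Prod>a\<in>A. 1 / ((b - a) * (b - y s a))) * (\<Prod>b'\<in>B - {b}. 1 / (b - b')))))
      \<longlongrightarrow> dd2 A B g) F"
    unfolding dd2_def by (intro tendsto_intros doubled single)
  moreover have "\<forall>\<^sub>F s in F. (\<Sum>c\<in>A. (g (y s c) * u c s - g c * v c s) / h c s)
      + (\<Sum>b\<in>B. g b * ((\<Prod>a\<in>A. 1 / ((b - a) * (b - y s a))) * (\<Prod>b'\<in>B - {b}. 1 / (b - b'))))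
      = dd (A \<union> y s ` A \<union> B) g"
  proof -
    have "\<forall>\<^sub>F s in F. inj_on (y s) A \<and> y s ` A \<inter> (A \<union> B) = {}"
      by (rule eventually_distinct_near[OF fin disj lim ne])
    then show ?thesis
  proof eventually_elim
    case (elim s)
    have "(\<Sum>c\<in>A. (g (y s c) * u c s - g c * v c s) / h c s) =
      (\<Sum>c\<in>A. (g (y s c) * ((\<Prod>a\<in>A - {c}. 1 / ((y s c - a) * (y s c - y s a))) * (\<Prod>b\<in>B. 1 / (y s c - b)))
            - g c * ((\<Prod>a\<in>A - {c}. 1 / ((c - a) * (c - y s a))) * (\<Prod>b\<in>B. 1 / (c - b)))) / (y s c - c))"
      by (intro sum.cong) (auto simp: u_def v_def h_def BA)
    then show ?case
      using dd_doubled[of A B "y s" g] fin disj elim by simp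
  qed
  qed
  ultimately show ?thesis by (rule Lim_transform_eventually)
qed


text \<open>The limit of \<open>dd_resolvent\<close> when each point of \<open>A\<close> is joined
  by its translate by a small \<open>s\<close>.\<close>

lemma dd2_resolvent:
  assumes fin: "finite A" "finite B" and disj: "A \<inter> B = {}" and ne: "A \<union> B \<noteq> {}" and t: "t \<notin> A \<union> B"
  shows "dd2 A B (\<lambda>x. 1 / (t - x)) = 1 / ((\<Prod>a\<in>A. (t - a)\<^sup>2) * (\<Prod>b\<in>B. t - b))"
proof -
  let ?F = "at_right (0::real)"
  define y where "y s c = c + s" for s c :: real
  have lim: "((\<lambda>s. y s c) \<longlongrightarrow> c) ?F" for c
    unfolding y_def by (rule tendsto_eq_intros refl tendsto_ident_at | simp)+
  have yne: "\<forall>\<^sub>F s in ?F. y s c \<noteq> c" for c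
    using eventually_at_right_less[of 0] unfolding y_def by eventually_elim auto
  have 1: "((\<lambda>s. dd (A \<union> y s ` A \<union> B) (\<lambda>x. 1 / (t - x))) \<longlongrightarrow> dd2 A B (\<lambda>x. 1 / (t - x))) ?F"
  proof (rule dd_tendsto_dd2[OF fin disj lim yne])
    fix c assume "c \<in> A"
    then have "t - c \<noteq> 0" using t by auto
    then show "(\<lambda>x. 1 / (t - x)) differentiable (at c)"
      by (intro derivative_intros) auto
  qed
  have "((\<lambda>s. 1 / ((\<Prod>a\<in>A. t - a) * (\<Prod>a\<in>A. t - y s a) * (\<Prod>b\<in>B. t - b))) \<longlongrightarrow>
      1 / ((\<Prod>a\<in>A. t - a) * (\<Prod>a\<in>A. t - a) * (\<Prod>b\<in>B. t - b))) ?F"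
    using t fin by (intro tendsto_intros lim) auto
  moreover have "\<forall>\<^sub>F s in ?F. 1 / ((\<Prod>a\<in>A. t - a) * (\<Prod>a\<in>A. t - y s a) * (\<Prod>b\<in>B. t - b))
      = dd (A \<union> y s ` A \<union> B) (\<lambda>x. 1 / (t - x))"
  proof -
    \<comment> \<open>Adding \<open>t\<close> to the points to be avoided makes the translates
      differ from \<open>t\<close> as well.\<close>
    have "\<forall>\<^sub>F s in ?F. inj_on (y s) A \<and> y s ` A \<inter> (A \<union> insert t B) = {}"
      using fin disj t by (intro eventually_distinct_near lim yne) auto
    then show ?thesis
    proof eventually_elim
      case (elim s)
      have "dd (A \<union> y s ` A \<union> B) (\<lambda>x. 1 / (t - x)) = 1 / (\<Prod>x\<in>A \<union> y s ` A \<union> B. t - x)"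
        using fin ne t elim by (intro dd_resolvent) auto
      also have "(\<Prod>x\<in>A \<union> y s ` A \<union> B. t - x) = (\<Prod>a\<in>A. t - a) * (\<Prod>a\<in>y s ` A. t - a) * (\<Prod>b\<in>B. t - b)"
        using fin disj elim by (intro prod_Un3) auto
      also have "(\<Prod>a\<in>y s ` A. t - a) = (\<Prod>a\<in>A. t - y s a)"
        using elim by (subst prod.reindex) auto
      finally show ?case by simp
    qed
  qed
  ultimately have "((\<lambda>s. dd (A \<union> y s ` A \<union> B) (\<lambda>x. 1 / (t - x))) \<longlongrightarrow>
      1 / ((\<Prod>a\<in>A. t - a) * (\<Prod>a\<in>A. t - a) * (\<Prod>b\<in>B. t - b))) ?F"
    by (rule Lim_transform_eventually)
  from tendsto_unique[OF trivial_limit_at_right_real 1 this]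
  show ?thesis by (simp add: power2_eq_square prod.distrib)
qed

section \<open>Partial fraction coefficients for points of multiplicity at most two\<close>

lemma prod_list_count_list:
  fixes h :: "'a \<Rightarrow> 'b :: comm_monoid_mult"
  assumes "finite S" "set xs \<subseteq> S"
  shows "(\<Prod>c\<leftarrow>xs. h c) = (\<Prod>c\<in>S. h c ^ count_list xs c)"
  using assms(2)
proof (induction xs)
  case (Cons x xs)
  have "(\<Prod>c\<in>S. h c ^ count_list (x # xs) c) = (\<Prod>c\<in>S. (if c = x then h c else 1) * h c ^ count_list xs c)"
    by (intro prod.cong) auto
  also have "\<dots> = h x * (\<Prod>c\<in>S. h c ^ count_list xs c)"
    using assms(1) Cons.prems by (simp add: prod.distrib prod.delta)
  finally show ?case using Cons by simp
qed simp

definition points_of_mult :: "nat \<Rightarrow> real list \<Rightarrow> real set" where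
  "points_of_mult m xs = {c. count_list xs c = m}"

lemma finite_points_of_mult: "m > 0 \<Longrightarrow> finite (points_of_mult m xs)"
proof (rule finite_subset)
  assume "m > 0"
  show "points_of_mult m xs \<subseteq> set xs"
  proof (intro subsetI)
    fix c assume "c \<in> points_of_mult m xs"
    then have "count_list xs c \<noteq> 0" using \<open>m > 0\<close> by (simp add: points_of_mult_def)
    then show "c \<in> set xs" by (simp add: count_list_0_iff)
  qed
qed simp

lemma set_eq_points_of_mult:
  assumes "\<And>c. count_list xs c \<le> 2"
  shows "set xs = points_of_mult 2 xs \<union> points_of_mult 1 xs"
proof -
  have iff: "c \<in> set xs \<longleftrightarrow> count_list xs c = 2 \<or> count_list xs c = 1" for c
  proof -
    have "count_list xs c = 0 \<or> count_list xs c = 1 \<or> count_list xs c = 2"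
      using assms[of c] by linarith
    moreover have "c \<in> set xs \<longleftrightarrow> count_list xs c \<noteq> 0" by (simp add: count_list_0_iff)
    ultimately show ?thesis by auto
  qed
  have "set xs = {c. c \<in> set xs}" by (rule Collect_mem_eq[symmetric])
  also have "\<dots> = {c. count_list xs c = 2} \<union> {c. count_list xs c = 1}"
    unfolding Collect_disj_eq[symmetric] by (rule Collect_cong) (rule iff)
  finally show ?thesis unfolding points_of_mult_def .
qed

lemma sum_count_list_le_2:
  fixes \<psi> :: "real \<Rightarrow> nat \<Rightarrow> real"
  assumes "\<And>c. count_list xs c \<le> 2"
  shows "(\<Sum>c\<in>set xs. \<Sum>k<count_list xs c. \<psi> c k)
    = (\<Sum>c\<in>points_of_mult 2 xs. \<psi> c 1 + \<psi> c 0) + (\<Sum>c\<in>points_of_mult 1 xs. \<psi> c 0)"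
proof -
  have "(\<Sum>c\<in>set xs. \<Sum>k<count_list xs c. \<psi> c k)
    = (\<Sum>c\<in>points_of_mult 2 xs. \<Sum>k<count_list xs c. \<psi> c k) + (\<Sum>c\<in>points_of_mult 1 xs. \<Sum>k<count_list xs c. \<psi> c k)"
    unfolding set_eq_points_of_mult[OF assms]
    by (intro sum.union_disjoint finite_points_of_mult) (auto simp: points_of_mult_def)
  also have "(\<Sum>c\<in>points_of_mult 2 xs. \<Sum>k<count_list xs c. \<psi> c k) = (\<Sum>c\<in>points_of_mult 2 xs. \<psi> c 1 + \<psi> c 0)"
    by (intro sum.cong) (auto simp: points_of_mult_def numeral_2_eq_2)
  also have "(\<Sum>c\<in>points_of_mult 1 xs. \<Sum>k<count_list xs c. \<psi> c k) = (\<Sum>c\<in>points_of_mult 1 xs. \<psi> c 0)"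
    by (intro sum.cong) (auto simp: points_of_mult_def)
  finally show ?thesis .
qed

text \<open>\<open>dd2_resolvent\<close> says that the coefficients in \<open>dd2\<close> are
  partial fraction coefficients, and these are unique. The derivative of \<open>1 / (t - x)\<close>
  in \<open>x\<close> is the double pole, so the coefficient of \<open>deriv g c\<close> is the one
  with index 1.\<close>

lemma divdiff_eq_dd2:
  assumes le2: "\<And>c. count_list xs c \<le> 2"
  shows "divdiff xs g = dd2 (points_of_mult 2 xs) (points_of_mult 1 xs) g"
proof (cases "xs = []")
  case True
  then show ?thesis by (simp add: divdiff_def points_of_mult_def dd2_def)
next
  case False
  let ?A = "points_of_mult 2 xs" and ?B = "points_of_mult 1 xs"
  define \<alpha> where "\<alpha> c k = (if c \<in> ?A \<and> k = 1 then val_coeff ?A ?B c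
     else if c \<in> ?A \<and> k = 0 then der_coeff ?A ?B c
     else if c \<in> ?B \<and> k = 0 then val_coeff ?A ?B c else 0)" for c and k :: nat
  have fin: "finite ?A" "finite ?B" by (simp_all add: finite_points_of_mult)
  have disj: "?A \<inter> ?B = {}" by (auto simp: points_of_mult_def)
  have "is_partial_fraction xs \<alpha>"
    unfolding is_partial_fraction_def
  proof (intro conjI allI impI)
    fix c and k :: nat assume "count_list xs c \<le> k"
    then show "\<alpha> c k = 0" by (auto simp: \<alpha>_def points_of_mult_def)
  next
    fix t assume t: "t \<notin> set xs"
    have tn: "t \<notin> ?A \<union> ?B" using t set_eq_points_of_mult[OF le2] by simp
    have "(\<Prod>c\<leftarrow>xs. t - c) = (\<Prod>c\<in>?A \<union> ?B. (t - c) ^ count_list xs c)"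
      unfolding set_eq_points_of_mult[OF le2, symmetric] by (rule prod_list_count_list) auto
    also have "\<dots> = (\<Prod>c\<in>?A. (t - c) ^ count_list xs c) * (\<Prod>c\<in>?B. (t - c) ^ count_list xs c)"
      using fin disj by (intro prod.union_disjoint) auto
    also have "(\<Prod>c\<in>?A. (t - c) ^ count_list xs c) = (\<Prod>c\<in>?A. (t - c)\<^sup>2)"
      by (intro prod.cong) (auto simp: points_of_mult_def)
    also have "(\<Prod>c\<in>?B. (t - c) ^ count_list xs c) = (\<Prod>c\<in>?B. t - c)"
      by (intro prod.cong) (auto simp: points_of_mult_def)
    finally have e: "(\<Prod>c\<leftarrow>xs. t - c) = (\<Prod>c\<in>?A. (t - c)\<^sup>2) * (\<Prod>c\<in>?B. t - c)" .
    have "?A \<union> ?B \<noteq> {}" using False set_eq_points_of_mult[OF le2] by (metis set_empty)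
    then have "1 / (\<Prod>c\<leftarrow>xs. t - c) = dd2 ?A ?B (\<lambda>x. 1 / (t - x))"
      unfolding e using dd2_resolvent[OF fin disj _ tn] by simp
    also have "\<dots> = (\<Sum>c\<in>?A. \<alpha> c 1 / (t - c) ^ (1 + 1) + \<alpha> c 0 / (t - c) ^ (0 + 1)) + (\<Sum>c\<in>?B. \<alpha> c 0 / (t - c) ^ (0 + 1))"
    proof -
      have "deriv (\<lambda>x. 1 / (t - x)) c = 1 / (t - c)\<^sup>2" if "c \<in> ?A" for c
      proof -
        have "t - c \<noteq> 0" using that tn by auto
        then have "((\<lambda>x. 1 / (t - x)) has_real_derivative 1 / (t - c)\<^sup>2) (at c)"
          by (auto intro!: derivative_eq_intros simp: power2_eq_square)
        then show ?thesis by (rule DERIV_imp_deriv)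
      qed
      moreover have "c \<notin> ?A" if "c \<in> ?B" for c using that disj by auto
      ultimately show ?thesis
        unfolding dd2_def by (intro arg_cong2[where f = "(+)"] sum.cong) (auto simp: \<alpha>_def power2_eq_square)
    qed
    also have "\<dots> = (\<Sum>c\<in>set xs. \<Sum>k<count_list xs c. \<alpha> c k / (t - c) ^ (k + 1))"
      using sum_count_list_le_2[OF le2, of "\<lambda>c k. \<alpha> c k / (t - c) ^ (k + 1)"] by simp
    finally show "1 / (\<Prod>c\<leftarrow>xs. t - c) = \<dots>" .
  qed
  then have "divdiff xs g = (\<Sum>c\<in>set xs. \<Sum>k<count_list xs c. \<alpha> c k * ((deriv ^^ k) g c / fact k))"
    unfolding divdiff_def by (simp add: partial_fraction_coeff_eqI)
  also have "\<dots> = (\<Sum>c\<in>?A. \<alpha> c 1 * ((deriv ^^ 1) g c / fact 1) + \<alpha> c 0 * ((deriv ^^ 0) g c / fact 0))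
      + (\<Sum>c\<in>?B. \<alpha> c 0 * ((deriv ^^ 0) g c / fact 0))"
    by (rule sum_count_list_le_2[OF le2])
  also have "\<dots> = dd2 ?A ?B g"
  proof -
    have "c \<notin> ?A" if "c \<in> ?B" for c using that disj by auto
    then show ?thesis
      unfolding dd2_def by (intro arg_cong2[where f = "(+)"] sum.cong) (auto simp: \<alpha>_def)
  qed
  finally show ?thesis .
qed

lemma divdiff_distinct:
  assumes "distinct xs"
  shows "divdiff xs g = dd (set xs) g"
proof -
  have c: "count_list xs c = (if c \<in> set xs then 1 else 0)" for c
    using assms by (simp add: distinct_count_atmost_1 count_mset[symmetric])
  have "points_of_mult 2 xs = {}" "points_of_mult 1 xs = set xs"
    by (auto simp: points_of_mult_def c)
  moreover have "count_list xs c \<le> 2" for c by (simp add: c)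
  ultimately show ?thesis
    by (subst divdiff_eq_dd2) (auto simp: dd2_def dd_def val_coeff_def prod_dividef)
qed

section \<open>Cancellation of linear factors\<close>

lemma dd2_insert_single:
  assumes fin: "finite A" "finite B" and disj: "A \<inter> B = {}" and c: "c \<notin> A \<union> B"
    and diff: "\<And>a. a \<in> A \<Longrightarrow> g differentiable (at a)"
  shows "dd2 A (insert c B) (\<lambda>t. (t - c) * g t) = dd2 A B g"
proof -
  let ?F = "at_right (0::real)"
  define y where "y s c = c + s" for s c :: real
  have lim: "((\<lambda>s. y s c) \<longlongrightarrow> c) ?F" for c
    unfolding y_def by (rule tendsto_eq_intros refl tendsto_ident_at | simp)+
  have yne: "\<forall>\<^sub>F s in ?F. y s c \<noteq> c" for c
    using eventually_at_right_less[of 0] unfolding y_def by eventually_elim auto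
  have 1: "((\<lambda>s. dd (A \<union> y s ` A \<union> B) g) \<longlongrightarrow> dd2 A B g) ?F"
    by (rule dd_tendsto_dd2[OF fin disj lim yne diff])
  have "((\<lambda>s. dd (A \<union> y s ` A \<union> insert c B) (\<lambda>t. (t - c) * g t)) \<longlongrightarrow> dd2 A (insert c B) (\<lambda>t. (t - c) * g t)) ?F"
    using fin disj c diff by (intro dd_tendsto_dd2 lim yne derivative_intros) auto
  moreover have "\<forall>\<^sub>F s in ?F. dd (A \<union> y s ` A \<union> insert c B) (\<lambda>t. (t - c) * g t) = dd (A \<union> y s ` A \<union> B) g"
  proof -
    have "\<forall>\<^sub>F s in ?F. inj_on (y s) A \<and> y s ` A \<inter> (A \<union> insert c B) = {}"
      using fin disj c by (intro eventually_distinct_near lim yne) auto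
    then show ?thesis
    proof eventually_elim
      case (elim s)
      then show ?case using dd_insert_mult[of "A \<union> y s ` A \<union> B" c g] fin c by auto
    qed
  qed
  ultimately have "((\<lambda>s. dd (A \<union> y s ` A \<union> B) g) \<longlongrightarrow> dd2 A (insert c B) (\<lambda>t. (t - c) * g t)) ?F"
    by (rule Lim_transform_eventually)
  from tendsto_unique[OF trivial_limit_at_right_real this 1] show ?thesis .
qed

lemma dd2_insert_double:
  assumes fin: "finite A" "finite B" and disj: "A \<inter> B = {}" and c: "c \<notin> A \<union> B"
    and diff: "\<And>a. a \<in> insert c A \<Longrightarrow> g differentiable (at a)"
  shows "dd2 (insert c A) B (\<lambda>t. (t - c) * g t) = dd2 A (insert c B) g"
proof -
  let ?F = "at_right (0::real)"
  define y where "y s c = c + s" for s c :: real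
  have lim: "((\<lambda>s. y s c) \<longlongrightarrow> c) ?F" for c
    unfolding y_def by (rule tendsto_eq_intros refl tendsto_ident_at | simp)+
  have yne: "\<forall>\<^sub>F s in ?F. y s c \<noteq> c" for c
    using eventually_at_right_less[of 0] unfolding y_def by eventually_elim auto
  let ?X = "\<lambda>s. insert c A \<union> y s ` insert c A \<union> B"
  have 1: "((\<lambda>s. dd (A \<union> y s ` A \<union> insert c B) g) \<longlongrightarrow> dd2 A (insert c B) g) ?F"
    using fin disj c diff by (intro dd_tendsto_dd2 lim yne) auto
  have 2: "((\<lambda>s. dd (?X s) (\<lambda>t. (t - c) * g t)) \<longlongrightarrow> dd2 (insert c A) B (\<lambda>t. (t - c) * g t)) ?F"
    using fin disj c diff by (intro dd_tendsto_dd2 lim yne derivative_intros) auto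
  have 3: "((\<lambda>s. dd (?X s) g) \<longlongrightarrow> dd2 (insert c A) B g) ?F"
    using fin disj c diff by (intro dd_tendsto_dd2 lim yne) auto
  \<comment> \<open>\<open>dd_insert_mult\<close> is to remove the moving copy \<open>y s c\<close>
    and leave \<open>c\<close> as a simple point. It needs the factor \<open>t - y s c\<close>,
    which is \<open>(t - c) - s\<close>; the correction with the factor \<open>s\<close> disappears
    in the limit.\<close>
  have "((\<lambda>s. dd (?X s) (\<lambda>t. (t - c) * g t) - s * dd (?X s) g) \<longlongrightarrow> dd2 (insert c A) B (\<lambda>t. (t - c) * g t) - 0 * dd2 (insert c A) B g) ?F"
    by (intro tendsto_intros 2 3)
  moreover have "\<forall>\<^sub>F s in ?F. dd (?X s) (\<lambda>t. (t - c) * g t) - s * dd (?X s) g = dd (A \<union> y s ` A \<union> insert c B) g"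
  proof -
    have "\<forall>\<^sub>F s in ?F. inj_on (y s) (insert c A) \<and> y s ` insert c A \<inter> (insert c A \<union> B) = {}"
      using fin disj c by (intro eventually_distinct_near lim yne) auto
    then show ?thesis
    proof eventually_elim
      case (elim s)
      have "dd (?X s) (\<lambda>t. (t - c) * g t) - s * dd (?X s) g = dd (?X s) (\<lambda>t. (t - c) * g t - s * g t)"
        by (simp add: dd_diff dd_cmult)
      also have "(\<lambda>t. (t - c) * g t - s * g t) = (\<lambda>t. (t - y s c) * g t)"
        by (simp add: y_def algebra_simps)
      also have "dd (?X s) (\<lambda>t. (t - y s c) * g t) = dd (A \<union> y s ` A \<union> insert c B) g"
      proof -
        have X: "?X s = insert (y s c) (A \<union> y s ` A \<union> insert c B)" by auto
        have "y s c \<notin> y s ` A" using elim c by (auto simp: inj_on_def)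
        then have "y s c \<notin> A \<union> y s ` A \<union> insert c B" using elim by auto
        then show ?thesis unfolding X using fin by (intro dd_insert_mult) auto
      qed
      finally show ?case .
    qed
  qed
  ultimately have "((\<lambda>s. dd (A \<union> y s ` A \<union> insert c B) g) \<longlongrightarrow> dd2 (insert c A) B (\<lambda>t. (t - c) * g t) - 0 * dd2 (insert c A) B g) ?F"
    by (rule Lim_transform_eventually)
  from tendsto_unique[OF trivial_limit_at_right_real this 1] show ?thesis by simp
qed

lemma divdiff_Cons_mult:
  assumes le2: "\<And>d. count_list (c # xs) d \<le> 2"
    and diff: "\<And>a. a \<in> insert c (set xs) \<Longrightarrow> g differentiable (at a)"
  shows "divdiff (c # xs) (\<lambda>t. (t - c) * g t) = divdiff xs g"
proof -
  have le2': "count_list xs d \<le> 2" for d using le2[of d] by (auto split: if_splits)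
  let ?A = "points_of_mult 2" and ?B = "points_of_mult 1"
  have fin: "finite (?A xs)" "finite (?B xs)" "finite (?A (c # xs))" "finite (?B (c # xs))"
    by (simp_all add: finite_points_of_mult)
  have dA: "g differentiable (at a)" if "a \<in> ?A xs" for a
    using that diff set_eq_points_of_mult[OF le2'] by auto
  have dc: "g differentiable (at a)" if "a \<in> insert c (?A xs)" for a
    using that dA diff by auto
  have "count_list xs c = 0 \<or> count_list xs c = 1" using le2[of c] by auto
  then show ?thesis
  proof
    assume 0: "count_list xs c = 0"
    then have "?A (c # xs) = ?A xs" "?B (c # xs) = insert c (?B xs)" "c \<notin> ?A xs \<union> ?B xs"
      by (auto simp: points_of_mult_def)
    moreover have "?A xs \<inter> ?B xs = {}" by (auto simp: points_of_mult_def)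
    ultimately show ?thesis
      using dd2_insert_single[of "?A xs" "?B xs" c g] fin dA
      by (simp add: divdiff_eq_dd2[OF le2] divdiff_eq_dd2[OF le2'])
  next
    assume 1: "count_list xs c = 1"
    then have "?A (c # xs) = insert c (?A xs)" "?B xs = insert c (?B (c # xs))" "c \<notin> ?A xs \<union> ?B (c # xs)"
      by (auto simp: points_of_mult_def)
    moreover have "?A xs \<inter> ?B (c # xs) = {}" using le2 by (auto simp: points_of_mult_def)
    ultimately show ?thesis
      using dd2_insert_double[of "?A xs" "?B (c # xs)" c g, OF _ _ _ _ dc] fin
      by (simp add: divdiff_eq_dd2[OF le2] divdiff_eq_dd2[OF le2'])
  qed
qed

text \<open>Puts divided differences at different points over one common list, at the price of a
  polynomial factor. In this way all entries of a Loewner matrix become values of one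
  functional.\<close>

lemma divdiff_append_mult:
  assumes "\<And>d. count_list (ys @ xs) d \<le> 2"
    and "\<And>a. a \<in> set ys \<union> set xs \<Longrightarrow> g differentiable (at a)"
  shows "divdiff (ys @ xs) (\<lambda>t. (\<Prod>c\<leftarrow>ys. t - c) * g t) = divdiff xs g"
  using assms
proof (induction ys)
  case (Cons y ys)
  have le2: "count_list (ys @ xs) d \<le> 2" for d using Cons.prems(1)[of d] by (simp split: if_splits)
  have prod_diff: "(\<lambda>t. \<Prod>c\<leftarrow>zs. t - c) differentiable (at a)" for zs and a :: real
    by (induction zs) (auto intro!: derivative_intros)
  have "divdiff (y # (ys @ xs)) (\<lambda>t. (t - y) * ((\<Prod>c\<leftarrow>ys. t - c) * g t)) = divdiff (ys @ xs) (\<lambda>t. (\<Prod>c\<leftarrow>ys. t - c) * g t)"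
    using Cons.prems by (intro divdiff_Cons_mult differentiable_mult prod_diff) auto
  then show ?case using Cons.IH[OF le2] Cons.prems by (simp add: mult.assoc)
qed simp

lemma dd2_add:
  assumes "\<And>c. c \<in> A \<Longrightarrow> g differentiable (at c)" "\<And>c. c \<in> A \<Longrightarrow> h differentiable (at c)"
  shows "dd2 A B (\<lambda>x. g x + h x) = dd2 A B g + dd2 A B h"
proof -
  have "deriv (\<lambda>x. g x + h x) c = deriv g c + deriv h c" if "c \<in> A" for c
    using assms that
    by (intro DERIV_imp_deriv derivative_intros) (simp_all add: DERIV_deriv_iff_real_differentiable)
  then have "(\<Sum>c\<in>A. val_coeff A B c * deriv (\<lambda>x. g x + h x) c + der_coeff A B c * (g c + h c)) =
      (\<Sum>c\<in>A. (val_coeff A B c * deriv g c + der_coeff A B c * g c) + (val_coeff A B c * deriv h c + der_coeff A B c * h c))"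
    by (intro sum.cong) (auto simp: algebra_simps)
  then show ?thesis unfolding dd2_def by (simp add: sum.distrib distrib_left)
qed

lemma dd2_cmult:
  assumes "\<And>c. c \<in> A \<Longrightarrow> g differentiable (at c)"
  shows "dd2 A B (\<lambda>x. k * g x) = k * dd2 A B g"
proof -
  have "deriv (\<lambda>x. k * g x) c = k * deriv g c" if "c \<in> A" for c
    using assms that
    by (intro DERIV_imp_deriv) (auto intro!: derivative_eq_intros simp: DERIV_deriv_iff_real_differentiable)
  then show ?thesis unfolding dd2_def
    by (simp add: sum_distrib_left distrib_left mult_ac)
qed

section \<open>Functions with non-negative divided differences\<close>

text \<open>On an interval these are the non-decreasing functions for \<open>k = 1\<close> and the
  convex ones for \<open>k = 2\<close>.\<close>

definition tone :: "nat \<Rightarrow> real set \<Rightarrow> (real \<Rightarrow> real) \<Rightarrow> bool" where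
  "tone k I f \<longleftrightarrow> (\<forall>X. finite X \<and> card X = Suc k \<and> X \<subseteq> I \<longrightarrow> 0 \<le> dd X f)"

lemma dd_shift: "dd ((\<lambda>t. t + h) ` X) f = dd X (\<lambda>t. f (t + h))"
proof -
  have "(\<Prod>y\<in>(\<lambda>t. t + h) ` X - {x + h}. x + h - y) = (\<Prod>y\<in>X - {x}. x - y)" for x
  proof -
    have "(\<lambda>t. t + h) ` X - {x + h} = (\<lambda>t. t + h) ` (X - {x})" by auto
    then show ?thesis by (simp add: prod.reindex)
  qed
  then show ?thesis unfolding dd_def by (simp add: sum.reindex)
qed

text \<open>The points of \<open>S\<close> are moved one at a time. By \<open>dd_rec\<close> each
  move changes the divided difference by the positive length of the move times a divided difference
  of order \<open>k\<close>. The set \<open>R\<close> takes up the points already moved.\<close>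

lemma dd_le_replace:
  assumes tone: "tone k I f" and S: "finite S"
    and "finite R" "R \<inter> S = {}" "R \<inter> y ` S = {}" "S \<inter> y ` S = {}" "inj_on y S"
    and "R \<union> S \<union> y ` S \<subseteq> I" "card R + card S = k" and less: "\<And>s. s \<in> S \<Longrightarrow> s < y s"
  shows "dd (R \<union> S) f \<le> dd (R \<union> y ` S) f"
  using assms(2-)
proof (induction S arbitrary: R rule: finite_induct)
  case (insert s S)
  let ?X = "R \<union> S"
  have ys: "y s \<notin> ?X" "s \<notin> ?X" "y s \<noteq> s" "y s \<notin> y ` S"
    using insert.prems insert.hyps by (auto simp: inj_on_def)
  have "dd (insert (y s) ?X) f - dd (insert s ?X) f = (y s - s) * dd (insert (y s) (insert s ?X)) f"
    using ys insert by (intro dd_rec) auto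
  moreover have "0 \<le> dd (insert (y s) (insert s ?X)) f"
  proof -
    have "card ?X = card R + card S" using insert by (intro card_Un_disjoint) auto
    then have "card (insert (y s) (insert s ?X)) = Suc k" using ys insert by simp
    then show ?thesis using tone insert.prems insert.hyps unfolding tone_def by auto
  qed
  moreover have "0 \<le> y s - s" using insert.prems(8)[of s] by simp
  ultimately have "dd (insert s ?X) f \<le> dd (insert (y s) ?X) f" by (smt (verit) mult_nonneg_nonneg)
  moreover have "dd (insert (y s) R \<union> S) f \<le> dd (insert (y s) R \<union> y ` S) f"
    using insert.prems insert.hyps ys by (intro insert.IH) (auto simp: inj_on_def)
  ultimately show ?case by simp
qed simp

text \<open>The telescoping of \<open>dd_le_replace\<close> with a bound in place of a sign.\<close>

lemma dd_dist_replace: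
  assumes bound: "\<And>Z. finite Z \<Longrightarrow> card Z = Suc k \<Longrightarrow> Z \<subseteq> J \<Longrightarrow> \<bar>dd Z f\<bar> \<le> M" and S: "finite S"
    and "finite R" "R \<inter> S = {}" "R \<inter> y ` S = {}" "S \<inter> y ` S = {}" "inj_on y S"
    and "R \<union> S \<union> y ` S \<subseteq> J" "card R + card S = k"
    and L: "\<And>s. s \<in> S \<Longrightarrow> \<bar>s - y s\<bar> \<le> L"
  shows "\<bar>dd (R \<union> S) f - dd (R \<union> y ` S) f\<bar> \<le> real (card S) * (L * M)"
  using assms(2-)
proof (induction S arbitrary: R rule: finite_induct)
  case (insert s S)
  let ?X = "R \<union> S"
  have ys: "y s \<notin> ?X" "s \<notin> ?X" "y s \<noteq> s" "y s \<notin> y ` S"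
    using insert.prems insert.hyps by (auto simp: inj_on_def)
  have "dd (insert s ?X) f - dd (insert (y s) ?X) f = (s - y s) * dd (insert s (insert (y s) ?X)) f"
    using ys insert by (intro dd_rec) auto
  moreover have "\<bar>dd (insert s (insert (y s) ?X)) f\<bar> \<le> M"
  proof -
    have "card ?X = card R + card S" using insert by (intro card_Un_disjoint) auto
    then have "card (insert s (insert (y s) ?X)) = Suc k" using ys insert by simp
    then show ?thesis using insert.prems insert.hyps by (intro bound) auto
  qed
  moreover have "\<bar>s - y s\<bar> \<le> L" using insert.prems(8)[of s] by simp
  ultimately have "\<bar>dd (insert s ?X) f - dd (insert (y s) ?X) f\<bar> \<le> L * M"
    by (simp add: abs_mult mult_mono')
  moreover have "\<bar>dd (insert (y s) R \<union> S) f - dd (insert (y s) R \<union> y ` S) f\<bar> \<le> real (card S) * (L * M)"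
    using insert.prems insert.hyps ys by (intro insert.IH) (auto simp: inj_on_def)
  ultimately have "\<bar>dd (R \<union> insert s S) f - dd (R \<union> y ` insert s S) f\<bar> \<le> L * M + real (card S) * (L * M)"
    by (auto simp: abs_le_iff)
  then show ?case using insert.hyps by (simp add: algebra_simps)
qed simp

text \<open>\<open>m\<close> counts points, so this is about divided differences of order
  \<open>m - 1\<close>.\<close>

definition dd_locally_bounded :: "nat \<Rightarrow> real set \<Rightarrow> (real \<Rightarrow> real) \<Rightarrow> bool" where
  "dd_locally_bounded m I f \<longleftrightarrow> (\<forall>c\<in>I. \<forall>d\<in>I. c \<le> d \<longrightarrow>
     (\<exists>M. \<forall>Z. finite Z \<and> card Z = m \<and> Z \<subseteq> {c..d} \<longrightarrow> \<bar>dd Z f\<bar> \<le> M))"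

lemma open_real_bounds:
  fixes x :: real
  assumes "open I" "x \<in> I"
  obtains e where "0 < e" "{x - e..x + e} \<subseteq> I"
  using assms by (auto simp: open_contains_cball cball_eq_atLeastAtMost)

lemma finite_subset_right:
  fixes d :: real
  assumes "d < e"
  obtains T where "finite T" "card T = m" "T \<subseteq> {d<..<e}"
  using infinite_arbitrarily_large[of "{d<..<e}" m] assms by (auto simp: infinite_Ioo)

lemma Icc_subset: "is_interval I \<Longrightarrow> (c::real) \<in> I \<Longrightarrow> d \<in> I \<Longrightarrow> {c..d} \<subseteq> I"
  by (meson atLeastAtMost_iff interval_subset_is_interval subsetI mem_is_interval_1_I)

text \<open>Moving points to the right cannot decrease a divided difference with \<open>k\<close>
  points. Those with all points in \<open>{c..d}\<close> therefore lie between one with its points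
  left of \<open>c\<close> and one with its points right of \<open>d\<close>.\<close>

lemma tone_imp_dd_locally_bounded:
  assumes I: "open I" "is_interval I" and tone: "tone k I f"
  shows "dd_locally_bounded k I f"
  unfolding dd_locally_bounded_def
proof (intro ballI impI)
  fix c d assume cd: "c \<in> I" "d \<in> I" "c \<le> d"
  obtain e1 where e1: "e1 > 0" "{c - e1..c + e1} \<subseteq> I" using open_real_bounds[OF I(1) cd(1)] .
  obtain e2 where e2: "e2 > 0" "{d - e2..d + e2} \<subseteq> I" using open_real_bounds[OF I(1) cd(2)] .
  obtain S where S: "finite S" "card S = k" "S \<subseteq> {c - e1<..<c}" using finite_subset_right[of "c - e1" c] e1 by auto
  obtain T where T: "finite T" "card T = k" "T \<subseteq> {d<..<d + e2}" using finite_subset_right[of d "d + e2"] e2 by auto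
  have Sc: "u < c" "u \<in> I" if "u \<in> S" for u
  proof -
    have "u \<in> {c - e1<..<c}" using S(3) that by (rule subsetD)
    then have "u < c" "u \<in> {c - e1..c + e1}" using e1(1) by auto
    then show "u < c" "u \<in> I" using e1(2) by auto
  qed
  have Td: "d < u" "u \<in> I" if "u \<in> T" for u
  proof -
    have "u \<in> {d<..<d + e2}" using T(3) that by (rule subsetD)
    then have "d < u" "u \<in> {d - e2..d + e2}" using e2(1) by auto
    then show "d < u" "u \<in> I" using e2(2) by auto
  qed
  have le: "dd U f \<le> dd V f" if UV: "finite U" "finite V" "card U = k" "card V = k" "U \<subseteq> I" "V \<subseteq> I"
    "\<And>u v. u \<in> U \<Longrightarrow> v \<in> V \<Longrightarrow> u < v" for U V
  proof -
    obtain y where y: "bij_betw y U V" using finite_same_card_bij[of U V] UV by auto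
    have "U \<inter> V = {}" using UV(7) by (meson disjoint_iff less_irrefl)
    then have "dd ({} \<union> U) f \<le> dd ({} \<union> y ` U) f"
      using UV y by (intro dd_le_replace[OF tone]) (auto simp: bij_betw_def)
    then show ?thesis using y by (simp add: bij_betw_def)
  qed
  have "\<bar>dd Z f\<bar> \<le> \<bar>dd S f\<bar> + \<bar>dd T f\<bar>" if Z: "finite Z" "card Z = k" "Z \<subseteq> {c..d}" for Z
  proof -
    have ZI: "Z \<subseteq> I" using Z Icc_subset[OF I(2) cd(1,2)] by auto
    have zcd: "c \<le> z" "z \<le> d" if "z \<in> Z" for z using Z(3) that by auto
    have "dd S f \<le> dd Z f"
      by (rule le) (use S Z ZI Sc in \<open>auto intro: less_le_trans[OF Sc(1) zcd(1)]\<close>)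
    moreover have "dd Z f \<le> dd T f"
      by (rule le) (use T Z ZI Td in \<open>auto intro: le_less_trans[OF zcd(2) Td(1)]\<close>)
    ultimately show ?thesis by linarith
  qed
  then show "\<exists>M. \<forall>Z. finite Z \<and> card Z = k \<and> Z \<subseteq> {c..d} \<longrightarrow> \<bar>dd Z f\<bar> \<le> M" by blast
qed

text \<open>All points are moved to a fixed set \<open>T\<close> beyond \<open>d\<close>; every move
  costs at most its length times the bound for one more point.\<close>

lemma dd_locally_bounded_Suc:
  assumes I: "open I" "is_interval I" and bdd: "dd_locally_bounded (Suc m) I f"
  shows "dd_locally_bounded m I f"
  unfolding dd_locally_bounded_def
proof (intro ballI impI)
  fix c d assume cd: "c \<in> I" "d \<in> I" "c \<le> d"
  obtain e where e: "e > 0" "{d - e..d + e} \<subseteq> I" using open_real_bounds[OF I(1) cd(2)] .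
  obtain T where T: "finite T" "card T = m" "T \<subseteq> {d<..<d + e}" using finite_subset_right[of d "d + e"] e by auto
  have "d + e \<in> I" using e by auto
  then obtain M where M: "\<And>Z. finite Z \<Longrightarrow> card Z = Suc m \<Longrightarrow> Z \<subseteq> {c..d + e} \<Longrightarrow> \<bar>dd Z f\<bar> \<le> M"
    using bdd cd e unfolding dd_locally_bounded_def by (metis add.commute add_increasing less_imp_le)
  have "\<bar>dd Z f\<bar> \<le> \<bar>dd T f\<bar> + real m * ((d + e - c) * M)" if Z: "finite Z" "card Z = m" "Z \<subseteq> {c..d}" for Z
  proof -
    obtain y where y: "bij_betw y Z T" using Z T finite_same_card_bij[of Z T] by auto
    have yT: "y ` Z = T" "inj_on y Z" using y by (auto simp: bij_betw_def)
    have yz: "y z \<in> {d<..<d + e}" if "z \<in> Z" for z using that yT T by auto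
    have zcd: "c \<le> z" "z \<le> d" if "z \<in> Z" for z using Z(3) that by auto
    have Td: "d < u" "u < d + e" if "u \<in> T" for u using T(3) that by auto
    have "Z \<inter> T = {}" using zcd(2) Td(1) by (meson disjoint_iff not_less)
    moreover have "Z \<union> T \<subseteq> {c..d + e}"
    proof
      fix u assume "u \<in> Z \<union> T"
      then show "u \<in> {c..d + e}" using zcd[of u] Td[of u] cd(3) e(1) by auto
    qed
    moreover have "\<bar>z - y z\<bar> \<le> d + e - c" if "z \<in> Z" for z
    proof -
      have "c \<le> z" "z \<le> d" using that Z by auto
      then show ?thesis using yz[OF that] by auto
    qed
    ultimately have "\<bar>dd ({} \<union> Z) f - dd ({} \<union> y ` Z) f\<bar> \<le> real (card Z) * ((d + e - c) * M)"
      using Z T yT by (intro dd_dist_replace[OF M]) auto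
    then show ?thesis using Z yT by (auto simp: abs_le_iff)
  qed
  then show "\<exists>M. \<forall>Z. finite Z \<and> card Z = m \<and> Z \<subseteq> {c..d} \<longrightarrow> \<bar>dd Z f\<bar> \<le> M" by blast
qed

lemma dd_locally_bounded_le:
  assumes I: "open I" "is_interval I" and "dd_locally_bounded k I f" "m \<le> k"
  shows "dd_locally_bounded m I f"
  using assms(4,3)
  by (induction k rule: dec_induct) (auto intro: dd_locally_bounded_Suc[OF I])

text \<open>A bound on divided differences of order two makes the difference quotient at
  \<open>x\<close> a Lipschitz function of the other point. It extends to \<open>x\<close>, and its
  value there is the derivative.\<close>

lemma dd_locally_bounded_3_C1:
  assumes I: "open I" "is_interval I" and bdd: "dd_locally_bounded 3 I f"
  shows "\<And>x. x \<in> I \<Longrightarrow> f differentiable (at x)" "continuous_on I (deriv f)"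
proof -
  have key: "f differentiable (at x) \<and> (\<forall>y. c < y \<and> y < d \<and> y \<noteq> x \<longrightarrow> \<bar>(f y - f x) / (y - x) - deriv f x\<bar> \<le> M * \<bar>y - x\<bar>)"
    if x: "c < x" "x < d" and M: "\<And>Z. finite Z \<Longrightarrow> card Z = 3 \<Longrightarrow> Z \<subseteq> {c..d} \<Longrightarrow> \<bar>dd Z f\<bar> \<le> M" for c d x M
  proof -
    let ?J = "{c<..<d} - {x}"
    define \<phi> where "\<phi> y = (f y - f x) / (y - x)" for y
    have lip: "\<bar>\<phi> y - \<phi> z\<bar> \<le> M * \<bar>y - z\<bar>" if "y \<in> ?J" "z \<in> ?J" for y z
    proof (cases "y = z")
      case False
      have "dd {y, x} f - dd {z, x} f = (y - z) * dd {y, z, x} f"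
        using that False by (intro dd_rec) auto
      moreover have "dd {y, x} f = \<phi> y" "dd {z, x} f = \<phi> z"
        using that by (auto simp: dd_pair \<phi>_def)
      moreover have "\<bar>dd {y, z, x} f\<bar> \<le> M" using that False x by (intro M) auto
      ultimately show ?thesis
        using mult_left_mono[of "\<bar>dd {y, z, x} f\<bar>" M "\<bar>y - z\<bar>"] by (simp add: abs_mult mult.commute)
    qed simp
    have M0: "0 \<le> M"
    proof -
      have "\<bar>dd {(c + x) / 2, x, (x + d) / 2} f\<bar> \<le> M" using x by (intro M) auto
      then show ?thesis by linarith
    qed
    have "uniformly_continuous_on ?J \<phi>"
    proof (rule lipschitz_on_uniformly_continuous[of M])
      show "M-lipschitz_on ?J \<phi>"
        using lip M0 by (intro lipschitz_onI) (auto simp: dist_real_def)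
    qed
    have atx: "at x within ?J = at x"
    proof -
      have "at x within ?J = at x within {c<..<d}" by (simp add: at_within_def)
      also have "\<dots> = at x" by (rule at_within_open) (use x in auto)
      finally show ?thesis .
    qed
    have "x islimpt ?J" using trivial_limit_within[of x ?J] unfolding atx by simp
    then have "x \<in> closure ?J" by (simp add: closure_def)
    with \<open>uniformly_continuous_on ?J \<phi>\<close> obtain l where "(\<phi> \<longlongrightarrow> l) (at x within ?J)"
      using uniformly_continuous_on_extension_at_closure by metis
    then have l: "(\<phi> \<longlongrightarrow> l) (at x)" by (simp only: atx)
    then have D: "(f has_real_derivative l) (at x)"
      by (simp add: has_field_derivative_iff \<phi>_def[abs_def])
    have "\<bar>\<phi> y - l\<bar> \<le> M * \<bar>y - x\<bar>" if y: "y \<in> ?J" for y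
    proof (rule tendsto_le[of "at x"])
      show "((\<lambda>z. \<bar>\<phi> y - \<phi> z\<bar>) \<longlongrightarrow> \<bar>\<phi> y - l\<bar>) (at x)" by (intro tendsto_intros l)
      show "((\<lambda>z. M * \<bar>y - z\<bar>) \<longlongrightarrow> M * \<bar>y - x\<bar>) (at x)" by (intro tendsto_intros)
      have "\<forall>\<^sub>F z in at x. z \<in> {c<..<d}" using x by (intro eventually_at_in_open') auto
      then show "\<forall>\<^sub>F z in at x. \<bar>\<phi> y - \<phi> z\<bar> \<le> M * \<bar>y - z\<bar>"
        using eventually_neq_at_within[of x x UNIV] by eventually_elim (use lip y in auto)
    qed simp
    moreover have "deriv f x = l" using D by (rule DERIV_imp_deriv)
    ultimately show ?thesis
      using D by (auto simp: \<phi>_def real_differentiable_def)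
  qed
  have local: "\<exists>c d M. c < x \<and> x < d \<and> (\<forall>Z. finite Z \<and> card Z = 3 \<and> Z \<subseteq> {c..d} \<longrightarrow> \<bar>dd Z f\<bar> \<le> M)"
    if x: "x \<in> I" for x
  proof -
    obtain e where e: "e > 0" "{x - e..x + e} \<subseteq> I" using open_real_bounds[OF I(1) x] .
    then have "x - e \<in> I" "x + e \<in> I" "x - e \<le> x + e" by auto
    then obtain M where "\<forall>Z. finite Z \<and> card Z = 3 \<and> Z \<subseteq> {x - e..x + e} \<longrightarrow> \<bar>dd Z f\<bar> \<le> M"
      using bdd unfolding dd_locally_bounded_def by meson
    then show ?thesis using e by (intro exI[of _ "x - e"] exI[of _ "x + e"] exI[of _ M]) auto
  qed
  show "f differentiable (at x)" if "x \<in> I" for x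
    using local[OF that] key by meson
  show "continuous_on I (deriv f)"
  proof (rule continuous_at_imp_continuous_on, rule ballI)
    fix x assume "x \<in> I"
    from local[OF this] obtain c d M where cd: "c < x" "x < d"
      and M: "\<And>Z. finite Z \<Longrightarrow> card Z = 3 \<Longrightarrow> Z \<subseteq> {c..d} \<Longrightarrow> \<bar>dd Z f\<bar> \<le> M" by metis
    \<comment> \<open>The difference quotient of \<open>x\<close> and \<open>y\<close> is within
      \<open>M * \<bar>y - x\<bar>\<close> of the derivative at either point, hence the factor
      2.\<close>
    have ev: "\<forall>\<^sub>F y in at x. \<bar>deriv f y - deriv f x\<bar> \<le> 2 * M * \<bar>y - x\<bar>"
    proof -
      have "\<forall>\<^sub>F z in at x. z \<in> {c<..<d}" using cd by (intro eventually_at_in_open') auto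
      then show ?thesis
        using eventually_neq_at_within[of x x UNIV]
      proof eventually_elim
        case (elim y)
        have "\<bar>(f y - f x) / (y - x) - deriv f x\<bar> \<le> M * \<bar>y - x\<bar>"
          using key[OF cd M] elim by auto
        moreover have "\<bar>(f x - f y) / (x - y) - deriv f y\<bar> \<le> M * \<bar>x - y\<bar>"
          using key[of c y d M] M elim cd by auto
        moreover have "(f x - f y) / (x - y) = (f y - f x) / (y - x)"
          by (metis minus_diff_eq minus_divide_divide)
        ultimately show ?case by (simp add: abs_minus_commute abs_le_iff)
      qed
    qed
    have "((\<lambda>y. 2 * M * \<bar>y - x\<bar>) \<longlongrightarrow> 2 * M * \<bar>x - x\<bar>) (at x)" by (intro tendsto_intros)
    then have "((\<lambda>y. 2 * M * \<bar>y - x\<bar>) \<longlongrightarrow> 0) (at x)" by simp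
    then have "((\<lambda>y. deriv f y - deriv f x) \<longlongrightarrow> 0) (at x)"
      by (rule Lim_null_comparison[rotated]) (use ev in simp)
    then show "isCont (deriv f) x" unfolding isCont_def by (simp add: LIM_zero_cancel)
  qed
qed

text \<open>The divided difference of \<open>(f (t + h) - f t) / h\<close> over \<open>X\<close>
  compares the points of \<open>X\<close> with the same points moved to the right by
  \<open>h\<close>, so \<open>dd_le_replace\<close> gives its sign.\<close>

lemma tone_deriv:
  assumes I: "open I" and tone: "tone (Suc k) I f" and diff: "\<And>x. x \<in> I \<Longrightarrow> f differentiable (at x)"
  shows "tone k I (deriv f)"
  unfolding tone_def
proof (intro allI impI, elim conjE)
  fix X assume X: "finite X" "card X = Suc k" "X \<subseteq> I"
  let ?F = "at_right (0::real)"
  have lim: "((\<lambda>h. t + h) \<longlongrightarrow> t) ?F" for t :: real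
    by (rule tendsto_eq_intros refl tendsto_ident_at | simp)+
  have ne: "\<forall>\<^sub>F h in ?F. t + h \<noteq> t" for t :: real
    using eventually_at_right_less[of 0] by eventually_elim auto
  have "((\<lambda>h. dd X (\<lambda>t. (f (t + h) - f t) / h)) \<longlongrightarrow> dd X (deriv f)) ?F"
    unfolding dd_def
  proof (intro tendsto_sum tendsto_divide tendsto_const)
    fix t assume "t \<in> X"
    then have "(f has_real_derivative deriv f t) (at t)"
      using X diff by (auto simp: DERIV_deriv_iff_real_differentiable)
    then have "((\<lambda>h. (f (t + h) - f t) / h) \<longlongrightarrow> deriv f t) (at 0)" by (simp add: DERIV_def)
    then show "((\<lambda>h. (f (t + h) - f t) / h) \<longlongrightarrow> deriv f t) ?F"
      by (rule filterlim_mono) (auto simp: at_le)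
  qed (use X in auto)
  moreover have "\<forall>\<^sub>F h in ?F. 0 \<le> dd X (\<lambda>t. (f (t + h) - f t) / h)"
  proof -
    have "\<forall>\<^sub>F h in ?F. inj_on (\<lambda>t. t + h) X \<and> (\<lambda>t. t + h) ` X \<inter> (X \<union> {}) = {}"
      using X by (intro eventually_distinct_near lim ne) auto
    moreover have "\<forall>\<^sub>F h in ?F. \<forall>t\<in>X. t + h \<in> I"
      using X I lim by (intro eventually_ball_finite ballI) (auto simp: tendsto_def)
    ultimately show ?thesis using eventually_at_right_less[of 0]
    proof eventually_elim
      case (elim h)
      have "dd ({} \<union> X) f \<le> dd ({} \<union> (\<lambda>t. t + h) ` X) f"
        using elim X by (intro dd_le_replace[OF tone]) auto
      then have "0 \<le> dd X (\<lambda>t. f (t + h) - f t)" by (simp add: dd_shift dd_diff)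
      then show ?case using elim by (simp add: dd_divide)
    qed
  qed
  ultimately show "0 \<le> dd X (deriv f)"
    by (rule tendsto_lowerbound) simp
qed

section \<open>Order two and convexity\<close>

lemma dd_triple:
  assumes "x < m" "m < y"
  shows "dd {x, m, y} f = ((f y - f m) / (y - m) - (f m - f x) / (m - x)) / (y - x)"
proof -
  have "dd (insert y {m}) f - dd (insert x {m}) f = (y - x) * dd (insert y (insert x {m})) f"
    using assms by (intro dd_rec) auto
  moreover have "dd {y, m} f = (f y - f m) / (y - m)" "dd {x, m} f = (f m - f x) / (m - x)"
    using assms by (simp_all add: dd_pair) (metis minus_diff_eq minus_divide_divide)
  moreover have "{x, m, y} = insert y (insert x {m})" by auto
  ultimately show ?thesis using assms by simp
qed

lemma convex_on_slopeI:
  assumes I: "is_interval I"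
    and slope: "\<And>x m y. x \<in> I \<Longrightarrow> y \<in> I \<Longrightarrow> x < m \<Longrightarrow> m < y \<Longrightarrow>
      (f m - f x) / (m - x) \<le> (f y - f m) / (y - m)"
  shows "convex_on I (f :: real \<Rightarrow> real)"
proof (rule convex_on_linorderI)
  fix t x y :: real assume t: "0 < t" "t < 1" and xy: "x \<in> I" "y \<in> I" "x < y"
  define m where "m = (1 - t) *\<^sub>R x + t *\<^sub>R y"
  have mx: "m - x = t * (y - x)" and my: "y - m = (1 - t) * (y - x)"
    by (simp_all add: m_def algebra_simps)
  have xm: "x < m" "m < y"
  proof -
    have "0 < m - x" unfolding mx using t xy by simp
    then show "x < m" by simp
    have "0 < y - m" unfolding my using t xy by simp
    then show "m < y" by simp
  qed
  have "(f m - f x) / (m - x) \<le> (f y - f m) / (y - m)" using slope xy xm by blast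
  then have "(f m - f x) * (y - m) \<le> (f y - f m) * (m - x)"
    using xm by (simp add: divide_simps split: if_splits)
  then have "((f m - f x) * (1 - t)) * (y - x) \<le> ((f y - f m) * t) * (y - x)"
    unfolding mx my by (simp add: mult_ac)
  then have "(f m - f x) * (1 - t) \<le> (f y - f m) * t" using xy by simp
  then show "f ((1 - t) *\<^sub>R x + t *\<^sub>R y) \<le> (1 - t) * f x + t * f y"
    unfolding m_def[symmetric] by (simp add: algebra_simps)
qed (use I in \<open>simp add: is_interval_convex\<close>)

lemma tone_2_imp_convex:
  assumes I: "is_interval I" and tone: "tone 2 I f"
  shows "convex_on I f"
proof (rule convex_on_slopeI[OF I])
  fix x m y assume xy: "x \<in> I" "y \<in> I" and xm: "x < m" "m < y"
  have "m \<in> I" using Icc_subset[OF I xy(1,2)] xm by auto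
  then have "0 \<le> dd {x, m, y} f" using tone xy xm unfolding tone_def by auto
  then show "(f m - f x) / (m - x) \<le> (f y - f m) / (y - m)"
    using xm by (simp add: dd_triple zero_le_divide_iff)
qed

lemma convex_imp_tone_2:
  assumes "convex_on I f"
  shows "tone 2 I f"
  unfolding tone_def
proof (intro allI impI, elim conjE)
  fix X assume X: "finite X" "card X = Suc 2" "X \<subseteq> I"
  define x where "x = Min X"
  define y where "y = Max X"
  have ne: "X \<noteq> {}" using X by auto
  have xy: "x \<in> X" "y \<in> X" "\<And>z. z \<in> X \<Longrightarrow> x \<le> z \<and> z \<le> y" using X ne by (auto simp: x_def y_def)
  have "card (X - {x, y}) \<noteq> 0"
  proof -
    have "card X \<le> card (X - {x, y}) + card {x, y}" using X card_Un_le[of "X - {x,y}" "{x,y}"]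
      by (metis Un_Diff_cancel2 Un_absorb2 insert_subset empty_subsetI xy(1,2))
    moreover have "card {x, y} \<le> 2" by (simp add: card_insert_if)
    ultimately show ?thesis using X by linarith
  qed
  then obtain m where m: "m \<in> X" "m \<noteq> x" "m \<noteq> y" by (metis Diff_iff card.empty equals0I insertCI)
  then have less: "x < m" "m < y" using xy(3)[of m] by auto
  have "X = {x, m, y}" using X less xy m
    by (intro card_subset_eq[symmetric]) auto
  moreover have "(f m - f x) / (m - x) \<le> (f y - f m) / (y - m)"
  proof -
    have "(f x - f m) / (x - m) \<le> (f x - f y) / (x - y)" "(f x - f y) / (x - y) \<le> (f m - f y) / (m - y)"
      using convex_on_slope_le[OF assms _ _ less] xy X by auto
    moreover have "(f x - f m) / (x - m) = (f m - f x) / (m - x)" "(f m - f y) / (m - y) = (f y - f m) / (y - m)"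
      by (metis minus_diff_eq minus_divide_divide)+
    ultimately show ?thesis by linarith
  qed
  ultimately show "0 \<le> dd X f" using less by (simp add: dd_triple)
qed

lemma C_k_on_Suc:
  "C_k_on (Suc j) I f \<longleftrightarrow> (\<forall>t\<in>I. f differentiable (at t)) \<and> C_k_on j I (deriv f)"
  unfolding C_k_on_def by (auto simp: funpow_Suc_right less_Suc_eq_0_disj simp del: funpow.simps(2))

text \<open>Every derivative lowers the order by one until order 2 is reached, which is convexity.
  At order at least 3 the divided differences of order two are locally bounded, so the derivative
  exists.\<close>

lemma tone_imp_C_k_convex:
  assumes I: "open I" "is_interval I" and "tone (j + 2) I f"
  shows "C_k_on j I f \<and> convex_on I ((deriv ^^ j) f)"
  using assms(3)
proof (induction j arbitrary: f)
  case 0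
  then have "convex_on I f" using tone_2_imp_convex[OF I(2)] by (simp add: numeral_2_eq_2)
  then show ?case using convex_on_continuous[OF I(1)] by (simp add: C_k_on_def)
next
  case (Suc j)
  have "dd_locally_bounded 3 I f"
    using tone_imp_dd_locally_bounded[OF I Suc.prems] by (rule dd_locally_bounded_le[OF I]) simp
  note C1 = dd_locally_bounded_3_C1[OF I this]
  have "tone (j + 2) I (deriv f)"
    using Suc.prems by (intro tone_deriv[OF I(1)] C1) simp
  from Suc.IH[OF this] C1 show ?case
    by (simp add: C_k_on_Suc funpow_Suc_right del: funpow.simps(2))
qed

section \<open>The mean value form of divided differences\<close>

lemma lagrange_interpolation:
  fixes f :: "'a :: field \<Rightarrow> 'a"
  assumes "finite X" "X \<noteq> {}"
  obtains p where "degree p < card X" "\<And>x. x \<in> X \<Longrightarrow> poly p x = f x"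
proof -
  have "\<exists>p. degree p < card X \<and> (\<forall>x\<in>X. poly p x = f x)"
    using assms
  proof (induction X rule: finite_ne_induct)
    case (singleton x)
    show ?case by (rule exI[of _ "[:f x:]"]) auto
  next
    case (insert c X)
    then obtain p where p: "degree p < card X" "\<forall>x\<in>X. poly p x = f x" by blast
    define w where "w = (\<Prod>x\<in>X. [:-x, 1:])"
    have w: "poly w x = 0" if "x \<in> X" for x using that insert by (auto simp: w_def poly_prod)
    have wc: "poly w c \<noteq> 0" using insert by (auto simp: w_def poly_prod)
    have dw: "degree w \<le> card X"
      unfolding w_def using degree_prod_sum_le[of X "\<lambda>x. [:-x, 1:]"] insert by simp
    define r where "r = p + Polynomial.smult ((f c - poly p c) / poly w c) w"
    have "degree r < card (insert c X)"
      unfolding r_def using insert p dw by (intro degree_add_less) (auto intro: le_less_trans[OF degree_smult_le])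
    moreover have "\<forall>x\<in>insert c X. poly r x = f x" using w wc p by (auto simp: r_def)
    ultimately show ?case by blast
  qed
  then show thesis using that by blast
qed

text \<open>If \<open>p\<close> interpolates \<open>f\<close> on \<open>X\<close>, Rolle's theorem gives one point fewer at which \<open>p'\<close>
  interpolates \<open>f'\<close>, and both divided differences are read off the leading coefficient of \<open>p\<close>.\<close>

lemma dd_eq_dd_deriv:
  assumes I: "is_interval I" and diff: "\<And>x. x \<in> I \<Longrightarrow> f differentiable (at x)"
    and X: "finite X" "card X = Suc (Suc k)" "X \<subseteq> I"
  obtains Y where "finite Y" "card Y = Suc k" "Y \<subseteq> I" "dd Y (deriv f) = real (Suc k) * dd X f"
proof -
  have ne: "X \<noteq> {}" using X by auto
  obtain p where p: "degree p < card X" "\<And>x. x \<in> X \<Longrightarrow> poly p x = f x"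
    using lagrange_interpolation[OF X(1) ne, of f] by blast
  define xs where "xs = sorted_list_of_set X"
  have xs: "set xs = X" "length xs = Suc (Suc k)" "sorted_wrt (<) xs"
    using X by (auto simp: xs_def)
  define g where "g t = f t - poly p t" for t
  have mono: "xs ! i < xs ! j" if "i < j" "j < Suc (Suc k)" for i j
    using xs that by (simp add: sorted_wrt_nth_less)
  have inX: "xs ! i \<in> X" if "i < Suc (Suc k)" for i using xs that nth_mem by metis
  have "\<exists>z. xs ! i < z \<and> z < xs ! Suc i \<and> deriv f z = poly (pderiv p) z" if i: "i < Suc k" for i
  proof -
    have sub: "{xs ! i..xs ! Suc i} \<subseteq> I" using i inX X by (intro Icc_subset[OF I]) auto
    have Dg: "(g has_real_derivative deriv f t - poly (pderiv p) t) (at t)" if "t \<in> I" for t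
      unfolding g_def[abs_def] using diff[OF that]
      by (intro derivative_intros) (auto simp: DERIV_deriv_iff_real_differentiable poly_DERIV)
    have "\<exists>z. xs ! i < z \<and> z < xs ! Suc i \<and> (g has_real_derivative 0) (at z)"
    proof (rule Rolle)
      show "xs ! i < xs ! Suc i" using i mono by simp
      show "g (xs ! i) = g (xs ! Suc i)" using i inX p by (simp add: g_def)
      show "continuous_on {xs ! i..xs ! Suc i} g"
        using Dg sub by (intro continuous_at_imp_continuous_on) (auto intro: DERIV_isCont)
      show "g differentiable (at x)" if "xs ! i < x" "x < xs ! Suc i" for x
      proof -
        have "x \<in> I" using sub that by auto
        then show ?thesis using Dg[of x] by (auto simp: real_differentiable_def)
      qed
    qed
    then obtain z where z: "xs ! i < z" "z < xs ! Suc i" "(g has_real_derivative 0) (at z)" by blast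
    have "z \<in> {xs ! i..xs ! Suc i}" using z by simp
    then have "z \<in> I" using sub by (rule subsetD[rotated])
    from DERIV_unique[OF Dg[OF this] z(3)] have "deriv f z - poly (pderiv p) z = 0" .
    then show ?thesis using z by auto
  qed
  then obtain z where z: "\<And>i. i < Suc k \<Longrightarrow> xs ! i < z i \<and> z i < xs ! Suc i \<and> deriv f (z i) = poly (pderiv p) (z i)"
    by metis
  have zmono: "z i < z j" if "i < j" "j < Suc k" for i j
  proof -
    have "z i < xs ! Suc i" using z that by simp
    also have "xs ! Suc i \<le> xs ! j" using that mono[of "Suc i" j] by (cases "Suc i = j") auto
    also have "xs ! j < z j" using z that by simp
    finally show ?thesis .
  qed
  define Y where "Y = z ` {..<Suc k}"
  have inj: "inj_on z {..<Suc k}"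
    by (rule linorder_inj_onI) (use zmono in \<open>auto simp: less_imp_neq\<close>)
  have Y: "finite Y" "card Y = Suc k" unfolding Y_def using inj by (simp_all add: card_image)
  have YI: "Y \<subseteq> I"
  proof
    fix y assume "y \<in> Y"
    then obtain i where i: "i < Suc k" "y = z i" by (auto simp: Y_def)
    have "{xs ! i..xs ! Suc i} \<subseteq> I" using i inX X by (intro Icc_subset[OF I]) auto
    moreover have "y \<in> {xs ! i..xs ! Suc i}" using z[OF i(1)] i by simp
    ultimately show "y \<in> I" by (rule subsetD)
  qed
  have "dd Y (deriv f) = dd Y (poly (pderiv p))" using z by (intro dd_cong) (auto simp: Y_def)
  also have "\<dots> = coeff (pderiv p) k"
    using p X by (intro dd_poly Y) (simp add: degree_pderiv)
  also have "\<dots> = real (Suc k) * coeff p (Suc k)" by (simp add: coeff_pderiv)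
  also have "coeff p (Suc k) = dd X (poly p)" using p X by (intro dd_poly[symmetric]) auto
  also have "dd X (poly p) = dd X f" using p by (intro dd_cong)
  finally show thesis using that Y YI by blast
qed

text \<open>By \<open>dd_eq_dd_deriv\<close> a divided difference of \<open>f\<close> has the sign
  of one of \<open>deriv f\<close> with a point less.\<close>

lemma C_k_convex_imp_tone:
  assumes I: "is_interval I" and "C_k_on j I f" "convex_on I ((deriv ^^ j) f)"
  shows "tone (j + 2) I f"
  using assms(2,3)
proof (induction j arbitrary: f)
  case 0
  then show ?case using convex_imp_tone_2[of I f] by (simp add: numeral_2_eq_2)
next
  case (Suc j)
  have diff: "\<And>x. x \<in> I \<Longrightarrow> f differentiable (at x)" and "C_k_on j I (deriv f)"
    using Suc.prems by (simp_all add: C_k_on_Suc)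
  moreover have "convex_on I ((deriv ^^ j) (deriv f))"
    using Suc.prems by (simp add: funpow_Suc_right del: funpow.simps(2))
  ultimately have "tone (j + 2) I (deriv f)" by (intro Suc.IH)
  then show ?case
    unfolding tone_def
  proof (intro allI impI, elim conjE)
    fix X assume tone: "\<forall>X. finite X \<and> card X = Suc (j + 2) \<and> X \<subseteq> I \<longrightarrow> 0 \<le> dd X (deriv f)"
      and X: "finite X" "card X = Suc (Suc j + 2)" "X \<subseteq> I"
    obtain Y where "finite Y" "card Y = Suc (j + 2)" "Y \<subseteq> I" "dd Y (deriv f) = real (Suc (j + 2)) * dd X f"
      using dd_eq_dd_deriv[OF I diff, of X "j + 2"] X by auto
    then show "0 \<le> dd X f" using tone by (metis of_nat_0_less_iff zero_le_mult_iff zero_less_Suc not_less)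
  qed
qed

section \<open>Monotone functions are differentiable almost everywhere\<close>

text \<open>A pair \<open>(a, \<rho>)\<close> stands for the interval \<open>{a - \<rho>..a + \<rho>}\<close>, the form in which the
  Vitali covering theorem takes intervals.\<close>

definition mean_slope :: "(real \<Rightarrow> real) \<Rightarrow> real \<times> real \<Rightarrow> real" where
  "mean_slope r i = (r (fst i + snd i) - r (fst i - snd i)) / (2 * snd i)"

text \<open>The condition of a Vitali cover at \<open>x\<close>. With \<open>P\<close> the condition
  that \<open>mean_slope\<close> passes a given number, it says that the slopes of intervals
  shrinking to \<open>x\<close> keep passing that number.\<close>

definition finely_covered :: "(real \<times> real \<Rightarrow> bool) \<Rightarrow> real \<Rightarrow> bool" where
  "finely_covered P x \<longleftrightarrow> (\<forall>d>0. \<exists>i. 0 < snd i \<and> snd i < d \<and> x \<in> cball (fst i) (snd i) \<and> P i)"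

lemma measure_cball_real: "0 < \<rho> \<Longrightarrow> measure lebesgue (cball a \<rho>) = 2 * \<rho>" for a \<rho> :: real
  by (simp add: cball_eq_atLeastAtMost)

lemma measure_Union_disjoint_cball:
  fixes F :: "(real \<times> real) set"
  assumes "finite F" "\<And>i. i \<in> F \<Longrightarrow> 0 < snd i"
    "pairwise (\<lambda>i j. disjnt (cball (fst i) (snd i)) (cball (fst j) (snd j))) F"
  shows "measure lebesgue (\<Union>i\<in>F. cball (fst i) (snd i)) = (\<Sum>i\<in>F. 2 * snd i)"
proof -
  have "measure lebesgue (\<Union>i\<in>F. cball (fst i) (snd i)) = (\<Sum>i\<in>F. measure lebesgue (cball (fst i) (snd i)))"
  proof (rule measure_negligible_finite_Union_image)
    show "pairwise (\<lambda>x y. negligible (cball (fst x) (snd x) \<inter> cball (fst y) (snd y))) F"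
      using assms(3) by (rule pairwise_mono) (auto simp: disjnt_def)
  qed (use assms in auto)
  also have "\<dots> = (\<Sum>i\<in>F. 2 * snd i)"
    by (intro sum.cong refl measure_cball_real assms(2))
  finally show ?thesis .
qed

lemma vitali_cover:
  fixes E :: "real set"
  assumes fine: "\<And>x. x \<in> E \<Longrightarrow> finely_covered P x" and W: "open W" "E \<subseteq> W"
  obtains C where "countable C" "\<forall>i\<in>C. 0 < snd i \<and> P i \<and> cball (fst i) (snd i) \<subseteq> W"
    "pairwise (\<lambda>i j. disjnt (cball (fst i) (snd i)) (cball (fst j) (snd j))) C"
    "negligible (E - (\<Union>i\<in>C. cball (fst i) (snd i)))"
proof -
  define K where "K = {i. 0 < snd i \<and> P i \<and> cball (fst i) (snd i) \<subseteq> W}"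
  have fineK: "\<exists>i. i \<in> K \<and> x \<in> cball (fst i) (snd i) \<and> snd i < d" if x: "x \<in> E" and d: "0 < d" for x d
  proof -
    obtain e where e: "e > 0" "ball x e \<subseteq> W" using W x by (meson openE subsetD)
    \<comment> \<open>An interval of radius below \<open>e / 2\<close> that contains
      \<open>x\<close> lies in the ball of radius \<open>e\<close>.\<close>
    obtain i where i: "0 < snd i" "snd i < min d (e / 2)" "x \<in> cball (fst i) (snd i)" "P i"
      using fine[OF x] d e unfolding finely_covered_def by (metis half_gt_zero min_less_iff_conj)
    have "cball (fst i) (snd i) \<subseteq> ball x e"
    proof
      fix z assume "z \<in> cball (fst i) (snd i)"
      then have "dist x z \<le> snd i + snd i"
        using i(3) dist_triangle[of x z "fst i"] by (simp add: dist_commute)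
      then show "z \<in> ball x e" using i by simp
    qed
    then show ?thesis using i e by (intro exI[of _ i]) (auto simp: K_def)
  qed
  have posK: "\<And>i. i \<in> K \<Longrightarrow> 0 < snd i" by (auto simp: K_def)
  obtain C where C: "countable C" "C \<subseteq> K"
    "pairwise (\<lambda>i j. disjnt (cball (fst i) (snd i)) (cball (fst j) (snd j))) C"
    "negligible (E - (\<Union>i\<in>C. cball (fst i) (snd i)))"
    by (rule Vitali_covering_theorem_cballs[of K snd E fst, OF posK fineK])
  show thesis by (rule that[OF C(1) _ C(3,4)]) (use C(2) in \<open>auto simp: K_def\<close>)
qed

text \<open>If all finite subfamilies had total length at most \<open>m - e\<close>, so would the
  countable family; but its union covers \<open>E\<close> up to a null set and cannot be smaller
  than \<open>m\<close>.\<close>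

lemma vitali_cover_finite:
  fixes E :: "real set"
  assumes fine: "\<And>x. x \<in> E \<Longrightarrow> finely_covered P x" and W: "open W" "E \<subseteq> W"
    and least: "\<And>B. B \<in> lmeasurable \<Longrightarrow> negligible (E - B) \<Longrightarrow> m \<le> measure lebesgue B" and e: "0 < e"
  obtains F where "finite F" "\<forall>i\<in>F. 0 < snd i \<and> P i \<and> cball (fst i) (snd i) \<subseteq> W"
    "pairwise (\<lambda>i j. disjnt (cball (fst i) (snd i)) (cball (fst j) (snd j))) F"
    "m - e < (\<Sum>i\<in>F. 2 * snd i)"
proof -
  obtain C where C: "countable C" "\<forall>i\<in>C. 0 < snd i \<and> P i \<and> cball (fst i) (snd i) \<subseteq> W"
    "pairwise (\<lambda>i j. disjnt (cball (fst i) (snd i)) (cball (fst j) (snd j))) C"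
    "negligible (E - (\<Union>i\<in>C. cball (fst i) (snd i)))"
    by (rule vitali_cover[OF fine W])
  have sumeq: "measure lebesgue (\<Union>i\<in>F. cball (fst i) (snd i)) = (\<Sum>i\<in>F. 2 * snd i)" if "F \<subseteq> C" "finite F" for F
  proof (rule measure_Union_disjoint_cball[OF that(2)])
    show "0 < snd i" if "i \<in> F" for i using C(2)[rule_format, OF subsetD[OF \<open>F \<subseteq> C\<close> that]] by simp
    show "pairwise (\<lambda>i j. disjnt (cball (fst i) (snd i)) (cball (fst j) (snd j))) F"
      using C(3) that(1) by (rule pairwise_subset)
  qed
  have "\<exists>F\<subseteq>C. finite F \<and> m - e < (\<Sum>i\<in>F. 2 * snd i)"
  proof (rule ccontr)
    assume "\<not> ?thesis"
    then have le: "measure lebesgue (\<Union>i\<in>F. cball (fst i) (snd i)) \<le> m - e" if "F \<subseteq> C" "finite F" for F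
      using that sumeq by (metis not_less)
    have "(\<Union>i\<in>C. cball (fst i) (snd i)) \<in> lmeasurable"
      by (rule fmeasurable_UN_bound[OF C(1) _ le]) auto
    moreover have "measure lebesgue (\<Union>i\<in>C. cball (fst i) (snd i)) \<le> m - e"
      by (rule measure_UN_bound[OF C(1) _ le]) auto
    ultimately show False using least C(4) e by fastforce
  qed
  then obtain F where F: "F \<subseteq> C" "finite F" "m - e < (\<Sum>i\<in>F. 2 * snd i)" by blast
  show thesis
    by (rule that[OF F(2) _ pairwise_subset[OF C(3) F(1)] F(3)]) (use C(2) F(1) in blast)
qed

text \<open>The interval with the largest centre lies to the right of all others, so it can be split
  off and the rest treated on the part of \<open>{u..v}\<close> to its left. Monotonicity makes the
  increments over the gaps non-negative.\<close>

lemma sum_increments_le: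
  fixes F :: "(real \<times> real) set" and r :: "real \<Rightarrow> real"
  assumes r: "mono r" and "finite F"
    and "\<And>i. i \<in> F \<Longrightarrow> 0 < snd i \<and> cball (fst i) (snd i) \<subseteq> {u..v}"
    and "pairwise (\<lambda>i j. disjnt (cball (fst i) (snd i)) (cball (fst j) (snd j))) F" "u \<le> v"
  shows "(\<Sum>i\<in>F. r (fst i + snd i) - r (fst i - snd i)) \<le> r v - r u"
  using assms(2-)
proof (induction "card F" arbitrary: F v)
  case 0
  then show ?case using monoD[OF r, of u v] by simp
next
  case (Suc n)
  then have "F \<noteq> {}" by auto
  then have "Max (fst ` F) \<in> fst ` F" using Suc.prems by (intro Max_in) auto
  then obtain i where i: "i \<in> F" "fst i = Max (fst ` F)" by auto
  have imax: "fst j \<le> fst i" if "j \<in> F" for j using that Suc.prems i by simp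
  have iv: "u \<le> fst i - snd i" "fst i + snd i \<le> v" "0 < snd i"
    using Suc.prems(2)[OF i(1)] by (auto simp: cball_eq_atLeastAtMost)
  have left: "fst j + snd j < fst i - snd i" if j: "j \<in> F - {i}" for j
  proof (rule ccontr)
    assume "\<not> ?thesis"
    moreover have "disjnt (cball (fst j) (snd j)) (cball (fst i) (snd i))"
      by (rule pairwiseD[OF Suc.prems(3)]) (use i(1) j in auto)
    moreover have "0 < snd j" "fst j \<le> fst i" using j Suc.prems(2) imax by auto
    ultimately have "max (fst j) (fst i - snd i) \<in> cball (fst j) (snd j) \<inter> cball (fst i) (snd i)"
      using iv by (auto simp: cball_eq_atLeastAtMost)
    then show False using \<open>disjnt _ _\<close> by (auto simp: disjnt_def)
  qed
  have "(\<Sum>j\<in>F - {i}. r (fst j + snd j) - r (fst j - snd j)) \<le> r (fst i - snd i) - r u"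
  proof (rule Suc.hyps(1))
    show "n = card (F - {i})" using Suc.hyps(2) Suc.prems(1) i by simp
    show "0 < snd j \<and> cball (fst j) (snd j) \<subseteq> {u..fst i - snd i}" if "j \<in> F - {i}" for j
      using left[OF that] Suc.prems(2)[of j] that by (auto simp: cball_eq_atLeastAtMost)
    show "pairwise (\<lambda>i j. disjnt (cball (fst i) (snd i)) (cball (fst j) (snd j))) (F - {i})"
      using Suc.prems(3) by (rule pairwise_subset) auto
  qed (use Suc.prems iv in auto)
  moreover have "r (fst i + snd i) \<le> r v" using iv r by (simp add: monoD)
  ultimately show ?case using Suc.prems i by (simp add: sum.remove)
qed

lemma negligible_if_small_covers:
  assumes "\<And>e. 0 < e \<Longrightarrow> \<exists>B\<in>lmeasurable. negligible (E - B) \<and> measure lebesgue B < e"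
  shows "negligible (E :: real set)"
  unfolding negligible_outer
proof (intro allI impI)
  fix e :: real assume "0 < e"
  then obtain B where B: "B \<in> lmeasurable" "negligible (E - B)" "measure lebesgue B < e" using assms by blast
  have "measure lebesgue (B \<union> (E - B)) \<le> measure lebesgue B + measure lebesgue (E - B)"
    using B by (intro measure_Un_le) (auto dest: fmeasurableD negligible_imp_measurable)
  then have "measure lebesgue (B \<union> (E - B)) \<le> measure lebesgue B"
    using B by (simp add: negligible_imp_measure0)
  moreover have "B \<union> (E - B) \<in> lmeasurable"
    by (rule fmeasurable.Un[OF B(1) negligible_imp_measurable[OF B(2)]])
  ultimately show "\<exists>T. E \<subseteq> T \<and> T \<in> lmeasurable \<and> measure lebesgue T < e"
    using B by (intro exI[of _ "B \<union> (E - B)"]) auto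
qed

text \<open>The infimum of the measures of the sets covering \<open>E\<close> up to a null set replaces the measure of
  \<open>E\<close>, whose measurability is not known.\<close>

lemma negligible_by_essential_measure:
  fixes E :: "real set"
  assumes E: "bounded E"
    and small: "\<And>m. 0 \<le> m \<Longrightarrow>
       (\<And>B. B \<in> lmeasurable \<Longrightarrow> negligible (E - B) \<Longrightarrow> m \<le> measure lebesgue B) \<Longrightarrow>
       (\<And>e. 0 < e \<Longrightarrow> \<exists>B\<in>lmeasurable. negligible (E - B) \<and> measure lebesgue B < m + e) \<Longrightarrow> m = 0"
  shows "negligible E"
proof -
  define M where "M = measure lebesgue ` {B \<in> lmeasurable. negligible (E - B)}"
  obtain N where "E \<subseteq> ball 0 N" using E bounded_subset_ballD by blast
  then have neg: "negligible (E - ball 0 N)" by (metis Diff_eq_empty_iff negligible_empty)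
  have "measure lebesgue (ball (0::real) N) \<in> M" unfolding M_def by (rule imageI) (simp add: neg)
  then have ne: "M \<noteq> {}" by auto
  have bdd: "bdd_below M" by (intro bdd_belowI[of _ 0]) (auto simp: M_def)
  have attain: "\<exists>B\<in>lmeasurable. negligible (E - B) \<and> measure lebesgue B < Inf M + e" if "0 < e" for e
    using cInf_lessD[OF ne, of "Inf M + e"] that by (auto simp: M_def)
  have "Inf M = 0"
  proof (rule small[OF _ _ attain])
    show "0 \<le> Inf M" using ne by (intro cInf_greatest) (auto simp: M_def)
    show "Inf M \<le> measure lebesgue B" if "B \<in> lmeasurable" "negligible (E - B)" for B
      using that by (intro cInf_lower bdd) (auto simp: M_def)
  qed
  then show ?thesis using attain by (intro negligible_if_small_covers) auto
qed

lemma mean_slope_nonneg: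
  assumes "mono r" "0 < snd i"
  shows "0 \<le> mean_slope r i"
proof -
  have "r (fst i - snd i) \<le> r (fst i + snd i)" using assms(2) by (intro monoD[OF assms(1)]) simp
  then show ?thesis using assms(2) by (simp add: mean_slope_def)
qed

text \<open>Disjoint intervals with steep slopes and total length bounded below would force
  \<open>r\<close> to grow more than it does.\<close>

lemma negligible_infinite_slope:
  assumes r: "mono r" and E: "bounded E" and fine: "\<And>x K. x \<in> E \<Longrightarrow> finely_covered (\<lambda>i. K < mean_slope r i) x"
  shows "negligible E"
proof (rule negligible_by_essential_measure[OF E])
  fix m :: real assume m: "0 \<le> m"
    and least: "\<And>B. B \<in> lmeasurable \<Longrightarrow> negligible (E - B) \<Longrightarrow> m \<le> measure lebesgue B"
  obtain N where N: "0 < N" "E \<subseteq> ball 0 N" using E bounded_subset_ballD by blast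
  show "m = 0"
  proof (rule ccontr)
    assume "m \<noteq> 0"
    then have m: "0 < m" using m by simp
    \<comment> \<open>Chosen so that slope \<open>K\<close> over the total length
      \<open>m / 2\<close> exceeds the increment of \<open>r\<close> on \<open>{- N..N}\<close> by
      1.\<close>
    define K where "K = (r N - r (- N) + 1) / (m / 2)"
    have rN: "r (- N) \<le> r N" using r N by (simp add: monoD)
    obtain F where F: "finite F"
      "\<forall>i\<in>F. 0 < snd i \<and> K < mean_slope r i \<and> cball (fst i) (snd i) \<subseteq> ball 0 N"
      "pairwise (\<lambda>i j. disjnt (cball (fst i) (snd i)) (cball (fst j) (snd j))) F"
      "m - m / 2 < (\<Sum>i\<in>F. 2 * snd i)"
      by (rule vitali_cover_finite[OF fine open_ball N(2) least half_gt_zero[OF m]])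
    have K: "0 < K" using rN m by (simp add: K_def)
    have "r N - r (- N) + 1 = K * (m / 2)" using m by (simp add: K_def)
    also have "\<dots> < K * (\<Sum>i\<in>F. 2 * snd i)" using F(4) K by (intro mult_strict_left_mono) auto
    also have "\<dots> \<le> (\<Sum>i\<in>F. r (fst i + snd i) - r (fst i - snd i))"
      unfolding sum_distrib_left
    proof (rule sum_mono)
      fix i assume "i \<in> F"
      then have "K < mean_slope r i" "0 < snd i" using F(2) by auto
      then show "K * (2 * snd i) \<le> r (fst i + snd i) - r (fst i - snd i)"
        by (simp add: mean_slope_def pos_less_divide_eq)
    qed
    also have "\<dots> \<le> r N - r (- N)"
    proof (rule sum_increments_le[OF r F(1) _ F(3)])
      fix i assume "i \<in> F"
      then have "0 < snd i" "cball (fst i) (snd i) \<subseteq> ball 0 N" using F(2) by auto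
      moreover have "ball 0 N \<subseteq> {- N..N}" by (auto simp: ball_eq_greaterThanLessThan)
      ultimately show "0 < snd i \<and> cball (fst i) (snd i) \<subseteq> {- N..N}" by blast
    qed (use N in auto)
    finally show False by simp
  qed
qed

text \<open>Intervals with slope below \<open>p\<close> are taken inside a set of measure less than
  \<open>m + e\<close>, and intervals with slope above \<open>q\<close> and total length more than
  \<open>m - e\<close> inside those. The increments of \<open>r\<close> over the inner ones are at
  most those over the outer ones, hence \<open>q * (m - e) \<le> p * (m + e)\<close>, and
  \<open>e\<close> tends to 0.\<close>

lemma negligible_slope_gap:
  assumes r: "mono r" and E: "bounded E" and pq: "p < q"
    and lo: "\<And>x. x \<in> E \<Longrightarrow> finely_covered (\<lambda>i. mean_slope r i < p) x"
    and hi: "\<And>x. x \<in> E \<Longrightarrow> finely_covered (\<lambda>i. q < mean_slope r i) x"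
  shows "negligible E"
proof (cases "E = {}")
  case False
  then obtain x where "x \<in> E" by auto
  from lo[OF this] have "\<exists>i. 0 < snd i \<and> snd i < 1 \<and> x \<in> cball (fst i) (snd i) \<and> mean_slope r i < p"
    unfolding finely_covered_def by (rule allE[of _ 1]) simp
  then obtain i where "0 < snd i" "mean_slope r i < p" by auto
  then have p: "0 < p" using mean_slope_nonneg[OF r, of i] by simp
  show ?thesis
  proof (rule negligible_by_essential_measure[OF E])
    fix m :: real assume m0: "0 \<le> m"
      and least: "\<And>B. B \<in> lmeasurable \<Longrightarrow> negligible (E - B) \<Longrightarrow> m \<le> measure lebesgue B"
      and attain: "\<And>e. 0 < e \<Longrightarrow> \<exists>B\<in>lmeasurable. negligible (E - B) \<and> measure lebesgue B < m + e"
    have key: "q * (m - e) \<le> p * (m + e)" if e: "0 < e" for e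
    proof -
      obtain B where B: "B \<in> lmeasurable" "negligible (E - B)" "measure lebesgue B < m + e / 2"
        using attain[of "e / 2"] e by auto
      obtain U where U: "open U" "B \<subseteq> U" "U - B \<in> lmeasurable" "emeasure lebesgue (U - B) < ennreal (e / 2)"
        using sets_lebesgue_outer_open[of B "e / 2"] B e by auto
      have "measure lebesgue (U - B) < e / 2"
        using U(3,4) e by (simp add: emeasure_eq_measure2 ennreal_less_iff)
      moreover have UB: "U = B \<union> (U - B)" using U by auto
      have Um: "U \<in> lmeasurable" by (subst UB) (intro fmeasurable.Un B U)
      have "measure lebesgue U \<le> measure lebesgue B + measure lebesgue (U - B)"
        by (subst UB) (intro measure_Un_le fmeasurableD B U)
      ultimately have mU: "measure lebesgue U < m + e" using B(3) by simp
      obtain C where C: "countable C"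
        "\<forall>i\<in>C. 0 < snd i \<and> mean_slope r i < p \<and> cball (fst i) (snd i) \<subseteq> U"
        "pairwise (\<lambda>i j. disjnt (cball (fst i) (snd i)) (cball (fst j) (snd j))) C"
        "negligible (E \<inter> U - (\<Union>i\<in>C. cball (fst i) (snd i)))"
        by (rule vitali_cover[of "E \<inter> U" "\<lambda>i. mean_slope r i < p" U]) (use lo U(1) in auto)
      \<comment> \<open>The open intervals leave room around each point for the inner cover. The
        endpoints left out are countably many.\<close>
      define W where "W = (\<Union>i\<in>C. ball (fst i) (snd i))"
      have W: "open W" by (auto simp: W_def)
      \<comment> \<open>Each inner interval has to lie in a single outer one, so that the increments
        can be grouped by the outer interval.\<close>
      define P where "P i \<longleftrightarrow> q < mean_slope r i \<and> (\<exists>j\<in>C. cball (fst i) (snd i) \<subseteq> ball (fst j) (snd j))" for i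
      have "negligible (E - E \<inter> W)"
      proof (rule negligible_subset)
        show "negligible ((E - B) \<union> (E \<inter> U - (\<Union>i\<in>C. cball (fst i) (snd i))) \<union> (\<Union>i\<in>C. sphere (fst i) (snd i)))"
          using B(2) C(1,4) by (intro negligible_Un negligible_countable_Union) (auto intro: negligible_sphere)
        show "E - E \<inter> W \<subseteq> (E - B) \<union> (E \<inter> U - (\<Union>i\<in>C. cball (fst i) (snd i))) \<union> (\<Union>i\<in>C. sphere (fst i) (snd i))"
        proof
          fix x assume x: "x \<in> E - E \<inter> W"
          show "x \<in> (E - B) \<union> (E \<inter> U - (\<Union>i\<in>C. cball (fst i) (snd i))) \<union> (\<Union>i\<in>C. sphere (fst i) (snd i))"
          proof (cases "x \<in> U \<and> x \<in> (\<Union>i\<in>C. cball (fst i) (snd i))")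
            case True
            then obtain j where j: "j \<in> C" "x \<in> cball (fst j) (snd j)" by blast
            moreover have "x \<notin> ball (fst j) (snd j)" using x j(1) by (auto simp: W_def)
            ultimately have "x \<in> sphere (fst j) (snd j)" by simp
            then show ?thesis using j(1) by blast
          qed (use x U(2) in blast)
        qed
      qed
      then have least': "m \<le> measure lebesgue B'" if "B' \<in> lmeasurable" "negligible (E \<inter> W - B')" for B'
        using that by (intro least) (auto intro: negligible_subset[OF negligible_Un])
      have fine': "finely_covered P x" if x: "x \<in> E \<inter> W" for x
        unfolding finely_covered_def
      proof (intro allI impI)
        fix d :: real assume d: "0 < d"
        obtain j where j: "j \<in> C" "x \<in> ball (fst j) (snd j)" using x by (auto simp: W_def)
        then obtain \<epsilon> where \<epsilon>: "0 < \<epsilon>" "ball x \<epsilon> \<subseteq> ball (fst j) (snd j)" by (meson open_ball openE)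
        obtain i where i: "0 < snd i" "snd i < min d (\<epsilon> / 2)" "x \<in> cball (fst i) (snd i)" "q < mean_slope r i"
          using hi[of x] x d \<epsilon> unfolding finely_covered_def by (metis Int_iff half_gt_zero min_less_iff_conj)
        have "cball (fst i) (snd i) \<subseteq> ball x \<epsilon>"
        proof
          fix z assume "z \<in> cball (fst i) (snd i)"
          then have "dist x z \<le> snd i + snd i"
            using i(3) dist_triangle[of x z "fst i"] by (simp add: dist_commute)
          then show "z \<in> ball x \<epsilon>" using i by simp
        qed
        then show "\<exists>i. 0 < snd i \<and> snd i < d \<and> x \<in> cball (fst i) (snd i) \<and> P i"
          using i j \<epsilon> unfolding P_def by (intro exI[of _ i]) auto
      qed
      obtain F where F: "finite F"
        "\<forall>i\<in>F. 0 < snd i \<and> P i \<and> cball (fst i) (snd i) \<subseteq> W"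
        "pairwise (\<lambda>i j. disjnt (cball (fst i) (snd i)) (cball (fst j) (snd j))) F"
        "m - e < (\<Sum>i\<in>F. 2 * snd i)"
        by (rule vitali_cover_finite[OF fine' W inf_le2 least' e])
      have "\<forall>i\<in>F. \<exists>j\<in>C. cball (fst i) (snd i) \<subseteq> ball (fst j) (snd j)" using F(2) by (auto simp: P_def)
      then obtain \<phi> where \<phi>: "\<And>i. i \<in> F \<Longrightarrow> \<phi> i \<in> C \<and> cball (fst i) (snd i) \<subseteq> ball (fst (\<phi> i)) (snd (\<phi> i))"
        by metis
      have "q * (m - e) \<le> q * (\<Sum>i\<in>F. 2 * snd i)" using F(4) p pq by (intro mult_left_mono) auto
      also have "\<dots> \<le> (\<Sum>i\<in>F. r (fst i + snd i) - r (fst i - snd i))"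
        unfolding sum_distrib_left
      proof (rule sum_mono)
        fix i assume "i \<in> F"
        then have "q < mean_slope r i" "0 < snd i" using F(2) by (auto simp: P_def)
        then show "q * (2 * snd i) \<le> r (fst i + snd i) - r (fst i - snd i)"
          by (simp add: mean_slope_def pos_less_divide_eq)
      qed
      also have "\<dots> = (\<Sum>j\<in>\<phi> ` F. \<Sum>i\<in>{i\<in>F. \<phi> i = j}. r (fst i + snd i) - r (fst i - snd i))"
        by (rule sum.image_gen[OF F(1)])
      also have "\<dots> \<le> (\<Sum>j\<in>\<phi> ` F. r (fst j + snd j) - r (fst j - snd j))"
      proof (rule sum_mono)
        fix j assume "j \<in> \<phi> ` F"
        then have j: "0 < snd j" using \<phi> C(2) by auto
        show "(\<Sum>i\<in>{i\<in>F. \<phi> i = j}. r (fst i + snd i) - r (fst i - snd i)) \<le> r (fst j + snd j) - r (fst j - snd j)"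
        proof (rule sum_increments_le[OF r])
          show "0 < snd i \<and> cball (fst i) (snd i) \<subseteq> {fst j - snd j..fst j + snd j}" if "i \<in> {i\<in>F. \<phi> i = j}" for i
            using that F(2)[rule_format, of i] \<phi>[of i] ball_subset_cball[of "fst j" "snd j"]
            by (auto simp: cball_eq_atLeastAtMost[of "fst j"])
          show "pairwise (\<lambda>i j. disjnt (cball (fst i) (snd i)) (cball (fst j) (snd j))) {i\<in>F. \<phi> i = j}"
            using F(3) by (rule pairwise_subset) auto
        qed (use F(1) j in auto)
      qed
      also have "\<dots> \<le> (\<Sum>j\<in>\<phi> ` F. p * (2 * snd j))"
      proof (rule sum_mono)
        fix j assume "j \<in> \<phi> ` F"
        then have "mean_slope r j < p" "0 < snd j" using \<phi> C(2) by auto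
        then show "r (fst j + snd j) - r (fst j - snd j) \<le> p * (2 * snd j)"
          by (simp add: mean_slope_def pos_divide_less_eq)
      qed
      also have "\<dots> = p * (\<Sum>j\<in>\<phi> ` F. 2 * snd j)" by (simp add: sum_distrib_left)
      also have "(\<Sum>j\<in>\<phi> ` F. 2 * snd j) = measure lebesgue (\<Union>j\<in>\<phi> ` F. cball (fst j) (snd j))"
      proof (rule measure_Union_disjoint_cball[symmetric])
        have "\<phi> ` F \<subseteq> C" using \<phi> by auto
        then show "pairwise (\<lambda>i j. disjnt (cball (fst i) (snd i)) (cball (fst j) (snd j))) (\<phi> ` F)"
          using C(3) pairwise_subset by blast
      qed (use F(1) \<phi> C(2) in auto)
      also have "p * \<dots> \<le> p * measure lebesgue U"
      proof (rule mult_left_mono[OF measure_mono_fmeasurable])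
        show "(\<Union>j\<in>\<phi> ` F. cball (fst j) (snd j)) \<subseteq> U" using \<phi> C(2) by blast
      qed (use F(1) Um p in auto)
      also have "\<dots> \<le> p * (m + e)" using mU p by (intro mult_left_mono) auto
      finally show ?thesis .
    qed
    have lims: "((\<lambda>e. q * (m - e)) \<longlongrightarrow> q * (m - 0)) (at_right 0)" "((\<lambda>e. p * (m + e)) \<longlongrightarrow> p * (m + 0)) (at_right 0)"
      by (intro tendsto_intros)+
    have "q * (m - 0) \<le> p * (m + 0)"
      by (rule tendsto_le[OF trivial_limit_at_right_real lims(2,1)])
        (use eventually_at_right_less[of 0] in \<open>auto elim!: eventually_mono intro: key\<close>)
    then have "(q - p) * m \<le> 0" by (simp add: algebra_simps)
    then show "m = 0" using pq m0 by (simp add: mult_le_0_iff)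
  qed
qed simp

lemma mono_differentiable_if_slopes_agree:
  assumes r: "mono r" and fin: "\<not> (\<forall>K. finely_covered (\<lambda>i. K < mean_slope r i) x)"
    and gap: "\<And>p q. p \<in> \<rat> \<Longrightarrow> q \<in> \<rat> \<Longrightarrow> p < q \<Longrightarrow>
      \<not> (finely_covered (\<lambda>i. mean_slope r i < p) x \<and> finely_covered (\<lambda>i. q < mean_slope r i) x)"
  shows "r differentiable (at x)"
proof -
  \<comment> \<open>The supremum of \<open>L\<close> is the lower limit of the mean slopes over
    intervals that contain \<open>x\<close> and shrink to it. It is the candidate for the
    derivative.\<close>
  define L where "L = {p. \<exists>d>0. \<forall>i. 0 < snd i \<longrightarrow> snd i < d \<longrightarrow> x \<in> cball (fst i) (snd i) \<longrightarrow> p \<le> mean_slope r i}"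
  obtain K d0 where K: "0 < d0" "\<And>i. 0 < snd i \<Longrightarrow> snd i < d0 \<Longrightarrow> x \<in> cball (fst i) (snd i) \<Longrightarrow> mean_slope r i \<le> K"
    using fin unfolding finely_covered_def by (metis not_less)
  have bdd: "p \<le> K" if "p \<in> L" for p
  proof -
    obtain d where d: "0 < d" "\<And>i. 0 < snd i \<Longrightarrow> snd i < d \<Longrightarrow> x \<in> cball (fst i) (snd i) \<Longrightarrow> p \<le> mean_slope r i"
      using \<open>p \<in> L\<close> unfolding L_def by blast
    define i where "i = (x, min d d0 / 2)"
    have "0 < snd i" "snd i < d" "snd i < d0" "x \<in> cball (fst i) (snd i)"
      using d(1) K(1) by (auto simp: i_def min_def)
    then show ?thesis using d(2)[of i] K(2)[of i] by linarith
  qed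
  have "0 \<in> L" unfolding L_def using mean_slope_nonneg[OF r] by (auto intro: exI[of _ 1])
  then have ne: "L \<noteq> {}" by auto
  have bddL: "bdd_above L" using bdd by (rule bdd_aboveI)
  define l where "l = Sup L"
  have near: "\<exists>d>0. \<forall>i. 0 < snd i \<longrightarrow> snd i < d \<longrightarrow> x \<in> cball (fst i) (snd i) \<longrightarrow> \<bar>mean_slope r i - l\<bar> \<le> e"
    if e: "0 < e" for e
  proof -
    obtain p where p: "p \<in> L" "l - e < p" using less_cSupD[OF ne, of "l - e"] e by (auto simp: l_def)
    then obtain d1 where d1: "0 < d1" "\<And>i. 0 < snd i \<Longrightarrow> snd i < d1 \<Longrightarrow> x \<in> cball (fst i) (snd i) \<Longrightarrow> p \<le> mean_slope r i"
      unfolding L_def by blast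
    \<comment> \<open>Slopes below the rational \<open>s > l\<close> occur on arbitrarily short
      intervals, so by the gap hypothesis slopes above the rational \<open>t > s\<close> do
      not.\<close>
    obtain s where s: "s \<in> \<rat>" "l < s" "s < l + e / 2" using Rats_dense_in_real[of l "l + e / 2"] e by auto
    obtain t where t: "t \<in> \<rat>" "l + e / 2 < t" "t < l + e" using Rats_dense_in_real[of "l + e / 2" "l + e"] e by auto
    have "s \<notin> L" using cSup_upper[OF _ bddL, of s] s by (auto simp: l_def)
    then have "finely_covered (\<lambda>i. mean_slope r i < s) x"
      unfolding L_def finely_covered_def by (auto simp: not_le)
    then have "\<not> finely_covered (\<lambda>i. t < mean_slope r i) x" using gap[OF s(1) t(1)] s t by auto
    then obtain d2 where d2: "0 < d2" "\<And>i. 0 < snd i \<Longrightarrow> snd i < d2 \<Longrightarrow> x \<in> cball (fst i) (snd i) \<Longrightarrow> mean_slope r i \<le> t"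
      unfolding finely_covered_def by (metis not_less)
    have "\<bar>mean_slope r i - l\<bar> \<le> e" if "0 < snd i" "snd i < min d1 d2" "x \<in> cball (fst i) (snd i)" for i
      using d1(2)[of i] d2(2)[of i] that p t by (auto simp: abs_le_iff)
    then show ?thesis using d1(1) d2(1) by (intro exI[of _ "min d1 d2"]) auto
  qed
  have "((\<lambda>y. (r y - r x) / (y - x)) \<longlongrightarrow> l) (at x)"
    unfolding tendsto_iff
  proof (intro allI impI)
    fix e :: real assume "0 < e"
    then obtain d where d: "0 < d"
      "\<And>i. 0 < snd i \<Longrightarrow> snd i < d \<Longrightarrow> x \<in> cball (fst i) (snd i) \<Longrightarrow> \<bar>mean_slope r i - l\<bar> \<le> e / 2"
      using near[of "e / 2"] by auto
    have "dist ((r y - r x) / (y - x)) l < e" if y: "y \<noteq> x" "dist y x < d" for y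
    proof -
      \<comment> \<open>The interval with endpoints \<open>x\<close> and \<open>y\<close>; its mean
        slope is the difference quotient.\<close>
      define i where "i = ((x + y) / 2, \<bar>y - x\<bar> / 2)"
      have ends: "fst i + snd i = max x y" "fst i - snd i = min x y" "2 * snd i = \<bar>y - x\<bar>"
        by (auto simp: i_def max_def min_def abs_if field_simps)
      have "mean_slope r i = (r y - r x) / (y - x)"
      proof (cases "x < y")
        case True
        then show ?thesis unfolding mean_slope_def ends by simp
      next
        case False
        then have "max x y = x" "min x y = y" "\<bar>y - x\<bar> = - (y - x)" using y by auto
        then show ?thesis unfolding mean_slope_def ends
          by (metis minus_diff_eq minus_divide_divide)
      qed
      moreover have "x \<in> cball (fst i) (snd i)"
        unfolding cball_eq_atLeastAtMost ends by simp
      moreover have "0 < snd i" "snd i < d" using y by (auto simp: i_def dist_real_def)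
      ultimately show ?thesis using d(2)[of i] \<open>0 < e\<close> by (simp add: dist_real_def)
    qed
    then show "\<forall>\<^sub>F y in at x. dist ((r y - r x) / (y - x)) l < e"
      unfolding eventually_at using d(1) by auto
  qed
  then show ?thesis by (auto simp: real_differentiable_def has_field_derivative_iff)
qed

text \<open>Lebesgue's theorem. Where \<open>r\<close> is not differentiable, either the slopes are
  unbounded or a pair of rationals separates them. Both sets are cut down to balls because the
  covering argument is for bounded sets.\<close>

theorem mono_differentiable_ae:
  assumes r: "mono (r :: real \<Rightarrow> real)"
  shows "negligible {x. \<not> r differentiable (at x)}"
proof -
  define E where "E p q N = {x \<in> ball 0 (real N). finely_covered (\<lambda>i. mean_slope r i < p) x \<and>
    finely_covered (\<lambda>i. q < mean_slope r i) x}" for p q and N :: nat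
  define G where "G N = {x \<in> ball 0 (real N). \<forall>K. finely_covered (\<lambda>i. K < mean_slope r i) x}" for N :: nat
  define PQ where "PQ = {(p, q). p \<in> \<rat> \<and> q \<in> \<rat> \<and> p < (q::real)}"
  have bE: "bounded (E p q N)" "bounded (G N)" for p q N
    by (rule bounded_subset[of "ball 0 (real N)"]; auto simp: E_def G_def)+
  have nE: "negligible (E p q N)" if "p < q" for p q N
    by (rule negligible_slope_gap[OF r bE(1) that]) (auto simp: E_def)
  have nG: "negligible (G N)" for N
    by (rule negligible_infinite_slope[OF r bE(2)]) (auto simp: G_def)
  have "countable PQ"
    by (rule countable_subset[of _ "\<rat> \<times> \<rat>"]) (auto simp: PQ_def intro!: countable_SIGMA countable_rat)
  then have "negligible ((\<Union>N. G N) \<union> (\<Union>N. \<Union>(p, q)\<in>PQ. E p q N))"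
    by (intro negligible_Un negligible_countable_Union countable_image)
       (auto simp: PQ_def intro!: nE nG negligible_countable_Union countable_image)
  then show ?thesis
  proof (rule negligible_subset)
    show "{x. \<not> r differentiable (at x)} \<subseteq> (\<Union>N. G N) \<union> (\<Union>N. \<Union>(p, q)\<in>PQ. E p q N)"
    proof (intro subsetI, rule ccontr)
      fix x assume x: "x \<in> {x. \<not> r differentiable (at x)}" "x \<notin> (\<Union>N. G N) \<union> (\<Union>N. \<Union>(p, q)\<in>PQ. E p q N)"
      obtain N where N: "x \<in> ball 0 (real N)" using reals_Archimedean2[of "\<bar>x\<bar>"] by auto
      have "r differentiable (at x)"
        by (rule mono_differentiable_if_slopes_agree[OF r]) (use x N in \<open>auto simp: G_def E_def PQ_def\<close>)
      then show False using x by simp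
    qed
  qed
qed

section \<open>Monotonicity from an almost everywhere non-negative derivative\<close>

text \<open>The negative part of the slope on the exceptional null set \<open>E\<close> is compensated by adding
  \<open>K\<close> times the measure of \<open>U \<inter> {s..x}\<close>, where \<open>U\<close> is a small open neighbourhood of \<open>E\<close>.\<close>

lemma nondecreasing_by_ae_deriv:
  fixes R :: "real \<Rightarrow> real"
  assumes st: "s \<le> t" and C: "0 \<le> C"
    and lower: "\<And>x y. s \<le> x \<Longrightarrow> x \<le> y \<Longrightarrow> y \<le> t \<Longrightarrow> - C * (y - x) \<le> R y - R x"
    and E: "negligible E"
    and deriv: "\<And>x. s \<le> x \<Longrightarrow> x \<le> t \<Longrightarrow> x \<notin> E \<Longrightarrow> \<exists>D\<ge>0. (R has_real_derivative D) (at x)"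
  shows "R s \<le> R t"
proof -
  have key: "R s \<le> R t + e * (t - s) + (C + 1) * e" if e: "0 < e" for e
  proof -
    have "E \<in> sets lebesgue" using E by (simp add: negligible_imp_sets)
    then obtain U where U: "open U" "E \<subseteq> U" "U - E \<in> lmeasurable" "emeasure lebesgue (U - E) < ennreal e"
      using sets_lebesgue_outer_open e by metis
    have UE: "U = (U - E) \<union> E" using U by auto
    have Um: "U \<in> lmeasurable"
      by (subst UE) (intro fmeasurable.Un U negligible_imp_measurable E)
    have "measure lebesgue (U - E) < e"
      using U(3,4) e by (simp add: emeasure_eq_measure2 ennreal_less_iff)
    moreover have "measure lebesgue U \<le> measure lebesgue (U - E) + measure lebesgue E"
      by (subst UE) (intro measure_Un_le fmeasurableD U negligible_imp_measurable E)
    ultimately have mU: "measure lebesgue U < e" using E by (simp add: negligible_imp_measure0)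
    define \<sigma> where "\<sigma> x = measure lebesgue (U \<inter> {s..x})" for x
    have Ui: "U \<inter> {x..y} \<in> lmeasurable" "U \<inter> {x<..y} \<in> lmeasurable" for x y
    proof -
      have "{x<..y} \<in> lmeasurable" by (rule fmeasurableI2[of "{x..y}"]) auto
      then show "U \<inter> {x..y} \<in> lmeasurable" "U \<inter> {x<..y} \<in> lmeasurable"
        using fmeasurable.Int[OF Um, of "{x..y}"] fmeasurable.Int[OF Um, of "{x<..y}"] by simp_all
    qed
    have \<sigma>_diff: "\<sigma> y - \<sigma> x = measure lebesgue (U \<inter> {x<..y})" if "s \<le> x" "x \<le> y" for x y
    proof -
      have eq: "U \<inter> {s..y} = (U \<inter> {s..x}) \<union> (U \<inter> {x<..y})" using that by auto
      have "measure lebesgue (U \<inter> {s..y}) = measure lebesgue (U \<inter> {s..x}) + measure lebesgue (U \<inter> {x<..y})"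
        unfolding eq
      proof (rule measure_Union)
        show "emeasure lebesgue (U \<inter> {s..x}) \<noteq> \<infinity>" "emeasure lebesgue (U \<inter> {x<..y}) \<noteq> \<infinity>"
          using fmeasurableD2[OF Ui(1)] fmeasurableD2[OF Ui(2)] unfolding infinity_ennreal_def by blast+
        show "U \<inter> {s..x} \<in> sets lebesgue" "U \<inter> {x<..y} \<in> sets lebesgue"
          by (rule fmeasurableD[OF Ui(1)], rule fmeasurableD[OF Ui(2)])
      qed auto
      then show ?thesis by (simp add: \<sigma>_def)
    qed
    \<comment> \<open>Near a point outside \<open>E\<close> the term \<open>e * x\<close> absorbs
      the error of the difference quotient. Near a point of \<open>E\<close> the function
      \<open>\<sigma>\<close> grows at rate 1, and the factor \<open>C + 1\<close> outweighs the
      rate \<open>- C\<close> allowed for \<open>R\<close>.\<close>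
    define Q where "Q x = R x + e * x + (C + 1) * \<sigma> x" for x
    have "s \<le> s \<and> t \<le> t \<longrightarrow> Q s \<le> Q t"
    \<comment> \<open>Bisection: it is enough to compare the ends of short intervals around each
      point.\<close>
    proof (rule Bolzano[OF st, of "\<lambda>a b. s \<le> a \<and> b \<le> t \<longrightarrow> Q a \<le> Q b"])
      fix x assume x: "s \<le> x" "x \<le> t"
      show "\<exists>d>0. \<forall>a b. a \<le> x \<and> x \<le> b \<and> b - a < d \<longrightarrow> (s \<le> a \<and> b \<le> t \<longrightarrow> Q a \<le> Q b)"
      proof (cases "x \<in> E")
        case True
        then obtain d where d: "0 < d" "ball x d \<subseteq> U" using U by (meson openE subsetD)
        have "Q a \<le> Q b" if ab: "a \<le> x" "x \<le> b" "b - a < d" "s \<le> a" "b \<le> t" for a b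
        proof -
          have "{a<..b} \<subseteq> U" using ab d(2) by (auto simp: subset_iff dist_real_def)
          then have "U \<inter> {a<..b} = {a<..b}" by auto
          then have "\<sigma> b - \<sigma> a = b - a" using \<sigma>_diff[of a b] ab by simp
          then have "(C + 1) * (\<sigma> b - \<sigma> a) = C * (b - a) + (b - a)" by (simp add: distrib_right)
          moreover have "- C * (b - a) \<le> R b - R a" using ab by (intro lower) auto
          moreover have "0 \<le> e * (b - a)" using e ab by simp
          ultimately have "0 \<le> (R b - R a) + e * (b - a) + (C + 1) * (\<sigma> b - \<sigma> a)"
            using ab(1,2) by linarith
          then show ?thesis by (simp add: Q_def algebra_simps)
        qed
        then show ?thesis using d(1) by blast
      next
        case False
        then obtain D where D: "D \<ge> 0" "(R has_real_derivative D) (at x)" using deriv x by blast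
        then have "((\<lambda>y. (R y - R x) / (y - x)) \<longlongrightarrow> D) (at x)" by (simp add: has_field_derivative_iff)
        then have "\<forall>\<^sub>F y in at x. - e < (R y - R x) / (y - x)"
          using D(1) e by (intro order_tendstoD(1)) auto
        then obtain d where d: "0 < d" "\<And>y. y \<noteq> x \<Longrightarrow> dist y x < d \<Longrightarrow> - e < (R y - R x) / (y - x)"
          unfolding eventually_at by auto
        have "Q a \<le> Q b" if ab: "a \<le> x" "x \<le> b" "b - a < d" "s \<le> a" "b \<le> t" for a b
        proof -
          have "- e * (b - x) \<le> R b - R x"
            using d(2)[of b] ab by (cases "b = x") (auto simp: dist_real_def pos_less_divide_eq)
          moreover have "- e * (x - a) \<le> R x - R a"
            using d(2)[of a] ab by (cases "a = x") (auto simp: dist_real_def neg_less_divide_eq algebra_simps)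
          ultimately have "0 \<le> (R b - R a) + e * (b - a)" by (simp add: algebra_simps)
          moreover have "0 \<le> (C + 1) * (\<sigma> b - \<sigma> a)" using C \<sigma>_diff[of a b] ab by simp
          ultimately show ?thesis by (simp add: Q_def algebra_simps)
        qed
        then show ?thesis using d(1) by blast
      qed
    qed (meson order_trans)
    then have "Q s \<le> Q t" by simp
    have "\<sigma> t \<le> e"
    proof -
      have "\<sigma> t \<le> measure lebesgue U" unfolding \<sigma>_def using Um by (intro measure_mono_fmeasurable) auto
      then show ?thesis using mU by simp
    qed
    have "0 \<le> \<sigma> s" by (simp add: \<sigma>_def)
    then have "(C + 1) * \<sigma> t \<le> (C + 1) * e" "0 \<le> (C + 1) * \<sigma> s"
      using C \<open>\<sigma> t \<le> e\<close> by (intro mult_left_mono mult_nonneg_nonneg; simp)+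
    moreover have "e * (t - s) = e * t - e * s" by (simp add: algebra_simps)
    ultimately show ?thesis using \<open>Q s \<le> Q t\<close> unfolding Q_def by linarith
  qed
  have "((\<lambda>e. R t + e * (t - s) + (C + 1) * e) \<longlongrightarrow> R t + 0 * (t - s) + (C + 1) * 0) (at_right 0)"
    by (intro tendsto_intros)
  then have "R s \<le> R t + 0 * (t - s) + (C + 1) * 0"
    by (rule tendsto_lowerbound) (use eventually_at_right_less[of 0] in \<open>auto elim!: eventually_mono intro: key\<close>)
  then show ?thesis by simp
qed

section \<open>Right derivatives of convex functions\<close>

lemma convex_on_slopes:
  fixes \<phi> :: "real \<Rightarrow> real"
  assumes "convex_on I \<phi>" "x \<in> I" "y \<in> I" "x < m" "m < y"
  shows "(\<phi> m - \<phi> x) / (m - x) \<le> (\<phi> y - \<phi> x) / (y - x)"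
    and "(\<phi> y - \<phi> x) / (y - x) \<le> (\<phi> y - \<phi> m) / (y - m)"
proof -
  have flip: "(\<phi> s - \<phi> t) / (s - t) = (\<phi> t - \<phi> s) / (t - s)" for s t
    by (metis minus_diff_eq minus_divide_divide)
  show "(\<phi> m - \<phi> x) / (m - x) \<le> (\<phi> y - \<phi> x) / (y - x)"
    using convex_on_slope_le(1)[OF assms] by (simp only: flip[of x])
  show "(\<phi> y - \<phi> x) / (y - x) \<le> (\<phi> y - \<phi> m) / (y - m)"
    using convex_on_slope_le(2)[OF assms] by (simp only: flip[of _ y])
qed

text \<open>The right derivative is the infimum of the slopes to the right. The slopes to the left
  are lower bounds of that set, which also gives the last inequality.\<close>

lemma convex_right_deriv:
  fixes \<phi> :: "real \<Rightarrow> real"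
  assumes I: "open I" "is_interval I" and conv: "convex_on I \<phi>"
  obtains \<rho> where "\<And>t. t \<in> I \<Longrightarrow> (\<phi> has_real_derivative \<rho> t) (at_right t)"
    "\<And>s t. s \<in> I \<Longrightarrow> t \<in> I \<Longrightarrow> s < t \<Longrightarrow> \<rho> s \<le> (\<phi> t - \<phi> s) / (t - s)"
    "\<And>s t. s \<in> I \<Longrightarrow> t \<in> I \<Longrightarrow> s < t \<Longrightarrow> (\<phi> t - \<phi> s) / (t - s) \<le> \<rho> t"
proof -
  define A where "A t = (\<lambda>s. (\<phi> s - \<phi> t) / (s - t)) ` (I \<inter> {t<..})" for t
  define \<rho> where "\<rho> t = Inf (A t)" for t
  have chain: "(\<phi> t - \<phi> s) / (t - s) \<le> a" if sta: "s \<in> I" "s < t" "a \<in> A t" for s t a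
  proof -
    obtain u where u: "u \<in> I" "t < u" "a = (\<phi> u - \<phi> t) / (u - t)" using sta(3) by (auto simp: A_def)
    show ?thesis
      using convex_on_slopes[OF conv sta(1) u(1) sta(2) u(2)] u(3) by linarith
  qed
  have right: "\<exists>s\<in>I. t < s" and left: "\<exists>s\<in>I. s < t" if "t \<in> I" for t
  proof -
    obtain e where e: "0 < e" "{t - e..t + e} \<subseteq> I" by (rule open_real_bounds[OF I(1) \<open>t \<in> I\<close>])
    have "t - e \<in> I" "t + e \<in> I" using e by auto
    then show "\<exists>s\<in>I. t < s" "\<exists>s\<in>I. s < t" using e(1) by (auto intro: bexI[of _ "t + e"] bexI[of _ "t - e"])
  qed
  have ne: "A t \<noteq> {}" if "t \<in> I" for t using right[OF that] by (auto simp: A_def)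
  have bdd: "bdd_below (A t)" if "t \<in> I" for t
    using left[OF that] chain by (meson bdd_belowI)
  have lower: "\<rho> s \<le> (\<phi> t - \<phi> s) / (t - s)" if "s \<in> I" "t \<in> I" "s < t" for s t
    unfolding \<rho>_def by (rule cInf_lower[OF _ bdd[OF that(1)]]) (use that in \<open>auto simp: A_def\<close>)
  have upper: "(\<phi> t - \<phi> s) / (t - s) \<le> \<rho> t" if "s \<in> I" "t \<in> I" "s < t" for s t
    unfolding \<rho>_def by (rule cInf_greatest[OF ne[OF that(2)]]) (rule chain[OF that(1,3)])
  have "(\<phi> has_real_derivative \<rho> t) (at_right t)" if t: "t \<in> I" for t
    unfolding has_field_derivative_iff
  proof (rule order_tendstoI)
    fix a assume a: "a < \<rho> t"
    have "\<forall>\<^sub>F y in at_right t. y \<in> I \<and> t < y"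
      using t I(1) by (auto simp: eventually_at_filter intro!: eventually_mono[OF eventually_nhds_in_open])
    then show "\<forall>\<^sub>F y in at_right t. a < (\<phi> y - \<phi> t) / (y - t)"
      by eventually_elim (use a lower[OF t] in \<open>auto intro: less_le_trans\<close>)
  next
    fix a assume "\<rho> t < a"
    then obtain b where "b \<in> A t" "b < a"
      unfolding \<rho>_def using cInf_lessD[OF ne[OF t]] by blast
    then obtain u where u: "u \<in> I" "t < u" "(\<phi> u - \<phi> t) / (u - t) < a" by (auto simp: A_def)
    have "\<forall>\<^sub>F y in at_right t. t < y \<and> y < u" using u(2) by (auto simp: eventually_at_right_field)
    then show "\<forall>\<^sub>F y in at_right t. (\<phi> y - \<phi> t) / (y - t) < a"
    proof eventually_elim
      case (elim y)
      then show ?case using convex_on_slopes(1)[OF conv t u(1), of y] u(3) by auto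
    qed
  qed
  from this lower upper show thesis by (rule that)
qed

lemma right_deriv_unique:
  assumes "(f has_real_derivative a) (at_right t)" "(f has_real_derivative b) (at_right t)"
  shows "a = b"
  using assms tendsto_unique[OF trivial_limit_at_right_real] unfolding has_field_derivative_iff by blast

lemma deriv_eq_right_deriv:
  assumes "(f has_real_derivative r) (at_right t)" "f differentiable (at t)"
  shows "deriv f t = r"
  using assms right_deriv_unique[OF has_field_derivative_at_within]
  by (metis DERIV_deriv_iff_real_differentiable)

text \<open>A slope between two points lies between the values of \<open>\<rho>\<close> at them, so
  \<open>\<phi>\<close> is differentiable wherever \<open>\<rho>\<close> is continuous, and a
  monotone function has countably many discontinuities.\<close>

lemma convex_countable_nondifferentiable:
  fixes \<phi> :: "real \<Rightarrow> real"
  assumes I: "open I"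
    and lower: "\<And>s t. s \<in> I \<Longrightarrow> t \<in> I \<Longrightarrow> s < t \<Longrightarrow> \<rho> s \<le> (\<phi> t - \<phi> s) / (t - s)"
    and upper: "\<And>s t. s \<in> I \<Longrightarrow> t \<in> I \<Longrightarrow> s < t \<Longrightarrow> (\<phi> t - \<phi> s) / (t - s) \<le> \<rho> t"
  shows "mono_on I \<rho>" "countable {t \<in> I. \<not> \<phi> differentiable (at t)}"
proof -
  show mono: "mono_on I \<rho>"
  proof (rule mono_onI)
    fix s t assume "s \<in> I" "t \<in> I" "s \<le> t"
    then show "\<rho> s \<le> \<rho> t" using lower[of s t] upper[of s t] by (cases "s = t") auto
  qed
  have "\<phi> differentiable (at t)" if t: "t \<in> I" "isCont \<rho> t" for t
  proof -
    have "\<forall>\<^sub>F y in at t. y \<in> I" using I t by (simp add: eventually_at_topological) blast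
    then have "\<forall>\<^sub>F y in at t. norm ((\<phi> y - \<phi> t) / (y - t) - \<rho> t) \<le> \<bar>\<rho> y - \<rho> t\<bar>"
      using eventually_neq_at_within[of t t UNIV]
    proof eventually_elim
      case (elim y)
      show ?case
      proof (cases "y < t")
        case True
        have "(\<phi> y - \<phi> t) / (y - t) = (\<phi> t - \<phi> y) / (t - y)"
          by (metis minus_diff_eq minus_divide_divide)
        then show ?thesis using lower[of y t] upper[of y t] elim t True by auto
      next
        case False
        then show ?thesis using lower[of t y] upper[of t y] elim t by auto
      qed
    qed
    moreover have "((\<lambda>y. \<bar>\<rho> y - \<rho> t\<bar>) \<longlongrightarrow> 0) (at t)"
      using t(2) unfolding isCont_def by (intro tendsto_rabs_zero LIM_zero)
    ultimately have "((\<lambda>y. (\<phi> y - \<phi> t) / (y - t) - \<rho> t) \<longlongrightarrow> 0) (at t)"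
      by (rule Lim_null_comparison)
    then have "((\<lambda>y. (\<phi> y - \<phi> t) / (y - t)) \<longlongrightarrow> \<rho> t) (at t)" by (rule LIM_zero_cancel)
    then show ?thesis by (auto simp: real_differentiable_def has_field_derivative_iff)
  qed
  then have "{t \<in> I. \<not> \<phi> differentiable (at t)} \<subseteq> {t \<in> I. \<not> isCont \<rho> t}" by auto
  then show "countable {t \<in> I. \<not> \<phi> differentiable (at t)}"
    by (rule countable_subset) (rule mono_on_ctble_discont_open[OF I mono])
qed

text \<open>By monotonicity, \<open>h y\<close> is squeezed between values of \<open>h\<close> at points of \<open>D\<close> close to \<open>y\<close>.\<close>

lemma mono_on_deriv_within_cocountable:
  fixes h :: "real \<Rightarrow> real"
  assumes I: "open I" and mono: "mono_on I h" and D: "countable (I - D)"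
    and t: "t \<in> I" and deriv: "(h has_real_derivative d) (at t within D)"
  shows "(h has_real_derivative d) (at t)"
  unfolding has_field_derivative_iff tendsto_iff
proof (intro allI impI)
  fix e :: real assume e: "0 < e"
  define \<epsilon> where "\<epsilon> = e / 2"
  have \<epsilon>: "0 < \<epsilon>" using e by (simp add: \<epsilon>_def)
  obtain d1 where d1: "0 < d1" "{t - d1..t + d1} \<subseteq> I" by (rule open_real_bounds[OF I t])
  have "\<forall>\<^sub>F z in at t within D. dist ((h z - h t) / (z - t)) d < \<epsilon>"
    using deriv \<epsilon> unfolding has_field_derivative_iff tendsto_iff by blast
  then obtain d2 where d2: "0 < d2" "\<And>z. z \<in> D \<Longrightarrow> z \<noteq> t \<Longrightarrow> dist z t < d2 \<Longrightarrow> dist ((h z - h t) / (z - t)) d < \<epsilon>"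
    unfolding eventually_at by auto
  define \<delta> where "\<delta> = min d1 d2"
  have \<delta>: "0 < \<delta>" using d1 d2 by (simp add: \<delta>_def)
  have inI: "z \<in> I" if "t - \<delta> < z" "z < t + \<delta>" for z
  proof -
    have "t - d1 \<le> z" "z \<le> t + d1" using that unfolding \<delta>_def by linarith+
    then show ?thesis using subsetD[OF d1(2), of z] by simp
  qed
  have near: "\<bar>(h z - h t) - d * (z - t)\<bar> \<le> \<epsilon> * \<bar>z - t\<bar>" if "z \<in> D" "z \<noteq> t" "t - \<delta> < z" "z < t + \<delta>" for z
  proof -
    have "dist ((h z - h t) / (z - t)) d < \<epsilon>" using that by (intro d2) (auto simp: dist_real_def \<delta>_def)
    then have "\<bar>(h z - h t) / (z - t) - d\<bar> * \<bar>z - t\<bar> \<le> \<epsilon> * \<bar>z - t\<bar>"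
      by (intro mult_right_mono) (auto simp: dist_real_def)
    moreover have "((h z - h t) / (z - t) - d) * (z - t) = (h z - h t) - d * (z - t)"
    proof -
      have "z - t \<noteq> 0" using that by simp
      then have "(h z - h t) / (z - t) * (z - t) = h z - h t" by simp
      then show ?thesis by (simp only: left_diff_distrib[of "(h z - h t) / (z - t)" d])
    qed
    ultimately show ?thesis by (metis abs_mult)
  qed
  have dense: "\<exists>z\<in>D. u < z \<and> z < v \<and> z \<noteq> t" if "u < v" "t - \<delta> \<le> u" "v \<le> t + \<delta>" for u v
  proof (rule ccontr)
    assume "\<not> ?thesis"
    then have "{u<..<v} \<subseteq> insert t (I - D)" using inI that by fastforce
    then have "countable {u<..<v}" by (rule countable_subset) (simp add: D)
    then show False using uncountable_open_interval[of u v] that(1) by simp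
  qed
  have bound: "\<bar>(h y - h t) - d * (y - t)\<bar> \<le> \<epsilon> * \<bar>y - t\<bar>" if y: "t - \<delta> < y" "y < t + \<delta>" for y
  proof -
    have up: "(h y - h t) - d * (y - t) \<le> \<epsilon> * \<bar>y - t\<bar> + (\<bar>d\<bar> + \<epsilon>) * \<eta>"
      and lo: "- (\<epsilon> * \<bar>y - t\<bar> + (\<bar>d\<bar> + \<epsilon>) * \<eta>) \<le> (h y - h t) - d * (y - t)" if \<eta>: "0 < \<eta>" for \<eta>
    proof -
      have est: "\<bar>d * (z - t) - d * (y - t)\<bar> + \<epsilon> * \<bar>z - t\<bar> \<le> \<epsilon> * \<bar>y - t\<bar> + (\<bar>d\<bar> + \<epsilon>) * \<eta>"
        if "\<bar>z - y\<bar> \<le> \<eta>" for z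
      proof -
        have "d * (z - t) - d * (y - t) = d * (z - y)" by (simp add: algebra_simps)
        then have "\<bar>d * (z - t) - d * (y - t)\<bar> \<le> \<bar>d\<bar> * \<eta>"
          using that by (simp add: abs_mult mult_left_mono)
        moreover have "\<epsilon> * \<bar>z - t\<bar> \<le> \<epsilon> * (\<bar>y - t\<bar> + \<eta>)" using that \<epsilon> by (intro mult_left_mono) auto
        ultimately show ?thesis by (simp add: algebra_simps)
      qed
      obtain z where z: "z \<in> D" "y < z" "z < min (y + \<eta>) (t + \<delta>)" "z \<noteq> t"
        using dense[of y "min (y + \<eta>) (t + \<delta>)"] y \<eta> by auto
      have "h y \<le> h z" using mono_onD[OF mono, of y z] inI y z by auto
      moreover have "\<bar>(h z - h t) - d * (z - t)\<bar> \<le> \<epsilon> * \<bar>z - t\<bar>" using near z y by auto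
      moreover have "\<bar>z - y\<bar> \<le> \<eta>" using z by auto
      ultimately show "(h y - h t) - d * (y - t) \<le> \<epsilon> * \<bar>y - t\<bar> + (\<bar>d\<bar> + \<epsilon>) * \<eta>"
        using est[of z] by linarith
      obtain w where w: "w \<in> D" "max (y - \<eta>) (t - \<delta>) < w" "w < y" "w \<noteq> t"
        using dense[of "max (y - \<eta>) (t - \<delta>)" y] y \<eta> by auto
      have "h w \<le> h y" using mono_onD[OF mono, of w y] inI y w by auto
      moreover have "\<bar>(h w - h t) - d * (w - t)\<bar> \<le> \<epsilon> * \<bar>w - t\<bar>" using near w y by auto
      moreover have "\<bar>w - y\<bar> \<le> \<eta>" using w by auto
      ultimately show "- (\<epsilon> * \<bar>y - t\<bar> + (\<bar>d\<bar> + \<epsilon>) * \<eta>) \<le> (h y - h t) - d * (y - t)"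
        using est[of w] by linarith
    qed
    then have "\<bar>(h y - h t) - d * (y - t)\<bar> \<le> \<epsilon> * \<bar>y - t\<bar> + (\<bar>d\<bar> + \<epsilon>) * \<eta>" if "0 < \<eta>" for \<eta>
      unfolding abs_le_iff using up[OF that] lo[OF that] by linarith
    then have ev: "\<forall>\<^sub>F \<eta> in at_right 0. \<bar>(h y - h t) - d * (y - t)\<bar> \<le> \<epsilon> * \<bar>y - t\<bar> + (\<bar>d\<bar> + \<epsilon>) * \<eta>"
      using eventually_at_right_less[of "0::real"] by (auto elim: eventually_mono)
    have "((\<lambda>\<eta>. \<epsilon> * \<bar>y - t\<bar> + (\<bar>d\<bar> + \<epsilon>) * \<eta>) \<longlongrightarrow> \<epsilon> * \<bar>y - t\<bar> + (\<bar>d\<bar> + \<epsilon>) * 0) (at_right 0)"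
      by (intro tendsto_intros)
    from tendsto_lowerbound[OF this ev] show ?thesis by simp
  qed
  have "dist ((h y - h t) / (y - t)) d < e" if y: "y \<noteq> t" "dist y t < \<delta>" for y
  proof -
    have "\<bar>(h y - h t) - d * (y - t)\<bar> \<le> \<epsilon> * \<bar>y - t\<bar>"
      using y by (intro bound) (auto simp: dist_real_def abs_less_iff)
    moreover have "(h y - h t) / (y - t) - d = ((h y - h t) - d * (y - t)) / (y - t)"
      using y by (simp add: diff_divide_distrib)
    ultimately have "\<bar>(h y - h t) / (y - t) - d\<bar> \<le> \<epsilon>"
      using y by (simp add: abs_divide pos_divide_le_eq)
    then show ?thesis using e by (simp add: dist_real_def \<epsilon>_def)
  qed
  then show "\<forall>\<^sub>F y in at t. dist ((h y - h t) / (y - t)) d < e"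
    unfolding eventually_at using \<delta> by auto
qed

text \<open>At the last point \<open>z\<close> where the inequality with slope \<open>m - e\<close>
  still holds, the right derivative exceeds \<open>m - e\<close>, so it would hold at some point
  beyond \<open>z\<close> as well. The loss \<open>e\<close> makes the comparison strict.\<close>

lemma right_deriv_mean_value_lower:
  fixes G :: "real \<Rightarrow> real"
  assumes ab: "a \<le> b" and cont: "continuous_on {a..b} G"
    and deriv: "\<And>t. a \<le> t \<Longrightarrow> t < b \<Longrightarrow> (G has_real_derivative r t) (at_right t)"
    and lower: "\<And>t. a \<le> t \<Longrightarrow> t < b \<Longrightarrow> m \<le> r t"
  shows "m * (b - a) \<le> G b - G a"
proof -
  have "(m - e) * (b - a) \<le> G b - G a" if e: "0 < e" for e
  proof (rule ccontr)
    assume neg: "\<not> ?thesis"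
    define H where "H y = G y - G a - (m - e) * (y - a)" for y
    have contH: "continuous_on {a..b} H" unfolding H_def by (intro continuous_intros cont)
    define Z where "Z = {y \<in> {a..b}. 0 \<le> H y}"
    have "closed Z" unfolding Z_def
      by (intro continuous_on_closed_Collect_le contH continuous_intros)
    moreover have "bounded Z" by (rule bounded_subset[of "{a..b}"]) (auto simp: Z_def)
    ultimately have "compact Z" by (simp add: compact_eq_bounded_closed)
    moreover have "a \<in> Z" using ab by (simp add: Z_def H_def)
    ultimately obtain z where z: "z \<in> Z" "\<And>y. y \<in> Z \<Longrightarrow> y \<le> z"
      using compact_attains_sup[of Z] by auto
    have "H b < 0" using neg by (simp add: H_def)
    then have zb: "a \<le> z" "z < b" using z(1) by (auto simp: Z_def less_le)
    have "(H has_real_derivative r z - (m - e)) (at_right z)"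
      unfolding H_def[abs_def] by (rule derivative_eq_intros deriv zb refl | simp)+
    then have "((\<lambda>y. (H y - H z) / (y - z)) \<longlongrightarrow> r z - (m - e)) (at_right z)"
      by (simp add: has_field_derivative_iff)
    moreover have "0 < r z - (m - e)" using lower[OF zb] e by simp
    ultimately have "\<forall>\<^sub>F y in at_right z. 0 < (H y - H z) / (y - z)" by (rule order_tendstoD)
    moreover have "\<forall>\<^sub>F y in at_right z. z < y \<and> y < b" using zb(2) by (auto simp: eventually_at_right_field)
    ultimately have "\<forall>\<^sub>F y in at_right z. 0 < (H y - H z) / (y - z) \<and> z < y \<and> y < b" by (rule eventually_conj)
    then obtain y where y: "0 < (H y - H z) / (y - z)" "z < y" "y < b"
      using eventually_happens'[OF trivial_limit_at_right_real] by blast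
    then have "0 < H y - H z" by (simp add: zero_less_divide_iff)
    then have "y \<in> Z" using z(1) y zb by (auto simp: Z_def)
    then show False using z(2)[of y] y(2) by simp
  qed
  then have "\<forall>\<^sub>F e in at_right 0. (m - e) * (b - a) \<le> G b - G a"
    using eventually_at_right_less[of "0::real"] by (auto elim: eventually_mono)
  moreover have "((\<lambda>e. (m - e) * (b - a)) \<longlongrightarrow> (m - 0) * (b - a)) (at_right 0)" by (intro tendsto_intros)
  ultimately show ?thesis using tendsto_upperbound by fastforce
qed

lemma right_deriv_mean_value_upper:
  fixes G :: "real \<Rightarrow> real"
  assumes "a \<le> b" "continuous_on {a..b} G"
    and "\<And>t. a \<le> t \<Longrightarrow> t < b \<Longrightarrow> (G has_real_derivative r t) (at_right t)"
    and "\<And>t. a \<le> t \<Longrightarrow> t < b \<Longrightarrow> r t \<le> m"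
  shows "G b - G a \<le> m * (b - a)"
proof -
  have "- m * (b - a) \<le> (- G b) - (- G a)"
    using assms by (intro right_deriv_mean_value_lower[where r = "\<lambda>t. - r t"] continuous_intros DERIV_minus) auto
  then show ?thesis by simp
qed

text \<open>The slopes before \<open>m\<close> are at most \<open>r m\<close> and those after it at
  least \<open>r m\<close>.\<close>

lemma convex_by_right_deriv:
  assumes I: "is_interval I" and cont: "continuous_on I G"
    and deriv: "\<And>t. t \<in> I \<Longrightarrow> (G has_real_derivative r t) (at_right t)"
    and mono: "\<And>s t. s \<in> I \<Longrightarrow> t \<in> I \<Longrightarrow> s \<le> t \<Longrightarrow> r s \<le> r t"
  shows "convex_on I G"
proof (rule convex_on_slopeI[OF I])
  fix x m y assume xy: "x \<in> I" "y \<in> I" and less: "x < m" "m < y"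
  have sub: "{x..y} \<subseteq> I" by (rule Icc_subset[OF I xy])
  then have inI: "t \<in> I" if "x \<le> t" "t \<le> y" for t using that by auto
  have m: "m \<in> I" using inI less by auto
  have "G m - G x \<le> r m * (m - x)"
    by (rule right_deriv_mean_value_upper[where r = r])
      (use less inI m in \<open>auto intro!: deriv mono intro: continuous_on_subset[OF cont]\<close>)
  moreover have "r m * (y - m) \<le> G y - G m"
    by (rule right_deriv_mean_value_lower[where r = r])
      (use less inI m in \<open>auto intro!: deriv mono intro: continuous_on_subset[OF cont]\<close>)
  ultimately show "(G m - G x) / (m - x) \<le> (G y - G m) / (y - m)"
    using less by (smt (verit) divide_le_eq le_divide_eq)
qed

section \<open>Higher derivatives as partial functions\<close>

text \<open>At an accumulation point the limit is unique, which determines the value chosen by the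
  definite description.\<close>

lemma partial_deriv_eq_Some_iff:
  "partial_deriv g t = Some D \<longleftrightarrow> t \<in> dom g \<and> t islimpt dom g \<and>
     ((\<lambda>s. the (g s)) has_real_derivative D) (at t within dom g)"
proof (cases "t \<in> dom g \<and> t islimpt dom g")
  case True
  then have "at t within dom g \<noteq> bot" by (simp add: trivial_limit_within)
  then have uniq: "D = D'" if "((\<lambda>s. the (g s)) has_real_derivative D) (at t within dom g)"
      "((\<lambda>s. the (g s)) has_real_derivative D') (at t within dom g)" for D D'
    using that tendsto_unique unfolding has_field_derivative_iff by blast
  show ?thesis
  proof (cases "\<exists>D. ((\<lambda>s. the (g s)) has_real_derivative D) (at t within dom g)")
    case ex: True
    then obtain D' where D': "((\<lambda>s. the (g s)) has_real_derivative D') (at t within dom g)" by blast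
    have "(THE D. ((\<lambda>s. the (g s)) has_real_derivative D) (at t within dom g)) = D'"
      by (rule the_equality) (use D' uniq in blast)+
    then have "partial_deriv g t = Some D'" unfolding partial_deriv_def using True ex by simp
    then show ?thesis using True D' uniq by auto
  qed (auto simp: partial_deriv_def)
qed (auto simp: partial_deriv_def)

lemma islimpt_open: "open I \<Longrightarrow> t \<in> I \<Longrightarrow> t islimpt I" for t :: real
  by (metis at_within_open trivial_limit_at trivial_limit_within)

lemma partial_deriv_restrict_open:
  assumes I: "open I"
  shows "partial_deriv ((\<lambda>t. Some (g t)) |` I) =
     (\<lambda>t. if t \<in> I \<and> g differentiable (at t) then Some (deriv g t) else None)"
proof
  fix t
  have dom: "dom ((\<lambda>t. Some (g t)) |` I) = I" by (auto simp: dom_def restrict_map_def)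
  have iff: "partial_deriv ((\<lambda>t. Some (g t)) |` I) t = Some D \<longleftrightarrow> t \<in> I \<and> (g has_real_derivative D) (at t)" for D
  proof (cases "t \<in> I")
    case True
    then have "((\<lambda>s. the (((\<lambda>t. Some (g t)) |` I) s)) has_real_derivative D) (at t within I) \<longleftrightarrow>
        (g has_real_derivative D) (at t within I)"
      by (intro has_field_derivative_cong_ev) (auto simp: restrict_map_def intro: eventually_mono)
    then show ?thesis
      unfolding partial_deriv_eq_Some_iff dom at_within_open[OF True I]
      using True islimpt_open[OF I True] by blast
  qed (simp add: partial_deriv_eq_Some_iff dom)
  show "partial_deriv ((\<lambda>t. Some (g t)) |` I) t =
     (if t \<in> I \<and> g differentiable (at t) then Some (deriv g t) else None)"
  proof (cases "t \<in> I \<and> g differentiable (at t)")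
    case True
    then have "partial_deriv ((\<lambda>t. Some (g t)) |` I) t = Some (deriv g t)"
      by (simp add: iff DERIV_deriv_iff_real_differentiable)
    then show ?thesis using True by simp
  next
    case False
    then have "partial_deriv ((\<lambda>t. Some (g t)) |` I) t \<noteq> Some D" for D
      unfolding iff by (auto simp: real_differentiable_def)
    then show ?thesis using False by auto
  qed
qed

lemma nth_deriv_smooth:
  assumes I: "open I" and "\<And>j t. j < k \<Longrightarrow> t \<in> I \<Longrightarrow> (deriv ^^ j) f differentiable (at t)"
  shows "nth_deriv k I f = (\<lambda>t. Some ((deriv ^^ k) f t)) |` I"
  using assms(2)
proof (induction k)
  case (Suc k)
  then have "nth_deriv (Suc k) I f = partial_deriv ((\<lambda>t. Some ((deriv ^^ k) f t)) |` I)"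
    by (simp add: nth_deriv_def)
  also have "\<dots> = (\<lambda>t. Some ((deriv ^^ Suc k) f t)) |` I"
    unfolding partial_deriv_restrict_open[OF I] using Suc.prems
    by (auto simp: restrict_map_def fun_eq_iff)
  finally show ?case .
qed (simp add: nth_deriv_def)

lemma nth_deriv_Suc_C_k:
  assumes I: "open I" and "C_k_on k I f"
  shows "nth_deriv (Suc k) I f =
     (\<lambda>t. if t \<in> I \<and> (deriv ^^ k) f differentiable (at t) then Some (deriv ((deriv ^^ k) f) t) else None)"
proof -
  have "nth_deriv (Suc k) I f = partial_deriv (nth_deriv k I f)" by (simp add: nth_deriv_def)
  also have "nth_deriv k I f = (\<lambda>t. Some ((deriv ^^ k) f t)) |` I"
    using assms by (intro nth_deriv_smooth) (auto simp: C_k_on_def)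
  finally show ?thesis by (simp add: partial_deriv_restrict_open[OF I])
qed

text \<open>On \<open>D\<close> the derivative of order \<open>k + 1\<close> agrees with the right
  derivative \<open>r\<close>, which is defined on all of \<open>I\<close>. The next derivative is
  therefore that of \<open>r\<close> along \<open>D\<close>, and only total functions occur on the
  right side.\<close>

lemma nth_deriv_Suc_Suc_eq_Some_iff:
  assumes I: "open I" and Ck: "C_k_on k I f"
    and r: "\<And>t. t \<in> I \<Longrightarrow> ((deriv ^^ k) f has_real_derivative r t) (at_right t)"
  defines "D \<equiv> {t \<in> I. (deriv ^^ k) f differentiable (at t)}"
  shows "nth_deriv (Suc (Suc k)) I f t = Some d \<longleftrightarrow>
     t \<in> D \<and> t islimpt D \<and> (r has_real_derivative d) (at t within D)"
proof -
  have dom: "dom (nth_deriv (Suc k) I f) = D"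
    by (auto simp: nth_deriv_Suc_C_k[OF I Ck] D_def dom_def)
  have val: "the (nth_deriv (Suc k) I f s) = r s" if "s \<in> D" for s
    using that deriv_eq_right_deriv[OF r] by (auto simp: nth_deriv_Suc_C_k[OF I Ck] D_def)
  have "nth_deriv (Suc (Suc k)) I f = partial_deriv (nth_deriv (Suc k) I f)" by (simp add: nth_deriv_def)
  moreover have "((\<lambda>s. the (nth_deriv (Suc k) I f s)) has_real_derivative d) (at t within D) \<longleftrightarrow>
      (r has_real_derivative d) (at t within D)" if "t \<in> D"
    using that by (auto intro: has_field_derivative_transform_within[where d = 1] simp: val)
  ultimately show ?thesis unfolding partial_deriv_eq_Some_iff dom by (metis dom partial_deriv_eq_Some_iff)
qed

section \<open>Leibniz rule in Taylor coefficients\<close>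

text \<open>Dividing by factorials turns Leibniz' rule into a convolution: the two shifted sums
  carry the weights \<open>j\<close> and \<open>Suc m - j\<close>, which add up to
  \<open>Suc m\<close>. The set \<open>S\<close> is general so that right derivatives are
  covered.\<close>

lemma leibniz_taylor_step:
  fixes \<phi> N :: "nat \<Rightarrow> real \<Rightarrow> real" and v w :: "nat \<Rightarrow> real"
  assumes \<phi>: "\<And>j. j \<le> m \<Longrightarrow> (\<phi> j has_real_derivative real (Suc j) * v (Suc j)) (at t within S)"
    and N: "\<And>j. j \<le> m \<Longrightarrow> (N j has_real_derivative real (Suc j) * w (Suc j)) (at t within S)"
    and val: "\<And>j. j \<le> m \<Longrightarrow> \<phi> j t = v j" "\<And>j. j \<le> m \<Longrightarrow> N j t = w j"
  shows "((\<lambda>x. \<Sum>j\<le>m. \<phi> j x * N (m - j) x) has_real_derivative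
     real (Suc m) * (\<Sum>j\<le>Suc m. v j * w (Suc m - j))) (at t within S)"
proof -
  have "((\<lambda>x. \<Sum>j\<le>m. \<phi> j x * N (m - j) x) has_real_derivative
      (\<Sum>j\<le>m. real (Suc j) * v (Suc j) * N (m - j) t + real (Suc (m - j)) * w (Suc (m - j)) * \<phi> j t)) (at t within S)"
    by (intro DERIV_sum DERIV_mult \<phi> N) auto
  moreover have "(\<Sum>j\<le>m. real (Suc j) * v (Suc j) * N (m - j) t + real (Suc (m - j)) * w (Suc (m - j)) * \<phi> j t)
      = (\<Sum>j\<le>m. real (Suc j) * v (Suc j) * w (m - j)) + (\<Sum>j\<le>m. real (Suc m - j) * (v j * w (Suc m - j)))"
    unfolding sum.distrib[symmetric]
    by (intro sum.cong refl) (auto simp: val Suc_diff_le)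
  moreover have "(\<Sum>j\<le>m. real (Suc j) * v (Suc j) * w (m - j)) = (\<Sum>j\<le>Suc m. real j * (v j * w (Suc m - j)))"
    by (subst sum.atMost_Suc_shift) (simp add: mult.assoc)
  moreover have "(\<Sum>j\<le>m. real (Suc m - j) * (v j * w (Suc m - j))) = (\<Sum>j\<le>Suc m. real (Suc m - j) * (v j * w (Suc m - j)))"
    by simp
  moreover have "(\<Sum>j\<le>Suc m. real j * (v j * w (Suc m - j))) + (\<Sum>j\<le>Suc m. real (Suc m - j) * (v j * w (Suc m - j)))
      = real (Suc m) * (\<Sum>j\<le>Suc m. v j * w (Suc m - j))"
    unfolding sum.distrib[symmetric] sum_distrib_left
  proof (intro sum.cong refl)
    fix j assume "j \<in> {..Suc m}"
    then have "real j + real (Suc m - j) = real (Suc m)" by auto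
    then show "real j * (v j * w (Suc m - j)) + real (Suc m - j) * (v j * w (Suc m - j)) = real (Suc m) * (v j * w (Suc m - j))"
      by (metis distrib_right)
  qed
  ultimately show ?thesis by simp
qed

definition poly_taylor :: "real poly \<Rightarrow> nat \<Rightarrow> real \<Rightarrow> real" where
  "poly_taylor p i t = poly ((pderiv ^^ i) p) t / fact i"

definition fun_taylor :: "(real \<Rightarrow> real) \<Rightarrow> nat \<Rightarrow> real \<Rightarrow> real" where
  "fun_taylor f j t = (deriv ^^ j) f t / fact j"

lemma has_real_derivative_poly_taylor:
  "(poly_taylor p i has_real_derivative real (Suc i) * poly_taylor p (Suc i) t) (at t within S)"
proof -
  have "(poly_taylor p i has_real_derivative poly (pderiv ((pderiv ^^ i) p)) t / fact i) (at t)"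
    unfolding poly_taylor_def[abs_def] by (intro DERIV_cdivide poly_DERIV)
  moreover have "poly (pderiv ((pderiv ^^ i) p)) t / fact i = real (Suc i) * poly_taylor p (Suc i) t"
    by (simp add: poly_taylor_def)
  ultimately show ?thesis by (metis has_field_derivative_at_within)
qed

lemma has_real_derivative_fun_taylor:
  assumes "((deriv ^^ j) f has_real_derivative d) (at t within S)"
  shows "(fun_taylor f j has_real_derivative real (Suc j) * (d / fact (Suc j))) (at t within S)"
proof -
  have "(fun_taylor f j has_real_derivative d / fact j) (at t within S)"
    unfolding fun_taylor_def[abs_def] by (intro DERIV_cdivide assms)
  moreover have "d / fact j = real (Suc j) * (d / fact (Suc j))" by simp
  ultimately show ?thesis by metis
qed

lemma coeff_higher_pderiv_0: "coeff ((pderiv ^^ i) p) 0 = fact i * coeff (p :: real poly) i"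
proof (induction i arbitrary: p)
  case (Suc i)
  have "coeff ((pderiv ^^ Suc i) p) 0 = fact i * coeff (pderiv p) i"
    using Suc[of "pderiv p"] by (simp add: funpow_swap1)
  then show ?case by (simp add: coeff_pderiv algebra_simps)
qed simp

lemma poly_taylor_eq_coeff: "poly_taylor p i t = coeff (pcompose p [:t, 1:]) i"
proof -
  have "(pderiv ^^ i) (pcompose p [:t, 1:]) = pcompose ((pderiv ^^ i) p) [:t, 1:]"
    by (induction i) (simp_all add: pderiv_pcompose pderiv_pCons)
  then have "poly ((pderiv ^^ i) p) t = coeff ((pderiv ^^ i) (pcompose p [:t, 1:])) 0"
    by (simp add: poly_0_coeff_0[symmetric] poly_pcompose)
  then show ?thesis by (simp add: poly_taylor_def coeff_higher_pderiv_0)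
qed

lemma fun_taylor_mult_poly:
  assumes I: "open I" and diff: "\<And>j t. j < k \<Longrightarrow> t \<in> I \<Longrightarrow> (deriv ^^ j) f differentiable (at t)"
    and m: "m \<le> k" and t: "t \<in> I"
  shows "fun_taylor (\<lambda>s. f s * poly p s) m t = (\<Sum>j\<le>m. fun_taylor f j t * poly_taylor p (m - j) t)"
    and "m < k \<Longrightarrow> (deriv ^^ m) (\<lambda>s. f s * poly p s) differentiable (at t)"
proof -
  let ?F = "\<lambda>s. f s * poly p s"
  \<comment> \<open>The formula of order \<open>m\<close> is needed on all of \<open>I\<close> in
    order to be differentiated, so formula and differentiability are obtained together, order by
    order.\<close>
  have deriv_step: "((deriv ^^ m) ?F has_real_derivative fact (Suc m) * (\<Sum>j\<le>Suc m. fun_taylor f j t * poly_taylor p (Suc m - j) t)) (at t)"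
    if eq: "\<And>t. t \<in> I \<Longrightarrow> fun_taylor ?F m t = (\<Sum>j\<le>m. fun_taylor f j t * poly_taylor p (m - j) t)"
      and m: "m < k" and t: "t \<in> I" for m t
  proof -
    have "((\<lambda>x. \<Sum>j\<le>m. fun_taylor f j x * poly_taylor p (m - j) x) has_real_derivative
       real (Suc m) * (\<Sum>j\<le>Suc m. fun_taylor f j t * poly_taylor p (Suc m - j) t)) (at t)"
    proof (rule leibniz_taylor_step)
      fix j assume "j \<le> m"
      then have "((deriv ^^ j) f has_real_derivative (deriv ^^ Suc j) f t) (at t)"
        using diff[of j t] m t by (simp add: DERIV_deriv_iff_real_differentiable)
      then show "(fun_taylor f j has_real_derivative real (Suc j) * fun_taylor f (Suc j) t) (at t)"
        unfolding fun_taylor_def[of f "Suc j"] by (rule has_real_derivative_fun_taylor)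
    qed (rule has_real_derivative_poly_taylor refl)+
    then have "((\<lambda>x. fact m * (\<Sum>j\<le>m. fun_taylor f j x * poly_taylor p (m - j) x)) has_real_derivative
       fact m * (real (Suc m) * (\<Sum>j\<le>Suc m. fun_taylor f j t * poly_taylor p (Suc m - j) t))) (at t)"
      by (rule DERIV_cmult)
    then have "((deriv ^^ m) ?F has_real_derivative
       fact m * (real (Suc m) * (\<Sum>j\<le>Suc m. fun_taylor f j t * poly_taylor p (Suc m - j) t))) (at t)"
    proof (rule has_field_derivative_transform_within_open[OF _ I t])
      fix x assume "x \<in> I"
      from eq[OF this] show "fact m * (\<Sum>j\<le>m. fun_taylor f j x * poly_taylor p (m - j) x) = (deriv ^^ m) ?F x"
        unfolding fun_taylor_def[of ?F] by (simp add: field_simps)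
    qed
    moreover have "fact m * (real (Suc m) * a) = fact (Suc m) * a" for a :: real
      by (simp add: algebra_simps)
    ultimately show ?thesis by metis
  qed
  have main: "\<forall>t\<in>I. fun_taylor ?F m t = (\<Sum>j\<le>m. fun_taylor f j t * poly_taylor p (m - j) t)" if "m \<le> k" for m
    using that
  proof (induction m)
    case (Suc m)
    then have eq: "fun_taylor ?F m t = (\<Sum>j\<le>m. fun_taylor f j t * poly_taylor p (m - j) t)" if "t \<in> I" for t
      using that by simp
    show ?case
    proof
      fix t assume "t \<in> I"
      then have "(deriv ^^ Suc m) ?F t = fact (Suc m) * (\<Sum>j\<le>Suc m. fun_taylor f j t * poly_taylor p (Suc m - j) t)"
        using DERIV_imp_deriv[OF deriv_step[OF eq]] Suc.prems by simp
      then show "fun_taylor ?F (Suc m) t = (\<Sum>j\<le>Suc m. fun_taylor f j t * poly_taylor p (Suc m - j) t)"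
        unfolding fun_taylor_def[of ?F] by simp
    qed
  qed (simp add: fun_taylor_def poly_taylor_def)
  show "fun_taylor ?F m t = (\<Sum>j\<le>m. fun_taylor f j t * poly_taylor p (m - j) t)"
    using main m t by blast
  show "(deriv ^^ m) ?F differentiable (at t)" if "m < k"
    using deriv_step[OF _ that t] main[OF m] by (auto simp: real_differentiable_def)
qed

lemma C_k_on_mult_poly:
  assumes I: "open I" and Ck: "C_k_on k I f"
  shows "C_k_on k I (\<lambda>s. f s * poly p s)"
proof -
  have diff: "\<And>j t. j < k \<Longrightarrow> t \<in> I \<Longrightarrow> (deriv ^^ j) f differentiable (at t)"
    using Ck by (auto simp: C_k_on_def)
  have cont: "continuous_on I (fun_taylor f j)" if "j \<le> k" for j
  proof -
    have "continuous_on I ((deriv ^^ j) f)"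
    proof (cases "j = k")
      case False
      then show ?thesis using that diff[of j]
        by (intro continuous_at_imp_continuous_on) (auto intro: differentiable_imp_continuous_within)
    qed (use Ck in \<open>auto simp: C_k_on_def\<close>)
    then show ?thesis unfolding fun_taylor_def[abs_def] by (intro continuous_intros) auto
  qed
  have contp: "continuous_on I (poly_taylor p j)" for j
    unfolding poly_taylor_def[abs_def] by (intro continuous_intros) auto
  have "continuous_on I (\<lambda>t. fact k * (\<Sum>j\<le>k. fun_taylor f j t * poly_taylor p (k - j) t))"
    by (intro continuous_intros cont contp) auto
  moreover have "(deriv ^^ k) (\<lambda>s. f s * poly p s) t = fact k * (\<Sum>j\<le>k. fun_taylor f j t * poly_taylor p (k - j) t)"
    if "t \<in> I" for t
    using fun_taylor_mult_poly(1)[OF I diff order_refl that, where p = p] unfolding fun_taylor_def[of "\<lambda>s. f s * poly p s"]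
    by (simp add: field_simps)
  ultimately have "continuous_on I ((deriv ^^ k) (\<lambda>s. f s * poly p s))"
    by (simp cong: continuous_on_cong)
  then show ?thesis
    unfolding C_k_on_def using fun_taylor_mult_poly(2)[OF I diff] by auto
qed

text \<open>The Taylor coefficients of \<open>f\<close>, continued at index \<open>k + 1\<close> by the right derivative \<open>r\<close> of the
  \<open>k\<close>-th derivative.\<close>

definition ext_taylor :: "(real \<Rightarrow> real) \<Rightarrow> nat \<Rightarrow> (real \<Rightarrow> real) \<Rightarrow> nat \<Rightarrow> real \<Rightarrow> real" where
  "ext_taylor f k r j t = (if j \<le> k then fun_taylor f j t else r t / fact j)"

text \<open>The right derivative of the \<open>k\<close>-th derivative of \<open>f * poly p\<close>
  by Leibniz' rule (\<open>has_right_deriv_mult_poly\<close>). The function \<open>r\<close> enters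
  only through the summand with \<open>j = Suc k\<close>, with the factor
  \<open>poly p\<close>.\<close>

definition mult_right_deriv :: "(real \<Rightarrow> real) \<Rightarrow> nat \<Rightarrow> (real \<Rightarrow> real) \<Rightarrow> real poly \<Rightarrow> real \<Rightarrow> real" where
  "mult_right_deriv f k r p t = fact (Suc k) * (\<Sum>j\<le>Suc k. ext_taylor f k r j t * poly_taylor p (Suc k - j) t)"

lemma has_right_deriv_transform_open:
  fixes g h :: "real \<Rightarrow> real"
  assumes g: "(g has_real_derivative d) (at_right t)" and I: "open I" "t \<in> I"
    and eq: "\<And>x. x \<in> I \<Longrightarrow> g x = h x"
  shows "(h has_real_derivative d) (at_right t)"
proof -
  have "\<forall>\<^sub>F x in at_right t. (g x - g t) / (x - t) = (h x - h t) / (x - t)"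
    unfolding eventually_at_topological using I eq by (intro exI[of _ I]) auto
  then show ?thesis
    using g unfolding has_field_derivative_iff by (rule Lim_transform_eventually[rotated])
qed

lemma has_right_deriv_mult_poly:
  assumes I: "open I" and Ck: "C_k_on k I f" and t: "t \<in> I"
    and r: "((deriv ^^ k) f has_real_derivative r t) (at_right t)"
  shows "((deriv ^^ k) (\<lambda>s. f s * poly p s) has_real_derivative mult_right_deriv f k r p t) (at_right t)"
proof -
  have diff: "\<And>j t. j < k \<Longrightarrow> t \<in> I \<Longrightarrow> (deriv ^^ j) f differentiable (at t)"
    using Ck by (auto simp: C_k_on_def)
  have "((\<lambda>x. \<Sum>j\<le>k. fun_taylor f j x * poly_taylor p (k - j) x) has_real_derivative
       real (Suc k) * (\<Sum>j\<le>Suc k. ext_taylor f k r j t * poly_taylor p (Suc k - j) t)) (at_right t)"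
  proof (rule leibniz_taylor_step)
    fix j assume j: "j \<le> k"
    show "(fun_taylor f j has_real_derivative real (Suc j) * ext_taylor f k r (Suc j) t) (at_right t)"
    proof (cases "j = k")
      case True
      then show ?thesis using has_real_derivative_fun_taylor[OF r] by (simp add: ext_taylor_def)
    next
      case False
      then have "((deriv ^^ j) f has_real_derivative (deriv ^^ Suc j) f t) (at t)"
        using diff[of j t] j t by (simp add: DERIV_deriv_iff_real_differentiable)
      from has_real_derivative_fun_taylor[OF has_field_derivative_at_within[OF this]] False j
      show ?thesis by (simp add: ext_taylor_def fun_taylor_def del: fact_Suc)
    qed
  qed (rule has_real_derivative_poly_taylor refl | simp add: ext_taylor_def)+
  then have "((\<lambda>x. fact k * (\<Sum>j\<le>k. fun_taylor f j x * poly_taylor p (k - j) x)) has_real_derivative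
       fact k * (real (Suc k) * (\<Sum>j\<le>Suc k. ext_taylor f k r j t * poly_taylor p (Suc k - j) t))) (at_right t)"
    by (rule DERIV_cmult)
  then have "((deriv ^^ k) (\<lambda>s. f s * poly p s) has_real_derivative
       fact k * (real (Suc k) * (\<Sum>j\<le>Suc k. ext_taylor f k r j t * poly_taylor p (Suc k - j) t))) (at_right t)"
  proof (rule has_right_deriv_transform_open[OF _ I t])
    fix x assume "x \<in> I"
    from fun_taylor_mult_poly(1)[OF I diff order_refl this, where p = p]
    show "fact k * (\<Sum>j\<le>k. fun_taylor f j x * poly_taylor p (k - j) x) = (deriv ^^ k) (\<lambda>s. f s * poly p s) x"
      unfolding fun_taylor_def[of "\<lambda>s. f s * poly p s"] by (simp add: field_simps)
  qed
  moreover have "fact k * (real (Suc k) * a) = fact (Suc k) * a" for a :: real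
    by (simp add: algebra_simps)
  ultimately show ?thesis unfolding mult_right_deriv_def by metis
qed

lemma has_deriv_mult_right_deriv:
  assumes Ck: "C_k_on k I f" and t: "t \<in> I"
    and fk: "(deriv ^^ k) f differentiable (at t)" "r t = deriv ((deriv ^^ k) f) t"
    and r: "(r has_real_derivative d) (at t)"
  defines "v \<equiv> \<lambda>j. if j \<le> Suc k then ext_taylor f k r j t else d / fact (Suc (Suc k))"
  shows "(mult_right_deriv f k r p has_real_derivative
     fact (Suc (Suc k)) * (\<Sum>j\<le>Suc (Suc k). v j * poly_taylor p (Suc (Suc k) - j) t)) (at t)"
proof -
  have diff: "\<And>j t. j < k \<Longrightarrow> t \<in> I \<Longrightarrow> (deriv ^^ j) f differentiable (at t)"
    using Ck by (auto simp: C_k_on_def)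
  have "((\<lambda>x. \<Sum>j\<le>Suc k. ext_taylor f k r j x * poly_taylor p (Suc k - j) x) has_real_derivative
       real (Suc (Suc k)) * (\<Sum>j\<le>Suc (Suc k). v j * poly_taylor p (Suc (Suc k) - j) t)) (at t)"
  proof (rule leibniz_taylor_step)
    fix j assume j: "j \<le> Suc k"
    show "(ext_taylor f k r j has_real_derivative real (Suc j) * v (Suc j)) (at t)"
    proof (cases "j = Suc k")
      case True
      have "((\<lambda>t. r t / fact (Suc k)) has_real_derivative d / fact (Suc k)) (at t)"
        by (intro DERIV_cdivide r)
      moreover have "d / fact (Suc k) = real (Suc j) * v (Suc j)" using True by (simp add: v_def)
      moreover have "ext_taylor f k r j = (\<lambda>t. r t / fact (Suc k))" using True by (auto simp: ext_taylor_def)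
      ultimately show ?thesis by metis
    next
      case False
      then have jk: "j \<le> k" using j by simp
      then have "((deriv ^^ j) f has_real_derivative (deriv ^^ Suc j) f t) (at t)"
        using diff[of j t] fk t by (cases "j = k") (auto simp: DERIV_deriv_iff_real_differentiable)
      from has_real_derivative_fun_taylor[OF this]
      have "(fun_taylor f j has_real_derivative real (Suc j) * fun_taylor f (Suc j) t) (at t)"
        by (simp only: fun_taylor_def[of f "Suc j"])
      moreover have "ext_taylor f k r j = fun_taylor f j" using jk by (auto simp: ext_taylor_def)
      moreover have "v (Suc j) = fun_taylor f (Suc j) t"
        using jk fk(2) by (cases "j = k") (auto simp: v_def ext_taylor_def fun_taylor_def)
      ultimately show ?thesis by simp
    qed
  qed (rule has_real_derivative_poly_taylor refl | simp add: v_def)+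
  then have "((\<lambda>x. fact (Suc k) * (\<Sum>j\<le>Suc k. ext_taylor f k r j x * poly_taylor p (Suc k - j) x)) has_real_derivative
       fact (Suc k) * (real (Suc (Suc k)) * (\<Sum>j\<le>Suc (Suc k). v j * poly_taylor p (Suc (Suc k) - j) t))) (at t)"
    by (rule DERIV_cmult)
  moreover have "fact (Suc k) * (real (Suc (Suc k)) * a) = fact (Suc (Suc k)) * a" for a :: real
    by (simp add: algebra_simps)
  ultimately show ?thesis unfolding mult_right_deriv_def[abs_def] by metis
qed

text \<open>The left side is a coefficient of a product of power series at \<open>t\<close>. Only
  the coefficients of \<open>q\<close> below \<open>n\<close> contribute, and reading them backwards
  turns the index \<open>2*n-1 - (a + b)\<close> into the Hankel index
  \<open>i + j + 1\<close>.\<close>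

lemma sum_taylor_square_eq_quadratic_form:
  fixes q :: "real poly" and v :: "nat \<Rightarrow> real" and t :: real
  assumes q: "degree q \<le> n - 1" and n: "1 \<le> n"
  defines "c \<equiv> coeff (pcompose q [:t, 1:])"
  shows "(\<Sum>j\<le>2*n-1. v j * poly_taylor (q\<^sup>2) (2*n-1 - j) t)
    = (\<Sum>i<n. \<Sum>j<n. v (i + j + 1) * (c (n - 1 - i) * c (n - 1 - j)))"
proof -
  define M where "M = 2 * n - 1"
  have c0: "c i = 0" if "n \<le> i" for i
    using that q n unfolding c_def by (intro coeff_eq_0) (simp add: degree_pcompose)
  have "poly_taylor (q\<^sup>2) i t = (\<Sum>a\<le>i. c a * c (i - a))" for i
    by (simp add: poly_taylor_eq_coeff c_def power2_eq_square pcompose_mult coeff_mult)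
  then have "(\<Sum>j\<le>M. v j * poly_taylor (q\<^sup>2) (M - j) t) = (\<Sum>j\<le>M. v j * (\<Sum>a\<le>M - j. c a * c (M - j - a)))"
    by simp
  also have "\<dots> = (\<Sum>i\<le>M. v (M - i) * (\<Sum>a\<le>i. c a * c (i - a)))"
    by (rule sum.reindex_bij_witness[of _ "\<lambda>i. M - i" "\<lambda>i. M - i"]) auto
  also have "\<dots> = (\<Sum>i\<le>M. \<Sum>a\<le>i. v (M - (a + (i - a))) * (c a * c (i - a)))"
    unfolding sum_distrib_left by (intro sum.cong refl) auto
  also have "\<dots> = (\<Sum>(a, b)\<in>{(a, b). a + b \<le> M}. v (M - (a + b)) * (c a * c b))"
    by (rule sum.triangle_reindex_eq[symmetric])
  also have "\<dots> = (\<Sum>(a, b)\<in>{..<n} \<times> {..<n}. v (M - (a + b)) * (c a * c b))"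
  proof (rule sum.mono_neutral_cong_right)
    show "finite {(a, b). a + b \<le> M}" by (rule finite_subset[of _ "{..M} \<times> {..M}"]) auto
    show "{..<n} \<times> {..<n} \<subseteq> {(a, b). a + b \<le> M}" unfolding M_def by auto
    show "\<forall>i\<in>{(a, b). a + b \<le> M} - {..<n} \<times> {..<n}. (case i of (a, b) \<Rightarrow> v (M - (a + b)) * (c a * c b)) = 0"
    proof -
      have "a < n" if "c a \<noteq> 0" for a using c0[of a] that by (meson not_less)
      then show ?thesis by auto
    qed
  qed auto
  also have "\<dots> = (\<Sum>a<n. \<Sum>b<n. v (M - (a + b)) * (c a * c b))"
    by (rule sum.cartesian_product[symmetric])
  also have "\<dots> = (\<Sum>i<n. \<Sum>b<n. v (M - (n - 1 - i + b)) * (c (n - 1 - i) * c b))"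
    by (rule sum.reindex_bij_witness[of _ "\<lambda>i. n - 1 - i" "\<lambda>i. n - 1 - i"]) auto
  also have "\<dots> = (\<Sum>i<n. \<Sum>j<n. v (M - (n - 1 - i + (n - 1 - j))) * (c (n - 1 - i) * c (n - 1 - j)))"
    by (intro sum.cong refl sum.reindex_bij_witness[of _ "\<lambda>i. n - 1 - i" "\<lambda>i. n - 1 - i"]) auto
  also have "\<dots> = (\<Sum>i<n. \<Sum>j<n. v (i + j + 1) * (c (n - 1 - i) * c (n - 1 - j)))"
  proof (intro sum.cong refl)
    fix i j assume "i \<in> {..<n}" "j \<in> {..<n}"
    then have "M - (n - 1 - i + (n - 1 - j)) = i + j + 1" unfolding M_def by auto
    then show "v (M - (n - 1 - i + (n - 1 - j))) * (c (n - 1 - i) * c (n - 1 - j)) = v (i + j + 1) * (c (n - 1 - i) * c (n - 1 - j))"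
      by simp
  qed
  finally show ?thesis unfolding M_def .
qed

section \<open>Lower Lipschitz bounds\<close>

definition lipschitz_Icc :: "real \<Rightarrow> real \<Rightarrow> (real \<Rightarrow> real) \<Rightarrow> bool" where
  "lipschitz_Icc s t g \<longleftrightarrow> (\<exists>L\<ge>0. \<forall>x y. s \<le> x \<and> x \<le> y \<and> y \<le> t \<longrightarrow> \<bar>g y - g x\<bar> \<le> L * (y - x))"

text \<open>One-sided, since the right derivative of a convex function may jump upwards.\<close>

definition lower_lipschitz_Icc :: "real \<Rightarrow> real \<Rightarrow> (real \<Rightarrow> real) \<Rightarrow> bool" where
  "lower_lipschitz_Icc s t g \<longleftrightarrow> (\<exists>L\<ge>0. \<forall>x y. s \<le> x \<and> x \<le> y \<and> y \<le> t \<longrightarrow> - L * (y - x) \<le> g y - g x)"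

lemma lipschitz_imp_lower: "lipschitz_Icc s t g \<Longrightarrow> lower_lipschitz_Icc s t g"
  unfolding lipschitz_Icc_def lower_lipschitz_Icc_def
proof (elim exE conjE)
  fix L assume L: "0 \<le> L" "\<forall>x y. s \<le> x \<and> x \<le> y \<and> y \<le> t \<longrightarrow> \<bar>g y - g x\<bar> \<le> L * (y - x)"
  have "- L * (y - x) \<le> g y - g x" if "s \<le> x \<and> x \<le> y \<and> y \<le> t" for x y
    using L(2)[rule_format, OF that] by (simp add: abs_le_iff)
  then show "\<exists>L\<ge>0. \<forall>x y. s \<le> x \<and> x \<le> y \<and> y \<le> t \<longrightarrow> - L * (y - x) \<le> g y - g x"
    using L(1) by blast
qed

lemma lower_lipschitz_add:
  assumes "lower_lipschitz_Icc s t g" "lower_lipschitz_Icc s t h"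
  shows "lower_lipschitz_Icc s t (\<lambda>x. g x + h x)"
proof -
  obtain L M where L: "0 \<le> L" "\<And>x y. s \<le> x \<Longrightarrow> x \<le> y \<Longrightarrow> y \<le> t \<Longrightarrow> - L * (y - x) \<le> g y - g x"
    and M: "0 \<le> M" "\<And>x y. s \<le> x \<Longrightarrow> x \<le> y \<Longrightarrow> y \<le> t \<Longrightarrow> - M * (y - x) \<le> h y - h x"
    using assms unfolding lower_lipschitz_Icc_def by blast
  have "- (L + M) * (y - x) \<le> (g y + h y) - (g x + h x)" if "s \<le> x" "x \<le> y" "y \<le> t" for x y
    using L(2)[OF that] M(2)[OF that] by (simp add: algebra_simps)
  then show ?thesis unfolding lower_lipschitz_Icc_def using L(1) M(1) by (intro exI[of _ "L + M"]) auto
qed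

lemma lower_lipschitz_sum:
  assumes "\<And>i. i \<in> A \<Longrightarrow> lower_lipschitz_Icc s t (g i)"
  shows "lower_lipschitz_Icc s t (\<lambda>x. \<Sum>i\<in>A. g i x)"
  using assms
proof (induction A rule: infinite_finite_induct)
  case (insert i A)
  then show ?case using lower_lipschitz_add[of s t "g i" "\<lambda>x. \<Sum>i\<in>A. g i x"] by simp
qed (auto simp: lower_lipschitz_Icc_def)

lemma lower_lipschitz_cmult:
  assumes "lower_lipschitz_Icc s t g" "0 \<le> c"
  shows "lower_lipschitz_Icc s t (\<lambda>x. c * g x)"
proof -
  obtain L where L: "0 \<le> L" "\<And>x y. s \<le> x \<Longrightarrow> x \<le> y \<Longrightarrow> y \<le> t \<Longrightarrow> - L * (y - x) \<le> g y - g x"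
    using assms unfolding lower_lipschitz_Icc_def by blast
  have "- (c * L) * (y - x) \<le> c * g y - c * g x" if "s \<le> x" "x \<le> y" "y \<le> t" for x y
    using mult_left_mono[OF L(2)[OF that] assms(2)] by (simp add: algebra_simps)
  then show ?thesis unfolding lower_lipschitz_Icc_def using L(1) assms(2) by (intro exI[of _ "c * L"]) auto
qed

lemma lipschitz_bounded:
  assumes "lipschitz_Icc s t g"
  obtains B where "0 \<le> B" "\<And>x. s \<le> x \<Longrightarrow> x \<le> t \<Longrightarrow> \<bar>g x\<bar> \<le> B"
proof -
  obtain L where L: "0 \<le> L" "\<And>x y. s \<le> x \<Longrightarrow> x \<le> y \<Longrightarrow> y \<le> t \<Longrightarrow> \<bar>g y - g x\<bar> \<le> L * (y - x)"
    using assms unfolding lipschitz_Icc_def by blast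
  have "\<bar>g x\<bar> \<le> \<bar>g s\<bar> + L * \<bar>t - s\<bar>" if "s \<le> x" "x \<le> t" for x
  proof -
    have "\<bar>g x - g s\<bar> \<le> L * (x - s)" using L(2)[of s x] that by simp
    also have "\<dots> \<le> L * \<bar>t - s\<bar>" using that L(1) by (intro mult_left_mono) auto
    finally show ?thesis by linarith
  qed
  moreover have "0 \<le> \<bar>g s\<bar> + L * \<bar>t - s\<bar>" using L(1) by simp
  ultimately show thesis using that by blast
qed

lemma lipschitz_mult:
  assumes "lipschitz_Icc s t g" "lipschitz_Icc s t h"
  shows "lipschitz_Icc s t (\<lambda>x. g x * h x)"
proof -
  obtain L M where L: "0 \<le> L" "\<And>x y. s \<le> x \<Longrightarrow> x \<le> y \<Longrightarrow> y \<le> t \<Longrightarrow> \<bar>g y - g x\<bar> \<le> L * (y - x)"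
    and M: "0 \<le> M" "\<And>x y. s \<le> x \<Longrightarrow> x \<le> y \<Longrightarrow> y \<le> t \<Longrightarrow> \<bar>h y - h x\<bar> \<le> M * (y - x)"
    using assms unfolding lipschitz_Icc_def by blast
  obtain A where A: "0 \<le> A" "\<And>x. s \<le> x \<Longrightarrow> x \<le> t \<Longrightarrow> \<bar>g x\<bar> \<le> A" using lipschitz_bounded[OF assms(1)] by metis
  obtain B where B: "0 \<le> B" "\<And>x. s \<le> x \<Longrightarrow> x \<le> t \<Longrightarrow> \<bar>h x\<bar> \<le> B" using lipschitz_bounded[OF assms(2)] by metis
  have "\<bar>g y * h y - g x * h x\<bar> \<le> (L * B + A * M) * (y - x)" if xy: "s \<le> x" "x \<le> y" "y \<le> t" for x y
  proof -
    have "g y * h y - g x * h x = (g y - g x) * h y + g x * (h y - h x)" by (simp add: algebra_simps)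
    also have "\<bar>\<dots>\<bar> \<le> \<bar>g y - g x\<bar> * \<bar>h y\<bar> + \<bar>g x\<bar> * \<bar>h y - h x\<bar>"
      by (metis abs_mult abs_triangle_ineq)
    also have "\<dots> \<le> (L * (y - x)) * B + A * (M * (y - x))"
      using xy L A M B by (intro add_mono mult_mono) auto
    finally show ?thesis by (simp add: algebra_simps)
  qed
  then show ?thesis unfolding lipschitz_Icc_def using L(1) A(1) M(1) B(1)
    by (intro exI[of _ "L * B + A * M"]) auto
qed

lemma lipschitz_C1:
  assumes "\<And>x. s \<le> x \<Longrightarrow> x \<le> t \<Longrightarrow> (g has_real_derivative g' x) (at x)" and "continuous_on {s..t} g'"
  shows "lipschitz_Icc s t g"
proof -
  have "bounded (g' ` {s..t})" using assms(2) by (intro compact_imp_bounded compact_continuous_image) auto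
  then obtain B where B: "0 < B" "\<And>x. x \<in> {s..t} \<Longrightarrow> \<bar>g' x\<bar> \<le> B"
    unfolding bounded_pos by auto
  have "\<bar>g y - g x\<bar> \<le> B * (y - x)" if xy: "s \<le> x" "x \<le> y" "y \<le> t" for x y
  proof (cases "x = y")
    case False
    then obtain z where z: "x < z" "z < y" "g y - g x = (y - x) * g' z"
      using MVT2[of x y g g'] assms(1) xy by auto
    have "\<bar>g y - g x\<bar> = (y - x) * \<bar>g' z\<bar>" unfolding z(3) abs_mult using xy by simp
    also have "\<dots> \<le> (y - x) * B" using B(2)[of z] z xy by (intro mult_left_mono) auto
    finally show ?thesis by (simp add: mult.commute)
  qed simp
  then show ?thesis unfolding lipschitz_Icc_def using B(1) by (intro exI[of _ B]) auto
qed

text \<open>In \<open>(r y - r x) * N y + r x * (N y - N x)\<close> the first term is non-negative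
  and the second is bounded by a multiple of \<open>y - x\<close>.\<close>

lemma lower_lipschitz_mono_mult:
  assumes r: "\<And>x y. s \<le> x \<Longrightarrow> x \<le> y \<Longrightarrow> y \<le> t \<Longrightarrow> r x \<le> r y"
    and N: "lipschitz_Icc s t N" "\<And>x. 0 \<le> N x"
  shows "lower_lipschitz_Icc s t (\<lambda>x. r x * N x)"
proof -
  obtain L where L: "0 \<le> L" "\<And>x y. s \<le> x \<Longrightarrow> x \<le> y \<Longrightarrow> y \<le> t \<Longrightarrow> \<bar>N y - N x\<bar> \<le> L * (y - x)"
    using N(1) unfolding lipschitz_Icc_def by blast
  define B where "B = \<bar>r s\<bar> + \<bar>r t\<bar>"
  have B: "\<bar>r x\<bar> \<le> B" if "s \<le> x" "x \<le> t" for x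
    using r[of s x] r[of x t] that unfolding B_def by (auto simp: abs_if)
  have "- (B * L) * (y - x) \<le> r y * N y - r x * N x" if xy: "s \<le> x" "x \<le> y" "y \<le> t" for x y
  proof -
    have "r y * N y - r x * N x = (r y - r x) * N y + r x * (N y - N x)" by (simp add: algebra_simps)
    moreover have "0 \<le> (r y - r x) * N y" using r[OF xy] N(2) by simp
    moreover have "\<bar>r x * (N y - N x)\<bar> \<le> B * (L * (y - x))"
      unfolding abs_mult using L B[of x] xy by (intro mult_mono) (auto simp: B_def)
    ultimately show ?thesis by (simp add: algebra_simps abs_le_iff)
  qed
  then show ?thesis unfolding lower_lipschitz_Icc_def using L(1) by (intro exI[of _ "B * L"]) (auto simp: B_def)
qed

text \<open>Supplies the lower bound required by \<open>nondecreasing_by_ae_deriv\<close>. All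
  summands are Lipschitz except possibly the one with \<open>r\<close>, where \<open>r\<close> is
  non-decreasing and its factor \<open>poly p\<close> is non-negative.\<close>

lemma lower_lipschitz_mult_right_deriv:
  assumes I: "open I" "is_interval I" and Ck: "C_k_on k I f"
    and lower: "\<And>s t. s \<in> I \<Longrightarrow> t \<in> I \<Longrightarrow> s < t \<Longrightarrow> r s \<le> ((deriv ^^ k) f t - (deriv ^^ k) f s) / (t - s)"
    and upper: "\<And>s t. s \<in> I \<Longrightarrow> t \<in> I \<Longrightarrow> s < t \<Longrightarrow> ((deriv ^^ k) f t - (deriv ^^ k) f s) / (t - s) \<le> r t"
    and p: "\<And>x. 0 \<le> poly p x" and st: "s \<in> I" "t \<in> I"
  shows "lower_lipschitz_Icc s t (mult_right_deriv f k r p)"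
proof -
  have sub: "x \<in> I" if "s \<le> x" "x \<le> t" for x using Icc_subset[OF I(2) st] that by auto
  have mono: "r x \<le> r y" if "s \<le> x" "x \<le> y" "y \<le> t" for x y
    using lower[of x y] upper[of x y] sub that by (cases "x = y") auto
  have lip_p: "lipschitz_Icc s t (poly_taylor p j)" for j
    by (rule lipschitz_C1[OF has_real_derivative_poly_taylor])
      (auto simp: poly_taylor_def[abs_def] intro!: continuous_intros)
  have lip_f: "lipschitz_Icc s t (fun_taylor f j)" if j: "j \<le> k" for j
  proof (cases "j = k")
    case False
    have D: "((deriv ^^ i) f has_real_derivative (deriv ^^ Suc i) f x) (at x)" if "i < k" "x \<in> I" for i x
      using Ck that by (auto simp: C_k_on_def DERIV_deriv_iff_real_differentiable)
    have "continuous_on I ((deriv ^^ Suc j) f)"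
    proof (cases "Suc j = k")
      case True
      then show ?thesis using Ck by (simp add: C_k_on_def)
    next
      case False
      then have "Suc j < k" using j \<open>j \<noteq> k\<close> by simp
      then show ?thesis using D[of "Suc j"] by (intro continuous_at_imp_continuous_on) (auto intro: DERIV_isCont)
    qed
    then have "continuous_on {s..t} ((deriv ^^ Suc j) f)"
      using Icc_subset[OF I(2) st] by (rule continuous_on_subset)
    then have "continuous_on {s..t} (\<lambda>x. real (Suc j) * ((deriv ^^ Suc j) f x / fact (Suc j)))"
      by (intro continuous_intros) auto
    then show ?thesis
    proof (rule lipschitz_C1[rotated])
      fix x assume "s \<le> x" "x \<le> t"
      then show "(fun_taylor f j has_real_derivative real (Suc j) * ((deriv ^^ Suc j) f x / fact (Suc j))) (at x)"
        using j False sub by (intro has_real_derivative_fun_taylor D) auto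
    qed
  next
    case True
    \<comment> \<open>The slopes of the \<open>k\<close>-th derivative on \<open>{s..t}\<close> lie
      between \<open>r s\<close> and \<open>r t\<close>.\<close>
    have "\<bar>fun_taylor f k y - fun_taylor f k x\<bar> \<le> (\<bar>r s\<bar> + \<bar>r t\<bar>) / fact k * (y - x)"
      if xy: "s \<le> x" "x \<le> y" "y \<le> t" for x y
    proof (cases "x = y")
      case False
      then have less: "x < y" using xy by simp
      define m where "m = ((deriv ^^ k) f y - (deriv ^^ k) f x) / (y - x)"
      have "r s \<le> m" "m \<le> r t"
        using lower[of x y] upper[of x y] mono[of s x] mono[of y t] sub xy less by (auto simp: m_def intro: order_trans)
      then have "\<bar>m\<bar> \<le> \<bar>r s\<bar> + \<bar>r t\<bar>" by linarith
      then have "\<bar>m\<bar> * (y - x) \<le> (\<bar>r s\<bar> + \<bar>r t\<bar>) * (y - x)" using less by (intro mult_right_mono) auto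
      moreover have "\<bar>m\<bar> * (y - x) = \<bar>(deriv ^^ k) f y - (deriv ^^ k) f x\<bar>"
        using less by (simp add: m_def abs_divide)
      moreover have "fun_taylor f k y - fun_taylor f k x = ((deriv ^^ k) f y - (deriv ^^ k) f x) / fact k"
        by (simp add: fun_taylor_def diff_divide_distrib)
      ultimately show ?thesis by (simp add: abs_divide divide_right_mono)
    qed simp
    then show ?thesis unfolding True lipschitz_Icc_def
      by (intro exI[of _ "(\<bar>r s\<bar> + \<bar>r t\<bar>) / fact k"]) auto
  qed
  have "lower_lipschitz_Icc s t (\<lambda>x. ext_taylor f k r j x * poly_taylor p (Suc k - j) x)" if "j \<le> Suc k" for j
  proof (cases "j = Suc k")
    case True
    have "lower_lipschitz_Icc s t (\<lambda>x. (r x / fact (Suc k)) * poly_taylor p 0 x)"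
      by (rule lower_lipschitz_mono_mult[OF _ lip_p])
        (auto intro!: divide_right_mono mono simp: poly_taylor_def p)
    then show ?thesis using True by (simp add: ext_taylor_def)
  next
    case False
    then have "ext_taylor f k r j = fun_taylor f j" using that by (auto simp: ext_taylor_def)
    then show ?thesis using False that by (auto intro!: lipschitz_imp_lower lipschitz_mult lip_f lip_p)
  qed
  then show ?thesis unfolding mult_right_deriv_def[abs_def]
    by (intro lower_lipschitz_cmult lower_lipschitz_sum) auto
qed

section \<open>Almost everywhere conditions\<close>

lemma AE_lborel_iff_negligible:
  fixes P :: "real \<Rightarrow> bool"
  shows "(AE t in lborel. P t) \<longleftrightarrow> negligible {t. \<not> P t}"
proof -
  have "(AE t in lborel. P t) \<longleftrightarrow> (AE t in lebesgue. P t)" by (rule AE_completion_iff[symmetric])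
  also have "\<dots> \<longleftrightarrow> (\<exists>N\<in>null_sets lebesgue. {t. \<not> P t} \<subseteq> N)"
    by (simp add: eventually_ae_filter)
  also have "\<dots> \<longleftrightarrow> negligible {t. \<not> P t}"
    unfolding negligible_iff_null_sets
  proof
    assume "\<exists>N\<in>null_sets lebesgue. {t. \<not> P t} \<subseteq> N"
    then obtain N where "negligible N" "{t. \<not> P t} \<subseteq> N" unfolding negligible_iff_null_sets by blast
    then show "{t. \<not> P t} \<in> null_sets lebesgue"
      unfolding negligible_iff_null_sets[symmetric] by (rule negligible_subset)
  next
    assume "{t. \<not> P t} \<in> null_sets lebesgue"
    then show "\<exists>N\<in>null_sets lebesgue. {t. \<not> P t} \<subseteq> N" by (intro bexI[of _ "{t. \<not> P t}"]) auto
  qed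
  finally show ?thesis .
qed

text \<open>\<open>mono_differentiable_ae\<close> is about functions on the whole line. Clamping the
  argument to \<open>{c..d}\<close> extends \<open>r\<close> monotonically, and countably many
  rational intervals exhaust \<open>I\<close>.\<close>

lemma mono_on_differentiable_ae:
  fixes r :: "real \<Rightarrow> real"
  assumes I: "open I" and mono: "mono_on I r"
  shows "negligible {t \<in> I. \<not> r differentiable (at t)}"
proof -
  define S where "S = {(c, d). c \<in> \<rat> \<and> d \<in> \<rat> \<and> c < d \<and> {c..d} \<subseteq> I}"
  define ext where "ext c d x = r (max c (min x d))" for c d x
  have "countable S"
    by (rule countable_subset[of _ "\<rat> \<times> \<rat>"]) (auto simp: S_def intro!: countable_SIGMA countable_rat)
  moreover have "negligible {x. \<not> ext c d differentiable (at x)}" if "(c, d) \<in> S" for c d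
  proof (rule mono_differentiable_ae, rule monoI)
    fix x y :: real assume "x \<le> y"
    moreover have "max c (min z d) \<in> I" for z
    proof -
      have "max c (min z d) \<in> {c..d}" using that by (auto simp: S_def)
      then show ?thesis using that by (auto simp: S_def)
    qed
    ultimately show "ext c d x \<le> ext c d y" unfolding ext_def by (intro mono_onD[OF mono]) auto
  qed
  ultimately have neg: "negligible (\<Union>(c, d)\<in>S. {x. \<not> ext c d differentiable (at x)})"
    by (intro negligible_countable_Union countable_image) auto
  show ?thesis
  proof (rule negligible_subset[OF neg], rule subsetI)
    fix t assume t: "t \<in> {t \<in> I. \<not> r differentiable (at t)}"
    then have tI: "t \<in> I" by simp
    obtain e where e: "0 < e" "{t - e..t + e} \<subseteq> I" by (rule open_real_bounds[OF I tI])
    obtain c where c: "c \<in> \<rat>" "t - e < c" "c < t" using Rats_dense_in_real[of "t - e" t] e by auto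
    obtain d where d: "d \<in> \<rat>" "t < d" "d < t + e" using Rats_dense_in_real[of t "t + e"] e by auto
    have "{c..d} \<subseteq> {t - e..t + e}" using c d by auto
    then have S: "(c, d) \<in> S" using c d e by (auto simp: S_def)
    have "\<not> ext c d differentiable (at t)"
    proof
      assume "ext c d differentiable (at t)"
      then obtain D where "(ext c d has_real_derivative D) (at t)" by (auto simp: real_differentiable_def)
      then have "(r has_real_derivative D) (at t)"
        by (rule has_field_derivative_transform_within_open[where S = "{c<..<d}"])
          (use c d in \<open>auto simp: ext_def max_def min_def\<close>)
      then show False using t by (auto simp: real_differentiable_def)
    qed
    then show "t \<in> (\<Union>(c, d)\<in>S. {x. \<not> ext c d differentiable (at x)})" using S by auto
  qed
qed

lemma islimpt_cocountable:
  fixes t :: real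
  assumes I: "open I" "t \<in> I" and D: "countable (I - D)"
  shows "t islimpt D"
proof (rule islimptI, rule ccontr)
  fix T assume T: "t \<in> T" "open T" and none: "\<not> (\<exists>y\<in>D. y \<in> T \<and> y \<noteq> t)"
  obtain e where e: "0 < e" "{t - e..t + e} \<subseteq> I \<inter> T"
    by (rule open_real_bounds[of "I \<inter> T" t]) (use I T in auto)
  have "{t<..<t + e} \<subseteq> I - D"
  proof
    fix y assume y: "y \<in> {t<..<t + e}"
    then have "y \<in> {t - e..t + e}" by auto
    then have "y \<in> I \<inter> T" by (rule subsetD[OF e(2)])
    then show "y \<in> I - D" using none y by auto
  qed
  then have "countable {t<..<t + e}" using D by (rule countable_subset)
  then show False using uncountable_open_interval[of t "t + e"] e(1) by simp
qed

lemma convex_right_deriv_mono: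
  fixes G :: "real \<Rightarrow> real"
  assumes I: "open I" "is_interval I" and conv: "convex_on I G"
    and r: "\<And>t. t \<in> I \<Longrightarrow> (G has_real_derivative r t) (at_right t)"
  shows "mono_on I r" "countable (I - {t \<in> I. G differentiable (at t)})"
proof -
  obtain \<rho> where \<rho>: "\<And>t. t \<in> I \<Longrightarrow> (G has_real_derivative \<rho> t) (at_right t)"
    "\<And>s t. s \<in> I \<Longrightarrow> t \<in> I \<Longrightarrow> s < t \<Longrightarrow> \<rho> s \<le> (G t - G s) / (t - s)"
    "\<And>s t. s \<in> I \<Longrightarrow> t \<in> I \<Longrightarrow> s < t \<Longrightarrow> (G t - G s) / (t - s) \<le> \<rho> t"
    by (rule convex_right_deriv[OF I conv]) (rule that)
  have eq: "r t = \<rho> t" if "t \<in> I" for t using right_deriv_unique[OF r \<rho>(1)] that by blast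
  have "mono_on I \<rho>" and c: "countable {t \<in> I. \<not> G differentiable (at t)}"
    by (rule convex_countable_nondifferentiable[OF I(1) \<rho>(2,3)]; assumption)+
  then show "mono_on I r" unfolding mono_on_def using eq by metis
  have "I - {t \<in> I. G differentiable (at t)} = {t \<in> I. \<not> G differentiable (at t)}" by auto
  then show "countable (I - {t \<in> I. G differentiable (at t)})" using c by simp
qed

text \<open>The \<open>k\<close>-th derivative is convex, so its right derivative is non-decreasing
  and, almost everywhere, differentiable with a non-negative derivative.\<close>

lemma tone_imp_nth_deriv_nonneg_ae:
  assumes I: "open I" "is_interval I" and tone: "tone (k + 2) I F"
  shows "negligible {t \<in> I. \<not> (\<exists>D. nth_deriv (Suc (Suc k)) I F t = Some D \<and> 0 \<le> D)}"
proof -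
  let ?G = "(deriv ^^ k) F"
  have Ck: "C_k_on k I F" and conv: "convex_on I ?G" using tone_imp_C_k_convex[OF I tone] by auto
  obtain r where r: "\<And>t. t \<in> I \<Longrightarrow> (?G has_real_derivative r t) (at_right t)"
    by (rule convex_right_deriv[OF I conv]) (rule that)
  note mono = convex_right_deriv_mono[OF I conv r]
  let ?D = "{t \<in> I. ?G differentiable (at t)}"
  have neg: "negligible ((I - ?D) \<union> {t \<in> I. \<not> r differentiable (at t)})"
    by (intro negligible_Un mono_on_differentiable_ae I mono countable_imp_null_set_lborel[THEN null_sets_completionI, folded negligible_iff_null_sets])
  show ?thesis
  proof (rule negligible_subset[OF neg], rule subsetI, rule ccontr)
    fix t assume t: "t \<in> {t \<in> I. \<not> (\<exists>D. nth_deriv (Suc (Suc k)) I F t = Some D \<and> 0 \<le> D)}"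
      and nt: "t \<notin> (I - ?D) \<union> {t \<in> I. \<not> r differentiable (at t)}"
    then have tI: "t \<in> I" and tD: "t \<in> ?D" and rd: "r differentiable (at t)" by auto
    from rd obtain d where d: "(r has_real_derivative d) (at t)" by (auto simp: real_differentiable_def)
    have "0 \<le> d" using mono_on_imp_deriv_nonneg[OF mono(1) d] tI I(1) by (simp add: interior_open)
    moreover have "nth_deriv (Suc (Suc k)) I F t = Some d"
      using nth_deriv_Suc_Suc_eq_Some_iff[OF I(1) Ck r, of t d] tD islimpt_cocountable[OF I(1) tI mono(2)]
        has_field_derivative_at_within[OF d] by blast
    ultimately show False using t by auto
  qed
qed

lemma differentiable_deriv_mult_poly:
  assumes I: "open I" and Ck: "C_k_on k I f" and t: "t \<in> I" and fk: "(deriv ^^ k) f differentiable (at t)"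
  shows "(deriv ^^ k) (\<lambda>s. f s * poly p s) differentiable (at t)"
proof -
  have diff: "\<And>j t. j < k \<Longrightarrow> t \<in> I \<Longrightarrow> (deriv ^^ j) f differentiable (at t)"
    using Ck by (auto simp: C_k_on_def)
  have "\<exists>d. (fun_taylor f j has_real_derivative d) (at t)" if "j \<le> k" for j
  proof -
    have "(deriv ^^ j) f differentiable (at t)" using diff[of j t] fk t that by (cases "j = k") auto
    then obtain d where "((deriv ^^ j) f has_real_derivative d) (at t)" by (auto simp: real_differentiable_def)
    then show ?thesis using has_real_derivative_fun_taylor by blast
  qed
  then obtain d where d: "\<And>j. j \<le> k \<Longrightarrow> (fun_taylor f j has_real_derivative d j) (at t)" by metis
  have "((\<lambda>x. fact k * (\<Sum>j\<le>k. fun_taylor f j x * poly_taylor p (k - j) x)) has_real_derivative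
     fact k * (\<Sum>j\<le>k. d j * poly_taylor p (k - j) t + (real (Suc (k - j)) * poly_taylor p (Suc (k - j)) t) * fun_taylor f j t)) (at t)"
    by (intro DERIV_cmult DERIV_sum DERIV_mult d has_real_derivative_poly_taylor) auto
  then have "((deriv ^^ k) (\<lambda>s. f s * poly p s) has_real_derivative
     fact k * (\<Sum>j\<le>k. d j * poly_taylor p (k - j) t + (real (Suc (k - j)) * poly_taylor p (Suc (k - j)) t) * fun_taylor f j t)) (at t)"
  proof (rule has_field_derivative_transform_within_open[OF _ I t])
    fix x assume "x \<in> I"
    from fun_taylor_mult_poly(1)[OF I diff order_refl this, where p = p]
    show "fact k * (\<Sum>j\<le>k. fun_taylor f j x * poly_taylor p (k - j) x) = (deriv ^^ k) (\<lambda>s. f s * poly p s) x"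
      unfolding fun_taylor_def[of "\<lambda>s. f s * poly p s"] by (simp add: field_simps)
  qed
  then show ?thesis by (auto simp: real_differentiable_def)
qed

text \<open>The common end of both conditions on almost everywhere derivatives: the right derivative
  of the \<open>k\<close>-th derivative of \<open>f * poly p\<close> is shown to be non-decreasing.
  Its derivative is assumed only along a set \<open>D\<close> with countable complement, as
  derivatives of partial functions provide it.\<close>

lemma tone_mult_poly_if_ae_deriv_nonneg:
  assumes I: "open I" "is_interval I" and Ck: "C_k_on k I f"
    and r: "\<And>t. t \<in> I \<Longrightarrow> ((deriv ^^ k) f has_real_derivative r t) (at_right t)"
    and lower: "\<And>s t. s \<in> I \<Longrightarrow> t \<in> I \<Longrightarrow> s < t \<Longrightarrow> r s \<le> ((deriv ^^ k) f t - (deriv ^^ k) f s) / (t - s)"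
    and upper: "\<And>s t. s \<in> I \<Longrightarrow> t \<in> I \<Longrightarrow> s < t \<Longrightarrow> ((deriv ^^ k) f t - (deriv ^^ k) f s) / (t - s) \<le> r t"
    and p: "\<And>x. 0 \<le> poly p x" and D: "countable (I - D)"
    and neg: "negligible E"
    and deriv: "\<And>t. t \<in> I \<Longrightarrow> t \<notin> E \<Longrightarrow> \<exists>d\<ge>0. (mult_right_deriv f k r p has_real_derivative d) (at t within D)"
  shows "tone (k + 2) I (\<lambda>t. f t * poly p t)"
proof -
  let ?R = "mult_right_deriv f k r p" and ?F = "\<lambda>t. f t * poly p t"
  have mono: "?R s \<le> ?R t" if st: "s \<in> I" "t \<in> I" "s \<le> t" for s t
  proof -
    obtain e1 where e1: "0 < e1" "{s - e1..s + e1} \<subseteq> I" by (rule open_real_bounds[OF I(1) st(1)])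
    obtain e2 where e2: "0 < e2" "{t - e2..t + e2} \<subseteq> I" by (rule open_real_bounds[OF I(1) st(2)])
    \<comment> \<open>The interval is enlarged so that \<open>s\<close> and \<open>t\<close> become
      interior points, where a two-sided derivative makes sense.\<close>
    define s' where "s' = s - e1"
    define t' where "t' = t + e2"
    have s't': "s' \<in> I" "t' \<in> I" "s' < s" "t < t'" using e1 e2 by (auto simp: s'_def t'_def)
    have sub: "{s'<..<t'} \<subseteq> I" using Icc_subset[OF I(2) s't'(1,2)] by (auto simp: subset_iff)
    obtain L where L: "0 \<le> L" "\<And>x y. s' \<le> x \<Longrightarrow> x \<le> y \<Longrightarrow> y \<le> t' \<Longrightarrow> - L * (y - x) \<le> ?R y - ?R x"
      using lower_lipschitz_mult_right_deriv[OF I Ck lower upper p s't'(1,2)]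
      unfolding lower_lipschitz_Icc_def by blast
    let ?J = "{s'<..<t'}"
    \<comment> \<open>Adding \<open>L * x\<close> makes the function non-decreasing, so that its
      derivative along \<open>D\<close> is a full derivative by
      \<open>mono_on_deriv_within_cocountable\<close>.\<close>
    have monoJ: "mono_on ?J (\<lambda>x. ?R x + L * x)"
    proof (rule mono_onI)
      fix x y assume "x \<in> ?J" "y \<in> ?J" "x \<le> y"
      then show "?R x + L * x \<le> ?R y + L * y" using L(2)[of x y] by (simp add: algebra_simps)
    qed
    have cD: "countable (?J - D)" by (rule countable_subset[OF _ D]) (use sub in auto)
    show ?thesis
    proof (rule nondecreasing_by_ae_deriv[OF st(3) L(1) _ neg])
      show "- L * (y - x) \<le> ?R y - ?R x" if "s \<le> x" "x \<le> y" "y \<le> t" for x y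
        using that s't' by (intro L(2)) auto
      show "\<exists>d\<ge>0. (?R has_real_derivative d) (at x)" if x: "s \<le> x" "x \<le> t" "x \<notin> E" for x
      proof -
        have xJ: "x \<in> ?J" using x s't' by auto
        then obtain d where d: "0 \<le> d" "(?R has_real_derivative d) (at x within D)"
          using deriv[of x] sub x by blast
        have "((\<lambda>x. ?R x + L * x) has_real_derivative d + L) (at x within D)"
          using d(2) by (auto intro!: derivative_eq_intros)
        from mono_on_deriv_within_cocountable[OF _ monoJ cD xJ this]
        have "((\<lambda>x. ?R x + L * x) has_real_derivative d + L) (at x)" by simp
        from DERIV_diff[OF this DERIV_cmult_Id[of L]]
        have "(?R has_real_derivative d) (at x)" by simp
        then show ?thesis using d(1) by auto
      qed
    qed
  qed
  have CkF: "C_k_on k I ?F" by (rule C_k_on_mult_poly[OF I(1) Ck])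
  have "convex_on I ((deriv ^^ k) ?F)"
  proof (rule convex_by_right_deriv[OF I(2)])
    show "continuous_on I ((deriv ^^ k) ?F)" using CkF by (simp add: C_k_on_def)
    show "((deriv ^^ k) ?F has_real_derivative ?R t) (at_right t)" if "t \<in> I" for t
      by (rule has_right_deriv_mult_poly[where f = f and k = k and r = r, OF I(1) Ck that r[OF that]])
  qed (rule mono)
  then show ?thesis by (rule C_k_convex_imp_tone[OF I(2) CkF])
qed

lemma tone_if_nth_deriv_nonneg_ae:
  assumes I: "open I" "is_interval I" and Ck: "C_k_on k I f" and conv: "convex_on I ((deriv ^^ k) f)"
    and p: "\<And>x. 0 \<le> poly p x"
    and ae: "negligible {t \<in> I. \<not> (\<exists>D. nth_deriv (Suc (Suc k)) I (\<lambda>s. f s * poly p s) t = Some D \<and> 0 \<le> D)}"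
  shows "tone (k + 2) I (\<lambda>t. f t * poly p t)"
proof -
  let ?F = "\<lambda>t. f t * poly p t"
  obtain r where r: "\<And>t. t \<in> I \<Longrightarrow> ((deriv ^^ k) f has_real_derivative r t) (at_right t)"
    "\<And>s t. s \<in> I \<Longrightarrow> t \<in> I \<Longrightarrow> s < t \<Longrightarrow> r s \<le> ((deriv ^^ k) f t - (deriv ^^ k) f s) / (t - s)"
    "\<And>s t. s \<in> I \<Longrightarrow> t \<in> I \<Longrightarrow> s < t \<Longrightarrow> ((deriv ^^ k) f t - (deriv ^^ k) f s) / (t - s) \<le> r t"
    by (rule convex_right_deriv[OF I conv]) (rule that)
  \<comment> \<open>The domain of the derivative of order \<open>k + 1\<close> of the product. It
    may be larger than that of \<open>f\<close>, for instance at zeros of \<open>p\<close>.\<close>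
  define D where "D = {t \<in> I. (deriv ^^ k) ?F differentiable (at t)}"
  have CkF: "C_k_on k I ?F" by (rule C_k_on_mult_poly[OF I(1) Ck])
  have rF: "((deriv ^^ k) ?F has_real_derivative mult_right_deriv f k r p t) (at_right t)" if "t \<in> I" for t
    by (rule has_right_deriv_mult_poly[where f = f and k = k and r = r, OF I(1) Ck that r(1)[OF that]])
  have "I - D \<subseteq> I - {t \<in> I. (deriv ^^ k) f differentiable (at t)}"
    using differentiable_deriv_mult_poly[OF I(1) Ck] by (auto simp: D_def)
  then have cD: "countable (I - D)" using convex_right_deriv_mono(2)[OF I conv r(1)] by (rule countable_subset)
  show ?thesis
  proof (rule tone_mult_poly_if_ae_deriv_nonneg[OF I Ck r p cD ae])
    fix t assume "t \<in> I" "t \<notin> {t \<in> I. \<not> (\<exists>D. nth_deriv (Suc (Suc k)) I ?F t = Some D \<and> 0 \<le> D)}"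
    then obtain d where "nth_deriv (Suc (Suc k)) I ?F t = Some d" "0 \<le> d" by auto
    then show "\<exists>d\<ge>0. (mult_right_deriv f k r p has_real_derivative d) (at t within D)"
      using nth_deriv_Suc_Suc_eq_Some_iff[OF I(1) CkF rF, of t d] by (auto simp: D_def)
  qed
qed

lemma nth_deriv_eq_ext_taylor:
  assumes I: "open I" "is_interval I" and Ck: "C_k_on k I f" and conv: "convex_on I ((deriv ^^ k) f)"
    and r: "\<And>t. t \<in> I \<Longrightarrow> ((deriv ^^ k) f has_real_derivative r t) (at_right t)"
    and t: "t \<in> I" and fk: "(deriv ^^ k) f differentiable (at t)" and d: "(r has_real_derivative d) (at t)"
    and j: "j \<le> Suc (Suc k)"
  shows "nth_deriv j I f t = Some (fact j * (if j \<le> Suc k then ext_taylor f k r j t else d / fact (Suc (Suc k))))"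
proof -
  have "j \<le> k \<or> j = Suc k \<or> j = Suc (Suc k)" using j by auto
  then show ?thesis
  proof (elim disjE)
    assume "j \<le> k"
    then have "nth_deriv j I f = (\<lambda>t. Some ((deriv ^^ j) f t)) |` I"
      using Ck by (intro nth_deriv_smooth I) (auto simp: C_k_on_def)
    then show ?thesis using t \<open>j \<le> k\<close> by (simp add: ext_taylor_def fun_taylor_def)
  next
    assume "j = Suc k"
    then show ?thesis using t fk deriv_eq_right_deriv[OF r[OF t] fk]
      by (simp add: nth_deriv_Suc_C_k[OF I(1) Ck] ext_taylor_def)
  next
    assume j: "j = Suc (Suc k)"
    have "nth_deriv (Suc (Suc k)) I f t = Some d"
      using nth_deriv_Suc_Suc_eq_Some_iff[OF I(1) Ck r, of t d] t fk
        islimpt_cocountable[OF I(1) t convex_right_deriv_mono(2)[OF I conv r]] has_field_derivative_at_within[OF d] by blast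
    then show ?thesis using j by simp
  qed
qed

text \<open>Polynomials with prescribed Taylor coefficients at \<open>t\<close> turn positivity for all \<open>q\<close> into
  positivity of the Hankel form at the point \<open>t\<close>.\<close>

lemma tone_imp_hankel_psd_ae:
  assumes I: "open I" "is_interval I" and n: "2 \<le> n"
    and tone: "\<And>q :: real poly. degree q \<le> n - 1 \<Longrightarrow> tone (2*n-1) I (\<lambda>t. f t * poly (q\<^sup>2) t)"
  shows "negligible {t \<in> I. \<not> ((\<forall>k\<in>{1..2*n-1}. t \<in> dom (nth_deriv k I f)) \<and>
    (\<forall>x. 0 \<le> (\<Sum>i<n. \<Sum>j<n. the (nth_deriv (i + j + 1) I f t) / fact (i + j + 1) * (x i * x j))))}"
proof -
  define k where "k = 2 * n - 3"
  have k: "2 * n - 1 = Suc (Suc k)" "2 * n - 1 = k + 2" using n by (auto simp: k_def)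
  have "tone (k + 2) I (\<lambda>t. f t * poly (1\<^sup>2) t)" unfolding k(2)[symmetric] by (rule tone) simp
  then have "tone (k + 2) I f" by simp
  then have Ck: "C_k_on k I f" and conv: "convex_on I ((deriv ^^ k) f)" using tone_imp_C_k_convex[OF I] by auto
  obtain r where r: "\<And>t. t \<in> I \<Longrightarrow> ((deriv ^^ k) f has_real_derivative r t) (at_right t)"
    by (rule convex_right_deriv[OF I conv]) (rule that)
  note mono = convex_right_deriv_mono[OF I conv r]
  let ?D = "{t \<in> I. (deriv ^^ k) f differentiable (at t)}"
  have neg: "negligible ((I - ?D) \<union> {t \<in> I. \<not> r differentiable (at t)})"
    by (intro negligible_Un mono_on_differentiable_ae I mono countable_imp_null_set_lborel[THEN null_sets_completionI, folded negligible_iff_null_sets])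
  show ?thesis
  proof (rule negligible_subset[OF neg], rule subsetI, rule ccontr)
    fix t assume t: "t \<in> {t \<in> I. \<not> ((\<forall>k\<in>{1..2*n-1}. t \<in> dom (nth_deriv k I f)) \<and>
        (\<forall>x. 0 \<le> (\<Sum>i<n. \<Sum>j<n. the (nth_deriv (i + j + 1) I f t) / fact (i + j + 1) * (x i * x j))))}"
      and nt: "t \<notin> (I - ?D) \<union> {t \<in> I. \<not> r differentiable (at t)}"
    then have tI: "t \<in> I" and fk: "(deriv ^^ k) f differentiable (at t)" and rd: "r differentiable (at t)" by auto
    from rd obtain d where d: "(r has_real_derivative d) (at t)" by (auto simp: real_differentiable_def)
    define v where "v j = (if j \<le> Suc k then ext_taylor f k r j t else d / fact (Suc (Suc k)))" for j
    have nth: "nth_deriv j I f t = Some (fact j * v j)" if "j \<le> 2 * n - 1" for j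
      using nth_deriv_eq_ext_taylor[OF I Ck conv r tI fk d, of j] that unfolding k v_def by blast
    have rt: "r t = deriv ((deriv ^^ k) f) t" using deriv_eq_right_deriv[OF r[OF tI] fk] by simp
    have "0 \<le> (\<Sum>i<n. \<Sum>j<n. the (nth_deriv (i + j + 1) I f t) / fact (i + j + 1) * (x i * x j))" for x
    proof -
      \<comment> \<open>\<open>sum_taylor_square_eq_quadratic_form\<close> reads the Taylor
        coefficients of \<open>q\<close> at \<open>t\<close> backwards, so \<open>Q\<close> carries
        \<open>x\<close> in reverse order and \<open>q\<close> is \<open>Q\<close> recentred at
        \<open>t\<close>.\<close>
      define Q where "Q = (\<Sum>a<n. monom (x (n - 1 - a)) a)"
      have Qc: "coeff Q a = (if a < n then x (n - 1 - a) else 0)" for a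
        by (simp add: Q_def coeff_sum coeff_monom)
      have dQ: "degree Q \<le> n - 1" by (rule degree_le) (auto simp: Qc)
      define q where "q = pcompose Q [:- t, 1:]"
      have dq: "degree q \<le> n - 1" using dQ by (simp add: q_def degree_pcompose)
      have qQ: "pcompose q [:t, 1:] = Q" by (simp add: q_def pcompose_assoc[symmetric] pcompose_pCons)
      let ?F = "\<lambda>t. f t * poly (q\<^sup>2) t" and ?R = "mult_right_deriv f k r (q\<^sup>2)"
      have "tone (k + 2) I ?F" unfolding k(2)[symmetric] by (rule tone[OF dq])
      then have convF: "convex_on I ((deriv ^^ k) ?F)" using tone_imp_C_k_convex[OF I] by auto
      have "((deriv ^^ k) ?F has_real_derivative ?R t) (at_right t)" if "t \<in> I" for t
        by (rule has_right_deriv_mult_poly[where f = f and k = k and r = r, OF I(1) Ck that r[OF that]])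
      then have monoR: "mono_on I ?R" by (rule convex_right_deriv_mono(1)[OF I convF])
      have "(?R has_real_derivative fact (Suc (Suc k)) * (\<Sum>j\<le>Suc (Suc k). v j * poly_taylor (q\<^sup>2) (Suc (Suc k) - j) t)) (at t)"
        unfolding v_def by (rule has_deriv_mult_right_deriv[where f = f and k = k and r = r and t = t and d = d, OF Ck tI fk rt d])
      then have "0 \<le> fact (Suc (Suc k)) * (\<Sum>j\<le>Suc (Suc k). v j * poly_taylor (q\<^sup>2) (Suc (Suc k) - j) t)"
        using mono_on_imp_deriv_nonneg[OF monoR] tI I(1) by (simp add: interior_open)
      then have "0 \<le> (\<Sum>j\<le>2*n-1. v j * poly_taylor (q\<^sup>2) (2*n-1 - j) t)"
        unfolding k(1) using mult_le_cancel_left_pos[OF fact_gt_zero, of "Suc (Suc k)" "0::real"]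
        by (simp only: mult_zero_right)
      also have "\<dots> = (\<Sum>i<n. \<Sum>j<n. v (i + j + 1) * (coeff Q (n - 1 - i) * coeff Q (n - 1 - j)))"
        using sum_taylor_square_eq_quadratic_form[OF dq, of v t] n by (simp add: qQ)
      also have "\<dots> = (\<Sum>i<n. \<Sum>j<n. the (nth_deriv (i + j + 1) I f t) / fact (i + j + 1) * (x i * x j))"
        by (intro sum.cong refl) (auto simp: Qc nth)
      finally show ?thesis .
    qed
    moreover have "t \<in> dom (nth_deriv j I f)" if "j \<in> {1..2*n-1}" for j using nth[of j] that by auto
    ultimately show False using t by auto
  qed
qed

lemma tone_if_hankel_psd_ae:
  assumes I: "open I" "is_interval I" and n: "2 \<le> n"
    and Ck: "C_k_on (2*n-3) I f" and conv: "convex_on I ((deriv ^^ (2*n-3)) f)"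
    and ae: "negligible {t \<in> I. \<not> ((\<forall>k\<in>{1..2*n-1}. t \<in> dom (nth_deriv k I f)) \<and>
    (\<forall>x. 0 \<le> (\<Sum>i<n. \<Sum>j<n. the (nth_deriv (i + j + 1) I f t) / fact (i + j + 1) * (x i * x j))))}"
    and q: "degree (q :: real poly) \<le> n - 1"
  shows "tone (2*n-1) I (\<lambda>t. f t * poly (q\<^sup>2) t)"
proof -
  define k where "k = 2 * n - 3"
  have k: "2 * n - 1 = Suc (Suc k)" "2 * n - 1 = k + 2" using n by (auto simp: k_def)
  note Ck = Ck[folded k_def] and conv = conv[folded k_def]
  obtain r where r: "\<And>t. t \<in> I \<Longrightarrow> ((deriv ^^ k) f has_real_derivative r t) (at_right t)"
    "\<And>s t. s \<in> I \<Longrightarrow> t \<in> I \<Longrightarrow> s < t \<Longrightarrow> r s \<le> ((deriv ^^ k) f t - (deriv ^^ k) f s) / (t - s)"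
    "\<And>s t. s \<in> I \<Longrightarrow> t \<in> I \<Longrightarrow> s < t \<Longrightarrow> ((deriv ^^ k) f t - (deriv ^^ k) f s) / (t - s) \<le> r t"
    by (rule convex_right_deriv[OF I conv]) (rule that)
  note mono = convex_right_deriv_mono[OF I conv r(1)]
  have p: "0 \<le> poly (q\<^sup>2) x" for x by (simp add: poly_power)
  show ?thesis
    unfolding k(2)
  \<comment> \<open>Here the function to be differentiated is \<open>r\<close>, which is itself
    non-decreasing; its derivative along the domain is a full derivative, and \<open>D\<close> can
    be all of \<open>I\<close>.\<close>
  proof (rule tone_mult_poly_if_ae_deriv_nonneg[where D = I, OF I Ck r p _ ae])
    fix t assume tI: "t \<in> I" and "t \<notin> {t \<in> I. \<not> ((\<forall>k\<in>{1..2*n-1}. t \<in> dom (nth_deriv k I f)) \<and>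
      (\<forall>x. 0 \<le> (\<Sum>i<n. \<Sum>j<n. the (nth_deriv (i + j + 1) I f t) / fact (i + j + 1) * (x i * x j))))}"
    then have dom: "\<And>k. k \<in> {1..2*n-1} \<Longrightarrow> t \<in> dom (nth_deriv k I f)"
      and psd: "\<And>x. 0 \<le> (\<Sum>i<n. \<Sum>j<n. the (nth_deriv (i + j + 1) I f t) / fact (i + j + 1) * (x i * x j))"
      by auto
    have "t \<in> dom (nth_deriv (Suc (Suc k)) I f)" unfolding k(1)[symmetric] by (rule dom) (use n in auto)
    then obtain d where "nth_deriv (Suc (Suc k)) I f t = Some d" by blast
    then have "t \<in> {t \<in> I. (deriv ^^ k) f differentiable (at t)}"
      and dw: "(r has_real_derivative d) (at t within {t \<in> I. (deriv ^^ k) f differentiable (at t)})"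
      using nth_deriv_Suc_Suc_eq_Some_iff[OF I(1) Ck r(1), of t d] by auto
    then have fk: "(deriv ^^ k) f differentiable (at t)" by simp
    have d: "(r has_real_derivative d) (at t)"
      by (rule mono_on_deriv_within_cocountable[OF I(1) mono tI dw])
    define v where "v j = (if j \<le> Suc k then ext_taylor f k r j t else d / fact (Suc (Suc k)))" for j
    have nth: "nth_deriv j I f t = Some (fact j * v j)" if "j \<le> 2 * n - 1" for j
      using nth_deriv_eq_ext_taylor[OF I Ck conv r(1) tI fk d, of j] that unfolding k v_def by blast
    have rt: "r t = deriv ((deriv ^^ k) f) t" using deriv_eq_right_deriv[OF r(1)[OF tI] fk] by simp
    define c where "c = coeff (pcompose q [:t, 1:])"
    have "(mult_right_deriv f k r (q\<^sup>2) has_real_derivative fact (Suc (Suc k)) * (\<Sum>j\<le>Suc (Suc k). v j * poly_taylor (q\<^sup>2) (Suc (Suc k) - j) t)) (at t)"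
      unfolding v_def by (rule has_deriv_mult_right_deriv[where f = f and k = k and r = r and t = t and d = d, OF Ck tI fk rt d])
    moreover have "(\<Sum>j\<le>2*n-1. v j * poly_taylor (q\<^sup>2) (2*n-1 - j) t)
        = (\<Sum>i<n. \<Sum>j<n. the (nth_deriv (i + j + 1) I f t) / fact (i + j + 1) * (c (n - 1 - i) * c (n - 1 - j)))"
      using sum_taylor_square_eq_quadratic_form[OF q, of v t] n by (simp add: nth c_def)
    then have "0 \<le> (\<Sum>j\<le>Suc (Suc k). v j * poly_taylor (q\<^sup>2) (Suc (Suc k) - j) t)"
      using psd[of "\<lambda>i. c (n - 1 - i)"] unfolding k(1) by simp
    ultimately show "\<exists>d\<ge>0. (mult_right_deriv f k r (q\<^sup>2) has_real_derivative d) (at t within I)"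
      by (metis has_field_derivative_at_within mult_nonneg_nonneg fact_ge_zero)
  qed auto
qed

section \<open>From doubled points to distinct points\<close>

lemma monic_prod_linear:
  fixes a :: "'a \<Rightarrow> real"
  shows "degree (\<Prod>i\<in>S. [:- a i, 1:]) = card S" "lead_coeff (\<Prod>i\<in>S. [:- a i, 1:]) = 1"
proof -
  show "degree (\<Prod>i\<in>S. [:- a i, 1:]) = card S"
    by (cases "finite S") (simp_all add: degree_prod_eq_sum_degree)
  show "lead_coeff (\<Prod>i\<in>S. [:- a i, 1:]) = 1" by (subst lead_coeff_prod) simp
qed

text \<open>The pencil \<open>(1 - t) P + t Q\<close> moves the roots \<open>l i\<close> of \<open>P\<close> to the roots \<open>m i\<close> of \<open>Q\<close>.\<close>

locale interlacing_roots =
  fixes n :: nat and l m :: "nat \<Rightarrow> real"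
  assumes l_less_m: "\<And>i. i < n \<Longrightarrow> l i < m i"
    and m_less_l: "\<And>i j. i < j \<Longrightarrow> j < n \<Longrightarrow> m i < l j"
begin

definition P :: "real poly" where "P = (\<Prod>i<n. [:- l i, 1:])"
definition Q :: "real poly" where "Q = (\<Prod>i<n. [:- m i, 1:])"
definition R :: "real \<Rightarrow> real" where "R x = poly P x - poly Q x"
definition pencil :: "real \<Rightarrow> real poly" where "pencil t = Polynomial.smult (1 - t) P + Polynomial.smult t Q"

lemma poly_P: "poly P x = (\<Prod>i<n. x - l i)" and poly_Q: "poly Q x = (\<Prod>i<n. x - m i)"
  by (simp_all add: P_def Q_def poly_prod)

lemma PQ_degree: "degree P = n" "degree Q = n" "lead_coeff P = 1" "lead_coeff Q = 1"
  using monic_prod_linear[of l "{..<n}"] monic_prod_linear[of m "{..<n}"] by (simp_all add: P_def Q_def)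

lemma poly_pencil: "poly (pencil t) x = poly P x - t * R x"
  by (simp add: pencil_def R_def algebra_simps)

lemma pencil_degree: "degree (pencil t) = n" "lead_coeff (pencil t) = 1"
proof -
  have "coeff (pencil t) n = 1" using PQ_degree by (simp add: pencil_def)
  moreover have "degree (pencil t) \<le> n" unfolding pencil_def
    using PQ_degree by (intro degree_add_le) (auto intro: order_trans[OF degree_smult_le])
  ultimately show "degree (pencil t) = n" "lead_coeff (pencil t) = 1"
    by (metis le_antisym le_degree zero_neq_one)+
qed

lemma interval_less: "i < j \<Longrightarrow> j < n \<Longrightarrow> x \<in> {l i..m i} \<Longrightarrow> y \<in> {l j..m j} \<Longrightarrow> x < y"
  using m_less_l[of i j] by simp

lemma interval_unique: "i < n \<Longrightarrow> j < n \<Longrightarrow> x \<in> {l i..m i} \<Longrightarrow> x \<in> {l j..m j} \<Longrightarrow> i = j"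
  using interval_less[of i j x x] interval_less[of j i x x] by (meson less_irrefl linorder_neqE_nat)

text \<open>In the product over all indices only the factor \<open>(x - l i) * (x - m i)\<close> is
  not positive, since \<open>x\<close> lies outside all other intervals.\<close>

lemma PQ_nonpos:
  assumes "i < n" "x \<in> {l i..m i}"
  shows "poly P x * poly Q x \<le> 0" "poly P x = 0 \<Longrightarrow> x = l i" "poly Q x = 0 \<Longrightarrow> x = m i"
proof -
  have out: "0 < (x - l j) * (x - m j)" if "j < n" "j \<noteq> i" for j
  proof (cases "j < i")
    case True
    then have "l j < m j" "m j < l i" using that assms by (auto intro: l_less_m m_less_l)
    then show ?thesis using assms by (intro mult_pos_pos) auto
  next
    case False
    then have "l j < m j" "m i < l j" using that assms by (auto intro: l_less_m m_less_l)
    then show ?thesis using assms by (intro mult_neg_neg) auto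
  qed
  have "poly P x * poly Q x = (\<Prod>j<n. (x - l j) * (x - m j))" by (simp add: poly_P poly_Q prod.distrib)
  also have "\<dots> = (x - l i) * (x - m i) * (\<Prod>j\<in>{..<n} - {i}. (x - l j) * (x - m j))"
    using assms by (simp add: prod.remove[of "{..<n}" i])
  also have "\<dots> \<le> 0"
  proof (rule mult_nonpos_nonneg)
    show "(x - l i) * (x - m i) \<le> 0" using assms by (intro mult_nonneg_nonpos) auto
    show "0 \<le> (\<Prod>j\<in>{..<n} - {i}. (x - l j) * (x - m j))" using out by (intro prod_nonneg) (auto intro: less_imp_le)
  qed
  finally show "poly P x * poly Q x \<le> 0" .
  show "x = l i" if "poly P x = 0"
  proof -
    from that obtain j where "j < n" "x = l j" by (auto simp: poly_P)
    then show ?thesis using out[of j] by fastforce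
  qed
  show "x = m i" if "poly Q x = 0"
  proof -
    from that obtain j where "j < n" "x = m j" by (auto simp: poly_Q)
    then show ?thesis using out[of j] by fastforce
  qed
qed

text \<open>If \<open>P\<close> and \<open>Q\<close> agreed at \<open>x\<close>, both would vanish
  there because their product is not positive, and \<open>x\<close> would be \<open>l i\<close> as
  well as \<open>m i\<close>.\<close>

lemma R_nonzero:
  assumes "i < n" "x \<in> {l i..m i}"
  shows "R x \<noteq> 0"
proof
  assume "R x = 0"
  then have eq: "poly P x = poly Q x" by (simp add: R_def)
  then have "poly P x * poly P x \<le> 0" using PQ_nonpos(1)[OF assms] by simp
  then have "poly P x = 0" by (auto simp: mult_le_0_iff)
  then have "x = l i" "x = m i" using PQ_nonpos(2,3)[OF assms] eq by auto
  then show False using l_less_m[OF assms(1)] by simp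
qed

text \<open>The parameter of the member of the pencil that has \<open>x\<close> as a root.\<close>

definition param :: "real \<Rightarrow> real" where "param x = poly P x / R x"

lemma pencil_root_iff: "i < n \<Longrightarrow> x \<in> {l i..m i} \<Longrightarrow> poly (pencil t) x = 0 \<longleftrightarrow> param x = t"
  using R_nonzero[of i x] by (auto simp: poly_pencil param_def field_simps)

lemma param_ends: "i < n \<Longrightarrow> param (l i) = 0" "i < n \<Longrightarrow> param (m i) = 1"
proof -
  show "param (l i) = 0" if "i < n"
  proof -
    have "poly P (l i) = 0" using that by (auto simp: poly_P)
    then show ?thesis by (simp add: param_def)
  qed
  show "param (m i) = 1" if i: "i < n"
  proof -
    have "poly Q (m i) = 0" using i by (auto simp: poly_Q)
    moreover have "R (m i) \<noteq> 0" by (rule R_nonzero[OF i]) (use l_less_m[OF i] in auto)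
    ultimately show ?thesis by (simp add: param_def R_def)
  qed
qed

lemma param_cont: "i < n \<Longrightarrow> continuous_on {l i..m i} param"
  unfolding param_def[abs_def] R_def using R_nonzero unfolding R_def by (intro continuous_intros) auto

lemma param_surj:
  assumes "i < n" "t \<in> {0..1}"
  shows "\<exists>x\<in>{l i..m i}. param x = t"
  using IVT'[of param "l i" t "m i"] assms param_ends[OF assms(1)] param_cont[OF assms(1)] l_less_m[OF assms(1)] by auto

text \<open>A second root in one of the intervals would give the pencil \<open>n + 1\<close> roots.\<close>

lemma param_inj:
  assumes i: "i < n" and xy: "x \<in> {l i..m i}" "y \<in> {l i..m i}" "param x = param y" and t: "param x \<in> {0..1}"
  shows "x = y"
proof (rule ccontr)
  assume ne: "x \<noteq> y"
  obtain z where z: "\<And>j. j < n \<Longrightarrow> z j \<in> {l j..m j} \<and> param (z j) = param x"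
    using param_surj[OF _ t] by metis
  define z' where "z' = z(i := x)"
  have z': "z' j \<in> {l j..m j} \<and> param (z' j) = param x" if "j < n" for j
    using z[OF that] xy by (simp add: z'_def)
  have inj: "inj_on z' {..<n}"
  proof (rule inj_onI)
    fix j k assume "j \<in> {..<n}" "k \<in> {..<n}" "z' j = z' k"
    then show "j = k" using interval_unique[of j k "z' j"] z'[of j] z'[of k] by simp
  qed
  have "y \<notin> z' ` {..<n}"
  proof
    assume "y \<in> z' ` {..<n}"
    then obtain j where j: "j < n" "y = z' j" by auto
    then have "j = i" using interval_unique[of j i y] z'[of j] xy i by simp
    then show False using j ne by (simp add: z'_def)
  qed
  then have "card (insert y (z' ` {..<n})) = Suc n" using inj by (simp add: card_image)
  moreover have "insert y (z' ` {..<n}) \<subseteq> {w. poly (pencil (param x)) w = 0}"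
    using z' xy i pencil_root_iff by auto
  moreover have "pencil (param x) \<noteq> 0" using pencil_degree(2)[of "param x"] by auto
  ultimately have "Suc n \<le> degree (pencil (param x))"
    using card_poly_roots_bound[of "pencil (param x)"] poly_roots_finite[of "pencil (param x)"]
    by (metis card_mono order_trans)
  then show False by (simp add: pencil_degree)
qed

text \<open>\<open>P\<close> and \<open>Q\<close> have opposite signs at \<open>x\<close>, so
  \<open>P / (P - Q)\<close> lies between 0 and 1.\<close>

lemma param_range:
  assumes "i < n" "x \<in> {l i..m i}"
  shows "param x \<in> {0..1}"
proof -
  have neg: "poly P x * poly Q x \<le> 0" and R: "R x \<noteq> 0" using PQ_nonpos(1) R_nonzero assms by blast+
  show ?thesis
  proof (cases "0 \<le> poly P x")
    case True
    then have "poly Q x \<le> 0 \<or> poly P x = 0" using neg by (auto simp: mult_le_0_iff)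
    then show ?thesis
    proof
      assume "poly Q x \<le> 0"
      then have "0 < R x" using True R unfolding R_def by linarith
      then show ?thesis using True \<open>poly Q x \<le> 0\<close> by (auto simp: param_def R_def divide_simps)
    qed (simp add: param_def)
  next
    case False
    then have "0 \<le> poly Q x" using neg by (auto simp: mult_le_0_iff)
    then have "R x < 0" using False unfolding R_def by linarith
    then show ?thesis using False \<open>0 \<le> poly Q x\<close> by (auto simp: param_def R_def divide_simps)
  qed
qed

definition root :: "nat \<Rightarrow> real \<Rightarrow> real" where "root i t = inv_into {l i..m i} param t"

lemma root:
  assumes "i < n" "t \<in> {0..1}"
  shows "root i t \<in> {l i..m i}" "param (root i t) = t"
proof -
  have "t \<in> param ` {l i..m i}" using param_surj[OF assms] by auto
  then show "root i t \<in> {l i..m i}" "param (root i t) = t"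
    unfolding root_def by (rule inv_into_into, rule f_inv_into_f)
qed

lemma root_param: "i < n \<Longrightarrow> x \<in> {l i..m i} \<Longrightarrow> root i (param x) = x"
  using root[of i "param x"] param_inj[of i "root i (param x)" x] param_range by simp

lemma root_cont:
  assumes i: "i < n"
  shows "continuous_on {0..1} (root i)"
proof -
  have "continuous_on (param ` {l i..m i}) (root i)"
    by (rule continuous_on_inv[OF param_cont[OF i]]) (use root_param[OF i] in auto)
  moreover have "{0..1} \<subseteq> param ` {l i..m i}" using param_surj[OF i] by force
  ultimately show ?thesis by (rule continuous_on_subset)
qed

definition roots :: "real \<Rightarrow> real set" where "roots t = (\<lambda>i. root i t) ` {..<n}"

lemma roots_inj: "t \<in> {0..1} \<Longrightarrow> inj_on (\<lambda>i. root i t) {..<n}"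
  by (rule inj_onI) (metis interval_unique root(1) lessThan_iff)

lemma finite_roots: "finite (roots t)" and card_roots: "t \<in> {0..1} \<Longrightarrow> card (roots t) = n"
  using roots_inj by (auto simp: roots_def card_image)

lemma poly_pencil_eq_prod:
  assumes t: "t \<in> {0..1}"
  shows "poly (pencil t) x = (\<Prod>y\<in>roots t. x - y)"
proof -
  let ?W = "\<Prod>y\<in>roots t. [:- y, 1:]"
  have W: "degree ?W = n" "lead_coeff ?W = 1"
    using monic_prod_linear[of "\<lambda>y. y" "roots t"] card_roots[OF t] by simp_all
  have "pencil t = ?W"
  proof (rule poly_eqI_degree_lead_coeff[where n = n and A = "roots t"])
    show "coeff (pencil t) n = coeff ?W n" using W pencil_degree[of t] by simp
    fix z assume "z \<in> roots t"
    then obtain i where i: "i < n" "z = root i t" by (auto simp: roots_def)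
    have "poly (pencil t) z = 0" using pencil_root_iff[OF i(1)] root[OF i(1) t] i(2) by simp
    moreover have "poly ?W z = 0" using \<open>z \<in> roots t\<close> finite_roots by (auto simp: poly_prod)
    ultimately show "poly (pencil t) z = poly ?W z" by simp
  qed (use card_roots[OF t] W pencil_degree[of t] in auto)
  then show ?thesis by (simp add: poly_prod)
qed

lemma param_roots: "t \<in> {0..1} \<Longrightarrow> x \<in> roots t \<Longrightarrow> param x = t"
  using root by (auto simp: roots_def)

text \<open>At a root of \<open>pencil a\<close> the polynomial \<open>pencil b\<close> takes the
  value \<open>(a - b) * R x\<close>. The roots of \<open>pencil b\<close> contribute this factor to
  the denominator, so the divided difference at all roots splits into two of
  \<open>g / R\<close>.\<close>

lemma dd_roots_diff:
  assumes t: "t \<in> {0..1}" and s: "s \<in> {0..1}" and ts: "t \<noteq> s"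
  shows "dd (roots s) (\<lambda>x. g x / R x) - dd (roots t) (\<lambda>x. g x / R x) = (s - t) * dd (roots t \<union> roots s) g"
proof -
  have disj: "roots t \<inter> roots s = {}" using param_roots t s ts by blast
  have half: "(\<Sum>x\<in>roots a. g x / (\<Prod>y\<in>roots a \<union> roots b - {x}. x - y)) = dd (roots a) (\<lambda>x. g x / R x) / (a - b)"
    if ab: "a \<in> {0..1}" "b \<in> {0..1}" "a \<noteq> b" "roots a \<inter> roots b = {}" for a b
    unfolding dd_def sum_divide_distrib
  proof (rule sum.cong[OF refl])
    fix x assume x: "x \<in> roots a"
    have "roots a \<union> roots b - {x} = (roots a - {x}) \<union> roots b" using x ab(4) by auto
    then have "(\<Prod>y\<in>roots a \<union> roots b - {x}. x - y) = (\<Prod>y\<in>roots a - {x}. x - y) * (\<Prod>y\<in>roots b. x - y)"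
      using ab(4) finite_roots by (simp add: prod.union_disjoint Diff_Int_distrib2)
    also have "(\<Prod>y\<in>roots b. x - y) = poly (pencil b) x - poly (pencil a) x"
      using poly_pencil_eq_prod[OF ab(2), of x] poly_pencil_eq_prod[OF ab(1), of x] x finite_roots[of a] by auto
    also have "\<dots> = (a - b) * R x" by (simp add: poly_pencil algebra_simps)
    finally show "g x / (\<Prod>y\<in>roots a \<union> roots b - {x}. x - y) = g x / R x / (\<Prod>y\<in>roots a - {x}. x - y) / (a - b)"
      by (simp add: mult_ac)
  qed
  have "dd (roots t \<union> roots s) g = (\<Sum>x\<in>roots t. g x / (\<Prod>y\<in>roots t \<union> roots s - {x}. x - y))
      + (\<Sum>x\<in>roots s. g x / (\<Prod>y\<in>roots s \<union> roots t - {x}. x - y))"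
    unfolding dd_def using disj finite_roots by (subst sum.union_disjoint) (auto simp: Un_commute)
  also have "\<dots> = dd (roots t) (\<lambda>x. g x / R x) / (t - s) + dd (roots s) (\<lambda>x. g x / R x) / (s - t)"
    using half[OF t s ts disj] half[OF s t ts[symmetric]] disj by (simp add: Int_commute)
  finally have e: "dd (roots t \<union> roots s) g = dd (roots t) (\<lambda>x. g x / R x) / (t - s) + dd (roots s) (\<lambda>x. g x / R x) / (s - t)" .
  define k where "k = s - t"
  have k: "t - s = - k" "k \<noteq> 0" using ts by (auto simp: k_def)
  show ?thesis unfolding e k_def[symmetric] k(1) using k(2) by (simp add: field_simps)
qed

lemma dd_roots_has_derivative:
  assumes t: "t \<in> {0..1}" and g: "\<And>x. x \<in> roots t \<Longrightarrow> g differentiable (at x)"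
  shows "((\<lambda>s. dd (roots s) (\<lambda>x. g x / R x)) has_real_derivative dd2 (roots t) {} g) (at t within {0..1})"
proof -
  let ?F = "at t within {0..1}"
  \<comment> \<open>The partner of the \<open>i\<close>-th root at \<open>t\<close> is the
    \<open>i\<close>-th root at \<open>s\<close>; the index has to be recovered because
    \<open>dd_tendsto_dd2\<close> pairs points and not indices.\<close>
  define y where "y s c = root (inv_into {..<n} (\<lambda>i. root i t) c) s" for s c
  have y_root: "y s (root i t) = root i s" if "i < n" for s i
    using inv_into_f_f[OF roots_inj[OF t], of i] that by (simp add: y_def)
  have img: "y s ` roots t = roots s" for s
    unfolding roots_def image_image using y_root by (intro image_cong) auto
  have ev: "\<forall>\<^sub>F s in ?F. s \<in> {0..1} \<and> s \<noteq> t" by (simp add: eventually_at_filter)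
  have "((\<lambda>s. dd (roots t \<union> y s ` roots t \<union> {}) g) \<longlongrightarrow> dd2 (roots t) {} g) ?F"
  proof (rule dd_tendsto_dd2)
    fix c assume c: "c \<in> roots t"
    then obtain i where i: "i < n" "c = root i t" by (auto simp: roots_def)
    have "(root i \<longlongrightarrow> root i t) ?F" using root_cont[OF i(1)] t by (auto simp: continuous_on_def)
    then show "((\<lambda>s. y s c) \<longlongrightarrow> c) ?F" using i y_root by simp
    show "\<forall>\<^sub>F s in ?F. y s c \<noteq> c"
      using ev
    proof eventually_elim
      case (elim s)
      then show ?case using root(2)[OF i(1), of s] root(2)[OF i(1) t] i y_root by metis
    qed
    show "g differentiable (at c)" using g c by blast
  qed (auto simp: finite_roots)
  then have "((\<lambda>s. dd (roots t \<union> roots s) g) \<longlongrightarrow> dd2 (roots t) {} g) ?F" by (simp add: img)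
  moreover have "\<forall>\<^sub>F s in ?F. dd (roots t \<union> roots s) g =
      (dd (roots s) (\<lambda>x. g x / R x) - dd (roots t) (\<lambda>x. g x / R x)) / (s - t)"
    using ev by eventually_elim (use dd_roots_diff[OF t] in auto)
  ultimately show ?thesis
    unfolding has_field_derivative_iff by (rule Lim_transform_eventually)
qed

lemma roots_0: "roots 0 = l ` {..<n}" and roots_1: "roots 1 = m ` {..<n}"
proof -
  have "root i 0 = l i" "root i 1 = m i" if "i < n" for i
    using root_param[OF that, of "l i"] root_param[OF that, of "m i"] param_ends[OF that] l_less_m[OF that] by auto
  then show "roots 0 = l ` {..<n}" "roots 1 = m ` {..<n}" by (auto simp: roots_def)
qed

text \<open>By \<open>dd_roots_diff\<close> the divided difference at all \<open>2n\<close> points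
  is the increment of that of \<open>g / R\<close> from parameter 0 to parameter 1.\<close>

lemma dd_nonneg_if_dd2_nonneg:
  assumes g: "\<And>t x. t \<in> {0..1} \<Longrightarrow> x \<in> roots t \<Longrightarrow> g differentiable (at x)"
    and nonneg: "\<And>t. t \<in> {0..1} \<Longrightarrow> 0 \<le> dd2 (roots t) {} g"
  shows "0 \<le> dd (l ` {..<n} \<union> m ` {..<n}) g"
proof -
  let ?\<Phi> = "\<lambda>s. dd (roots s) (\<lambda>x. g x / R x)"
  have D: "(?\<Phi> has_real_derivative dd2 (roots t) {} g) (at t within {0..1})" if "t \<in> {0..1}" for t
    by (rule dd_roots_has_derivative[OF that g[OF that]])
  have "?\<Phi> 0 \<le> ?\<Phi> 1"
  proof (rule DERIV_nonneg_imp_increasing_open[of 0 1])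
    show "\<exists>y. (?\<Phi> has_real_derivative y) (at x) \<and> 0 \<le> y" if "0 < x" "x < 1" for x
    proof (intro exI conjI)
      show "(?\<Phi> has_real_derivative dd2 (roots x) {} g) (at x)"
        using D[of x] that by (simp add: at_within_Icc_at)
    qed (use nonneg that in auto)
    show "continuous_on {0..1} ?\<Phi>"
      unfolding continuous_on_eq_continuous_within by (intro ballI DERIV_continuous[OF D]) auto
  qed auto
  then show ?thesis using dd_roots_diff[of 0 1 g] by (simp add: roots_0 roots_1)
qed

end

lemma interlacing_enumeration:
  fixes X :: "real set"
  assumes X: "finite X" "card X = 2 * n"
  obtains l m where "interlacing_roots n l m" "l ` {..<n} \<union> m ` {..<n} = X"
proof -
  define xs where "xs = sorted_list_of_set X"
  have xs: "set xs = X" "length xs = 2 * n" "sorted_wrt (<) xs" using X by (auto simp: xs_def)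
  have mono: "xs ! i < xs ! j" if "i < j" "j < 2 * n" for i j using xs that by (simp add: sorted_wrt_nth_less)
  have inX: "xs ! i \<in> X" if "i < 2 * n" for i using xs that nth_mem by metis
  define l where "l i = xs ! (2 * i)" for i
  define m where "m i = xs ! (2 * i + 1)" for i
  have "xs ! i \<in> l ` {..<n} \<union> m ` {..<n}" if "i < 2 * n" for i
  proof (cases "even i")
    case True
    then have "xs ! i = l (i div 2)" "i div 2 < n" using that by (auto simp: l_def)
    then show ?thesis by blast
  next
    case False
    then have "xs ! i = m (i div 2)" "i div 2 < n" using that by (auto simp: m_def)
    then show ?thesis by blast
  qed
  then have "X \<subseteq> l ` {..<n} \<union> m ` {..<n}" unfolding xs(1)[symmetric] set_conv_nth xs(2) by blast
  moreover have "l ` {..<n} \<union> m ` {..<n} \<subseteq> X" using inX by (auto simp: l_def m_def)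
  moreover have "interlacing_roots n l m" by unfold_locales (auto simp: l_def m_def intro: mono)
  ultimately show thesis using that by blast
qed

theorem dd_nonneg_if_doubled:
  assumes I: "is_interval I" and g: "\<And>x. x \<in> I \<Longrightarrow> g differentiable (at x)"
    and doubled: "\<And>A. finite A \<Longrightarrow> card A = n \<Longrightarrow> A \<subseteq> I \<Longrightarrow> 0 \<le> dd2 A {} g"
    and X: "finite X" "card X = 2 * n" "X \<subseteq> I"
  shows "0 \<le> dd X g"
proof -
  obtain l m where lm: "interlacing_roots n l m" and XI: "l ` {..<n} \<union> m ` {..<n} = X"
    by (rule interlacing_enumeration[OF X(1,2)])
  interpret interlacing_roots n l m by (rule lm)
  have rootsI: "roots t \<subseteq> I" if t: "t \<in> {0..1}" for t
  proof
    fix x assume "x \<in> roots t"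
    then obtain i where i: "i < n" "x = root i t" by (auto simp: roots_def)
    then have "x \<in> {l i..m i}" using root t by auto
    moreover have "l i \<in> I" "m i \<in> I" using XI X(3) i(1) by blast+
    ultimately show "x \<in> I" using Icc_subset[OF I] by blast
  qed
  have "0 \<le> dd (l ` {..<n} \<union> m ` {..<n}) g"
    by (rule dd_nonneg_if_dd2_nonneg) (use rootsI g doubled finite_roots card_roots in blast)+
  then show ?thesis by (simp only: XI)
qed

section \<open>Norms of complex polynomials\<close>

lemma poly_map_poly_Re: "poly (map_poly Re p) t = Re (poly p (of_real t))"
  by (induction p) (simp_all add: map_poly_pCons)

lemma poly_map_poly_Im: "poly (map_poly Im p) t = Im (poly p (of_real t))"
  by (induction p) (simp_all add: map_poly_pCons)

lemma poly_map_poly_cnj_of_real: "poly (map_poly cnj p) (of_real t) = cnj (poly p (of_real t))"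
  by (induction p) (simp_all add: map_poly_pCons)

lemma poly_map_poly_of_real: "poly (map_poly complex_of_real p) (of_real t) = of_real (poly p t)"
  by (induction p) (simp_all add: map_poly_pCons)

lemma poly_poly_N:
  "poly (poly_N q) t = (poly (map_poly Re q) t)\<^sup>2 + (poly (map_poly Im q) t)\<^sup>2"
  by (simp add: poly_N_def poly_map_poly_Re poly_map_poly_Im poly_map_poly_cnj_of_real power2_eq_square)

lemma poly_poly_N_of_real: "poly (poly_N (map_poly complex_of_real q)) t = (poly q t)\<^sup>2"
  by (simp add: poly_poly_N poly_map_poly_Re poly_map_poly_Im poly_map_poly_of_real)

lemma poly_poly_N_nonneg: "0 \<le> poly (poly_N q) t"
  by (simp add: poly_poly_N)

section \<open>Conditions with squares of polynomials\<close>

definition tone_squares :: "nat \<Rightarrow> real set \<Rightarrow> (real \<Rightarrow> real) \<Rightarrow> bool" where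
  "tone_squares n I f \<longleftrightarrow>
     (\<forall>q :: real poly. degree q \<le> n - 1 \<longrightarrow> tone (2*n-1) I (\<lambda>t. f t * (poly q t)\<^sup>2))"

definition doubled_squares :: "nat \<Rightarrow> real set \<Rightarrow> (real \<Rightarrow> real) \<Rightarrow> bool" where
  "doubled_squares n I f \<longleftrightarrow> (\<forall>A (q :: real poly). finite A \<and> card A = n \<and> A \<subseteq> I \<and> degree q \<le> n - 1 \<longrightarrow>
     0 \<le> dd2 A {} (\<lambda>t. f t * (poly q t)\<^sup>2))"

lemma tone_add: "tone k I g \<Longrightarrow> tone k I h \<Longrightarrow> tone k I (\<lambda>t. g t + h t)"
  by (simp add: tone_def dd_add)

lemma tone_squares_poly_N:
  assumes "tone_squares n I f" "degree q \<le> n - 1"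
  shows "tone (2*n-1) I (\<lambda>t. f t * poly (poly_N q) t)"
proof -
  have "degree (map_poly Re q) \<le> n - 1" "degree (map_poly Im q) \<le> n - 1"
    using assms(2) degree_map_poly_le order_trans by blast+
  then show ?thesis
    using assms(1) tone_add unfolding tone_squares_def by (simp add: poly_poly_N distrib_left)
qed

lemma tone_iff_increasing_sequences:
  assumes m: "1 \<le> m"
  shows "tone (m - 1) I g \<longleftrightarrow> (\<forall>x :: nat \<Rightarrow> real. strict_mono_on {0..m-1} x \<and> x ` {0..m-1} \<subseteq> I \<longrightarrow>
     0 \<le> divdiff (map x [0..<m]) g)"
proof -
  have set: "{0..m-1} = {0..<m}" using m by auto
  show ?thesis
  proof (intro iffI allI impI)
    fix x :: "nat \<Rightarrow> real"
    assume tone: "tone (m - 1) I g" and x: "strict_mono_on {0..m-1} x \<and> x ` {0..m-1} \<subseteq> I"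
    then have "inj_on x {0..m-1}" by (auto intro: strict_mono_on_imp_inj_on)
    then have inj: "inj_on x {0..<m}" unfolding set .
    then have "divdiff (map x [0..<m]) g = dd (x ` {0..<m}) g"
      by (subst divdiff_distinct) (auto simp: distinct_map)
    moreover have "card (x ` {0..<m}) = Suc (m - 1)" using inj m by (simp add: card_image)
    ultimately show "0 \<le> divdiff (map x [0..<m]) g" using tone x set unfolding tone_def by auto
  next
    assume seq: "\<forall>x :: nat \<Rightarrow> real. strict_mono_on {0..m-1} x \<and> x ` {0..m-1} \<subseteq> I \<longrightarrow>
      0 \<le> divdiff (map x [0..<m]) g"
    show "tone (m - 1) I g"
      unfolding tone_def
    proof (intro allI impI, elim conjE)
      fix X assume X: "finite X" "card X = Suc (m - 1)" "X \<subseteq> I"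
      define xs where "xs = sorted_list_of_set X"
      have xs: "set xs = X" "length xs = m" "sorted_wrt (<) xs" "distinct xs" using X m by (auto simp: xs_def)
      have "strict_mono_on {0..m-1} ((!) xs)"
        using xs m by (intro strict_mono_onI) (auto simp: sorted_wrt_nth_less)
      moreover have "(!) xs ` {0..m-1} \<subseteq> I"
      proof
        fix y assume "y \<in> (!) xs ` {0..m-1}"
        then have "y \<in> (!) xs ` {0..<m}" by (simp only: set)
        then obtain i where "i < m" "y = xs ! i" by auto
        then have "y \<in> set xs" using xs(2) by simp
        then show "y \<in> I" using xs(1) X(3) by auto
      qed
      ultimately have "0 \<le> divdiff (map ((!) xs) [0..<m]) g" using seq by blast
      also have "map ((!) xs) [0..<m] = xs" using map_nth[of xs] xs by simp
      finally show "0 \<le> dd X g" using xs by (simp add: divdiff_distinct)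
    qed
  qed
qed

lemma condition_2_iff:
  assumes n: "2 \<le> n"
  shows "(\<forall>(x :: nat \<Rightarrow> real) (q :: real poly).
      strict_mono_on {0..2*n-1} x \<and> x ` {0..2*n-1} \<subseteq> I \<and> degree q \<le> n - 1 \<longrightarrow>
      0 \<le> divdiff (map x [0..<2*n]) (\<lambda>t. f t * (poly q t)\<^sup>2)) \<longleftrightarrow> tone_squares n I f"
  unfolding tone_squares_def using n by (subst tone_iff_increasing_sequences) auto

lemma condition_3_iff:
  assumes n: "2 \<le> n"
  shows "(\<forall>(x :: nat \<Rightarrow> real) (q :: complex poly).
      strict_mono_on {0..2*n-1} x \<and> x ` {0..2*n-1} \<subseteq> I \<and> degree q \<le> n - 1 \<longrightarrow>
      0 \<le> divdiff (map x [0..<2*n]) (\<lambda>t. f t * poly (poly_N q) t)) \<longleftrightarrow> tone_squares n I f"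
    (is "?L \<longleftrightarrow> _")
proof -
  have "?L \<longleftrightarrow> (\<forall>q. degree q \<le> n - 1 \<longrightarrow> tone (2*n-1) I (\<lambda>t. f t * poly (poly_N q) t))"
    using n by (subst tone_iff_increasing_sequences) auto
  also have "\<dots> \<longleftrightarrow> tone_squares n I f"
  proof
    assume L: "\<forall>q. degree q \<le> n - 1 \<longrightarrow> tone (2*n-1) I (\<lambda>t. f t * poly (poly_N q) t)"
    show "tone_squares n I f"
      unfolding tone_squares_def
    proof (intro allI impI)
      fix q :: "real poly" assume "degree q \<le> n - 1"
      then have "degree (map_poly complex_of_real q) \<le> n - 1"
        using degree_map_poly_le order_trans by blast
      then have "tone (2*n-1) I (\<lambda>t. f t * poly (poly_N (map_poly complex_of_real q)) t)" using L by blast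
      then show "tone (2*n-1) I (\<lambda>t. f t * (poly q t)\<^sup>2)" by (simp only: poly_poly_N_of_real)
    qed
  qed (blast intro: tone_squares_poly_N)
  finally show ?thesis .
qed

lemma C_k_on_le: "C_k_on k I f \<Longrightarrow> j \<le> k \<Longrightarrow> C_k_on j I f"
proof -
  assume Ck: "C_k_on k I f" and j: "j \<le> k"
  have "continuous_on I ((deriv ^^ j) f)"
  proof (cases "j = k")
    case False
    then have "\<forall>t\<in>I. (deriv ^^ j) f differentiable (at t)" using Ck j by (auto simp: C_k_on_def)
    then show ?thesis
      by (intro continuous_at_imp_continuous_on) (auto intro: differentiable_imp_continuous_within)
  qed (use Ck in \<open>auto simp: C_k_on_def\<close>)
  then show "C_k_on j I f" using Ck j by (auto simp: C_k_on_def)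
qed

lemma tone_squares_imp_smooth:
  assumes I: "open I" "is_interval I" and n: "2 \<le> n" and "tone_squares n I f"
  shows "C_k_on (2*n-3) I f" "convex_on I ((deriv ^^ (2*n-3)) f)" "C_k_on 1 I f"
proof -
  have k: "2*n-1 = (2*n-3) + 2" using n by simp
  have "tone (2*n-1) I (\<lambda>t. f t * (poly 1 t)\<^sup>2)"
    using assms(4) unfolding tone_squares_def by (rule allE[of _ 1]) simp
  then have "tone ((2*n-3) + 2) I f" unfolding k by simp
  from tone_imp_C_k_convex[OF I this]
  show "C_k_on (2*n-3) I f" "convex_on I ((deriv ^^ (2*n-3)) f)" by auto
  show "C_k_on 1 I f" by (rule C_k_on_le[OF \<open>C_k_on (2*n-3) I f\<close>]) (use n in simp)
qed

lemma C_1_differentiable: "C_k_on 1 I f \<Longrightarrow> t \<in> I \<Longrightarrow> f differentiable (at t)"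
  by (auto simp: C_k_on_def)

lemma differentiable_mult_square:
  "f differentiable (at t) \<Longrightarrow> (\<lambda>t. f t * (poly q t)\<^sup>2) differentiable (at (t :: real))"
  by (intro differentiable_mult differentiable_power) (auto intro: differentiableI poly_differentiable)

text \<open>Towards double points, each point is paired with a small translate of itself; for the
  way back the roots of a pencil are followed (\<open>dd_nonneg_if_doubled\<close>).\<close>

lemma tone_squares_iff_doubled:
  assumes I: "open I" "is_interval I" and n: "2 \<le> n"
  shows "tone_squares n I f \<longleftrightarrow> C_k_on 1 I f \<and> doubled_squares n I f"
proof
  assume T: "tone_squares n I f"
  have C1: "C_k_on 1 I f" by (rule tone_squares_imp_smooth(3)[OF I n T])
  have "0 \<le> dd2 A {} (\<lambda>t. f t * (poly q t)\<^sup>2)"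
    if A: "finite A" "card A = n" "A \<subseteq> I" and q: "degree q \<le> n - 1" for A and q :: "real poly"
  proof -
    let ?g = "\<lambda>t. f t * (poly q t)\<^sup>2" and ?F = "at_right (0::real)"
    have lim: "((\<lambda>h. t + h) \<longlongrightarrow> t) ?F" for t :: real
      by (rule tendsto_eq_intros refl tendsto_ident_at | simp)+
    have ne: "\<forall>\<^sub>F h in ?F. t + h \<noteq> t" for t :: real
      using eventually_at_right_less[of 0] by eventually_elim auto
    have "((\<lambda>h. dd (A \<union> (\<lambda>t. t + h) ` A \<union> {}) ?g) \<longlongrightarrow> dd2 A {} ?g) ?F"
      using A C1 by (intro dd_tendsto_dd2 lim ne differentiable_mult_square C_1_differentiable[OF C1]) auto
    moreover have "\<forall>\<^sub>F h in ?F. 0 \<le> dd (A \<union> (\<lambda>t. t + h) ` A \<union> {}) ?g"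
    proof -
      have "\<forall>\<^sub>F h in ?F. inj_on (\<lambda>t. t + h) A \<and> (\<lambda>t. t + h) ` A \<inter> (A \<union> {}) = {}"
        using A by (intro eventually_distinct_near lim ne) auto
      moreover have "\<forall>\<^sub>F h in ?F. \<forall>t\<in>A. t + h \<in> I"
        using A I lim by (intro eventually_ball_finite ballI) (auto simp: tendsto_def)
      ultimately show ?thesis
      proof eventually_elim
        case (elim h)
        then have "card (A \<union> (\<lambda>t. t + h) ` A) = card A + card A"
          using A by (subst card_Un_disjoint) (auto simp: card_image)
        then have c: "card (A \<union> (\<lambda>t. t + h) ` A \<union> {}) = Suc (2*n-1)" using A n by simp
        have s: "A \<union> (\<lambda>t. t + h) ` A \<union> {} \<subseteq> I" using A elim by auto
        have "tone (2*n-1) I ?g" using T q unfolding tone_squares_def by blast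
        from this[unfolded tone_def, rule_format, OF conjI[OF _ conjI[OF c s]]] A(1) show ?case by simp
      qed
    qed
    ultimately show ?thesis by (rule tendsto_lowerbound) simp
  qed
  then show "C_k_on 1 I f \<and> doubled_squares n I f" using C1 unfolding doubled_squares_def by blast
next
  assume D: "C_k_on 1 I f \<and> doubled_squares n I f"
  show "tone_squares n I f"
    unfolding tone_squares_def tone_def
  proof (intro allI impI, elim conjE)
    fix q :: "real poly" and X assume q: "degree q \<le> n - 1" and X: "finite X" "card X = Suc (2*n-1)" "X \<subseteq> I"
    show "0 \<le> dd X (\<lambda>t. f t * (poly q t)\<^sup>2)"
    proof (rule dd_nonneg_if_doubled[OF I(2)])
      show "(\<lambda>t. f t * (poly q t)\<^sup>2) differentiable (at x)" if "x \<in> I" for x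
        using D that by (intro differentiable_mult_square C_1_differentiable) auto
      show "0 \<le> dd2 A {} (\<lambda>t. f t * (poly q t)\<^sup>2)" if "finite A" "card A = n" "A \<subseteq> I" for A
        using D q that unfolding doubled_squares_def by blast
    qed (use X n in auto)
  qed
qed

section \<open>Loewner matrices as divided differences\<close>

lemma count_list_concat_doubled:
  assumes "inj_on x (set ks)" "distinct ks"
  shows "count_list (concat (map (\<lambda>i. [x i, x i]) ks)) c = (if c \<in> x ` set ks then 2 else 0)"
  using assms by (induction ks) (auto simp: inj_on_def)

lemma divdiff_doubled:
  assumes "inj_on x {1..n}"
  shows "divdiff (concat (map (\<lambda>i. [x i, x i]) [1..<n+1])) g = dd2 (x ` {1..n}) {} g"
proof -
  have set: "set [1..<n+1] = {1..n}" by auto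
  have c: "count_list (concat (map (\<lambda>i. [x i, x i]) [1..<n+1])) c = (if c \<in> x ` {1..n} then 2 else 0)" for c
    using count_list_concat_doubled[of x "[1..<n+1]" c] assms unfolding set by simp
  show ?thesis
    by (subst divdiff_eq_dd2) (auto simp only: c points_of_mult_def intro!: arg_cong2[where f = "\<lambda>A B. dd2 A B g"] split: if_splits)
qed

text \<open>Appending to \<open>us\<close> and to \<open>vs\<close> the points of \<open>A\<close>
  that they miss makes every point of \<open>A\<close> double; the linear factors compensate for the
  added points.\<close>

lemma divdiff_eq_dd2_complement:
  assumes A: "finite A" and us: "distinct us" "set us \<subseteq> A" and vs: "distinct vs" "set vs \<subseteq> A"
    and f: "\<And>a. a \<in> A \<Longrightarrow> f differentiable (at a)"
  shows "divdiff (us @ vs) f = dd2 A {} (\<lambda>t. f t * ((\<Prod>c\<in>A - set us. t - c) * (\<Prod>c\<in>A - set vs. t - c)))"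
proof -
  define us' where "us' = sorted_list_of_set (A - set us)"
  define vs' where "vs' = sorted_list_of_set (A - set vs)"
  have us': "distinct us'" "set us' = A - set us" and vs': "distinct vs'" "set vs' = A - set vs"
    using A by (auto simp: us'_def vs'_def)
  have cnt: "count_list ws c = (if c \<in> set ws then 1 else 0)" if "distinct ws" for ws :: "real list" and c
    using that by (simp add: distinct_count_atmost_1 count_mset[symmetric])
  have c: "count_list ((us' @ vs') @ (us @ vs)) c = (if c \<in> A then 2 else 0)" for c
    using us vs us' vs' by (auto simp: cnt)
  have "divdiff (us @ vs) f = divdiff ((us' @ vs') @ (us @ vs)) (\<lambda>t. (\<Prod>c\<leftarrow>us' @ vs'. t - c) * f t)"
  proof (rule divdiff_append_mult[symmetric])
    show "count_list ((us' @ vs') @ us @ vs) d \<le> 2" for d using c[of d] by simp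
    show "f differentiable (at a)" if "a \<in> set (us' @ vs') \<union> set (us @ vs)" for a
      using that us vs us' vs' by (intro f) auto
  qed
  also have "\<dots> = dd2 A {} (\<lambda>t. (\<Prod>c\<leftarrow>us' @ vs'. t - c) * f t)"
    by (subst divdiff_eq_dd2) (auto simp only: c points_of_mult_def
      intro!: arg_cong2[where f = "\<lambda>A B. dd2 A B (\<lambda>t. (\<Prod>c\<leftarrow>us' @ vs'. t - c) * f t)"] split: if_splits)
  also have "(\<lambda>t. (\<Prod>c\<leftarrow>us' @ vs'. t - c) * f t)
      = (\<lambda>t. f t * ((\<Prod>c\<in>A - set us. t - c) * (\<Prod>c\<in>A - set vs. t - c)))"
    using us' vs' by (simp add: prod.distinct_set_conv_list[symmetric] mult_ac)
  finally show ?thesis .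
qed

lemma dd2_sum:
  assumes "\<And>i c. i \<in> S \<Longrightarrow> c \<in> A \<Longrightarrow> g i differentiable (at c)"
  shows "dd2 A B (\<lambda>x. \<Sum>i\<in>S. g i x) = (\<Sum>i\<in>S. dd2 A B (g i))"
  using assms
proof (induction S rule: infinite_finite_induct)
  case (insert i S)
  then show ?case using dd2_add[of A "g i" "\<lambda>x. \<Sum>i\<in>S. g i x" B]
    by (simp add: differentiable_sum)
qed (simp_all add: dd2_def)

text \<open>\<open>dd2 A {}\<close> is linear, so its value at \<open>f\<close> times the square of
  \<open>q\<close> is a quadratic form in the coordinates of \<open>q\<close> in any family spanning
  the polynomials of degree at most \<open>n - 1\<close>.\<close>

lemma doubled_squares_iff_form:
  fixes p :: "nat \<Rightarrow> real poly"
  assumes f: "\<And>a. a \<in> A \<Longrightarrow> f differentiable (at a)"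
    and deg: "\<And>i. i < n \<Longrightarrow> degree (p i) \<le> n - 1"
    and span: "\<And>q. degree q \<le> n - 1 \<Longrightarrow> \<exists>c. \<forall>t. poly q t = (\<Sum>i<n. c i * poly (p i) t)"
  shows "(\<forall>q. degree q \<le> n - 1 \<longrightarrow> 0 \<le> dd2 A {} (\<lambda>t. f t * (poly q t)\<^sup>2)) \<longleftrightarrow>
     (\<forall>c. 0 \<le> (\<Sum>i<n. \<Sum>j<n. dd2 A {} (\<lambda>t. f t * (poly (p i) t * poly (p j) t)) * (c i * c j)))"
proof -
  have form: "dd2 A {} (\<lambda>t. f t * (\<Sum>i<n. c i * poly (p i) t)\<^sup>2)
      = (\<Sum>i<n. \<Sum>j<n. dd2 A {} (\<lambda>t. f t * (poly (p i) t * poly (p j) t)) * (c i * c j))" for c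
  proof -
    have diff: "(\<lambda>t. f t * (poly (p i) t * poly (p j) t)) differentiable (at a)" if "a \<in> A" for i j a
      by (intro differentiable_mult f that) (auto intro: poly_differentiable)
    have diff': "(\<lambda>t. (c i * c j) * (f t * (poly (p i) t * poly (p j) t))) differentiable (at a)" if "a \<in> A" for i j a
      by (rule differentiable_mult[OF differentiable_const diff[OF that]])
    have eq: "(\<lambda>t. f t * (\<Sum>i<n. c i * poly (p i) t)\<^sup>2)
        = (\<lambda>t. \<Sum>i<n. \<Sum>j<n. (c i * c j) * (f t * (poly (p i) t * poly (p j) t)))"
      by (simp add: power2_eq_square sum_product sum_distrib_left mult_ac)
    have "dd2 A {} (\<lambda>t. f t * (\<Sum>i<n. c i * poly (p i) t)\<^sup>2)
        = (\<Sum>i<n. dd2 A {} (\<lambda>t. \<Sum>j<n. (c i * c j) * (f t * (poly (p i) t * poly (p j) t))))"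
      unfolding eq by (rule dd2_sum, rule differentiable_sum) (simp, (rule ballI)?, rule diff', assumption)
    also have "\<dots> = (\<Sum>i<n. \<Sum>j<n. dd2 A {} (\<lambda>t. (c i * c j) * (f t * (poly (p i) t * poly (p j) t))))"
      by (intro sum.cong refl dd2_sum diff')
    also have "\<dots> = (\<Sum>i<n. \<Sum>j<n. dd2 A {} (\<lambda>t. f t * (poly (p i) t * poly (p j) t)) * (c i * c j))"
      by (intro sum.cong refl) (subst dd2_cmult[OF diff], auto)
    finally show ?thesis .
  qed
  show ?thesis
  proof (intro iffI allI impI)
    fix c assume L: "\<forall>q. degree q \<le> n - 1 \<longrightarrow> 0 \<le> dd2 A {} (\<lambda>t. f t * (poly q t)\<^sup>2)"
    define q where "q = (\<Sum>i<n. Polynomial.smult (c i) (p i))"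
    have "degree q \<le> n - 1"
      unfolding q_def by (rule degree_sum_le, simp, rule order_trans[OF degree_smult_le deg], simp)
    then have "0 \<le> dd2 A {} (\<lambda>t. f t * (poly q t)\<^sup>2)" using L by blast
    then show "0 \<le> (\<Sum>i<n. \<Sum>j<n. dd2 A {} (\<lambda>t. f t * (poly (p i) t * poly (p j) t)) * (c i * c j))"
      unfolding form[symmetric] by (simp add: q_def poly_sum)
  next
    fix q :: "real poly" assume R: "\<forall>c. 0 \<le> (\<Sum>i<n. \<Sum>j<n. dd2 A {} (\<lambda>t. f t * (poly (p i) t * poly (p j) t)) * (c i * c j))"
      and "degree q \<le> n - 1"
    then obtain c where "\<forall>t. poly q t = (\<Sum>i<n. c i * poly (p i) t)" using span by blast
    then show "0 \<le> dd2 A {} (\<lambda>t. f t * (poly q t)\<^sup>2)" using R form[of c] by simp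
  qed
qed

lemma lagrange_basis_spans:
  fixes q :: "real poly"
  assumes x: "inj_on x {..<n}" and n: "1 \<le> n" and q: "degree q \<le> n - 1"
  shows "\<exists>c. \<forall>t. poly q t = (\<Sum>i<n. c i * poly (\<Prod>j\<in>{..<n} - {i}. [:- x j, 1:]) t)"
proof -
  define p where "p i = (\<Prod>j\<in>{..<n} - {i}. [:- x j, 1:])" for i
  define c where "c i = poly q (x i) / poly (p i) (x i)" for i
  define r where "r = (\<Sum>i<n. Polynomial.smult (c i) (p i))"
  have pv: "poly (p i) (x k) = 0" if "i < n" "k < n" "i \<noteq> k" for i k
    using that by (auto simp: p_def poly_prod)
  have pn: "poly (p i) (x i) \<noteq> 0" if "i < n" for i
    using that x by (auto simp: p_def poly_prod inj_on_def)
  have "q = r"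
  proof (rule poly_eqI_degree[where A = "x ` {..<n}"])
    fix y assume "y \<in> x ` {..<n}"
    then obtain k where k: "k < n" "y = x k" by auto
    have "poly r y = (\<Sum>i<n. c i * poly (p i) (x k))" by (simp add: r_def poly_sum k)
    also have "\<dots> = c k * poly (p k) (x k)"
      using k pv by (subst sum.remove[of _ k]) (auto intro!: sum.neutral)
    finally show "poly q y = poly r y" using pn[OF k(1)] k by (simp add: c_def)
  next
    have "degree (p i) \<le> n - 1" if "i < n" for i
      unfolding p_def monic_prod_linear using that by simp
    then have "degree r \<le> n - 1" unfolding r_def
      by (intro degree_sum_le) (auto intro: order_trans[OF degree_smult_le])
    then show "degree r < card (x ` {..<n})" "degree q < card (x ` {..<n})"
      using x n q by (auto simp: card_image)
  qed
  then show ?thesis by (intro exI[of _ c]) (simp add: r_def p_def poly_sum)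
qed

lemma newton_basis_spans:
  fixes p :: "nat \<Rightarrow> real poly" and q :: "real poly"
  assumes "\<And>i. i < n \<Longrightarrow> degree (p i) = i" "\<And>i. i < n \<Longrightarrow> lead_coeff (p i) = 1"
    and "\<forall>i\<ge>n. coeff q i = 0"
  shows "\<exists>c. \<forall>t. poly q t = (\<Sum>i<n. c i * poly (p i) t)"
  using assms
proof (induction n arbitrary: q)
  case 0
  then have "q = 0" by (intro poly_eqI) simp
  then show ?case by simp
next
  case (Suc n)
  define q' where "q' = q - Polynomial.smult (coeff q n) (p n)"
  have "coeff q' i = 0" if "n \<le> i" for i
  proof (cases "i = n")
    case True
    then show ?thesis using Suc.prems(1,2)[of n] by (simp add: q'_def)
  next
    case False
    then have "coeff (p n) i = 0" using Suc.prems(1)[of n] that by (intro coeff_eq_0) simp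
    then show ?thesis using Suc.prems(3) that False by (simp add: q'_def)
  qed
  then obtain c where c: "\<forall>t. poly q' t = (\<Sum>i<n. c i * poly (p i) t)" using Suc by (metis less_SucI)
  have "poly q t = (\<Sum>i<Suc n. (c(n := coeff q n)) i * poly (p i) t)" for t
  proof -
    have "(\<Sum>i<n. (c(n := coeff q n)) i * poly (p i) t) = (\<Sum>i<n. c i * poly (p i) t)"
      by (intro sum.cong) auto
    moreover have "poly q t = poly q' t + coeff q n * poly (p n) t" by (simp add: q'_def)
    ultimately show ?thesis using c by simp
  qed
  then show ?case by blast
qed

section \<open>Adjoints and real quadratic forms\<close>

lemma mat_adjoint_index:
  assumes "i < dim_col A" "j < dim_row A"
  shows "mat_adjoint A $$ (i, j) = conjugate (A $$ (j, i))"
  using assms by (simp add: mat_adjoint_def mat_of_rows_def)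

lemma mat_adjoint_dim [simp]: "dim_row (mat_adjoint A) = dim_col A" "dim_col (mat_adjoint A) = dim_row A"
  by (simp_all add: mat_adjoint_def)

lemma psd_mat_real_iff:
  fixes m :: "nat \<Rightarrow> nat \<Rightarrow> real"
  assumes sym: "\<And>i j. i < n \<Longrightarrow> j < n \<Longrightarrow> m i j = m j i"
  shows "psd_mat (Matrix.mat n n (\<lambda>(i, j). m i j)) \<longleftrightarrow> (\<forall>c. 0 \<le> (\<Sum>i<n. \<Sum>j<n. m i j * (c i * c j)))"
proof -
  let ?M = "Matrix.mat n n (\<lambda>(i, j). m i j)"
  have herm: "hermitian_mat ?M"
    unfolding hermitian_mat_def
    by (auto intro!: eq_matI simp: mat_adjoint_index sym)
  have form: "(?M *\<^sub>v v) \<bullet>c v = (\<Sum>i<n. \<Sum>j<n. m i j * (vec_index v i * vec_index v j))" if "v \<in> carrier_vec n" for v :: "real Matrix.vec"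
    using that by (simp add: scalar_prod_def sum_distrib_right sum_distrib_left atLeast0LessThan mult_ac)
  have "(\<forall>v \<in> carrier_vec n. 0 \<le> (?M *\<^sub>v v) \<bullet>c v) \<longleftrightarrow> (\<forall>c. 0 \<le> (\<Sum>i<n. \<Sum>j<n. m i j * (c i * c j)))"
  proof (intro iffI allI ballI)
    fix c assume L: "\<forall>v \<in> carrier_vec n. 0 \<le> (?M *\<^sub>v v) \<bullet>c v"
    have "0 \<le> (?M *\<^sub>v Matrix.vec n c) \<bullet>c Matrix.vec n c" using L by simp
    also have "\<dots> = (\<Sum>i<n. \<Sum>j<n. m i j * (vec_index (Matrix.vec n c) i * vec_index (Matrix.vec n c) j))"
      by (rule form) simp
    also have "\<dots> = (\<Sum>i<n. \<Sum>j<n. m i j * (c i * c j))" by (intro sum.cong) auto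
    finally show "0 \<le> \<dots>" .
  next
    fix v :: "real Matrix.vec" assume "\<forall>c. 0 \<le> (\<Sum>i<n. \<Sum>j<n. m i j * (c i * c j))" and v: "v \<in> carrier_vec n"
    then have "0 \<le> (\<Sum>i<n. \<Sum>j<n. m i j * (vec_index v i * vec_index v j))" by blast
    then show "0 \<le> (?M *\<^sub>v v) \<bullet>c v" by (simp only: form[OF v])
  qed
  then show ?thesis unfolding psd_mat_def using herm by simp
qed

section \<open>Spectral theorem for Hermitian matrices\<close>

lemma mat_mult_index:
  assumes "A \<in> carrier_mat n m" "B \<in> carrier_mat m k" "i < n" "j < k"
  shows "(A * B) $$ (i, j) = (\<Sum>l<m. A $$ (i, l) * B $$ (l, j))"
  using assms by (auto simp: scalar_prod_def atLeast0LessThan intro!: sum.cong)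

lemma mat_adjoint_carrier: "A \<in> carrier_mat n m \<Longrightarrow> mat_adjoint A \<in> carrier_mat m n"
  by auto

lemma mat_adjoint_mult:
  fixes A B :: "complex mat"
  assumes A: "A \<in> carrier_mat n m" and B: "B \<in> carrier_mat m k"
  shows "mat_adjoint (A * B) = mat_adjoint B * mat_adjoint A"
proof (rule eq_matI)
  fix i j assume "i < dim_row (mat_adjoint B * mat_adjoint A)" "j < dim_col (mat_adjoint B * mat_adjoint A)"
  then have ij: "i < k" "j < n" using A B by auto
  have "mat_adjoint (A * B) $$ (i, j) = conjugate ((A * B) $$ (j, i))"
    using A B ij by (intro mat_adjoint_index) auto
  also have "\<dots> = (\<Sum>l<m. cnj (A $$ (j, l)) * cnj (B $$ (l, i)))"
    by (simp add: mat_mult_index[OF A B ij(2,1)])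
  also have "\<dots> = (\<Sum>l<m. mat_adjoint B $$ (i, l) * mat_adjoint A $$ (l, j))"
    using A B ij by (intro sum.cong refl) (auto simp: mat_adjoint_index)
  also have "\<dots> = (mat_adjoint B * mat_adjoint A) $$ (i, j)"
    by (rule mat_mult_index[symmetric, OF mat_adjoint_carrier[OF B] mat_adjoint_carrier[OF A] ij])
  finally show "mat_adjoint (A * B) $$ (i, j) = (mat_adjoint B * mat_adjoint A) $$ (i, j)" .
qed (use A B in auto)

definition unitary_diag :: "nat \<Rightarrow> complex mat \<Rightarrow> (nat \<Rightarrow> real) \<Rightarrow> complex mat" where
  "unitary_diag n U d = U * mat_diag n (\<lambda>i. complex_of_real (d i)) * mat_adjoint U"

lemma unitary_diag_carrier: "U \<in> carrier_mat n n \<Longrightarrow> unitary_diag n U d \<in> carrier_mat n n"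
  unfolding unitary_diag_def by (auto intro!: mult_carrier_mat mat_adjoint_carrier)

lemma unitary_diag_index:
  assumes U: "U \<in> carrier_mat n n" and ij: "i < n" "j < n"
  shows "unitary_diag n U d $$ (i, j) = (\<Sum>k<n. U $$ (i, k) * of_real (d k) * cnj (U $$ (j, k)))"
proof -
  have "U * mat_diag n (\<lambda>i. complex_of_real (d i)) = Matrix.mat n n (\<lambda>(i, j). U $$ (i, j) * complex_of_real (d j))"
    by (rule mat_diag_mult_right[OF U])
  then have "unitary_diag n U d $$ (i, j)
      = (\<Sum>k<n. Matrix.mat n n (\<lambda>(i, j). U $$ (i, j) * complex_of_real (d j)) $$ (i, k) * mat_adjoint U $$ (k, j))"
    unfolding unitary_diag_def using U ij by (subst mat_mult_index[where n = n and m = n and k = n]) (auto intro: mat_adjoint_carrier)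
  also have "\<dots> = (\<Sum>k<n. U $$ (i, k) * of_real (d k) * cnj (U $$ (j, k)))"
    using U ij by (intro sum.cong refl) (auto simp: mat_adjoint_index)
  finally show ?thesis .
qed

lemma unitary_matD:
  assumes U: "U \<in> carrier_mat n n" and "unitary_mat U"
  shows "U * mat_adjoint U = 1\<^sub>m n" "mat_adjoint U * U = 1\<^sub>m n"
proof -
  show 1: "U * mat_adjoint U = 1\<^sub>m n" using assms by (simp add: unitary_mat_def)
  show "mat_adjoint U * U = 1\<^sub>m n"
    by (rule mat_mult_left_right_inverse[OF U mat_adjoint_carrier[OF U] 1])
qed

lemma unitary_mat_mult:
  assumes U: "U \<in> carrier_mat n n" "unitary_mat U" and V: "V \<in> carrier_mat n n" "unitary_mat V"
  shows "unitary_mat (U * V)"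
proof -
  note c = mat_adjoint_carrier[OF U(1)] mat_adjoint_carrier[OF V(1)] U(1) V(1)
  have "(U * V) * mat_adjoint (U * V) = U * (V * (mat_adjoint V * mat_adjoint U))"
    unfolding mat_adjoint_mult[OF U(1) V(1)] by (rule assoc_mult_mat[OF c(3) c(4) mult_carrier_mat[OF c(2) c(1)]])
  also have "V * (mat_adjoint V * mat_adjoint U) = (V * mat_adjoint V) * mat_adjoint U"
    by (rule assoc_mult_mat[symmetric, OF c(4) c(2) c(1)])
  also have "\<dots> = mat_adjoint U" using unitary_matD(1)[OF V] c by simp
  also have "U * mat_adjoint U = 1\<^sub>m n" by (rule unitary_matD(1)[OF U])
  finally show ?thesis using U V by (simp add: unitary_mat_def)
qed

lemma unitary_diag_conj:
  assumes W: "W \<in> carrier_mat n n" and U: "U \<in> carrier_mat n n"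
  shows "unitary_diag n (W * U) d = W * unitary_diag n U d * mat_adjoint W"
proof -
  let ?D = "mat_diag n (\<lambda>i. complex_of_real (d i))"
  note c = W U mat_adjoint_carrier[OF W] mat_adjoint_carrier[OF U]
  note asc = assoc_mult_mat[of _ n n _ n _ n] and cm = mult_carrier_mat[of _ n n _ n]
  have "unitary_diag n (W * U) d = W * U * ?D * (mat_adjoint U * mat_adjoint W)"
    unfolding unitary_diag_def mat_adjoint_mult[OF W U] ..
  also have "\<dots> = W * U * ?D * mat_adjoint U * mat_adjoint W"
    by (intro asc[symmetric] cm c mat_diag_dim)
  also have "W * U * ?D * mat_adjoint U = W * (U * ?D * mat_adjoint U)"
  proof -
    have "W * U * ?D = W * (U * ?D)" by (intro asc c mat_diag_dim)
    then show ?thesis by (simp only:) (intro asc cm c mat_diag_dim)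
  qed
  finally show ?thesis by (simp add: unitary_diag_def)
qed

text \<open>The reflection along \<open>w\<close>, the difference of \<open>u\<close> and the first
  basis vector, exchanges these two unit vectors because \<open>u 0\<close> is real. The number
  \<open>c\<close> is the squared length of \<open>w\<close>, and \<open>r \<le> 0\<close> keeps it
  from being zero.\<close>

lemma householder:
  fixes u :: "nat \<Rightarrow> complex"
  assumes n: "0 < n" and u: "(\<Sum>i<n. (cmod (u i))\<^sup>2) = 1" and u0: "u 0 = of_real r" "r \<le> 0"
  obtains W where "W \<in> carrier_mat n n" "mat_adjoint W = W" "W * W = 1\<^sub>m n" "\<forall>i<n. W $$ (i, 0) = u i"
proof -
  define w where "w i = u i - (if i = 0 then 1 else 0)" for i
  define c where "c = 2 - 2 * r"
  have c: "c \<noteq> 0" using u0 by (simp add: c_def)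
  have sw: "(\<Sum>i<n. w i * cnj (w i)) = of_real c"
  proof -
    have "(\<Sum>i<n. w i * cnj (w i)) = (\<Sum>i<n. u i * cnj (u i) + (if i = 0 then 1 - u 0 - cnj (u 0) else 0))"
      by (intro sum.cong refl) (auto simp: w_def algebra_simps)
    also have "\<dots> = (\<Sum>i<n. u i * cnj (u i)) + (1 - u 0 - cnj (u 0))"
      using n by (simp add: sum.distrib sum.delta)
    also have "(\<Sum>i<n. u i * cnj (u i)) = of_real (\<Sum>i<n. (cmod (u i))\<^sup>2)"
      unfolding of_real_sum complex_norm_square[symmetric] by simp
    finally show ?thesis by (simp add: u u0 c_def)
  qed
  define W where "W = Matrix.mat n n (\<lambda>(i, j). (if i = j then 1 else 0) - 2 * w i * cnj (w j) / of_real c)"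
  have Wc: "W \<in> carrier_mat n n" by (simp add: W_def)
  have "mat_adjoint W = W"
    by (rule eq_matI) (auto simp: mat_adjoint_index W_def)
  moreover have "W * W = 1\<^sub>m n"
  proof (rule eq_matI)
    fix i j assume "i < dim_row (1\<^sub>m n)" "j < dim_col (1\<^sub>m n)"
    then have ij: "i < n" "j < n" by auto
    have "(W * W) $$ (i, j) = (\<Sum>k<n. W $$ (i, k) * W $$ (k, j))" by (rule mat_mult_index[OF Wc Wc ij])
    also have "\<dots> = (\<Sum>k<n. (if i = k then (if k = j then 1 else 0) - 2 * w k * cnj (w j) / of_real c else 0)
        + (if k = j then - (2 * w i * cnj (w k) / of_real c) else 0)
        + (4 * w i * cnj (w j) / (of_real c)\<^sup>2) * (w k * cnj (w k)))"
      using ij c by (intro sum.cong refl) (auto simp: W_def field_simps power2_eq_square)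
    also have "\<dots> = ((if i = j then 1 else 0) - 2 * w i * cnj (w j) / of_real c)
        + (- (2 * w i * cnj (w j) / of_real c)) + (4 * w i * cnj (w j) / (of_real c)\<^sup>2) * (\<Sum>k<n. w k * cnj (w k))"
      using ij by (simp add: sum.distrib sum.delta sum_distrib_left)
    also have "\<dots> = (if i = j then 1 else 0)"
      unfolding sw using c by (simp add: power2_eq_square field_simps)
    finally show "(W * W) $$ (i, j) = 1\<^sub>m n $$ (i, j)" using ij by simp
  qed (use Wc in auto)
  moreover have "W $$ (i, 0) = u i" if "i < n" for i
  proof -
    have "2 * cnj (w 0) / of_real c = - 1"
    proof -
      have "2 * cnj (w 0) = - of_real c" by (simp add: w_def u0 c_def algebra_simps)
      then show ?thesis using c by simp
    qed
    then have "w i * (2 * cnj (w 0) / of_real c) = w i * - 1" by (rule arg_cong)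
    then have "2 * w i * cnj (w 0) / of_real c = - w i" by (simp add: mult_ac)
    moreover have "W $$ (i, 0) = (if i = 0 then 1 else 0) - 2 * w i * cnj (w 0) / of_real c"
      using that n by (simp add: W_def)
    ultimately show ?thesis by (simp add: w_def)
  qed
  ultimately show thesis using that Wc by blast
qed

lemma unit_eigenvector_exists:
  fixes A :: "complex mat"
  assumes A: "A \<in> carrier_mat n n" and n: "0 < n"
  obtains u :: "nat \<Rightarrow> complex" and \<mu> r where "(\<Sum>i<n. (cmod (u i))\<^sup>2) = 1" "u 0 = of_real r" "r \<le> 0"
    "\<forall>i<n. (\<Sum>j<n. A $$ (i, j) * u j) = \<mu> * u i"
proof -
  obtain \<mu> v where v: "v \<in> carrier_vec n" "v \<noteq> 0\<^sub>v n" "A *\<^sub>v v = \<mu> \<cdot>\<^sub>v v"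
    using spectrum_non_empty[OF A n] A unfolding spectrum_def eigenvalue_def eigenvector_def by auto
  define x where "x = vec_index v"
  have Ax: "(\<Sum>j<n. A $$ (i, j) * x j) = \<mu> * x i" if i: "i < n" for i
  proof -
    have "vec_index (A *\<^sub>v v) i = (\<Sum>j<n. A $$ (i, j) * x j)"
      using A v(1) i by (auto simp: scalar_prod_def x_def atLeast0LessThan intro!: sum.cong)
    then show ?thesis unfolding v(3) using v(1) i by (simp add: x_def)
  qed
  define N where "N = sqrt (\<Sum>i<n. (cmod (x i))\<^sup>2)"
  have "\<exists>i<n. x i \<noteq> 0"
  proof (rule ccontr)
    assume "\<not> ?thesis"
    then have "v = 0\<^sub>v n" using v(1) by (intro eq_vecI) (auto simp: x_def)
    then show False using v(2) by simp
  qed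
  then have "0 < (\<Sum>i<n. (cmod (x i))\<^sup>2)" by (auto intro!: sum_pos2)
  then have N: "0 < N" "N\<^sup>2 = (\<Sum>i<n. (cmod (x i))\<^sup>2)" by (simp_all add: N_def)
  \<comment> \<open>A phase that makes the first coordinate real and non-positive, as
    \<open>householder\<close> requires.\<close>
  define \<theta> where "\<theta> = (if x 0 = 0 then 1 else - cnj (x 0) / of_real (cmod (x 0)))"
  have \<theta>: "cmod \<theta> = 1" by (simp add: \<theta>_def norm_divide)
  define u where "u i = \<theta> * x i / of_real N" for i
  have "(\<Sum>i<n. (cmod (u i))\<^sup>2) = (\<Sum>i<n. (cmod (x i))\<^sup>2) / N\<^sup>2"
    using N(1) \<theta> by (simp add: u_def norm_mult norm_divide power_divide sum_divide_distrib)
  then have "(\<Sum>i<n. (cmod (u i))\<^sup>2) = 1" unfolding N(2)[symmetric] using N(1) by simp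
  moreover have "u 0 = of_real (- cmod (x 0) / N)"
  proof (cases "x 0 = 0")
    case False
    have "cnj (x 0) * x 0 = of_real (cmod (x 0)) * of_real (cmod (x 0))"
      using complex_norm_square[of "x 0"] by (simp add: power2_eq_square mult.commute)
    then show ?thesis using False by (simp add: u_def \<theta>_def)
  qed (simp add: u_def)
  moreover have "- cmod (x 0) / N \<le> 0" using N by simp
  moreover have "(\<Sum>j<n. A $$ (i, j) * u j) = \<mu> * u i" if "i < n" for i
  proof -
    have "(\<Sum>j<n. A $$ (i, j) * u j) = \<theta> / of_real N * (\<Sum>j<n. A $$ (i, j) * x j)"
      by (simp add: u_def sum_distrib_left mult_ac)
    then show ?thesis by (simp add: Ax[OF that] u_def)
  qed
  ultimately show thesis using that by blast
qed

text \<open>Deflation: a reflection carries the first basis vector to a unit eigenvector. In the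
  transformed matrix the first column, and by Hermitian symmetry the first row, vanish off the
  diagonal, and the remaining block is treated by induction.\<close>

theorem hermitian_unitary_diagonalization:
  assumes "A \<in> carrier_mat n n" "mat_adjoint A = A"
  shows "\<exists>U d. U \<in> carrier_mat n n \<and> unitary_mat U \<and> A = unitary_diag n U d"
  using assms
proof (induction n arbitrary: A)
  case 0
  then show ?case
    by (intro exI[of _ A]) (auto simp: unitary_mat_def unitary_diag_def intro!: eq_matI)
next
  case (Suc m)
  let ?n = "Suc m"
  note A = Suc.prems(1)
  have Aij: "A $$ (j, i) = cnj (A $$ (i, j))" if "i < ?n" "j < ?n" for i j
    using mat_adjoint_index[of j A i] Suc.prems that by (auto simp: mat_adjoint_def)
  obtain u \<mu> r where u: "(\<Sum>i<?n. (cmod (u i))\<^sup>2) = 1" "u 0 = of_real r" "r \<le> 0"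
    "\<forall>i<?n. (\<Sum>j<?n. A $$ (i, j) * u j) = \<mu> * u i"
    by (rule unit_eigenvector_exists[OF A zero_less_Suc])
  obtain W where W: "W \<in> carrier_mat ?n ?n" "mat_adjoint W = W" "W * W = 1\<^sub>m ?n" "\<forall>i<?n. W $$ (i, 0) = u i"
    by (rule householder[OF zero_less_Suc u(1,2,3)])
  note asc = assoc_mult_mat[of _ ?n ?n _ ?n _ ?n] and cm = mult_carrier_mat[of _ ?n ?n _ ?n]
  define B where "B = W * A * W"
  have B: "B \<in> carrier_mat ?n ?n" using A W by (simp add: B_def)
  have adjB: "mat_adjoint B = B"
  proof -
    have "mat_adjoint B = W * (A * W)"
      unfolding B_def using mat_adjoint_mult[of "W * A" ?n ?n W ?n] mat_adjoint_mult[OF W(1) A] W A Suc.prems(2) by simp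
    also have "\<dots> = B" unfolding B_def by (intro asc[symmetric] cm W(1) A)
    finally show ?thesis .
  qed
  have Bij: "B $$ (j, i) = cnj (B $$ (i, j))" if "i < ?n" "j < ?n" for i j
    using mat_adjoint_index[of j B i] adjB B that by auto
  have B0: "B $$ (i, 0) = (if i = 0 then \<mu> else 0)" if i: "i < ?n" for i
  proof -
    have "B = W * (A * W)" unfolding B_def by (intro asc cm W(1) A)
    then have "B $$ (i, 0) = (\<Sum>k<?n. W $$ (i, k) * (A * W) $$ (k, 0))"
      using mat_mult_index[of W ?n ?n "A * W" ?n i 0] W A i by auto
    also have "\<dots> = (\<Sum>k<?n. W $$ (i, k) * (\<mu> * W $$ (k, 0)))"
    proof (intro sum.cong refl)
      fix k assume "k \<in> {..<?n}"
      then have k: "k < ?n" by simp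
      have "(A * W) $$ (k, 0) = (\<Sum>j<?n. A $$ (k, j) * W $$ (j, 0))"
        by (rule mat_mult_index[OF A W(1) k]) simp
      also have "\<dots> = (\<Sum>j<?n. A $$ (k, j) * u j)" using W(4) by (intro sum.cong) auto
      finally show "W $$ (i, k) * (A * W) $$ (k, 0) = W $$ (i, k) * (\<mu> * W $$ (k, 0))" using u(4)[rule_format, OF k] W(4)[rule_format, OF k] by simp
    qed
    also have "\<dots> = \<mu> * (\<Sum>k<?n. W $$ (i, k) * W $$ (k, 0))" by (simp add: sum_distrib_left mult_ac del: sum.lessThan_Suc)
    also have "(\<Sum>k<?n. W $$ (i, k) * W $$ (k, 0)) = (W * W) $$ (i, 0)"
      by (rule mat_mult_index[symmetric, OF W(1) W(1) i]) simp
    finally show ?thesis using W(3) i by simp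
  qed
  have "\<mu> = of_real (Re \<mu>)" using Bij[of 0 0] B0[of 0] by (simp add: complex_eq_iff)
  then obtain \<nu> where \<nu>: "\<mu> = of_real \<nu>" by blast
  have B0': "B $$ (0, i) = (if i = 0 then \<mu> else 0)" if "i < ?n" for i
    using Bij[of i 0] B0[OF that] that \<nu> by simp
  define C where "C = Matrix.mat m m (\<lambda>(i, j). B $$ (Suc i, Suc j))"
  have "C \<in> carrier_mat m m" by (simp add: C_def)
  moreover have "mat_adjoint C = C"
  proof (rule eq_matI)
    fix i j assume "i < dim_row C" "j < dim_col C"
    then have ij: "i < m" "j < m" by (auto simp: C_def)
    then show "mat_adjoint C $$ (i, j) = C $$ (i, j)"
      using Bij[of "Suc j" "Suc i"] by (simp add: mat_adjoint_index C_def)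
  qed (simp_all add: C_def)
  ultimately obtain V e where V: "V \<in> carrier_mat m m" "unitary_mat V" "C = unitary_diag m V e"
    using Suc.IH by blast
  \<comment> \<open>The diagonalisation of the block, extended by 1 in the first corner.\<close>
  define V' where "V' = Matrix.mat ?n ?n (\<lambda>(i, j). if i = 0 \<and> j = 0 then 1 else if i = 0 \<or> j = 0 then 0 else V $$ (i - 1, j - 1))"
  define e' where "e' k = (case k of 0 \<Rightarrow> \<nu> | Suc k \<Rightarrow> e k)" for k
  have V'c: "V' \<in> carrier_mat ?n ?n" by (simp add: V'_def)
  have V'0: "V' $$ (0, k) = (if k = 0 then 1 else 0)" "V' $$ (k, 0) = (if k = 0 then 1 else 0)" if "k < ?n" for k
    using that by (auto simp: V'_def)
  have V'S: "V' $$ (Suc i, Suc j) = V $$ (i, j)" if "i < m" "j < m" for i j using that by (simp add: V'_def)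
  have "unitary_mat V'"
    unfolding unitary_mat_def
  proof (intro conjI)
    show "V' * mat_adjoint V' = 1\<^sub>m (dim_row V')"
    proof (rule eq_matI)
      fix i j assume "i < dim_row (1\<^sub>m (dim_row V'))" "j < dim_col (1\<^sub>m (dim_row V'))"
      then have ij: "i < ?n" "j < ?n" using V'c by auto
      have "(V' * mat_adjoint V') $$ (i, j) = (\<Sum>k<?n. V' $$ (i, k) * cnj (V' $$ (j, k)))"
        using V'c ij by (subst mat_mult_index[OF V'c mat_adjoint_carrier[OF V'c] ij]) (auto simp: mat_adjoint_index intro!: sum.cong)
      also have "\<dots> = V' $$ (i, 0) * cnj (V' $$ (j, 0)) + (\<Sum>k<m. V' $$ (i, Suc k) * cnj (V' $$ (j, Suc k)))"
        by (rule sum.lessThan_Suc_shift)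
      also have "\<dots> = (if i = j then 1 else 0)"
      proof (cases i; cases j)
        fix i' j' assume S: "i = Suc i'" "j = Suc j'"
        then have ij': "i' < m" "j' < m" using ij by auto
        have "(\<Sum>k<m. V $$ (i', k) * cnj (V $$ (j', k))) = (V * mat_adjoint V) $$ (i', j')"
          using V(1) ij' by (subst mat_mult_index[OF V(1) mat_adjoint_carrier[OF V(1)] ij']) (auto simp: mat_adjoint_index intro!: sum.cong)
        also have "\<dots> = (if i' = j' then 1 else 0)" using unitary_matD(1)[OF V(1,2)] ij' by simp
        finally show ?thesis using S ij' V'0(2)[of i] V'0(2)[of j] ij by (simp add: V'S)
      qed (use ij V'0 in auto)
      finally show "(V' * mat_adjoint V') $$ (i, j) = 1\<^sub>m (dim_row V') $$ (i, j)" using ij V'c by simp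
    qed (use V'c in auto)
  qed (use V'c in auto)
  moreover have BV: "B = unitary_diag ?n V' e'"
  proof (rule eq_matI)
    fix i j assume "i < dim_row (unitary_diag ?n V' e')" "j < dim_col (unitary_diag ?n V' e')"
    then have ij: "i < ?n" "j < ?n" using unitary_diag_carrier[OF V'c, of e'] by auto
    have "unitary_diag ?n V' e' $$ (i, j) = V' $$ (i, 0) * of_real (e' 0) * cnj (V' $$ (j, 0))
        + (\<Sum>k<m. V' $$ (i, Suc k) * of_real (e' (Suc k)) * cnj (V' $$ (j, Suc k)))"
      unfolding unitary_diag_index[OF V'c ij] by (rule sum.lessThan_Suc_shift)
    also have "\<dots> = B $$ (i, j)"
    proof (cases i; cases j)
      fix i' j' assume S: "i = Suc i'" "j = Suc j'"
      then have ij': "i' < m" "j' < m" using ij by auto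
      have "B $$ (i, j) = C $$ (i', j')" using S ij' by (simp add: C_def)
      also have "\<dots> = (\<Sum>k<m. V $$ (i', k) * of_real (e k) * cnj (V $$ (j', k)))"
        unfolding V(3) by (rule unitary_diag_index[OF V(1) ij'])
      finally show ?thesis using S ij' V'0(2)[of i] V'0(2)[of j] ij by (simp add: V'S e'_def)
    qed (use ij V'0 B0 B0' \<nu> in \<open>auto simp: e'_def\<close>)
    finally show "B $$ (i, j) = unitary_diag ?n V' e' $$ (i, j)" by simp
  qed (use B unitary_diag_carrier[OF V'c, of e'] in auto)
  moreover have "A = W * B * W"
  proof -
    have "W * B * W = W * (W * (A * W)) * W"
      unfolding B_def asc[OF W(1) A W(1)] ..
    also have "W * (W * (A * W)) = (W * W) * (A * W)"
      by (intro asc[symmetric] cm W(1) A)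
    also have "\<dots> = A * W" using W A by simp
    also have "A * W * W = A * (W * W)" by (intro asc cm W(1) A)
    finally show ?thesis using W A by simp
  qed
  moreover have "unitary_mat W" using W by (simp add: unitary_mat_def)
  ultimately have "unitary_mat (W * V')" "A = unitary_diag ?n (W * V') e'"
    using unitary_mat_mult[OF W(1) _ V'c] unitary_diag_conj[OF W(1) V'c, of e'] W(2) by auto
  then show ?case using W(1) V'c by (intro exI[of _ "W * V'"] exI[of _ e']) auto
qed

text \<open>The unitary \<open>W\<close> between the two bases intertwines the diagonal matrices, so
  \<open>W $$ (i, j)\<close> vanishes unless \<open>e i = d j\<close>. It then intertwines their
  images under \<open>f\<close> as well. This makes \<open>mat_fun\<close> well defined.\<close>

lemma unitary_diag_fun_unique:
  assumes U: "U \<in> carrier_mat n n" "unitary_mat U" and V: "V \<in> carrier_mat n n" "unitary_mat V"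
    and eq: "unitary_diag n U d = unitary_diag n V e"
  shows "unitary_diag n U (\<lambda>i. f (d i)) = unitary_diag n V (\<lambda>i. f (e i))"
proof -
  let ?D = "\<lambda>d. mat_diag n (\<lambda>i. complex_of_real (d i))"
  note U' = mat_adjoint_carrier[OF U(1)] and V' = mat_adjoint_carrier[OF V(1)]
  note asc = assoc_mult_mat[of _ n n _ n _ n]
  note cm = mult_carrier_mat[of _ n n _ n] and c = U(1) V(1) U' V'
  define W where "W = mat_adjoint V * U"
  have W: "W \<in> carrier_mat n n" using U V' by (simp add: W_def)
  have VW: "V * W = U"
    unfolding W_def asc[OF V(1) V' U(1), symmetric] unitary_matD(1)[OF V] by (rule left_mult_one_mat[OF U(1)])
  have WU: "W * mat_adjoint U = mat_adjoint V"
    unfolding W_def asc[OF V' U(1) U'] unitary_matD(1)[OF U] by (rule right_mult_one_mat[OF V'])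
  have "?D e * W = W * ?D d"
  proof -
    have "W * ?D d = mat_adjoint V * (U * ?D d * (mat_adjoint U * U))"
    proof -
      have "U * ?D d * 1\<^sub>m n = U * ?D d"
        by (rule right_mult_one_mat[OF mult_carrier_mat[OF U(1) mat_diag_dim]])
      then show ?thesis
        unfolding W_def unitary_matD(2)[OF U] by (simp only:) (rule asc[OF V' U(1) mat_diag_dim])
    qed
    also have "U * ?D d * (mat_adjoint U * U) = unitary_diag n U d * U"
      unfolding unitary_diag_def by (intro asc[symmetric] cm c W mat_diag_dim)
    also have "\<dots> = V * ?D e * (mat_adjoint V * U)"
      unfolding eq unfolding unitary_diag_def by (intro asc cm c W mat_diag_dim)
    also have "mat_adjoint V * \<dots> = mat_adjoint V * (V * ?D e) * W"
      unfolding W_def[symmetric] by (intro asc[symmetric] cm c W mat_diag_dim)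
    also have "mat_adjoint V * (V * ?D e) = (mat_adjoint V * V) * ?D e" by (intro asc[symmetric] cm c W mat_diag_dim)
    also have "\<dots> = ?D e" unfolding unitary_matD(2)[OF V] by (rule left_mult_one_mat[OF mat_diag_dim])
    finally show ?thesis by simp
  qed
  then have entry: "of_real (e i) * W $$ (i, j) = W $$ (i, j) * of_real (d j)" if "i < n" "j < n" for i j
    unfolding mat_diag_mult_left[OF W] mat_diag_mult_right[OF W]
    using that by (auto dest!: arg_cong[where f = "\<lambda>M. M $$ (i, j)"])
  have fW: "?D (\<lambda>i. f (e i)) * W = W * ?D (\<lambda>i. f (d i))"
    unfolding mat_diag_mult_left[OF W] mat_diag_mult_right[OF W]
  proof (rule eq_matI)
    fix i j assume "i < dim_row (Matrix.mat n n (\<lambda>(i, j). W $$ (i, j) * complex_of_real (f (d j))))"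
      "j < dim_col (Matrix.mat n n (\<lambda>(i, j). W $$ (i, j) * complex_of_real (f (d j))))"
    then have ij: "i < n" "j < n" by auto
    have "W $$ (i, j) = 0 \<or> e i = d j" using entry[OF ij] by auto
    then show "Matrix.mat n n (\<lambda>(i, j). complex_of_real (f (e i)) * W $$ (i, j)) $$ (i, j) =
        Matrix.mat n n (\<lambda>(i, j). W $$ (i, j) * complex_of_real (f (d j))) $$ (i, j)" using ij by auto
  qed auto
  have "unitary_diag n U (\<lambda>i. f (d i)) = V * W * ?D (\<lambda>i. f (d i)) * mat_adjoint U"
    by (simp add: unitary_diag_def VW)
  also have "V * W * ?D (\<lambda>i. f (d i)) = V * (?D (\<lambda>i. f (e i)) * W)"
    unfolding fW by (intro asc cm c W mat_diag_dim)
  also have "\<dots> = V * ?D (\<lambda>i. f (e i)) * W" by (intro asc[symmetric] cm c W mat_diag_dim)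
  also have "\<dots> * mat_adjoint U = V * ?D (\<lambda>i. f (e i)) * (W * mat_adjoint U)" by (intro asc cm c W mat_diag_dim)
  finally show ?thesis by (simp add: unitary_diag_def WU)
qed

lemma mat_fun_unitary_diag:
  assumes U: "U \<in> carrier_mat n n" "unitary_mat U"
  shows "mat_fun f (unitary_diag n U d) = unitary_diag n U (\<lambda>i. f (d i))"
proof -
  have dim: "dim_row (unitary_diag n U d) = n" using unitary_diag_carrier[OF U(1)] by auto
  show ?thesis
    unfolding mat_fun_def Let_def dim unitary_diag_def[symmetric]
  proof (rule the_equality)
    show "\<exists>V e. V \<in> carrier_mat n n \<and> unitary_mat V \<and> unitary_diag n U d = unitary_diag n V e \<and>
        unitary_diag n U (\<lambda>i. f (d i)) = unitary_diag n V (\<lambda>i. f (e i))" using U by blast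
    fix F assume "\<exists>V e. V \<in> carrier_mat n n \<and> unitary_mat V \<and> unitary_diag n U d = unitary_diag n V e \<and>
        F = unitary_diag n V (\<lambda>i. f (e i))"
    then show "F = unitary_diag n U (\<lambda>i. f (d i))" using unitary_diag_fun_unique[OF U] by metis
  qed
qed

section \<open>The secular equation of a rank-one perturbation\<close>

lemma degree_diff_monic_less:
  fixes p q :: "real poly"
  assumes "degree p = n" "degree q = n" "lead_coeff p = 1" "lead_coeff q = 1" "0 < n"
  shows "degree (p - q) < n"
proof (rule degree_lessI)
  show "\<forall>k\<ge>n. coeff (p - q) k = 0"
  proof (intro allI impI)
    fix k assume "n \<le> k"
    then show "coeff (p - q) k = 0"
      using assms by (cases "k = n") (auto simp: coeff_eq_0)
  qed
qed (use assms in simp)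

text \<open>The numbers \<open>m k\<close> are the eigenvalues of the diagonal matrix with entries \<open>l i\<close>
  perturbed by the rank-one matrix \<open>v i * v j\<close>.\<close>

locale secular =
  fixes n :: nat and l m v :: "nat \<Rightarrow> real"
  assumes l_inj: "inj_on l {..<n}" and m_inj: "inj_on m {..<n}"
    and l_neq_m: "\<And>i k. i < n \<Longrightarrow> k < n \<Longrightarrow> m k \<noteq> l i"
    and secular_eq: "\<And>k. k < n \<Longrightarrow> (\<Sum>i<n. (v i)\<^sup>2 / (m k - l i)) = 1"
begin

definition P :: "real poly" where "P = (\<Prod>i<n. [:- l i, 1:])"
definition Q :: "real poly" where "Q = (\<Prod>i<n. [:- m i, 1:])"
definition P_del :: "nat \<Rightarrow> real poly" where "P_del i = (\<Prod>j\<in>{..<n} - {i}. [:- l j, 1:])"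
definition Q_del :: "nat \<Rightarrow> real poly" where "Q_del i = (\<Prod>j\<in>{..<n} - {i}. [:- m j, 1:])"
text \<open>The squared length of the eigenvector for \<open>m k\<close> with entries
  \<open>v i / (m k - l i)\<close>.\<close>

definition N :: "nat \<Rightarrow> real" where "N k = (\<Sum>i<n. (v i)\<^sup>2 / (m k - l i)\<^sup>2)"

lemma P_remove: "i < n \<Longrightarrow> P = [:- l i, 1:] * P_del i"
  and Q_remove: "i < n \<Longrightarrow> Q = [:- m i, 1:] * Q_del i"
  unfolding P_def Q_def P_del_def Q_del_def by (rule prod.remove; simp)+

lemma poly_P_del: "i < n \<Longrightarrow> x \<noteq> l i \<Longrightarrow> poly (P_del i) x = poly P x / (x - l i)"
  by (simp add: P_remove field_simps)

lemma P_m_nonzero: "k < n \<Longrightarrow> poly P (m k) \<noteq> 0"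
  using l_neq_m by (auto simp: P_def poly_prod)

lemma P_del_l_nonzero: "i < n \<Longrightarrow> poly (P_del i) (l i) \<noteq> 0"
  using inj_onD[OF l_inj] by (force simp: P_del_def poly_prod)

lemma P_del_l_other: "i < n \<Longrightarrow> j < n \<Longrightarrow> i \<noteq> j \<Longrightarrow> poly (P_del j) (l i) = 0"
  by (force simp: P_del_def poly_prod)

text \<open>By the secular equation the right side vanishes at the \<open>n\<close> points
  \<open>m k\<close>, as does \<open>Q\<close>, and the difference of the two sides has degree less
  than \<open>n\<close>.\<close>

lemma Q_eq: "Q = P - (\<Sum>i<n. Polynomial.smult ((v i)\<^sup>2) (P_del i))"
proof (cases "n = 0")
  case False
  have "P - Q = (\<Sum>i<n. Polynomial.smult ((v i)\<^sup>2) (P_del i))"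
  proof (rule poly_eqI_degree)
    fix x assume "x \<in> m ` {..<n}"
    then obtain k where k: "k < n" "x = m k" by blast
    have "poly (\<Sum>i<n. Polynomial.smult ((v i)\<^sup>2) (P_del i)) x = (\<Sum>i<n. (v i)\<^sup>2 / (m k - l i) * poly P x)"
      using k l_neq_m by (simp add: poly_sum poly_P_del)
    also have "\<dots> = (\<Sum>i<n. (v i)\<^sup>2 / (m k - l i)) * poly P x" by (rule sum_distrib_right[symmetric])
    also have "\<dots> = poly P x" using secular_eq[OF k(1)] by simp
    finally show "poly (P - Q) x = poly (\<Sum>i<n. Polynomial.smult ((v i)\<^sup>2) (P_del i)) x"
      using k by (simp add: Q_remove[OF k(1)])
  next
    have card: "card (m ` {..<n}) = n" using card_image[OF m_inj] by simp
    show "degree (P - Q) < card (m ` {..<n})" unfolding card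
      using monic_prod_linear[of l "{..<n}"] monic_prod_linear[of m "{..<n}"] False
      by (intro degree_diff_monic_less) (simp_all add: P_def Q_def)
    show "degree (\<Sum>i<n. Polynomial.smult ((v i)\<^sup>2) (P_del i)) < card (m ` {..<n})" unfolding card
    proof (rule degree_sum_less)
      fix i assume "i \<in> {..<n}"
      then have "degree (P_del i) < n" using False by (simp add: P_del_def monic_prod_linear)
      then show "degree (Polynomial.smult ((v i)\<^sup>2) (P_del i)) < n" using degree_smult_le le_less_trans by blast
    qed (use False in simp)
  qed
  then show ?thesis by (simp add: algebra_simps)
next
  case True
  then show ?thesis unfolding P_def Q_def by simp
qed

lemma Q_l: "i < n \<Longrightarrow> poly Q (l i) = - (v i)\<^sup>2 * poly (P_del i) (l i)"
proof -
  assume i: "i < n"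
  have "(\<Sum>j<n. (v j)\<^sup>2 * poly (P_del j) (l i)) = (\<Sum>j<n. if j = i then (v i)\<^sup>2 * poly (P_del i) (l i) else 0)"
    using i P_del_l_other by (intro sum.cong) auto
  then show ?thesis using i by (simp add: Q_eq poly_sum P_remove[OF i])
qed

text \<open>Multiply by \<open>x - m k = (x - l i) - (m k - l i)\<close>: the first part gives
  \<open>P\<close> by the secular equation and the second gives the sum in
  \<open>Q_eq\<close>.\<close>

lemma Q_del_eq:
  assumes k: "k < n"
  shows "Q_del k = (\<Sum>i<n. Polynomial.smult ((v i)\<^sup>2 / (m k - l i)) (P_del i))"
proof -
  let ?c = "\<lambda>i. (v i)\<^sup>2 / (m k - l i)"
  have "[:- m k, 1:] * (\<Sum>i<n. Polynomial.smult (?c i) (P_del i))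
      = (\<Sum>i<n. Polynomial.smult (?c i) P - Polynomial.smult ((v i)\<^sup>2) (P_del i))"
    unfolding sum_distrib_left
  proof (intro sum.cong refl)
    fix i assume "i \<in> {..<n}"
    then have i: "i < n" by simp
    have "[:- m k, 1:] = [:- l i, 1:] - [:m k - l i:]" by simp
    then have "[:- m k, 1:] * Polynomial.smult (?c i) (P_del i)
        = Polynomial.smult (?c i) ([:- l i, 1:] * P_del i) - Polynomial.smult (?c i * (m k - l i)) (P_del i)"
      by (simp only: left_diff_distrib mult_smult_right) (simp add: smult_diff_right)
    also have "?c i * (m k - l i) = (v i)\<^sup>2" using l_neq_m[OF i k] by simp
    finally show "[:- m k, 1:] * Polynomial.smult (?c i) (P_del i)
        = Polynomial.smult (?c i) P - Polynomial.smult ((v i)\<^sup>2) (P_del i)"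
      unfolding P_remove[OF i] .
  qed
  also have "\<dots> = Polynomial.smult (\<Sum>i<n. ?c i) P - (\<Sum>i<n. Polynomial.smult ((v i)\<^sup>2) (P_del i))"
    by (simp add: sum_subtractf smult_sum)
  also have "\<dots> = [:- m k, 1:] * Q_del k" using secular_eq[OF k] Q_eq Q_remove[OF k] by simp
  finally have eq: "[:- m k, 1:] * (\<Sum>i<n. Polynomial.smult (?c i) (P_del i)) = [:- m k, 1:] * Q_del k" .
  have "[:- m k, 1:] \<noteq> 0" by simp
  from iffD1[OF mult_left_cancel[OF this] eq] show ?thesis by (rule sym)
qed

lemma Q_del_m: "k < n \<Longrightarrow> j < n \<Longrightarrow>
    poly (Q_del k) (m j) = poly P (m j) * (\<Sum>i<n. (v i)\<^sup>2 / ((m k - l i) * (m j - l i)))"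
  using l_neq_m by (simp add: Q_del_eq poly_sum poly_P_del sum_distrib_left mult_ac)

lemma N_eq: "k < n \<Longrightarrow> poly (Q_del k) (m k) = poly P (m k) * N k"
  using Q_del_m[of k k] by (simp add: N_def power2_eq_square)

text \<open>These are eigenvectors for different eigenvalues. The sum is the value of
  \<open>Q_del k\<close> at its root \<open>m j\<close>, up to the non-zero factor
  \<open>poly P (m j)\<close>.\<close>

lemma orthogonal:
  assumes "k < n" "j < n" "k \<noteq> j"
  shows "(\<Sum>i<n. (v i)\<^sup>2 / ((m k - l i) * (m j - l i))) = 0"
proof -
  have "poly (Q_del k) (m j) = 0" using assms by (force simp: Q_del_def poly_prod)
  then show ?thesis using Q_del_m[OF assms(1,2)] P_m_nonzero[OF assms(2)] by simp
qed

lemma N_pos: "k < n \<Longrightarrow> 0 < N k"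
proof -
  assume k: "k < n"
  have "\<exists>i<n. v i \<noteq> 0" using secular_eq[OF k] by (rule contrapos_pp) (simp add: sum.neutral)
  then obtain i where i: "i < n" "v i \<noteq> 0" by blast
  show "0 < N k" unfolding N_def by (rule sum_pos2[of _ i]) (use i l_neq_m[OF i(1) k] in auto)
qed

text \<open>The denominator at \<open>l i\<close> is minus the square of
  \<open>v i * poly (P_del i) (l i)\<close>, and the polynomial takes the value \<open>a i\<close>
  times the same product there. At \<open>m k\<close> the denominator is
  \<open>(poly P (m k))\<^sup>2 * N k\<close>, and the polynomial again contains the factor
  \<open>poly P (m k)\<close>. The squares cancel.\<close>

lemma dd_square:
  fixes f :: "real \<Rightarrow> real"
  shows "dd (l ` {..<n} \<union> m ` {..<n})
      (\<lambda>t. f t * (poly (\<Sum>i<n. Polynomial.smult (a i * v i) (P_del i)) t)\<^sup>2)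
    = (\<Sum>k<n. f (m k) * ((\<Sum>i<n. a i * v i / (m k - l i))\<^sup>2 / N k)) - (\<Sum>i<n. f (l i) * (a i)\<^sup>2)"
proof -
  let ?q = "\<Sum>i<n. Polynomial.smult (a i * v i) (P_del i)"
  let ?X = "l ` {..<n} \<union> m ` {..<n}"
  let ?t = "\<lambda>c. f c * (poly ?q c)\<^sup>2 / (\<Prod>b\<in>?X - {c}. c - b)"
  have disj: "l ` {..<n} \<inter> m ` {..<n} = {}" using l_neq_m by force
  have "dd ?X (\<lambda>t. f t * (poly ?q t)\<^sup>2) = sum ?t (l ` {..<n}) + sum ?t (m ` {..<n})"
    unfolding dd_def by (rule sum.union_disjoint) (use disj in auto)
  also have "sum ?t (l ` {..<n}) = (\<Sum>i<n. - (f (l i) * (a i)\<^sup>2))"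
    unfolding sum.reindex[OF l_inj] o_def
  proof (intro sum.cong refl)
    fix i assume "i \<in> {..<n}"
    then have i: "i < n" by simp
    have "l ` ({..<n} - {i}) = l ` {..<n} - {l i}"
      using inj_on_image_set_diff[OF l_inj, of "{..<n}" "{i}"] i by auto
    moreover have "l i \<notin> m ` {..<n}" using disj i by blast
    ultimately have "?X - {l i} = l ` ({..<n} - {i}) \<union> m ` {..<n}" by blast
    then have "(\<Prod>b\<in>?X - {l i}. l i - b) = (\<Prod>b\<in>l ` ({..<n} - {i}). l i - b) * (\<Prod>b\<in>m ` {..<n}. l i - b)"
      using disj by (simp only:) (rule prod.union_disjoint; auto)
    also have "(\<Prod>b\<in>l ` ({..<n} - {i}). l i - b) = poly (P_del i) (l i)"
      by (subst prod.reindex[OF inj_on_subset[OF l_inj]]) (auto simp: P_del_def poly_prod)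
    also have "(\<Prod>b\<in>m ` {..<n}. l i - b) = poly Q (l i)"
      by (subst prod.reindex[OF m_inj]) (auto simp: Q_def poly_prod)
    finally have den: "(\<Prod>b\<in>?X - {l i}. l i - b) = - ((v i)\<^sup>2 * (poly (P_del i) (l i))\<^sup>2)"
      by (simp add: Q_l[OF i] power2_eq_square)
    have "poly ?q (l i) = (\<Sum>j<n. if j = i then a i * v i * poly (P_del i) (l i) else 0)"
      unfolding poly_sum using i P_del_l_other by (intro sum.cong) auto
    then have q: "poly ?q (l i) = a i * v i * poly (P_del i) (l i)" using i by simp
    have "poly Q (l i) \<noteq> 0" using not_sym[OF l_neq_m[OF i]] by (auto simp: Q_def poly_prod)
    then have "v i \<noteq> 0" using Q_l[OF i] by auto
    then show "?t (l i) = - (f (l i) * (a i)\<^sup>2)"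
      unfolding den q using P_del_l_nonzero[OF i] by (simp add: power_mult_distrib)
  qed
  also have "sum ?t (m ` {..<n}) = (\<Sum>k<n. f (m k) * ((\<Sum>i<n. a i * v i / (m k - l i))\<^sup>2 / N k))"
    unfolding sum.reindex[OF m_inj] o_def
  proof (intro sum.cong refl)
    fix k assume "k \<in> {..<n}"
    then have k: "k < n" by simp
    have "m ` ({..<n} - {k}) = m ` {..<n} - {m k}"
      using inj_on_image_set_diff[OF m_inj, of "{..<n}" "{k}"] k by auto
    moreover have "m k \<notin> l ` {..<n}" using disj k by blast
    ultimately have "?X - {m k} = l ` {..<n} \<union> m ` ({..<n} - {k})" by blast
    then have "(\<Prod>b\<in>?X - {m k}. m k - b) = (\<Prod>b\<in>l ` {..<n}. m k - b) * (\<Prod>b\<in>m ` ({..<n} - {k}). m k - b)"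
      using disj by (simp only:) (rule prod.union_disjoint; auto)
    also have "(\<Prod>b\<in>m ` ({..<n} - {k}). m k - b) = poly (Q_del k) (m k)"
      by (subst prod.reindex[OF inj_on_subset[OF m_inj]]) (auto simp: Q_del_def poly_prod)
    also have "(\<Prod>b\<in>l ` {..<n}. m k - b) = poly P (m k)"
      by (subst prod.reindex[OF l_inj]) (auto simp: P_def poly_prod)
    finally have den: "(\<Prod>b\<in>?X - {m k}. m k - b) = (poly P (m k))\<^sup>2 * N k"
      by (simp add: N_eq[OF k] power2_eq_square)
    have q: "poly ?q (m k) = poly P (m k) * (\<Sum>i<n. a i * v i / (m k - l i))"
      using l_neq_m k by (simp add: poly_sum poly_P_del sum_distrib_left mult_ac)
    show "?t (m k) = f (m k) * ((\<Sum>i<n. a i * v i / (m k - l i))\<^sup>2 / N k)"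
      unfolding den q using P_m_nonzero[OF k] N_pos[OF k] by (simp add: power_mult_distrib)
  qed
  finally show ?thesis by (simp add: sum_negf)
qed

lemma degree_combination: "degree (\<Sum>i<n. Polynomial.smult (c i) (P_del i)) \<le> n - 1"
proof (rule degree_sum_le)
  fix i assume "i \<in> {..<n}"
  then have "degree (P_del i) \<le> n - 1" by (simp add: P_del_def monic_prod_linear)
  then show "degree (Polynomial.smult (c i) (P_del i)) \<le> n - 1" using degree_smult_le order_trans by blast
qed simp

lemma card_nodes: "card (l ` {..<n} \<union> m ` {..<n}) = 2 * n"
proof -
  have "l ` {..<n} \<inter> m ` {..<n} = {}" using l_neq_m by force
  then show ?thesis by (simp add: card_Un_disjoint card_image l_inj m_inj)
qed

lemma tone_squares_imp_form_le:
  assumes f: "tone_squares n I f" and n: "0 < n" and I: "\<And>i. i < n \<Longrightarrow> l i \<in> I \<and> m i \<in> I"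
  shows "(\<Sum>i<n. f (l i) * (a i)\<^sup>2) \<le> (\<Sum>k<n. f (m k) * ((\<Sum>i<n. a i * v i / (m k - l i))\<^sup>2 / N k))"
proof -
  have "0 \<le> dd (l ` {..<n} \<union> m ` {..<n})
      (\<lambda>t. f t * (poly (\<Sum>i<n. Polynomial.smult (a i * v i) (P_del i)) t)\<^sup>2)"
    using f[unfolded tone_squares_def tone_def, rule_format, OF degree_combination[of "\<lambda>i. a i * v i"], of "l ` {..<n} \<union> m ` {..<n}"]
      card_nodes n I by auto
  then show ?thesis unfolding dd_square by simp
qed

end

text \<open>The squares of the \<open>v i\<close> are forced: they are the residues of
  \<open>(P - Q) / P\<close> at the \<open>l i\<close>. Interlacing makes them positive, since every
  factor \<open>(l i - m j) / (l i - l j)\<close> is.\<close>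

lemma interlacing_imp_secular:
  fixes l m :: "nat \<Rightarrow> real"
  assumes "interlacing_roots n l m"
  obtains v where "secular n l m v" "\<forall>i<n. 0 < v i"
proof -
  interpret interlacing_roots n l m by fact
  define P' where "P' i = (\<Prod>j\<in>{..<n} - {i}. l i - l j)" for i
  define v where "v i = sqrt (- poly Q (l i) / P' i)" for i
  have l_mono: "l i < l j" if "i < j" "j < n" for i j using l_less_m[of i] m_less_l[of i j] that by simp
  have m_mono: "m i < m j" if "i < j" "j < n" for i j using l_less_m[of j] m_less_l[of i j] that by simp
  have l_inj: "inj_on l {..<n}" by (rule linorder_inj_onI) (auto dest: l_mono)
  have m_inj: "inj_on m {..<n}" by (rule linorder_inj_onI) (auto dest: m_mono)
  have sgn: "0 < (l i - m j) / (l i - l j)" if "i < n" "j < n" "i \<noteq> j" for i j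
  proof (cases "j < i")
    case True
    then show ?thesis using m_less_l[of j i] l_mono[of j i] that by simp
  next
    case False
    then show ?thesis using l_less_m[of j] l_mono[of i j] that by (intro divide_neg_neg) auto
  qed
  have pos: "0 < - poly Q (l i) / P' i" if i: "i < n" for i
  proof -
    have "poly Q (l i) = (l i - m i) * (\<Prod>j\<in>{..<n} - {i}. l i - m j)"
      using i by (simp add: poly_Q prod.remove[of _ i])
    then have "- poly Q (l i) / P' i = (m i - l i) * (\<Prod>j\<in>{..<n} - {i}. (l i - m j) / (l i - l j))"
      by (simp add: P'_def prod_dividef minus_mult_left)
    also have "\<dots> > 0" using l_less_m[OF i] sgn i by (intro mult_pos_pos prod_pos) auto
    finally show ?thesis .
  qed
  have v: "(v i)\<^sup>2 = - poly Q (l i) / P' i" "0 < v i" if "i < n" for i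
    using pos[OF that] by (simp_all add: v_def)
  have neq: "m k \<noteq> l i" if "i < n" "k < n" for i k
    using l_less_m[of i] sgn[of i k] that by (cases "i = k") auto
  define D where "D i = (\<Prod>j\<in>{..<n} - {i}. [:- l j, 1:])" for i
  have PQ: "P - Q = (\<Sum>i<n. Polynomial.smult ((v i)\<^sup>2) (D i))" if n: "0 < n"
  proof (rule poly_eqI_degree)
    fix x assume "x \<in> l ` {..<n}"
    then obtain i where i: "i < n" "x = l i" by blast
    have "poly (\<Sum>i<n. Polynomial.smult ((v i)\<^sup>2) (D i)) x = (\<Sum>j<n. if j = i then (v i)\<^sup>2 * P' i else 0)"
      unfolding poly_sum using i by (intro sum.cong) (force simp: D_def P'_def poly_prod)+
    also have "\<dots> = - poly Q x" using i pos[OF i(1)] v(1)[OF i(1)] by auto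
    also have "\<dots> = poly (P - Q) x" using i by (auto simp: poly_P)
    finally show "poly (P - Q) x = poly (\<Sum>i<n. Polynomial.smult ((v i)\<^sup>2) (D i)) x" by simp
  next
    have card: "card (l ` {..<n}) = n" using card_image[OF l_inj] by simp
    show "degree (P - Q) < card (l ` {..<n})" unfolding card
      using PQ_degree n by (intro degree_diff_monic_less) auto
    show "degree (\<Sum>i<n. Polynomial.smult ((v i)\<^sup>2) (D i)) < card (l ` {..<n})" unfolding card
    proof (rule degree_sum_less)
      fix i assume "i \<in> {..<n}"
      then have "degree (D i) < n" using n by (simp add: D_def monic_prod_linear)
      then show "degree (Polynomial.smult ((v i)\<^sup>2) (D i)) < n" using degree_smult_le le_less_trans by blast
    qed (use n in simp)
  qed
  have "(\<Sum>i<n. (v i)\<^sup>2 / (m k - l i)) = 1" if k: "k < n" for k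
  proof -
    have Pk: "poly P (m k) \<noteq> 0" using neq k by (auto simp: poly_P)
    have "poly (D i) (m k) = poly P (m k) / (m k - l i)" if "i < n" for i
      using neq[OF that k] that by (simp add: D_def poly_prod poly_P prod.remove[of "{..<n}" i])
    then have "poly (P - Q) (m k) = (\<Sum>i<n. (v i)\<^sup>2 / (m k - l i)) * poly P (m k)"
      using PQ k by (simp add: poly_sum sum_distrib_right)
    moreover have "poly Q (m k) = 0" using k by (auto simp: poly_Q)
    ultimately show ?thesis using Pk by simp
  qed
  then have "secular n l m v" by unfold_locales (use l_inj m_inj neq in auto)
  then show thesis using that v(2) by blast
qed

section \<open>Monotonicity in terms of diagonal forms\<close>

definition coords :: "nat \<Rightarrow> complex mat \<Rightarrow> (nat \<Rightarrow> complex) \<Rightarrow> nat \<Rightarrow> complex" where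
  "coords n U w k = (\<Sum>i<n. cnj (U $$ (i, k)) * w i)"

text \<open>The quadratic form of \<open>unitary_diag n U d\<close> as a real number
  (\<open>herm_form_unitary_diag\<close>).\<close>

definition diag_form :: "nat \<Rightarrow> complex mat \<Rightarrow> (nat \<Rightarrow> real) \<Rightarrow> (nat \<Rightarrow> complex) \<Rightarrow> real" where
  "diag_form n U d w = (\<Sum>k<n. d k * (cmod (coords n U w k))\<^sup>2)"

definition herm_form :: "nat \<Rightarrow> complex mat \<Rightarrow> (nat \<Rightarrow> complex) \<Rightarrow> complex" where
  "herm_form n A w = (\<Sum>i<n. \<Sum>j<n. A $$ (i, j) * w j * cnj (w i))"

lemma herm_form_unitary_diag:
  assumes U: "U \<in> carrier_mat n n"
  shows "herm_form n (unitary_diag n U d) w = of_real (diag_form n U d w)"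
proof -
  let ?T = "\<lambda>i j k. of_real (d k) * ((U $$ (i, k) * cnj (w i)) * (cnj (U $$ (j, k)) * w j))"
  have "herm_form n (unitary_diag n U d) w = (\<Sum>i<n. \<Sum>j<n. \<Sum>k<n. ?T i j k)"
    unfolding herm_form_def
    by (intro sum.cong refl) (simp add: unitary_diag_index[OF U] sum_distrib_right sum_distrib_left mult_ac)
  also have "\<dots> = (\<Sum>i<n. \<Sum>k<n. \<Sum>j<n. ?T i j k)" by (intro sum.cong refl sum.swap)
  also have "\<dots> = (\<Sum>k<n. \<Sum>i<n. \<Sum>j<n. ?T i j k)" by (rule sum.swap)
  also have "\<dots> = (\<Sum>k<n. of_real (d k) * (cnj (coords n U w k) * coords n U w k))"
    by (intro sum.cong refl) (simp only: coords_def cnj_sum complex_cnj_mult complex_cnj_cnj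
        sum_distrib_left[symmetric] sum_distrib_right[symmetric])
  also have "\<dots> = (\<Sum>k<n. of_real (d k * (cmod (coords n U w k))\<^sup>2))"
    by (intro sum.cong refl) (simp only: of_real_mult complex_norm_square mult.commute[of "cnj _"])
  finally show ?thesis by (simp add: diag_form_def)
qed

lemma herm_form_vec:
  assumes "A \<in> carrier_mat n n" "v \<in> carrier_vec n"
  shows "(A *\<^sub>v v) \<bullet>c v = herm_form n A (vec_index v)"
  using assms by (simp add: herm_form_def scalar_prod_def sum_distrib_right atLeast0LessThan)

lemma herm_form_cong: "(\<And>i. i < n \<Longrightarrow> w i = w' i) \<Longrightarrow> herm_form n A w = herm_form n A w'"
  unfolding herm_form_def by (intro sum.cong refl) auto

lemma mat_adjoint_unitary_diag:
  assumes U: "U \<in> carrier_mat n n"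
  shows "mat_adjoint (unitary_diag n U d) = unitary_diag n U d"
proof -
  note c = unitary_diag_carrier[OF U, of d]
  show ?thesis
  proof (rule eq_matI)
    fix i j assume "i < dim_row (unitary_diag n U d)" "j < dim_col (unitary_diag n U d)"
    then have ij: "i < n" "j < n" using c by auto
    have "mat_adjoint (unitary_diag n U d) $$ (i, j) = conjugate (unitary_diag n U d $$ (j, i))"
      using ij c by (intro mat_adjoint_index) auto
    then show "mat_adjoint (unitary_diag n U d) $$ (i, j) = unitary_diag n U d $$ (i, j)"
      by (simp add: unitary_diag_index[OF U] ij mult_ac)
  qed (use c in auto)
qed

lemma psd_mat_iff_herm_form:
  assumes A: "A \<in> carrier_mat n n" and h: "mat_adjoint A = A"
  shows "psd_mat A \<longleftrightarrow> (\<forall>w. 0 \<le> herm_form n A w)"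
proof
  assume "psd_mat A"
  then have *: "0 \<le> (A *\<^sub>v v) \<bullet>c v" if "v \<in> carrier_vec n" for v
    using A that by (auto simp: psd_mat_def)
  show "\<forall>w. 0 \<le> herm_form n A w"
  proof
    fix w
    have "0 \<le> herm_form n A (vec_index (vec n w))"
      using *[of "vec n w"] herm_form_vec[OF A, of "vec n w"] by simp
    then show "0 \<le> herm_form n A w" using herm_form_cong[of n "vec_index (vec n w)" w A] by simp
  qed
next
  assume "\<forall>w. 0 \<le> herm_form n A w"
  then show "psd_mat A"
    using A h by (auto simp: psd_mat_def hermitian_mat_def herm_form_vec[OF A])
qed

lemma herm_form_diff:
  assumes "A \<in> carrier_mat n n" "B \<in> carrier_mat n n"
  shows "herm_form n (B - A) w = herm_form n B w - herm_form n A w"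
  using assms by (simp add: herm_form_def sum_subtractf[symmetric] left_diff_distrib)

lemma mat_adjoint_diff:
  fixes A B :: "complex mat"
  assumes "A \<in> carrier_mat n n" "B \<in> carrier_mat n n"
  shows "mat_adjoint (B - A) = mat_adjoint B - mat_adjoint A"
  using assms by (intro eq_matI) (auto simp: mat_adjoint_index)

lemma loewner_le_unitary_diag:
  assumes U: "U \<in> carrier_mat n n" and V: "V \<in> carrier_mat n n"
  shows "loewner_le (unitary_diag n U d) (unitary_diag n V e) \<longleftrightarrow> (\<forall>w. diag_form n U d w \<le> diag_form n V e w)"
proof -
  note c = unitary_diag_carrier[OF U, of d] unitary_diag_carrier[OF V, of e]
  have "mat_adjoint (unitary_diag n V e - unitary_diag n U d) = unitary_diag n V e - unitary_diag n U d"
    by (simp add: mat_adjoint_diff[OF c] mat_adjoint_unitary_diag U V)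
  moreover have "unitary_diag n V e - unitary_diag n U d \<in> carrier_mat n n" by (rule minus_carrier_mat[OF c(1)])
  moreover have "0 \<le> herm_form n (unitary_diag n V e - unitary_diag n U d) w
      \<longleftrightarrow> diag_form n U d w \<le> diag_form n V e w" for w
    by (simp add: herm_form_diff[OF c] herm_form_unitary_diag U V less_eq_complex_def)
  ultimately show ?thesis by (simp add: loewner_le_def psd_mat_iff_herm_form)
qed

lemma spectrum_unitary_diag:
  assumes U: "U \<in> carrier_mat n n" "unitary_mat U"
  shows "spectrum (unitary_diag n U d) = (\<lambda>k. complex_of_real (d k)) ` {..<n}"
proof -
  let ?D = "mat_diag n (\<lambda>i. complex_of_real (d i))"
  note c = unitary_diag_carrier[OF U(1), of d]
  have "similar_mat_wit (unitary_diag n U d) ?D U (mat_adjoint U)"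
    using c U mat_adjoint_carrier[OF U(1)] unitary_matD[OF U]
    by (intro similar_mat_witI[of _ _ n]) (auto simp: unitary_diag_def)
  then have "similar_mat (unitary_diag n U d) ?D" by (auto simp: similar_mat_def)
  then have "char_poly (unitary_diag n U d) = char_poly ?D" by (rule char_poly_similar)
  also have "\<dots> = (\<Prod>a\<leftarrow>diag_mat ?D. [:- a, 1:])"
    by (rule char_poly_upper_triangular[of _ n]) (auto simp: mat_diag_def upper_triangular_def)
  also have "diag_mat ?D = map (\<lambda>k. complex_of_real (d k)) [0..<n]" by (auto simp: diag_mat_def mat_diag_def)
  finally have cp: "char_poly (unitary_diag n U d) = (\<Prod>k\<leftarrow>[0..<n]. [:- complex_of_real (d k), 1:])"
    by (simp add: o_def)
  have "poly (char_poly (unitary_diag n U d)) z = 0 \<longleftrightarrow> (\<exists>k<n. z = complex_of_real (d k))" for z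
    unfolding cp by (simp add: poly_prod_list o_def prod_list_zero_iff) (auto simp: add_eq_0_iff)
  then show ?thesis
    unfolding spectrum_def eigenvalue_root_char_poly[OF c] by auto
qed

lemma spectrum_subset_iff:
  assumes U: "U \<in> carrier_mat n n" "unitary_mat U"
  shows "spectrum (unitary_diag n U d) \<subseteq> complex_of_real ` I \<longleftrightarrow> (\<forall>k<n. d k \<in> I)"
  unfolding spectrum_unitary_diag[OF U] by (auto simp: image_iff)

text \<open>Every Hermitian matrix is some \<open>unitary_diag\<close>, so the matrices and the
  definite description in \<open>mat_fun\<close> can be replaced by diagonalisations and real
  forms.\<close>

lemma n_monotone_iff:
  "n_monotone n I f \<longleftrightarrow>
    (\<forall>U V d e. U \<in> carrier_mat n n \<and> unitary_mat U \<and> V \<in> carrier_mat n n \<and> unitary_mat V \<and>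
      (\<forall>k<n. d k \<in> I) \<and> (\<forall>k<n. e k \<in> I) \<and> (\<forall>w. diag_form n U d w \<le> diag_form n V e w) \<longrightarrow>
      (\<forall>w. diag_form n U (\<lambda>k. f (d k)) w \<le> diag_form n V (\<lambda>k. f (e k)) w))" (is "_ \<longleftrightarrow> ?R")
proof
  assume m: "n_monotone n I f"
  show ?R
  proof (intro allI impI, elim conjE)
    fix U V d e w
    assume *: "U \<in> carrier_mat n n" "unitary_mat U" "V \<in> carrier_mat n n" "unitary_mat V"
      "\<forall>k<n. d k \<in> I" "\<forall>k<n. e k \<in> I" "\<forall>w. diag_form n U d w \<le> diag_form n V e w"
    have h: "hermitian_mat (unitary_diag n W d)" if "W \<in> carrier_mat n n" for W d
      using unitary_diag_carrier[OF that, of d] mat_adjoint_unitary_diag[OF that] by (auto simp: hermitian_mat_def)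
    have "loewner_le (mat_fun f (unitary_diag n U d)) (mat_fun f (unitary_diag n V e))"
      using m[unfolded n_monotone_def, rule_format, of "unitary_diag n U d" "unitary_diag n V e"]
        unitary_diag_carrier * h spectrum_subset_iff loewner_le_unitary_diag by auto
    then show "diag_form n U (\<lambda>k. f (d k)) w \<le> diag_form n V (\<lambda>k. f (e k)) w"
      using * by (simp add: mat_fun_unitary_diag loewner_le_unitary_diag)
  qed
next
  assume R: ?R
  show "n_monotone n I f"
    unfolding n_monotone_def
  proof (intro ballI impI, elim conjE)
    fix A B :: "complex mat"
    assume c: "A \<in> carrier_mat n n" "B \<in> carrier_mat n n" and h: "hermitian_mat A" "hermitian_mat B"
      and sp: "spectrum A \<subseteq> complex_of_real ` I" "spectrum B \<subseteq> complex_of_real ` I" and le: "loewner_le A B"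
    from h have h': "mat_adjoint A = A" "mat_adjoint B = B" by (simp_all add: hermitian_mat_def)
    obtain U d where U: "U \<in> carrier_mat n n" "unitary_mat U" "A = unitary_diag n U d"
      using hermitian_unitary_diagonalization[OF c(1) h'(1)] by (elim exE conjE)
    obtain V e where V: "V \<in> carrier_mat n n" "unitary_mat V" "B = unitary_diag n V e"
      using hermitian_unitary_diagonalization[OF c(2) h'(2)] by (elim exE conjE)
    have "\<forall>k<n. d k \<in> I" "\<forall>k<n. e k \<in> I" "\<forall>w. diag_form n U d w \<le> diag_form n V e w"
      using sp le unfolding U(3) V(3) spectrum_subset_iff[OF U(1,2)] spectrum_subset_iff[OF V(1,2)]
        loewner_le_unitary_diag[OF U(1) V(1)] .
    then have "\<forall>w. diag_form n U (\<lambda>k. f (d k)) w \<le> diag_form n V (\<lambda>k. f (e k)) w"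
      using R[rule_format, of U V d e] U(1,2) V(1,2) by simp
    then show "loewner_le (mat_fun f A) (mat_fun f B)"
      unfolding U(3) V(3) mat_fun_unitary_diag[OF U(1,2)] mat_fun_unitary_diag[OF V(1,2)]
        loewner_le_unitary_diag[OF U(1) V(1)] .
  qed
qed

section \<open>From monotonicity to divided differences\<close>

lemma diag_form_one: "diag_form n (1\<^sub>m n) d w = (\<Sum>k<n. d k * (cmod (w k))\<^sup>2)"
proof -
  have "coords n (1\<^sub>m n) w k = w k" if "k < n" for k
  proof -
    have "coords n (1\<^sub>m n) w k = (\<Sum>i<n. if i = k then w k else 0)"
      unfolding coords_def using that by (intro sum.cong) auto
    then show ?thesis using that by simp
  qed
  then show ?thesis by (simp add: diag_form_def)
qed

lemma unitary_mat_one: "unitary_mat (1\<^sub>m n)"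
proof -
  have "mat_adjoint (1\<^sub>m n) = (1\<^sub>m n :: complex mat)" by (rule eq_matI) (auto simp: mat_adjoint_index)
  then show ?thesis by (simp add: unitary_mat_def)
qed

context secular
begin

text \<open>The columns are the normalised eigenvectors of the rank-one perturbation of the diagonal
  matrix of \<open>l\<close>.\<close>

definition V :: "complex mat" where
  "V = Matrix.mat n n (\<lambda>(i, k). of_real (v i / ((m k - l i) * sqrt (N k))))"

lemma V_carrier: "V \<in> carrier_mat n n" by (simp add: V_def)

lemma V_index: "i < n \<Longrightarrow> k < n \<Longrightarrow> V $$ (i, k) = of_real (v i / ((m k - l i) * sqrt (N k)))"
  by (simp add: V_def)

lemma V_unitary: "unitary_mat V"
proof -
  have "mat_adjoint V * V = 1\<^sub>m n"
  proof (rule eq_matI)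
    fix k j assume "k < dim_row (1\<^sub>m n)" "j < dim_col (1\<^sub>m n)"
    then have kj: "k < n" "j < n" by auto
    have "(mat_adjoint V * V) $$ (k, j) = (\<Sum>i<n. mat_adjoint V $$ (k, i) * V $$ (i, j))"
      by (rule mat_mult_index[OF mat_adjoint_carrier[OF V_carrier] V_carrier kj])
    also have "\<dots> = (\<Sum>i<n. of_real ((v i)\<^sup>2 / ((m k - l i) * (m j - l i)) * (1 / (sqrt (N k) * sqrt (N j)))))"
    proof (intro sum.cong refl)
      fix i assume "i \<in> {..<n}"
      then have i: "i < n" by simp
      have "mat_adjoint V $$ (k, i) = cnj (V $$ (i, k))"
        using mat_adjoint_index[of k V i] V_carrier i kj by auto
      then show "mat_adjoint V $$ (k, i) * V $$ (i, j)
          = of_real ((v i)\<^sup>2 / ((m k - l i) * (m j - l i)) * (1 / (sqrt (N k) * sqrt (N j))))"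
        using i kj by (simp add: V_index power2_eq_square)
    qed
    also have "\<dots> = of_real ((\<Sum>i<n. (v i)\<^sup>2 / ((m k - l i) * (m j - l i))) * (1 / (sqrt (N k) * sqrt (N j))))"
      by (simp only: of_real_sum sum_distrib_right)
    also have "\<dots> = (if k = j then 1 else 0)"
    proof (cases "k = j")
      case True
      have "(\<Sum>i<n. (v i)\<^sup>2 / ((m k - l i) * (m k - l i))) = N k" by (simp add: N_def power2_eq_square)
      then show ?thesis using True N_pos[OF kj(1)] by simp
    next
      case False
      then show ?thesis using orthogonal[OF kj False] by simp
    qed
    finally show "(mat_adjoint V * V) $$ (k, j) = 1\<^sub>m n $$ (k, j)" using kj by simp
  qed (use V_carrier in auto)
  then have "V * mat_adjoint V = 1\<^sub>m n"
    by (rule mat_mult_left_right_inverse[OF mat_adjoint_carrier[OF V_carrier] V_carrier])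
  then show ?thesis using V_carrier by (simp add: unitary_mat_def)
qed

text \<open>The matrix with eigenvectors \<open>V\<close> and eigenvalues \<open>m\<close> is
  computed entry by entry as the diagonal matrix of \<open>l\<close> plus the rank-one matrix of
  \<open>v\<close>; the two forms then differ by a square.\<close>

lemma diag_form_rank_one: "diag_form n (1\<^sub>m n) l w \<le> diag_form n V m w"
proof -
  let ?V = "\<lambda>i k. v i / ((m k - l i) * sqrt (N k))"
  have rows: "(\<Sum>k<n. ?V i k * ?V j k) = (if i = j then 1 else 0)" if ij: "i < n" "j < n" for i j
  proof -
    have "complex_of_real (\<Sum>k<n. ?V i k * ?V j k) = (\<Sum>k<n. V $$ (i, k) * mat_adjoint V $$ (k, j))"
      unfolding of_real_sum
    proof (intro sum.cong refl)
      fix k assume "k \<in> {..<n}"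
      then have k: "k < n" by simp
      have "mat_adjoint V $$ (k, j) = cnj (V $$ (j, k))"
        using mat_adjoint_index[of k V j] V_carrier ij k by auto
      then show "of_real (?V i k * ?V j k) = V $$ (i, k) * mat_adjoint V $$ (k, j)"
        using ij k by (simp add: V_index)
    qed
    also have "\<dots> = (V * mat_adjoint V) $$ (i, j)"
      by (rule mat_mult_index[symmetric, OF V_carrier mat_adjoint_carrier[OF V_carrier] ij])
    also have "\<dots> = (if i = j then 1 else 0)" using unitary_matD(1)[OF V_carrier V_unitary] ij by simp
    finally show ?thesis by (auto split: if_splits simp flip: of_real_sum)
  qed
  \<comment> \<open>By the secular equation the inner product of \<open>v\<close> with the
    \<open>k\<close>-th column is \<open>1 / sqrt (N k)\<close>.\<close>
  have s: "1 / sqrt (N k) = (\<Sum>i<n. v i * ?V i k)" if k: "k < n" for k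
  proof -
    have "(\<Sum>i<n. v i * ?V i k) = (\<Sum>i<n. (v i)\<^sup>2 / (m k - l i)) * (1 / sqrt (N k))"
      by (simp add: sum_divide_distrib power2_eq_square)
    then show ?thesis using secular_eq[OF k] by simp
  qed
  have sV: "(\<Sum>k<n. 1 / sqrt (N k) * ?V j k) = v j" if j: "j < n" for j
  proof -
    have "(\<Sum>k<n. 1 / sqrt (N k) * ?V j k) = (\<Sum>k<n. \<Sum>i<n. v i * (?V i k * ?V j k))"
      by (intro sum.cong refl) (simp only: s lessThan_iff sum_distrib_right mult.assoc)
    also have "\<dots> = (\<Sum>i<n. v i * (\<Sum>k<n. ?V i k * ?V j k))"
      unfolding sum_distrib_left by (rule sum.swap)
    also have "\<dots> = (\<Sum>i<n. if i = j then v j else 0)" using rows j by (intro sum.cong refl) auto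
    finally show ?thesis using j by simp
  qed
  have entry: "unitary_diag n V m $$ (i, j) = of_real ((if i = j then l i else 0) + v i * v j)"
    if ij: "i < n" "j < n" for i j
  proof -
    have "unitary_diag n V m $$ (i, j) = of_real (\<Sum>k<n. ?V i k * m k * ?V j k)"
      unfolding unitary_diag_index[OF V_carrier ij] using ij by (simp add: V_index)
    also have "(\<Sum>k<n. ?V i k * m k * ?V j k)
        = (\<Sum>k<n. l i * (?V i k * ?V j k) + v i * (1 / sqrt (N k) * ?V j k))"
    proof (intro sum.cong refl)
      fix k assume "k \<in> {..<n}"
      then have k: "k < n" by simp
      have "?V i k * m k = l i * ?V i k + v i * (1 / sqrt (N k))"
        using l_neq_m[OF ij(1) k] N_pos[OF k] by (simp add: field_simps)
      then show "?V i k * m k * ?V j k = l i * (?V i k * ?V j k) + v i * (1 / sqrt (N k) * ?V j k)"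
        by (simp only: distrib_right mult.assoc)
    qed
    also have "\<dots> = l i * (\<Sum>k<n. ?V i k * ?V j k) + v i * (\<Sum>k<n. 1 / sqrt (N k) * ?V j k)"
      by (simp only: sum.distrib sum_distrib_left)
    also have "\<dots> = (if i = j then l i else 0) + v i * v j"
      unfolding rows[OF ij] sV[OF ij(2)] by simp
    finally show ?thesis .
  qed
  have "complex_of_real (diag_form n V m w) = (\<Sum>i<n. \<Sum>j<n.
      (if i = j then of_real (l i) * w i * cnj (w i) else 0) + (cnj (of_real (v i) * w i)) * (of_real (v j) * w j))"
    unfolding herm_form_unitary_diag[OF V_carrier, symmetric] herm_form_def
    by (intro sum.cong refl) (auto simp: entry algebra_simps)
  also have "\<dots> = (\<Sum>i<n. of_real (l i) * w i * cnj (w i)) + cnj (\<Sum>i<n. of_real (v i) * w i) * (\<Sum>j<n. of_real (v j) * w j)"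
    by (simp add: sum.distrib sum_product)
  also have "\<dots> = of_real (diag_form n (1\<^sub>m n) l w + (cmod (\<Sum>j<n. of_real (v j) * w j))\<^sup>2)"
    unfolding diag_form_one of_real_add of_real_sum of_real_mult complex_norm_square by (simp only: mult_ac)
  finally have "diag_form n V m w = diag_form n (1\<^sub>m n) l w + (cmod (\<Sum>j<n. of_real (v j) * w j))\<^sup>2"
    by (simp only: of_real_eq_iff)
  then show ?thesis by simp
qed

lemma diag_form_V_real:
  "diag_form n V g (\<lambda>i. of_real (a i)) = (\<Sum>k<n. g k * ((\<Sum>i<n. a i * v i / (m k - l i))\<^sup>2 / N k))"
  unfolding diag_form_def
proof (intro sum.cong refl)
  fix k assume "k \<in> {..<n}"
  then have k: "k < n" by simp
  have "coords n V (\<lambda>i. of_real (a i)) k = of_real ((\<Sum>i<n. a i * v i / (m k - l i)) / sqrt (N k))"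
    unfolding coords_def sum_divide_distrib of_real_sum using k by (intro sum.cong) (auto simp: V_index)
  then have "(cmod (coords n V (\<lambda>i. of_real (a i)) k))\<^sup>2 = ((\<Sum>i<n. a i * v i / (m k - l i)) / sqrt (N k))\<^sup>2"
    by (simp only: norm_of_real power2_abs)
  then show "g k * (cmod (coords n V (\<lambda>i. of_real (a i)) k))\<^sup>2 = g k * ((\<Sum>i<n. a i * v i / (m k - l i))\<^sup>2 / N k)"
    using N_pos[OF k] by (simp add: power_divide)
qed

lemma n_monotone_imp_dd_nonneg:
  assumes mono: "n_monotone n I f" and n: "0 < n" and v: "\<And>i. i < n \<Longrightarrow> v i \<noteq> 0"
    and I: "\<And>i. i < n \<Longrightarrow> l i \<in> I \<and> m i \<in> I" and q: "degree q \<le> n - 1"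
  shows "0 \<le> dd (l ` {..<n} \<union> m ` {..<n}) (\<lambda>t. f t * (poly q t)\<^sup>2)"
proof -
  \<comment> \<open>The coefficients of \<open>q\<close> in the basis \<open>P_del i\<close>, found
    by evaluation at the \<open>l i\<close>, divided by \<open>v i\<close>.\<close>
  define a where "a i = poly q (l i) / (v i * poly (P_del i) (l i))" for i
  have "q = (\<Sum>i<n. Polynomial.smult (a i * v i) (P_del i))"
  proof (rule poly_eqI_degree)
    fix x assume "x \<in> l ` {..<n}"
    then obtain i where i: "i < n" "x = l i" by blast
    have "poly (\<Sum>i<n. Polynomial.smult (a i * v i) (P_del i)) x = (\<Sum>j<n. if j = i then a i * v i * poly (P_del i) x else 0)"
      unfolding poly_sum using i P_del_l_other by (intro sum.cong) auto
    also have "\<dots> = a i * v i * poly (P_del i) (l i)" using i by simp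
    also have "\<dots> = poly q x" using P_del_l_nonzero[OF i(1)] v[OF i(1)] i by (simp add: a_def)
    finally show "poly q x = poly (\<Sum>i<n. Polynomial.smult (a i * v i) (P_del i)) x" by simp
  next
    have card: "card (l ` {..<n}) = n" using card_image[OF l_inj] by simp
    show "degree q < card (l ` {..<n})" using card q n by simp
    show "degree (\<Sum>i<n. Polynomial.smult (a i * v i) (P_del i)) < card (l ` {..<n})"
      using le_less_trans[OF degree_combination[of "\<lambda>i. a i * v i"], of n] card n by simp
  qed
  moreover have "diag_form n (1\<^sub>m n) (\<lambda>k. f (l k)) (\<lambda>i. of_real (a i)) \<le> diag_form n V (\<lambda>k. f (m k)) (\<lambda>i. of_real (a i))"
    using mono[unfolded n_monotone_iff, rule_format, of "1\<^sub>m n" V l m] V_carrier V_unitary unitary_mat_one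
      diag_form_rank_one I by auto
  ultimately show ?thesis using dd_square[of f a] by (simp add: diag_form_one diag_form_V_real)
qed

end

theorem n_monotone_imp_tone_squares:
  assumes mono: "n_monotone n I f" and n: "0 < n"
  shows "tone_squares n I f"
  unfolding tone_squares_def tone_def
proof (intro allI impI, elim conjE)
  fix q :: "real poly" and X :: "real set"
  assume q: "degree q \<le> n - 1" and X: "finite X" "card X = Suc (2 * n - 1)" "X \<subseteq> I"
  have "card X = 2 * n" using X n by simp
  then obtain l m where lm: "interlacing_roots n l m" "l ` {..<n} \<union> m ` {..<n} = X"
    by (rule interlacing_enumeration[OF X(1)])
  obtain v where "secular n l m v" and v: "\<forall>i<n. 0 < v i" by (rule interlacing_imp_secular[OF lm(1)])
  then interpret secular n l m v by simp
  have "v i \<noteq> 0" if "i < n" for i using v that by force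
  moreover have "l i \<in> I \<and> m i \<in> I" if "i < n" for i using X lm(2) that by blast
  ultimately show "0 \<le> dd X (\<lambda>t. f t * (poly q t)\<^sup>2)"
    using n_monotone_imp_dd_nonneg[OF mono n _ _ q] lm(2) by simp
qed

section \<open>Rank-one perturbations\<close>

lemma unitary_rows:
  assumes V: "V \<in> carrier_mat n n" "unitary_mat V" and ij: "i < n" "j < n"
  shows "(\<Sum>k<n. V $$ (i, k) * cnj (V $$ (j, k))) = (if i = j then 1 else 0)"
proof -
  have "(\<Sum>k<n. V $$ (i, k) * cnj (V $$ (j, k))) = (\<Sum>k<n. V $$ (i, k) * mat_adjoint V $$ (k, j))"
    using V ij by (intro sum.cong refl) (auto simp: mat_adjoint_index)
  also have "\<dots> = (V * mat_adjoint V) $$ (i, j)"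
    by (rule mat_mult_index[symmetric, OF V(1) mat_adjoint_carrier[OF V(1)] ij])
  finally show ?thesis using unitary_matD(1)[OF V] ij by simp
qed

lemma unitary_columns:
  assumes V: "V \<in> carrier_mat n n" "unitary_mat V" and ij: "i < n" "j < n"
  shows "(\<Sum>k<n. cnj (V $$ (k, i)) * V $$ (k, j)) = (if i = j then 1 else 0)"
proof -
  have "(\<Sum>k<n. cnj (V $$ (k, i)) * V $$ (k, j)) = (\<Sum>k<n. mat_adjoint V $$ (i, k) * V $$ (k, j))"
    using V ij by (intro sum.cong refl) (auto simp: mat_adjoint_index)
  also have "\<dots> = (mat_adjoint V * V) $$ (i, j)"
    by (rule mat_mult_index[symmetric, OF mat_adjoint_carrier[OF V(1)] V(1) ij])
  finally show ?thesis using unitary_matD(2)[OF V] ij by simp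
qed

lemma diag_form_column:
  assumes V: "V \<in> carrier_mat n n" "unitary_mat V" and k: "k < n"
  shows "diag_form n V d (\<lambda>i. V $$ (i, k)) = d k"
proof -
  have "diag_form n V d (\<lambda>i. V $$ (i, k)) = (\<Sum>j<n. if j = k then d k else 0)"
    unfolding diag_form_def coords_def using k by (intro sum.cong refl) (simp add: unitary_columns[OF V])
  then show ?thesis using k by simp
qed

lemma diag_form_const:
  assumes V: "V \<in> carrier_mat n n" "unitary_mat V"
  shows "diag_form n V (\<lambda>_. c) w = c * (\<Sum>i<n. (cmod (w i))\<^sup>2)"
proof -
  have "complex_of_real (diag_form n V (\<lambda>_. c) w) = (\<Sum>i<n. \<Sum>j<n. if j = i then of_real c * (w i * cnj (w i)) else 0)"
    unfolding herm_form_unitary_diag[OF V(1), symmetric] herm_form_def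
  proof (intro sum.cong refl)
    fix i j assume "i \<in> {..<n}" "j \<in> {..<n}"
    then have ij: "i < n" "j < n" by auto
    have "unitary_diag n V (\<lambda>_. c) $$ (i, j) = of_real c * (\<Sum>k<n. V $$ (i, k) * cnj (V $$ (j, k)))"
      by (simp add: unitary_diag_index[OF V(1) ij] sum_distrib_left mult_ac)
    then show "unitary_diag n V (\<lambda>_. c) $$ (i, j) * w j * cnj (w i)
        = (if j = i then of_real c * (w i * cnj (w i)) else 0)"
      using unitary_rows[OF V ij] by simp
  qed
  also have "\<dots> = of_real (c * (\<Sum>i<n. (cmod (w i))\<^sup>2))"
    unfolding of_real_mult of_real_sum complex_norm_square sum_distrib_left by simp
  finally show ?thesis by (simp only: of_real_eq_iff)
qed

lemma unitary_column_norm: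
  assumes V: "V \<in> carrier_mat n n" "unitary_mat V" and k: "k < n"
  shows "(\<Sum>i<n. (cmod (V $$ (i, k)))\<^sup>2) = 1"
  using diag_form_column[OF V k, of "\<lambda>_. 1"] diag_form_const[OF V, of 1] by simp

lemma diag_form_mono:
  assumes "\<And>k. k < n \<Longrightarrow> d k \<le> e k"
  shows "diag_form n U d w \<le> diag_form n U e w"
  unfolding diag_form_def using assms by (intro sum_mono mult_right_mono) auto

lemma diag_form_bounds:
  assumes V: "V \<in> carrier_mat n n" "unitary_mat V" and d: "\<And>k. k < n \<Longrightarrow> lo \<le> d k \<and> d k \<le> hi"
    and w: "(\<Sum>i<n. (cmod (w i))\<^sup>2) = 1"
  shows "lo \<le> diag_form n V d w" "diag_form n V d w \<le> hi"
proof -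
  have "diag_form n V (\<lambda>_. lo) w \<le> diag_form n V d w" "diag_form n V d w \<le> diag_form n V (\<lambda>_. hi) w"
    using d by (auto intro!: diag_form_mono)
  then show "lo \<le> diag_form n V d w" "diag_form n V d w \<le> hi" by (simp_all add: diag_form_const[OF V] w)
qed

lemma unitary_diag_times_unitary:
  assumes V: "V \<in> carrier_mat n n" "unitary_mat V" and ik: "i < n" "k < n"
  shows "(\<Sum>j<n. unitary_diag n V e $$ (i, j) * V $$ (j, k)) = of_real (e k) * V $$ (i, k)"
proof -
  have "(\<Sum>j<n. unitary_diag n V e $$ (i, j) * V $$ (j, k))
      = (\<Sum>j<n. \<Sum>l<n. V $$ (i, l) * of_real (e l) * (cnj (V $$ (j, l)) * V $$ (j, k)))"
    using ik by (intro sum.cong refl) (simp add: unitary_diag_index[OF V(1)] sum_distrib_right sum_distrib_left mult_ac)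
  also have "\<dots> = (\<Sum>l<n. V $$ (i, l) * of_real (e l) * (\<Sum>j<n. cnj (V $$ (j, l)) * V $$ (j, k)))"
    unfolding sum_distrib_left by (rule sum.swap)
  also have "\<dots> = (\<Sum>l<n. if l = k then of_real (e k) * V $$ (i, k) else 0)"
    using ik by (intro sum.cong refl) (simp add: unitary_columns[OF V])
  finally show ?thesis using ik by simp
qed

text \<open>Distinct \<open>d\<close> and non-zero \<open>v\<close> are the generic case. Here
  \<open>V\<close> and \<open>e\<close> come from the spectral theorem and not from formulas, and
  the secular equation is derived.\<close>

locale generic_rank_one =
  fixes n :: nat and V :: "complex mat" and d v e :: "nat \<Rightarrow> real"
  assumes V: "V \<in> carrier_mat n n" "unitary_mat V"
    and entries: "\<And>i j. i < n \<Longrightarrow> j < n \<Longrightarrow>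
      unitary_diag n V e $$ (i, j) = of_real ((if i = j then d i else 0) + v i * v j)"
    and d_inj: "inj_on d {..<n}" and v_nonzero: "\<And>i. i < n \<Longrightarrow> v i \<noteq> 0"
begin

definition s :: "nat \<Rightarrow> complex" where "s k = (\<Sum>j<n. of_real (v j) * V $$ (j, k))"

lemma eigen_eq:
  assumes ik: "i < n" "k < n"
  shows "of_real (e k - d i) * V $$ (i, k) = of_real (v i) * s k"
proof -
  have "of_real (e k) * V $$ (i, k)
      = (\<Sum>j<n. (if j = i then of_real (d i) * V $$ (i, k) else 0) + of_real (v i) * (of_real (v j) * V $$ (j, k)))"
    unfolding unitary_diag_times_unitary[OF V ik, symmetric] using ik
    by (intro sum.cong refl) (simp add: entries algebra_simps)
  also have "\<dots> = of_real (d i) * V $$ (i, k) + of_real (v i) * s k"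
    using ik by (simp add: sum.distrib s_def sum_distrib_left)
  finally show ?thesis by (simp add: algebra_simps)
qed

text \<open>If \<open>s k\<close> were zero, \<open>eigen_eq\<close> would confine the column to
  indices with \<open>d i = e k\<close>. There is only one such index because \<open>d\<close> is
  injective, and then \<open>s k\<close> is a single non-zero term.\<close>

lemma s_nonzero:
  assumes k: "k < n"
  shows "s k \<noteq> 0"
proof
  assume s: "s k = 0"
  have "\<exists>i<n. V $$ (i, k) \<noteq> 0"
  proof (rule ccontr)
    assume "\<not> ?thesis"
    then have "(\<Sum>i<n. (cmod (V $$ (i, k)))\<^sup>2) = 0" by (intro sum.neutral) auto
    then show False using unitary_column_norm[OF V k] by simp
  qed
  then obtain i where i: "i < n" "V $$ (i, k) \<noteq> 0" by blast
  have e: "e k = d i" using eigen_eq[OF i(1) k] s i by simp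
  have "V $$ (j, k) = 0" if "j < n" "j \<noteq> i" for j
  proof -
    have "d j \<noteq> d i" using inj_onD[OF d_inj, of j i] that i by auto
    then show ?thesis using eigen_eq[OF that(1) k] s e by auto
  qed
  then have "s k = (\<Sum>j<n. if j = i then of_real (v i) * V $$ (i, k) else 0)"
    unfolding s_def by (intro sum.cong refl) auto
  then show False using s i v_nonzero[OF i(1)] by simp
qed

lemma e_neq_d: "i < n \<Longrightarrow> k < n \<Longrightarrow> e k \<noteq> d i"
  using eigen_eq[of i k] s_nonzero[of k] v_nonzero[of i] by auto

lemma V_eq: "i < n \<Longrightarrow> k < n \<Longrightarrow> V $$ (i, k) = of_real (v i / (e k - d i)) * s k"
  using eigen_eq[of i k] e_neq_d[of i k] by (simp add: field_simps)

sublocale secular n d e v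
proof
  show "inj_on d {..<n}" by (rule d_inj)
  show "e k \<noteq> d i" if "i < n" "k < n" for i k using e_neq_d that .
  show "(\<Sum>i<n. (v i)\<^sup>2 / (e k - d i)) = 1" if k: "k < n" for k
  proof -
    have "s k = of_real (\<Sum>i<n. (v i)\<^sup>2 / (e k - d i)) * s k"
      unfolding of_real_sum sum_distrib_right using k
      by (subst s_def, intro sum.cong refl) (simp add: V_eq power2_eq_square)
    then have "complex_of_real (\<Sum>i<n. (v i)\<^sup>2 / (e k - d i)) = 1" using s_nonzero[OF k] by simp
    then show ?thesis by (simp only: of_real_eq_1_iff)
  qed
  \<comment> \<open>Columns with the same eigenvalue would be proportional by \<open>V_eq\<close>,
    but they are orthogonal and non-zero.\<close>
  show "inj_on e {..<n}"
  proof (rule inj_onI, rule ccontr)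
    fix k l assume kl: "k \<in> {..<n}" "l \<in> {..<n}" "e k = e l" "k \<noteq> l"
    have "(\<Sum>i<n. cnj (V $$ (i, k)) * V $$ (i, l)) = (\<Sum>i<n. s l / s k * (cnj (V $$ (i, k)) * V $$ (i, k)))"
      using kl s_nonzero[of k] by (intro sum.cong refl) (simp add: V_eq)
    also have "\<dots> = s l / s k"
      unfolding sum_distrib_left[symmetric] using unitary_columns[OF V, of k k] kl by simp
    finally show False using unitary_columns[OF V, of k l] kl s_nonzero[of k] s_nonzero[of l] by simp
  qed
qed

lemma coords_norm:
  assumes k: "k < n"
  shows "(cmod (coords n V w k))\<^sup>2 = (cmod (\<Sum>i<n. of_real (v i / (e k - d i)) * w i))\<^sup>2 / N k"
proof -
  have "1 = (\<Sum>i<n. (cmod (V $$ (i, k)))\<^sup>2)" using unitary_column_norm[OF V k] ..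
  also have "\<dots> = (\<Sum>i<n. (v i)\<^sup>2 / (e k - d i)\<^sup>2 * (cmod (s k))\<^sup>2)"
  proof (intro sum.cong refl)
    fix i assume "i \<in> {..<n}"
    then have i: "i < n" by simp
    show "(cmod (V $$ (i, k)))\<^sup>2 = (v i)\<^sup>2 / (e k - d i)\<^sup>2 * (cmod (s k))\<^sup>2"
      unfolding V_eq[OF i k] norm_mult norm_of_real power_mult_distrib power2_abs power_divide ..
  qed
  also have "\<dots> = N k * (cmod (s k))\<^sup>2" unfolding N_def sum_distrib_right ..
  finally have "(cmod (s k))\<^sup>2 = 1 / N k" using N_pos[OF k] by (simp add: field_simps)
  moreover have "coords n V w k = cnj (s k) * (\<Sum>i<n. of_real (v i / (e k - d i)) * w i)"
    unfolding coords_def sum_distrib_left using k by (intro sum.cong refl) (simp add: V_eq)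
  ultimately show ?thesis by (simp add: norm_mult power_mult_distrib)
qed

text \<open>The bound for real vectors is applied to the real and to the imaginary part of
  \<open>w\<close>; the coefficients \<open>v i / (e k - d i)\<close> are real, so the two squares
  add up to a squared modulus.\<close>

lemma tone_squares_imp_diag_form_le:
  assumes f: "tone_squares n I f" and n: "0 < n" and I: "\<And>i. i < n \<Longrightarrow> d i \<in> I \<and> e i \<in> I"
  shows "(\<Sum>i<n. f (d i) * (cmod (w i))\<^sup>2) \<le> diag_form n V (\<lambda>k. f (e k)) w"
proof -
  let ?R = "\<lambda>k. \<Sum>i<n. Re (w i) * v i / (e k - d i)" and ?J = "\<lambda>k. \<Sum>i<n. Im (w i) * v i / (e k - d i)"
  have "(\<Sum>i<n. f (d i) * (cmod (w i))\<^sup>2) = (\<Sum>i<n. f (d i) * (Re (w i))\<^sup>2) + (\<Sum>i<n. f (d i) * (Im (w i))\<^sup>2)"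
    by (simp add: cmod_power2 distrib_left sum.distrib)
  also have "\<dots> \<le> (\<Sum>k<n. f (e k) * ((?R k)\<^sup>2 / N k)) + (\<Sum>k<n. f (e k) * ((?J k)\<^sup>2 / N k))"
    by (intro add_mono tone_squares_imp_form_le[OF f n I])
  also have "\<dots> = diag_form n V (\<lambda>k. f (e k)) w"
    unfolding diag_form_def sum.distrib[symmetric]
  proof (intro sum.cong refl)
    fix k assume "k \<in> {..<n}"
    then have k: "k < n" by simp
    have RI: "Re (\<Sum>i<n. of_real (v i / (e k - d i)) * w i) = ?R k" "Im (\<Sum>i<n. of_real (v i / (e k - d i)) * w i) = ?J k"
      by (simp_all add: mult.commute)
    show "f (e k) * ((?R k)\<^sup>2 / N k) + f (e k) * ((?J k)\<^sup>2 / N k) = f (e k) * (cmod (coords n V w k))\<^sup>2"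
      unfolding coords_norm[OF k] unfolding cmod_power2 RI by (simp add: add_divide_distrib distrib_left)
  qed
  finally show ?thesis .
qed

end

section \<open>Continuity of the functional calculus\<close>

lemma unitary_diag_mult:
  assumes V: "V \<in> carrier_mat n n" "unitary_mat V"
  shows "unitary_diag n V (\<lambda>k. d k * e k) = unitary_diag n V d * unitary_diag n V e"
proof (rule eq_matI)
  note c = unitary_diag_carrier[OF V(1)]
  fix i j assume "i < dim_row (unitary_diag n V d * unitary_diag n V e)" "j < dim_col (unitary_diag n V d * unitary_diag n V e)"
  then have ij: "i < n" "j < n" using c[of d] c[of e] by auto
  have "(unitary_diag n V d * unitary_diag n V e) $$ (i, j)
      = (\<Sum>l<n. unitary_diag n V d $$ (i, l) * (\<Sum>k<n. V $$ (l, k) * of_real (e k) * cnj (V $$ (j, k))))"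
    using ij by (subst mat_mult_index[OF c c ij]) (intro sum.cong refl, simp add: unitary_diag_index[OF V(1)])
  also have "\<dots> = (\<Sum>l<n. \<Sum>k<n. of_real (e k) * cnj (V $$ (j, k)) * (unitary_diag n V d $$ (i, l) * V $$ (l, k)))"
    by (simp add: sum_distrib_left mult_ac)
  also have "\<dots> = (\<Sum>k<n. of_real (e k) * cnj (V $$ (j, k)) * (\<Sum>l<n. unitary_diag n V d $$ (i, l) * V $$ (l, k)))"
    unfolding sum_distrib_left by (rule sum.swap)
  also have "\<dots> = unitary_diag n V (\<lambda>k. d k * e k) $$ (i, j)"
    unfolding unitary_diag_index[OF V(1) ij] using ij
    by (intro sum.cong refl) (simp only: lessThan_iff unitary_diag_times_unitary[OF V], simp add: mult_ac)
  finally show "unitary_diag n V (\<lambda>k. d k * e k) $$ (i, j) = (unitary_diag n V d * unitary_diag n V e) $$ (i, j)" ..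
qed (use unitary_diag_carrier[OF V(1), of d] unitary_diag_carrier[OF V(1), of e]
    unitary_diag_carrier[OF V(1), of "\<lambda>k. d k * e k"] in auto)

lemma unitary_diag_one:
  assumes V: "V \<in> carrier_mat n n" "unitary_mat V"
  shows "unitary_diag n V (\<lambda>_. 1) = 1\<^sub>m n"
proof -
  have "mat_diag n (\<lambda>i. complex_of_real 1) = 1\<^sub>m n" by (rule eq_matI) (auto simp: mat_diag_def)
  then show ?thesis
    unfolding unitary_diag_def using V unitary_matD(1)[OF V] by simp
qed

lemma herm_form_diff_bound:
  assumes w: "(\<Sum>i<n. (cmod (w i))\<^sup>2) = 1"
  shows "cmod (herm_form n A w - herm_form n B w) \<le> (\<Sum>i<n. \<Sum>j<n. cmod (A $$ (i, j) - B $$ (i, j)))"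
proof -
  have le: "cmod (w i) \<le> 1" if "i < n" for i
  proof -
    have "(cmod (w i))\<^sup>2 \<le> (\<Sum>i<n. (cmod (w i))\<^sup>2)" using that by (intro member_le_sum) auto
    then show ?thesis unfolding w abs_square_le_1 by simp
  qed
  have "herm_form n A w - herm_form n B w = (\<Sum>i<n. \<Sum>j<n. (A $$ (i, j) - B $$ (i, j)) * w j * cnj (w i))"
    by (simp add: herm_form_def sum_subtractf[symmetric] left_diff_distrib)
  also have "cmod \<dots> \<le> (\<Sum>i<n. \<Sum>j<n. cmod ((A $$ (i, j) - B $$ (i, j)) * w j * cnj (w i)))"
    by (rule order_trans[OF norm_sum]) (intro sum_mono norm_sum)
  also have "\<dots> \<le> (\<Sum>i<n. \<Sum>j<n. cmod (A $$ (i, j) - B $$ (i, j)))"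
  proof (intro sum_mono)
    fix i j assume "i \<in> {..<n}" "j \<in> {..<n}"
    then have "cmod (w j) * cmod (w i) \<le> 1 * 1" using le by (intro mult_mono) auto
    then have "cmod (A $$ (i, j) - B $$ (i, j)) * (cmod (w j) * cmod (w i)) \<le> cmod (A $$ (i, j) - B $$ (i, j)) * 1"
      by (intro mult_left_mono) auto
    then show "cmod ((A $$ (i, j) - B $$ (i, j)) * w j * cnj (w i)) \<le> cmod (A $$ (i, j) - B $$ (i, j))"
      by (simp add: norm_mult mult.assoc)
  qed
  finally show ?thesis .
qed

text \<open>Convergence is assumed for the entries only, because eigenvectors of converging matrices
  need not converge.\<close>

locale diag_limit =
  fixes n :: nat and F :: "'a filter" and Vs :: "'a \<Rightarrow> complex mat" and es :: "'a \<Rightarrow> nat \<Rightarrow> real"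
    and V :: "complex mat" and e :: "nat \<Rightarrow> real"
  assumes Vs: "\<And>s. Vs s \<in> carrier_mat n n" "\<And>s. unitary_mat (Vs s)"
    and V: "V \<in> carrier_mat n n" "unitary_mat V"
    and lim: "\<And>i j. i < n \<Longrightarrow> j < n \<Longrightarrow>
      ((\<lambda>s. unitary_diag n (Vs s) (es s) $$ (i, j)) \<longlongrightarrow> unitary_diag n V e $$ (i, j)) F"
begin

lemma lim_power_entry:
  "i < n \<Longrightarrow> j < n \<Longrightarrow> ((\<lambda>s. unitary_diag n (Vs s) (\<lambda>k. es s k ^ m) $$ (i, j))
      \<longlongrightarrow> unitary_diag n V (\<lambda>k. e k ^ m) $$ (i, j)) F"
proof (induction m arbitrary: i j)
  case 0
  then show ?case by (simp add: unitary_diag_one[OF Vs] unitary_diag_one[OF V])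
next
  case (Suc m)
  have eq: "unitary_diag n W (\<lambda>k. d k ^ Suc m) $$ (i, j)
      = (\<Sum>l<n. unitary_diag n W d $$ (i, l) * unitary_diag n W (\<lambda>k. d k ^ m) $$ (l, j))"
    if W: "W \<in> carrier_mat n n" "unitary_mat W" for W d
    unfolding power_Suc unitary_diag_mult[OF W]
    by (rule mat_mult_index[OF unitary_diag_carrier[OF W(1)] unitary_diag_carrier[OF W(1)] Suc.prems])
  show ?case
    unfolding eq[OF Vs] eq[OF V] using Suc.prems by (intro tendsto_sum tendsto_mult lim Suc.IH) auto
qed

lemma lim_power: "((\<lambda>s. diag_form n (Vs s) (\<lambda>k. es s k ^ m) w) \<longlongrightarrow> diag_form n V (\<lambda>k. e k ^ m) w) F"
proof -
  have "((\<lambda>s. herm_form n (unitary_diag n (Vs s) (\<lambda>k. es s k ^ m)) w)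
      \<longlongrightarrow> herm_form n (unitary_diag n V (\<lambda>k. e k ^ m)) w) F"
    unfolding herm_form_def by (intro tendsto_sum tendsto_mult lim_power_entry tendsto_const) auto
  then show ?thesis
    unfolding herm_form_unitary_diag[OF Vs(1)] herm_form_unitary_diag[OF V(1)] by (rule tendsto_of_real_iff[THEN iffD1])
qed

lemma lim_poly:
  "((\<lambda>s. diag_form n (Vs s) (\<lambda>k. \<Sum>i\<le>m. a i * es s k ^ i) w) \<longlongrightarrow> diag_form n V (\<lambda>k. \<Sum>i\<le>m. a i * e k ^ i) w) F"
proof -
  have eq: "diag_form n W (\<lambda>k. \<Sum>i\<le>m. a i * d k ^ i) w = (\<Sum>i\<le>m. a i * diag_form n W (\<lambda>k. d k ^ i) w)" for W d
    unfolding diag_form_def sum_distrib_left sum_distrib_right by (subst sum.swap) (simp add: mult_ac)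
  show ?thesis unfolding eq by (intro tendsto_sum tendsto_mult tendsto_const lim_power)
qed

text \<open>An eigenvalue is the value of the form at a unit eigenvector, and entrywise convergence
  of matrices is uniform convergence of forms on unit vectors.\<close>

lemma eventually_eigenvalues:
  assumes e: "\<And>k. k < n \<Longrightarrow> lo \<le> e k \<and> e k \<le> hi" and "0 < \<eta>"
  shows "eventually (\<lambda>s. \<forall>k<n. es s k \<in> {lo - \<eta>..hi + \<eta>}) F"
proof -
  let ?\<delta> = "\<lambda>s. \<Sum>i<n. \<Sum>j<n. cmod (unitary_diag n (Vs s) (es s) $$ (i, j) - unitary_diag n V e $$ (i, j))"
  have "(?\<delta> \<longlongrightarrow> (\<Sum>i<n. \<Sum>j<n. 0)) F"
    by (intro tendsto_sum tendsto_norm_zero LIM_zero lim) auto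
  then have "eventually (\<lambda>s. ?\<delta> s < \<eta>) F" using assms(2) by (intro order_tendstoD) auto
  then show ?thesis
  proof eventually_elim
    case (elim s)
    show ?case
    proof (intro allI impI)
      fix k assume k: "k < n"
      let ?w = "\<lambda>i. Vs s $$ (i, k)"
      note w = unitary_column_norm[OF Vs k, of s]
      have "cmod (complex_of_real (diag_form n (Vs s) (es s) ?w - diag_form n V e ?w)) \<le> ?\<delta> s"
        using herm_form_diff_bound[OF w, of "unitary_diag n (Vs s) (es s)" "unitary_diag n V e"]
        by (simp add: herm_form_unitary_diag[OF Vs(1)] herm_form_unitary_diag[OF V(1)])
      then have "\<bar>diag_form n (Vs s) (es s) ?w - diag_form n V e ?w\<bar> < \<eta>"
        using elim unfolding norm_of_real by (rule le_less_trans)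
      then show "es s k \<in> {lo - \<eta>..hi + \<eta>}"
        using diag_form_bounds[OF V, where d = e, OF e w] unfolding diag_form_column[OF Vs k] by (auto simp: abs_less_iff)
    qed
  qed
qed

lemma eventually_eigenvalues_in:
  assumes "open I" "is_interval I" "\<And>k. k < n \<Longrightarrow> e k \<in> I"
  obtains K where "compact K" "K \<subseteq> I" "eventually (\<lambda>s. \<forall>k<n. es s k \<in> K) F" "\<forall>k<n. e k \<in> K"
proof (cases "n = 0")
  case True
  then show thesis using that[of "{}"] by simp
next
  case False
  define lo hi where "lo = Min (e ` {..<n})" and "hi = Max (e ` {..<n})"
  have lohi: "lo \<in> e ` {..<n}" "hi \<in> e ` {..<n}" unfolding lo_def hi_def using False by (auto intro!: Min_in Max_in)
  then have I: "lo \<in> I" "hi \<in> I" using assms(3) by auto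
  have e: "lo \<le> e k \<and> e k \<le> hi" if "k < n" for k using that by (simp add: lo_def hi_def)
  obtain \<epsilon>1 where 1: "0 < \<epsilon>1" "cball lo \<epsilon>1 \<subseteq> I" using assms(1) I(1) unfolding open_contains_cball by blast
  obtain \<epsilon>2 where 2: "0 < \<epsilon>2" "cball hi \<epsilon>2 \<subseteq> I" using assms(1) I(2) unfolding open_contains_cball by blast
  define \<eta> where "\<eta> = min \<epsilon>1 \<epsilon>2"
  have \<eta>: "0 < \<eta>" using 1 2 by (simp add: \<eta>_def)
  have "lo - \<eta> \<in> cball lo \<epsilon>1" "hi + \<eta> \<in> cball hi \<epsilon>2" using \<eta> by (auto simp: \<eta>_def dist_real_def)
  then have "lo - \<eta> \<in> I" "hi + \<eta> \<in> I" using 1(2) 2(2) by auto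
  then have sub: "{lo - \<eta>..hi + \<eta>} \<subseteq> I" by (rule Icc_subset[OF assms(2)])
  have "e k \<in> {lo - \<eta>..hi + \<eta>}" if "k < n" for k using e[OF that] \<eta> by simp
  then show thesis by (intro that[OF compact_Icc sub eventually_eigenvalues[OF e \<eta>]]) auto
qed

theorem lim_fun:
  assumes I: "open I" "is_interval I" "\<And>k. k < n \<Longrightarrow> e k \<in> I" and f: "continuous_on I f"
  shows "((\<lambda>s. diag_form n (Vs s) (\<lambda>k. f (es s k)) w) \<longlongrightarrow> diag_form n V (\<lambda>k. f (e k)) w) F"
proof (rule tendstoI)
  fix \<epsilon> :: real assume \<epsilon>: "0 < \<epsilon>"
  obtain K where K: "compact K" "K \<subseteq> I" and evK: "eventually (\<lambda>s. \<forall>k<n. es s k \<in> K) F" and eK: "\<forall>k<n. e k \<in> K"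
    by (rule eventually_eigenvalues_in[OF I])
  define W where "W = (\<Sum>i<n. (cmod (w i))\<^sup>2)"
  have W: "0 \<le> W" unfolding W_def by (intro sum_nonneg) auto
  \<comment> \<open>A uniform error \<open>\<eta>\<close> in the function changes the form at
    \<open>w\<close> by at most \<open>\<eta> * W\<close>; the added 1 avoids division by
    zero.\<close>
  define \<eta> where "\<eta> = \<epsilon> / 3 / (W + 1)"
  have \<eta>: "0 < \<eta>" using \<epsilon> W by (simp add: \<eta>_def)
  obtain g where g: "real_polynomial_function g" "\<And>x. x \<in> K \<Longrightarrow> \<bar>f x - g x\<bar> < \<eta>"
    using Stone_Weierstrass_real_polynomial_function[OF K(1) continuous_on_subset[OF f K(2)] \<eta>] by blast
  obtain a m where gs: "g = (\<lambda>x. \<Sum>i\<le>m. a i * x ^ i)" using g(1) unfolding real_polynomial_function_iff_sum by blast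
  have close: "\<bar>diag_form n U (\<lambda>k. f (c k)) w - diag_form n U (\<lambda>k. g (c k)) w\<bar> \<le> \<epsilon> / 3"
    if U: "U \<in> carrier_mat n n" "unitary_mat U" and c: "\<forall>k<n. c k \<in> K" for U c
  proof -
    have "diag_form n U (\<lambda>k. f (c k)) w - diag_form n U (\<lambda>k. g (c k)) w = diag_form n U (\<lambda>k. f (c k) - g (c k)) w"
      by (simp add: diag_form_def sum_subtractf[symmetric] left_diff_distrib)
    moreover have "diag_form n U (\<lambda>k. f (c k) - g (c k)) w \<le> diag_form n U (\<lambda>k. \<eta>) w"
      "diag_form n U (\<lambda>k. - \<eta>) w \<le> diag_form n U (\<lambda>k. f (c k) - g (c k)) w"
      using g(2) c by (force intro!: diag_form_mono)+
    ultimately have "\<bar>diag_form n U (\<lambda>k. f (c k)) w - diag_form n U (\<lambda>k. g (c k)) w\<bar> \<le> \<eta> * W"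
      by (simp add: diag_form_const[OF U] W_def)
    also have "\<dots> \<le> \<eta> * (W + 1)" using \<eta> by (intro mult_left_mono) auto
    also have "\<eta> * (W + 1) = \<epsilon> / 3"
    proof -
      have "W + 1 \<noteq> 0" using W by simp
      then show ?thesis unfolding \<eta>_def by (rule nonzero_eq_divide_eq[THEN iffD1, OF _ refl])
    qed
    finally show ?thesis .
  qed
  have "((\<lambda>s. diag_form n (Vs s) (\<lambda>k. g (es s k)) w) \<longlongrightarrow> diag_form n V (\<lambda>k. g (e k)) w) F"
    unfolding gs by (rule lim_poly)
  then have "eventually (\<lambda>s. dist (diag_form n (Vs s) (\<lambda>k. g (es s k)) w) (diag_form n V (\<lambda>k. g (e k)) w) < \<epsilon> / 3) F"
    using \<epsilon> by (intro tendstoD) auto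
  then show "eventually (\<lambda>s. dist (diag_form n (Vs s) (\<lambda>k. f (es s k)) w) (diag_form n V (\<lambda>k. f (e k)) w) < \<epsilon>) F"
    using evK
  proof eventually_elim
    case (elim s)
    then show ?case using close[OF Vs[of s] elim(2)] close[OF V eK] unfolding dist_real_def by linarith
  qed
qed

end

section \<open>From divided differences to monotonicity\<close>

lemma eventually_affine_nonzero:
  fixes a b :: real
  assumes "a \<noteq> 0 \<or> b \<noteq> 0"
  shows "eventually (\<lambda>s. a + s * b \<noteq> 0) (at_right 0)"
proof (cases "a = 0")
  case True
  then show ?thesis using assms eventually_at_right_less[of "0 :: real"] by (auto elim: eventually_mono)
next
  case False
  have "((\<lambda>s. a + s * b) \<longlongrightarrow> a + 0 * b) (at_right 0)" by (intro tendsto_intros)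
  then show ?thesis using False by (intro tendsto_imp_eventually_ne) auto
qed

text \<open>A small perturbation makes the situation generic; the inequality for it passes to the
  limit by \<open>lim_fun\<close>.\<close>

lemma rank_one_diagonal_le:
  assumes f: "tone_squares n I f" "continuous_on I f" and I: "open I" "is_interval I" and n: "0 < n"
    and V: "V \<in> carrier_mat n n" "unitary_mat V"
    and entries: "\<And>i j. i < n \<Longrightarrow> j < n \<Longrightarrow>
      unitary_diag n V e $$ (i, j) = of_real ((if i = j then d i else 0) + v i * v j)"
    and v: "\<And>i. 0 \<le> v i" and de: "\<And>i. i < n \<Longrightarrow> d i \<in> I \<and> e i \<in> I"
  shows "(\<Sum>i<n. f (d i) * (cmod (w i))\<^sup>2) \<le> diag_form n V (\<lambda>k. f (e k)) w"
proof -
  \<comment> \<open>The multiples \<open>i + 1\<close> of \<open>s\<close> separate equal entries of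
    \<open>d\<close>, and \<open>v i + s\<close> is positive because \<open>v i\<close> is
    non-negative.\<close>
  define ds where "ds s i = d i + s * real (i + 1)" for s i
  define vs where "vs s i = v i + s" for s i
  define M where "M s = Matrix.mat n n (\<lambda>(i, j). complex_of_real ((if i = j then ds s i else 0) + vs s i * vs s j))" for s
  have M: "M s \<in> carrier_mat n n" for s by (simp add: M_def)
  have "mat_adjoint (M s) = M s" for s by (rule eq_matI) (auto simp: M_def mat_adjoint_index mult.commute)
  then have "\<forall>s. \<exists>U c. U \<in> carrier_mat n n \<and> unitary_mat U \<and> M s = unitary_diag n U c"
    using hermitian_unitary_diagonalization[OF M] by blast
  then obtain Vs es where V': "\<forall>s. Vs s \<in> carrier_mat n n \<and> unitary_mat (Vs s) \<and> M s = unitary_diag n (Vs s) (es s)"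
    unfolding choice_iff by (elim exE)
  have ent: "unitary_diag n (Vs s) (es s) $$ (i, j) = of_real ((if i = j then ds s i else 0) + vs s i * vs s j)"
    if "i < n" "j < n" for s i j
  proof -
    have "unitary_diag n (Vs s) (es s) = M s" using V' by simp
    then show ?thesis using that by (simp add: M_def)
  qed
  have ds_lim: "((\<lambda>s. ds s i) \<longlongrightarrow> d i) (at_right 0)" for i
  proof -
    have "((\<lambda>s. ds s i) \<longlongrightarrow> d i + 0 * real (i + 1)) (at_right 0)" unfolding ds_def by (intro tendsto_intros)
    then show ?thesis by simp
  qed
  have vs_lim: "((\<lambda>s. vs s i) \<longlongrightarrow> v i) (at_right 0)" for i
  proof -
    have "((\<lambda>s. vs s i) \<longlongrightarrow> v i + 0) (at_right 0)" unfolding vs_def by (intro tendsto_intros)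
    then show ?thesis by simp
  qed
  interpret diag_limit n "at_right 0" Vs es V e
  proof
    show "Vs s \<in> carrier_mat n n" "unitary_mat (Vs s)" for s using V' by auto
    fix i j assume ij: "i < n" "j < n"
    have "((\<lambda>s. if i = j then ds s i else 0) \<longlongrightarrow> (if i = j then d i else 0)) (at_right 0)"
      by (simp add: ds_lim)
    then show "((\<lambda>s. unitary_diag n (Vs s) (es s) $$ (i, j)) \<longlongrightarrow> unitary_diag n V e $$ (i, j)) (at_right 0)"
      unfolding ent[OF ij] entries[OF ij] by (intro tendsto_of_real tendsto_add tendsto_mult vs_lim)
  qed (use V in auto)
  have eI: "e k \<in> I" if "k < n" for k using de[OF that] by simp
  obtain K where K: "compact K" "K \<subseteq> I" and evK: "eventually (\<lambda>s. \<forall>k<n. es s k \<in> K) (at_right 0)"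
    by (rule eventually_eigenvalues_in[OF I eI])
  have evd: "eventually (\<lambda>s. \<forall>i\<in>{..<n}. ds s i \<in> I) (at_right 0)"
    using de by (intro eventually_ball_finite ballI topological_tendstoD[OF ds_lim I(1)]) auto
  have inj: "eventually (\<lambda>s. \<forall>p\<in>{..<n} \<times> {..<n}. fst p \<noteq> snd p \<longrightarrow> ds s (fst p) \<noteq> ds s (snd p)) (at_right 0)"
  proof (intro eventually_ball_finite ballI)
    fix p
    show "eventually (\<lambda>s. fst p \<noteq> snd p \<longrightarrow> ds s (fst p) \<noteq> ds s (snd p)) (at_right 0)"
    proof (cases "fst p = snd p")
      case False
      then have "eventually (\<lambda>s. (d (fst p) - d (snd p)) + s * (real (fst p + 1) - real (snd p + 1)) \<noteq> 0) (at_right 0)"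
        by (intro eventually_affine_nonzero) auto
      then show ?thesis by (rule eventually_mono) (auto simp: ds_def algebra_simps)
    qed simp
  qed auto
  have ev: "eventually (\<lambda>s. (\<Sum>i<n. f (ds s i) * (cmod (w i))\<^sup>2) \<le> diag_form n (Vs s) (\<lambda>k. f (es s k)) w) (at_right 0)"
    using evK evd inj eventually_at_right_less[of "0 :: real"]
  proof eventually_elim
    case (elim s)
    interpret g: generic_rank_one n "Vs s" "ds s" "vs s" "es s"
    proof
      show "inj_on (ds s) {..<n}" using elim(3) by (force simp: inj_on_def)
      show "vs s i \<noteq> 0" if "i < n" for i using elim(4) v[of i] by (simp add: vs_def)
    qed (use V' ent in auto)
    show ?case
    proof (rule g.tone_squares_imp_diag_form_le[OF f(1) n])
      fix i assume i: "i < n"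
      then have "es s i \<in> K" "ds s i \<in> I" using elim(1,2) by auto
      then show "ds s i \<in> I \<and> es s i \<in> I" using K(2) by blast
    qed
  qed
  have lhs: "((\<lambda>s. \<Sum>i<n. f (ds s i) * (cmod (w i))\<^sup>2) \<longlongrightarrow> (\<Sum>i<n. f (d i) * (cmod (w i))\<^sup>2)) (at_right 0)"
  proof (intro tendsto_sum tendsto_mult tendsto_const)
    fix i assume "i \<in> {..<n}"
    then have "isCont f (d i)" using f(2) I(1) de by (auto simp: continuous_on_eq_continuous_at)
    then show "((\<lambda>s. f (ds s i)) \<longlongrightarrow> f (d i)) (at_right 0)" using ds_lim by (rule isCont_tendsto_compose)
  qed
  show ?thesis by (rule tendsto_le[OF trivial_limit_at_right_real lim_fun[OF I eI f(2), where w = w] lhs ev])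
qed

lemma coords_mult:
  assumes A: "A \<in> carrier_mat n n" and B: "B \<in> carrier_mat n n" and k: "k < n"
  shows "coords n (A * B) w k = coords n B (coords n A w) k"
proof -
  have "coords n (A * B) w k = (\<Sum>i<n. \<Sum>l<n. cnj (B $$ (l, k)) * (cnj (A $$ (i, l)) * w i))"
    unfolding coords_def using k
    by (intro sum.cong refl) (simp add: mat_mult_index[OF A B] sum_distrib_right sum_distrib_left mult_ac del: index_mult_mat)
  also have "\<dots> = coords n B (coords n A w) k"
    unfolding coords_def sum_distrib_left by (rule sum.swap)
  finally show ?thesis .
qed

lemma diag_form_cong:
  assumes "\<And>k. k < n \<Longrightarrow> cmod (coords n U w k) = cmod (coords n V w' k)"
  shows "diag_form n U d w = diag_form n V d w'"
  unfolding diag_form_def using assms by (intro sum.cong) auto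

lemma conj_index:
  assumes W: "W \<in> carrier_mat n n" and A: "A \<in> carrier_mat n n" and ij: "i < n" "j < n"
  shows "(W * A * mat_adjoint W) $$ (i, j) = (\<Sum>l<n. \<Sum>m<n. W $$ (i, l) * A $$ (l, m) * cnj (W $$ (j, m)))"
proof -
  have "(W * A * mat_adjoint W) $$ (i, j) = (\<Sum>m<n. (W * A) $$ (i, m) * mat_adjoint W $$ (m, j))"
    by (rule mat_mult_index[OF mult_carrier_mat[OF W A] mat_adjoint_carrier[OF W] ij])
  also have "\<dots> = (\<Sum>m<n. (\<Sum>l<n. W $$ (i, l) * A $$ (l, m)) * cnj (W $$ (j, m)))"
  proof (intro sum.cong refl)
    fix m assume "m \<in> {..<n}"
    then have m: "m < n" by simp
    have "mat_adjoint W $$ (m, j) = cnj (W $$ (j, m))" using mat_adjoint_index[of m W j] W m ij by auto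
    then show "(W * A) $$ (i, m) * mat_adjoint W $$ (m, j) = (\<Sum>l<n. W $$ (i, l) * A $$ (l, m)) * cnj (W $$ (j, m))"
      by (simp only: mat_mult_index[OF W A ij(1) m])
  qed
  also have "\<dots> = (\<Sum>l<n. \<Sum>m<n. W $$ (i, l) * A $$ (l, m) * cnj (W $$ (j, m)))"
    unfolding sum_distrib_right by (rule sum.swap)
  finally show ?thesis .
qed

lemma mat_adjoint_adjoint:
  fixes U :: "complex mat"
  assumes "U \<in> carrier_mat n n"
  shows "mat_adjoint (mat_adjoint U) = U"
  using assms by (intro eq_matI) (auto simp: mat_adjoint_index)

lemma unitary_mat_adjoint:
  assumes U: "U \<in> carrier_mat n n" "unitary_mat U"
  shows "unitary_mat (mat_adjoint U)"
  unfolding unitary_mat_def mat_adjoint_adjoint[OF U(1)] using U(1) unitary_matD(2)[OF U] by auto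

text \<open>Multiplying the columns by phases leaves the diagonalised matrix unchanged and makes the
  coordinates of \<open>z\<close> real and non-negative, as \<open>rank_one_diagonal_le\<close>
  requires.\<close>

lemma coords_phase:
  assumes U: "U \<in> carrier_mat n n" "unitary_mat U"
  obtains U' where "U' \<in> carrier_mat n n" "unitary_mat U'"
    "\<forall>k<n. coords n U' z k = of_real (cmod (coords n U z k))"
    "\<forall>w. \<forall>k<n. cmod (coords n U' w k) = cmod (coords n U w k)"
    "\<forall>d. unitary_diag n U' d = unitary_diag n U d"
proof -
  define \<phi> where "\<phi> k = (if coords n U z k = 0 then 1 else coords n U z k / of_real (cmod (coords n U z k)))" for k
  have \<phi>: "cmod (\<phi> k) = 1" for k by (simp add: \<phi>_def norm_divide)
  then have \<phi>': "\<phi> k * cnj (\<phi> k) = 1" for k using complex_norm_square[of "\<phi> k"] by simp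
  define U' where "U' = Matrix.mat n n (\<lambda>(i, k). U $$ (i, k) * \<phi> k)"
  have U'c: "U' \<in> carrier_mat n n" by (simp add: U'_def)
  have diag: "unitary_diag n U' d = unitary_diag n U d" for d
  proof (rule eq_matI)
    fix i j assume "i < dim_row (unitary_diag n U d)" "j < dim_col (unitary_diag n U d)"
    then have ij: "i < n" "j < n" using unitary_diag_carrier[OF U(1), of d] by auto
    show "unitary_diag n U' d $$ (i, j) = unitary_diag n U d $$ (i, j)"
      unfolding unitary_diag_index[OF U'c ij] unitary_diag_index[OF U(1) ij]
    proof (intro sum.cong refl)
      fix k assume "k \<in> {..<n}"
      then have "U' $$ (i, k) * of_real (d k) * cnj (U' $$ (j, k))
          = U $$ (i, k) * of_real (d k) * cnj (U $$ (j, k)) * (\<phi> k * cnj (\<phi> k))"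
        using ij by (simp add: U'_def mult_ac)
      then show "U' $$ (i, k) * of_real (d k) * cnj (U' $$ (j, k)) = U $$ (i, k) * of_real (d k) * cnj (U $$ (j, k))"
        by (simp add: \<phi>')
    qed
  qed (use unitary_diag_carrier[OF U(1), of d] unitary_diag_carrier[OF U'c, of d] in auto)
  have coords: "coords n U' w k = cnj (\<phi> k) * coords n U w k" if "k < n" for w k
    unfolding coords_def sum_distrib_left using that by (intro sum.cong) (auto simp: U'_def)
  have "unitary_mat U'"
  proof -
    have one: "mat_diag n (\<lambda>i. complex_of_real 1) = 1\<^sub>m n" by (rule eq_matI) (auto simp: mat_diag_def)
    have "U' * mat_adjoint U' = unitary_diag n U' (\<lambda>_. 1)"
      unfolding unitary_diag_def one right_mult_one_mat[OF U'c] ..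
    then show ?thesis using U'c unfolding unitary_mat_def diag unitary_diag_one[OF U] by auto
  qed
  moreover have "coords n U' z k = of_real (cmod (coords n U z k))" if "k < n" for k
  proof (cases "coords n U z k = 0")
    case False
    then show ?thesis
      unfolding coords[OF that] using complex_norm_square[of "coords n U z k"]
      by (simp add: \<phi>_def power2_eq_square field_simps)
  qed (simp add: coords[OF that])
  moreover have "cmod (coords n U' w k) = cmod (coords n U w k)" if "k < n" for w k
    by (simp add: coords[OF that] norm_mult \<phi>)
  ultimately show thesis using that U'c diag by blast
qed

text \<open>In an eigenbasis of the first matrix, with phases adapted to \<open>z\<close>, this is
  \<open>rank_one_diagonal_le\<close>.\<close>

lemma rank_one_le:
  assumes f: "tone_squares n I f" "continuous_on I f" and I: "open I" "is_interval I" and n: "0 < n"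
    and U: "U \<in> carrier_mat n n" "unitary_mat U" and V: "V \<in> carrier_mat n n" "unitary_mat V"
    and rank_one: "\<And>i j. i < n \<Longrightarrow> j < n \<Longrightarrow>
      unitary_diag n V e $$ (i, j) = unitary_diag n U d $$ (i, j) + z i * cnj (z j)"
    and de: "\<And>i. i < n \<Longrightarrow> d i \<in> I \<and> e i \<in> I"
  shows "diag_form n U (\<lambda>k. f (d k)) w \<le> diag_form n V (\<lambda>k. f (e k)) w"
proof -
  obtain U' where U': "U' \<in> carrier_mat n n" "unitary_mat U'"
    and z: "\<forall>k<n. coords n U' z k = of_real (cmod (coords n U z k))"
    and cmod: "\<forall>w. \<forall>k<n. cmod (coords n U' w k) = cmod (coords n U w k)"
    and diag: "\<forall>d. unitary_diag n U' d = unitary_diag n U d"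
    by (rule coords_phase[OF U, of z])
  define v where "v k = cmod (coords n U z k)" for k
  define W where "W = mat_adjoint U'"
  have W: "W \<in> carrier_mat n n" "unitary_mat W"
    unfolding W_def by (rule mat_adjoint_carrier[OF U'(1)], rule unitary_mat_adjoint[OF U'])
  have Wi: "W $$ (i, l) = cnj (U' $$ (l, i))" if "i < n" "l < n" for i l
    using mat_adjoint_index[of i U' l] U' that by (auto simp: W_def)
  have Wz: "(\<Sum>l<n. W $$ (i, l) * z l) = of_real (v i)" if i: "i < n" for i
  proof -
    have "(\<Sum>l<n. W $$ (i, l) * z l) = coords n U' z i"
      unfolding coords_def using i by (intro sum.cong refl) (simp add: Wi)
    then show ?thesis using z i by (simp add: v_def)
  qed
  have entries: "unitary_diag n (W * V) e $$ (i, j) = of_real ((if i = j then d i else 0) + v i * v j)"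
    if ij: "i < n" "j < n" for i j
  proof -
    have "unitary_diag n (W * V) e $$ (i, j)
        = (\<Sum>l<n. \<Sum>m<n. W $$ (i, l) * unitary_diag n V e $$ (l, m) * cnj (W $$ (j, m)))"
      unfolding unitary_diag_conj[OF W(1) V(1)] by (rule conj_index[OF W(1) unitary_diag_carrier[OF V(1)] ij])
    also have "\<dots> = (\<Sum>l<n. \<Sum>m<n. W $$ (i, l) * unitary_diag n U' d $$ (l, m) * cnj (W $$ (j, m))
        + (W $$ (i, l) * z l) * cnj (W $$ (j, m) * z m))"
      by (intro sum.cong refl) (simp add: rank_one diag algebra_simps)
    also have "\<dots> = (\<Sum>l<n. \<Sum>m<n. W $$ (i, l) * unitary_diag n U' d $$ (l, m) * cnj (W $$ (j, m)))
        + (\<Sum>l<n. W $$ (i, l) * z l) * cnj (\<Sum>m<n. W $$ (j, m) * z m)"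
      unfolding sum.distrib cnj_sum sum_product ..
    also have "(\<Sum>l<n. \<Sum>m<n. W $$ (i, l) * unitary_diag n U' d $$ (l, m) * cnj (W $$ (j, m)))
        = unitary_diag n (W * U') d $$ (i, j)"
      unfolding unitary_diag_conj[OF W(1) U'(1)]
      by (rule conj_index[symmetric, OF W(1) unitary_diag_carrier[OF U'(1)] ij])
    also have "W * U' = 1\<^sub>m n" unfolding W_def by (rule unitary_matD(2)[OF U'])
    also have "unitary_diag n (1\<^sub>m n) d $$ (i, j) = of_real (if i = j then d i else 0)"
    proof -
      have "unitary_diag n (1\<^sub>m n) d $$ (i, j) = (\<Sum>k<n. if k = i then of_real (if i = j then d i else 0) else 0)"
        unfolding unitary_diag_index[OF one_carrier_mat ij] using ij by (intro sum.cong refl) auto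
      then show ?thesis using ij by simp
    qed
    finally show ?thesis unfolding Wz[OF ij(1)] Wz[OF ij(2)] by simp
  qed
  have "diag_form n U (\<lambda>k. f (d k)) w = (\<Sum>i<n. f (d i) * (cmod (coords n U' w i))\<^sup>2)"
    unfolding diag_form_def using cmod by (intro sum.cong) auto
  also have "\<dots> \<le> diag_form n (W * V) (\<lambda>k. f (e k)) (coords n U' w)"
    by (rule rank_one_diagonal_le[OF f I n mult_carrier_mat[OF W(1) V(1)] unitary_mat_mult[OF W V] entries _ de])
      (simp_all add: v_def)
  also have "\<dots> = diag_form n V (\<lambda>k. f (e k)) w"
  proof (rule diag_form_cong)
    fix k assume k: "k < n"
    have "U' * (W * V) = (U' * W) * V" by (rule assoc_mult_mat[symmetric, OF U'(1) W(1) V(1)])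
    also have "\<dots> = V" unfolding W_def unitary_matD(1)[OF U'] by (rule left_mult_one_mat[OF V(1)])
    finally have "coords n V w k = coords n (W * V) (coords n U' w) k"
      using coords_mult[OF U'(1) mult_carrier_mat[OF W(1) V(1)] k, of w] by simp
    then show "cmod (coords n (W * V) (coords n U' w) k) = cmod (coords n V w k)" by simp
  qed
  finally show ?thesis .
qed

text \<open>The spectral theorem writes the difference as a sum of rank-one matrices, which are
  added one at a time. All intermediate matrices lie between the two given ones, so their spectra
  stay in the interval.\<close>

theorem tone_squares_imp_n_monotone:
  assumes f: "tone_squares n I f" "continuous_on I f" and I: "open I" "is_interval I" and n: "0 < n"
  shows "n_monotone n I f"
  unfolding n_monotone_iff
proof (intro allI impI, elim conjE)
  fix U V d e w
  assume U: "U \<in> carrier_mat n n" "unitary_mat U" and V: "V \<in> carrier_mat n n" "unitary_mat V"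
    and d: "\<forall>k<n. d k \<in> I" and e: "\<forall>k<n. e k \<in> I" and le: "\<forall>w. diag_form n U d w \<le> diag_form n V e w"
  note cU = unitary_diag_carrier[OF U(1), of d] and cV = unitary_diag_carrier[OF V(1), of e]
  have "mat_adjoint (unitary_diag n V e - unitary_diag n U d) = unitary_diag n V e - unitary_diag n U d"
    by (simp add: mat_adjoint_diff[OF cU cV] mat_adjoint_unitary_diag U V)
  from hermitian_unitary_diagonalization[OF minus_carrier_mat[OF cU] this]
  obtain Z \<delta> where Z: "Z \<in> carrier_mat n n" "unitary_mat Z" "unitary_diag n V e - unitary_diag n U d = unitary_diag n Z \<delta>"
    by (elim exE conjE)
  have form: "diag_form n Z \<delta> w = diag_form n V e w - diag_form n U d w" for w
  proof -
    have "complex_of_real (diag_form n Z \<delta> w) = of_real (diag_form n V e w - diag_form n U d w)"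
      unfolding herm_form_unitary_diag[OF Z(1), symmetric] Z(3)[symmetric] herm_form_diff[OF cU cV]
      by (simp add: herm_form_unitary_diag U V)
    then show ?thesis by (simp only: of_real_eq_iff)
  qed
  have \<delta>: "0 \<le> \<delta> k" if "k < n" for k
    using form[of "\<lambda>i. Z $$ (i, k)"] le unfolding diag_form_column[OF Z(1,2) that] by (metis diff_ge_0_iff_ge)
  define z where "z k i = of_real (sqrt (\<delta> k)) * Z $$ (i, k)" for k i
  have zz: "z k i * cnj (z k j) = Z $$ (i, k) * of_real (\<delta> k) * cnj (Z $$ (j, k))" if "k < n" for k i j
  proof -
    have "complex_of_real (sqrt (\<delta> k)) * of_real (sqrt (\<delta> k)) = of_real (\<delta> k)"
      using \<delta>[OF that] by (simp flip: of_real_mult)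
    then show ?thesis by (simp add: z_def mult_ac)
  qed
  define A where "A m = Matrix.mat n n (\<lambda>(i, j). unitary_diag n U d $$ (i, j) + (\<Sum>k<m. z k i * cnj (z k j)))" for m
  have A: "A m \<in> carrier_mat n n" for m by (simp add: A_def)
  have Ui: "unitary_diag n U d $$ (j, i) = cnj (unitary_diag n U d $$ (i, j))" if "i < n" "j < n" for i j
    using that by (simp add: unitary_diag_index[OF U(1)] mult_ac)
  have adjA: "mat_adjoint (A m) = A m" for m
  proof (rule eq_matI)
    fix i j assume "i < dim_row (A m)" "j < dim_col (A m)"
    then have ij: "i < n" "j < n" using A[of m] by auto
    have "mat_adjoint (A m) $$ (i, j) = cnj (A m $$ (j, i))" using mat_adjoint_index[of i "A m" j] A[of m] ij by auto
    also have "\<dots> = A m $$ (i, j)" using Ui[OF ij] ij by (simp add: A_def mult.commute)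
    finally show "mat_adjoint (A m) $$ (i, j) = A m $$ (i, j)" .
  qed (use A[of m] in auto)
  have An: "A n = unitary_diag n V e"
  proof (rule eq_matI)
    fix i j assume "i < dim_row (unitary_diag n V e)" "j < dim_col (unitary_diag n V e)"
    then have ij: "i < n" "j < n" using cV by auto
    have "(\<Sum>k<n. z k i * cnj (z k j)) = (unitary_diag n V e - unitary_diag n U d) $$ (i, j)"
      unfolding Z(3) unitary_diag_index[OF Z(1) ij] by (intro sum.cong refl) (simp add: zz)
    then show "A n $$ (i, j) = unitary_diag n V e $$ (i, j)" using ij cU cV by (simp add: A_def)
  qed (use cV A[of n] in auto)
  have formA: "herm_form n (A m) w = of_real (diag_form n U d w + (\<Sum>k<m. \<delta> k * (cmod (coords n Z w k))\<^sup>2))"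
    if m: "m \<le> n" for m w
  proof -
    have "herm_form n (A m) w = (\<Sum>i<n. \<Sum>j<n. unitary_diag n U d $$ (i, j) * w j * cnj (w i)
        + (\<Sum>k<m. of_real (\<delta> k) * ((Z $$ (i, k) * cnj (w i)) * (cnj (Z $$ (j, k)) * w j))))"
      unfolding herm_form_def
    proof (intro sum.cong refl)
      fix i j assume "i \<in> {..<n}" "j \<in> {..<n}"
      then have "A m $$ (i, j) * w j * cnj (w i) = unitary_diag n U d $$ (i, j) * w j * cnj (w i)
          + (\<Sum>k<m. z k i * cnj (z k j) * w j * cnj (w i))"
        by (simp add: A_def distrib_right sum_distrib_right)
      also have "(\<Sum>k<m. z k i * cnj (z k j) * w j * cnj (w i))
          = (\<Sum>k<m. of_real (\<delta> k) * ((Z $$ (i, k) * cnj (w i)) * (cnj (Z $$ (j, k)) * w j)))"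
      proof (intro sum.cong refl)
        fix k assume "k \<in> {..<m}"
        then have "k < n" using m by simp
        then show "z k i * cnj (z k j) * w j * cnj (w i)
            = of_real (\<delta> k) * ((Z $$ (i, k) * cnj (w i)) * (cnj (Z $$ (j, k)) * w j))"
          unfolding zz[OF \<open>k < n\<close>] by (simp add: mult_ac)
      qed
      finally show "A m $$ (i, j) * w j * cnj (w i) = unitary_diag n U d $$ (i, j) * w j * cnj (w i)
        + (\<Sum>k<m. of_real (\<delta> k) * ((Z $$ (i, k) * cnj (w i)) * (cnj (Z $$ (j, k)) * w j)))" .
    qed
    also have "\<dots> = herm_form n (unitary_diag n U d) w
        + (\<Sum>i<n. \<Sum>k<m. \<Sum>j<n. of_real (\<delta> k) * ((Z $$ (i, k) * cnj (w i)) * (cnj (Z $$ (j, k)) * w j)))"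
      unfolding herm_form_def sum.distrib by (intro arg_cong2[where f = "(+)"] refl sum.cong sum.swap)
    also have "(\<Sum>i<n. \<Sum>k<m. \<Sum>j<n. of_real (\<delta> k) * ((Z $$ (i, k) * cnj (w i)) * (cnj (Z $$ (j, k)) * w j)))
        = (\<Sum>k<m. \<Sum>i<n. \<Sum>j<n. of_real (\<delta> k) * ((Z $$ (i, k) * cnj (w i)) * (cnj (Z $$ (j, k)) * w j)))"
      by (rule sum.swap)
    also have "\<dots> = (\<Sum>k<m. of_real (\<delta> k) * (cnj (coords n Z w k) * coords n Z w k))"
      by (intro sum.cong refl) (simp only: coords_def cnj_sum complex_cnj_mult complex_cnj_cnj
          sum_distrib_left[symmetric] sum_distrib_right[symmetric])
    also have "\<dots> = of_real (\<Sum>k<m. \<delta> k * (cmod (coords n Z w k))\<^sup>2)"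
      unfolding of_real_sum by (intro sum.cong refl) (simp only: of_real_mult complex_norm_square mult.commute[of "cnj _"])
    finally show ?thesis by (simp add: herm_form_unitary_diag[OF U(1)])
  qed
  define lo hi where "lo = Min (d ` {..<n})" and "hi = Max (e ` {..<n})"
  have lohi: "lo \<in> d ` {..<n}" "hi \<in> e ` {..<n}" unfolding lo_def hi_def using n by (auto intro!: Min_in Max_in)
  have "lo \<in> I" "hi \<in> I" using d e lohi by auto
  then have Icc: "{lo..hi} \<subseteq> I" by (rule Icc_subset[OF I(2)])
  \<comment> \<open>An eigenvalue of \<open>A m\<close> is the value of its form at a unit vector,
    so it lies between the smallest \<open>d\<close> and the largest \<open>e\<close>, and the
    interval between these is contained in \<open>I\<close>.\<close>
  have inI: "c k \<in> I" if m: "m \<le> n" and T: "T \<in> carrier_mat n n" "unitary_mat T" "A m = unitary_diag n T c" and k: "k < n"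
    for m T c k
  proof -
    let ?w = "\<lambda>i. T $$ (i, k)"
    note w = unitary_column_norm[OF T(1,2) k]
    have "complex_of_real (c k) = herm_form n (A m) ?w"
      unfolding T(3) herm_form_unitary_diag[OF T(1)] diag_form_column[OF T(1,2) k] ..
    then have c: "c k = diag_form n U d ?w + (\<Sum>k<m. \<delta> k * (cmod (coords n Z ?w k))\<^sup>2)"
      unfolding formA[OF m] by (simp only: of_real_eq_iff)
    have "0 \<le> (\<Sum>k<m. \<delta> k * (cmod (coords n Z ?w k))\<^sup>2)" using \<delta> m by (intro sum_nonneg mult_nonneg_nonneg) auto
    moreover have "(\<Sum>k<m. \<delta> k * (cmod (coords n Z ?w k))\<^sup>2) \<le> diag_form n Z \<delta> ?w"
      unfolding diag_form_def using \<delta> m by (intro sum_mono2 mult_nonneg_nonneg) auto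
    moreover have "lo \<le> diag_form n U d ?w"
      by (rule diag_form_bounds(1)[OF U _ w, where hi = "Max (d ` {..<n})"]) (auto simp: lo_def)
    moreover have "diag_form n V e ?w \<le> hi"
      by (rule diag_form_bounds(2)[OF V _ w, where lo = "Min (e ` {..<n})"]) (auto simp: hi_def)
    ultimately have "c k \<in> {lo..hi}" unfolding c form by simp
    then show ?thesis using Icc by blast
  qed
  \<comment> \<open>The claim is made for every diagonalisation of \<open>A m\<close>, since those
    of the intermediate matrices come from an existence theorem.\<close>
  have "diag_form n U (\<lambda>k. f (d k)) w \<le> diag_form n T (\<lambda>k. f (c k)) w"
    if "m \<le> n" "T \<in> carrier_mat n n" "unitary_mat T" "A m = unitary_diag n T c" for m T c
    using that
  proof (induction m arbitrary: T c)
    case 0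
    have "A 0 = unitary_diag n U d" using cU by (intro eq_matI) (auto simp: A_def)
    then have eq: "unitary_diag n U (\<lambda>k. f (d k)) = unitary_diag n T (\<lambda>k. f (c k))"
      using unitary_diag_fun_unique[OF U 0(2,3)] 0(4) by simp
    have "complex_of_real (diag_form n U (\<lambda>k. f (d k)) w) = of_real (diag_form n T (\<lambda>k. f (c k)) w)"
      unfolding herm_form_unitary_diag[OF U(1), symmetric] herm_form_unitary_diag[OF 0(2), symmetric] eq ..
    then show ?case by (simp only: of_real_eq_iff order_refl)
  next
    case (Suc m)
    have m: "m \<le> n" using Suc.prems(1) by simp
    obtain T' c' where T': "T' \<in> carrier_mat n n" "unitary_mat T'" "A m = unitary_diag n T' c'"
      using hermitian_unitary_diagonalization[OF A adjA, of m] by (elim exE conjE)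
    have "diag_form n U (\<lambda>k. f (d k)) w \<le> diag_form n T' (\<lambda>k. f (c' k)) w" by (rule Suc.IH[OF m T'])
    also have "\<dots> \<le> diag_form n T (\<lambda>k. f (c k)) w"
    proof (rule rank_one_le[OF f I n T'(1,2) Suc.prems(2,3), where z = "z m"])
      fix i j assume "i < n" "j < n"
      then show "unitary_diag n T c $$ (i, j) = unitary_diag n T' c' $$ (i, j) + z m i * cnj (z m j)"
        unfolding Suc.prems(4)[symmetric] T'(3)[symmetric] by (simp add: A_def)
    next
      fix i assume i: "i < n"
      show "c' i \<in> I \<and> c i \<in> I" using inI[OF m T' i] inI[OF Suc.prems i] by simp
    qed
    finally show ?case .
  qed
  then show "diag_form n U (\<lambda>k. f (d k)) w \<le> diag_form n V (\<lambda>k. f (e k)) w" using An V by blast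
qed

section \<open>The equivalent conditions\<close>

lemma doubled_squares_iff_sequences:
  "doubled_squares n I f \<longleftrightarrow> (\<forall>x :: nat \<Rightarrow> real. strict_mono_on {1..n} x \<and> x ` {1..n} \<subseteq> I \<longrightarrow>
     (\<forall>q. degree q \<le> n - 1 \<longrightarrow> 0 \<le> dd2 (x ` {1..n}) {} (\<lambda>t. f t * (poly q t)\<^sup>2)))"
proof (intro iffI allI impI)
  fix x :: "nat \<Rightarrow> real" and q :: "real poly"
  assume "doubled_squares n I f" and x: "strict_mono_on {1..n} x \<and> x ` {1..n} \<subseteq> I" and "degree q \<le> n - 1"
  moreover have "card (x ` {1..n}) = n" using card_image[OF strict_mono_on_imp_inj_on, of "{1..n}" x] x by simp
  ultimately show "0 \<le> dd2 (x ` {1..n}) {} (\<lambda>t. f t * (poly q t)\<^sup>2)" unfolding doubled_squares_def by blast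
next
  assume R: "\<forall>x :: nat \<Rightarrow> real. strict_mono_on {1..n} x \<and> x ` {1..n} \<subseteq> I \<longrightarrow>
     (\<forall>q. degree q \<le> n - 1 \<longrightarrow> 0 \<le> dd2 (x ` {1..n}) {} (\<lambda>t. f t * (poly q t)\<^sup>2))"
  show "doubled_squares n I f"
    unfolding doubled_squares_def
  proof (intro allI impI, elim conjE)
    fix A and q :: "real poly" assume A: "finite A" "card A = n" "A \<subseteq> I" and q: "degree q \<le> n - 1"
    define xs where "xs = sorted_list_of_set A"
    have xs: "set xs = A" "length xs = n" "sorted_wrt (<) xs" using A by (auto simp: xs_def)
    define x where "x i = xs ! (i - 1)" for i
    have xA: "x ` {1..n} = A"
    proof -
      have "x ` {1..n} = (!) xs ` ((\<lambda>i. i - 1) ` {1..n})" by (simp add: x_def image_image)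
      also have "(\<lambda>i :: nat. i - 1) ` {1..n} = {0..<n}" by (force simp: image_iff intro: bexI[of _ "Suc _"])
      also have "(!) xs ` {0..<n} = A" unfolding xs(1)[symmetric] set_conv_nth xs(2) by auto
      finally show ?thesis .
    qed
    have "strict_mono_on {1..n} x"
    proof (rule strict_mono_onI)
      fix r s :: nat assume "r \<in> {1..n}" "s \<in> {1..n}" "r < s"
      then show "x r < x s"
        unfolding x_def using sorted_wrt_nth_less[OF xs(3), of "r - 1" "s - 1"] xs(2) by auto
    qed
    then show "0 \<le> dd2 A {} (\<lambda>t. f t * (poly q t)\<^sup>2)"
      using R[rule_format, of x, OF _ q] A(3) unfolding xA by simp
  qed
qed

lemma condition_4_iff:
  assumes C1: "C_k_on 1 I f"
  shows "(\<forall>(x :: nat \<Rightarrow> real) (q :: complex poly).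
      strict_mono_on {1..n} x \<and> x ` {1..n} \<subseteq> I \<and> degree q \<le> n - 1 \<longrightarrow>
      0 \<le> divdiff (concat (map (\<lambda>i. [x i, x i]) [1..<n+1])) (\<lambda>t. f t * poly (poly_N q) t))
    \<longleftrightarrow> doubled_squares n I f"
  unfolding doubled_squares_iff_sequences
proof (intro iffI allI impI; (elim conjE)?)
  fix x :: "nat \<Rightarrow> real" and q :: "real poly"
  assume L: "\<forall>(x :: nat \<Rightarrow> real) (q :: complex poly).
      strict_mono_on {1..n} x \<and> x ` {1..n} \<subseteq> I \<and> degree q \<le> n - 1 \<longrightarrow>
      0 \<le> divdiff (concat (map (\<lambda>i. [x i, x i]) [1..<n+1])) (\<lambda>t. f t * poly (poly_N q) t)"
    and x: "strict_mono_on {1..n} x" "x ` {1..n} \<subseteq> I" and q: "degree q \<le> n - 1"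
  have "degree (map_poly complex_of_real q) \<le> n - 1" using q degree_map_poly_le order_trans by blast
  with L x have "0 \<le> divdiff (concat (map (\<lambda>i. [x i, x i]) [1..<n+1])) (\<lambda>t. f t * poly (poly_N (map_poly of_real q)) t)"
    by blast
  then show "0 \<le> dd2 (x ` {1..n}) {} (\<lambda>t. f t * (poly q t)\<^sup>2)"
    unfolding divdiff_doubled[OF strict_mono_on_imp_inj_on[OF x(1)]] poly_poly_N_of_real .
next
  fix x :: "nat \<Rightarrow> real" and q :: "complex poly"
  assume R: "\<forall>x :: nat \<Rightarrow> real. strict_mono_on {1..n} x \<and> x ` {1..n} \<subseteq> I \<longrightarrow>
     (\<forall>q. degree q \<le> n - 1 \<longrightarrow> 0 \<le> dd2 (x ` {1..n}) {} (\<lambda>t. f t * (poly q t)\<^sup>2))"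
    and x: "strict_mono_on {1..n} x" "x ` {1..n} \<subseteq> I" and q: "degree q \<le> n - 1"
  have deg: "degree (map_poly Re q) \<le> n - 1" "degree (map_poly Im q) \<le> n - 1"
    using q degree_map_poly_le order_trans by blast+
  have diff: "f differentiable (at c)" if "c \<in> x ` {1..n}" for c
    by (rule C_1_differentiable[OF C1]) (use that x(2) in blast)
  have "dd2 (x ` {1..n}) {} (\<lambda>t. f t * poly (poly_N q) t)
      = dd2 (x ` {1..n}) {} (\<lambda>t. f t * (poly (map_poly Re q) t)\<^sup>2) + dd2 (x ` {1..n}) {} (\<lambda>t. f t * (poly (map_poly Im q) t)\<^sup>2)"
    unfolding poly_poly_N distrib_left by (intro dd2_add differentiable_mult_square diff)
  moreover have "0 \<le> dd2 (x ` {1..n}) {} (\<lambda>t. f t * (poly (map_poly Re q) t)\<^sup>2)"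
    "0 \<le> dd2 (x ` {1..n}) {} (\<lambda>t. f t * (poly (map_poly Im q) t)\<^sup>2)"
    using R[rule_format, of x] x deg by blast+
  ultimately show "0 \<le> divdiff (concat (map (\<lambda>i. [x i, x i]) [1..<n+1])) (\<lambda>t. f t * poly (poly_N q) t)"
    unfolding divdiff_doubled[OF strict_mono_on_imp_inj_on[OF x(1)]] by simp
qed

text \<open>The \<open>i\<close>-th basis polynomial is the product over the points of
  \<open>A\<close> missing in \<open>us i\<close>. One point per list gives the unnormalised
  Lagrange basis, and initial segments give a Newton basis.\<close>

lemma doubled_squares_iff_psd_mat:
  fixes us :: "nat \<Rightarrow> real list"
  assumes A: "finite A" and f: "\<And>a. a \<in> A \<Longrightarrow> f differentiable (at a)"
    and us: "\<And>i. i < n \<Longrightarrow> distinct (us i) \<and> set (us i) \<subseteq> A"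
    and deg: "\<And>i. i < n \<Longrightarrow> card (A - set (us i)) \<le> n - 1"
    and span: "\<And>q. degree q \<le> n - 1 \<Longrightarrow> \<exists>c. \<forall>t. poly q t = (\<Sum>i<n. c i * poly (\<Prod>b\<in>A - set (us i). [:- b, 1:]) t)"
  shows "psd_mat (Matrix.mat n n (\<lambda>(i, j). divdiff (us i @ us j) f))
    \<longleftrightarrow> (\<forall>q. degree q \<le> n - 1 \<longrightarrow> 0 \<le> dd2 A {} (\<lambda>t. f t * (poly q t)\<^sup>2))"
proof -
  let ?p = "\<lambda>i. \<Prod>b\<in>A - set (us i). [:- b, 1:]"
  have entry: "divdiff (us i @ us j) f = dd2 A {} (\<lambda>t. f t * (poly (?p i) t * poly (?p j) t))"
    if ij: "i < n" "j < n" for i j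
  proof -
    have "poly (?p i) = (\<lambda>t. \<Prod>b\<in>A - set (us i). t - b)" for i by (simp add: poly_prod fun_eq_iff)
    then show ?thesis
      using divdiff_eq_dd2_complement[OF A _ _ _ _ f, of "us i" "us j"] us[OF ij(1)] us[OF ij(2)] by simp
  qed
  have "psd_mat (Matrix.mat n n (\<lambda>(i, j). divdiff (us i @ us j) f))
      \<longleftrightarrow> (\<forall>c. 0 \<le> (\<Sum>i<n. \<Sum>j<n. divdiff (us i @ us j) f * (c i * c j)))"
    by (rule psd_mat_real_iff) (simp add: entry mult.commute)
  also have "\<dots> \<longleftrightarrow> (\<forall>c. 0 \<le> (\<Sum>i<n. \<Sum>j<n. dd2 A {} (\<lambda>t. f t * (poly (?p i) t * poly (?p j) t)) * (c i * c j)))"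
    by (intro all_cong1 arg_cong[where f = "(\<le>) 0"] sum.cong refl) (simp add: entry)
  also have "\<dots> \<longleftrightarrow> (\<forall>q. degree q \<le> n - 1 \<longrightarrow> 0 \<le> dd2 A {} (\<lambda>t. f t * (poly q t)\<^sup>2))"
    by (rule doubled_squares_iff_form[symmetric, OF f _ span])
      (use deg in \<open>simp_all add: monic_prod_linear[of "\<lambda>b. b", simplified]\<close>)
  finally show ?thesis .
qed

lemma condition_5_iff:
  assumes C1: "C_k_on 1 I f" and n: "1 \<le> n"
  shows "(\<forall>x :: nat \<Rightarrow> real. strict_mono_on {1..n} x \<and> x ` {1..n} \<subseteq> I \<longrightarrow>
      psd_mat (Matrix.mat n n (\<lambda>(i, j). divdiff [x (i+1), x (j+1)] f))) \<longleftrightarrow> doubled_squares n I f"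
  unfolding doubled_squares_iff_sequences
proof (intro all_cong1 imp_cong refl, elim conjE)
  fix x :: "nat \<Rightarrow> real" assume x: "strict_mono_on {1..n} x" "x ` {1..n} \<subseteq> I"
  define y where "y i = x (i + 1)" for i
  have inj: "inj_on x {1..n}" by (rule strict_mono_on_imp_inj_on[OF x(1)])
  have y: "inj_on y {..<n}"
  proof (rule inj_onI)
    fix i j assume "i \<in> {..<n}" "j \<in> {..<n}" "y i = y j"
    then have "i + 1 = j + 1" by (intro inj_onD[OF inj]) (simp_all add: y_def)
    then show "i = j" by simp
  qed
  have A: "x ` {1..n} = y ` {..<n}"
  proof -
    have "{1..n} = Suc ` {..<n}" by (simp add: image_Suc_lessThan)
    then show ?thesis by (simp add: y_def image_image)
  qed
  have rem: "y ` {..<n} - {y i} = y ` ({..<n} - {i})" if "i < n" for i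
    using inj_on_image_set_diff[OF y, of "{..<n}" "{i}"] that by auto
  have "psd_mat (Matrix.mat n n (\<lambda>(i, j). divdiff ((\<lambda>i. [y i]) i @ (\<lambda>i. [y i]) j) f))
      \<longleftrightarrow> (\<forall>q. degree q \<le> n - 1 \<longrightarrow> 0 \<le> dd2 (x ` {1..n}) {} (\<lambda>t. f t * (poly q t)\<^sup>2))"
  proof (rule doubled_squares_iff_psd_mat)
    show "f differentiable (at a)" if "a \<in> x ` {1..n}" for a
      by (rule C_1_differentiable[OF C1]) (use that x(2) in blast)
    fix q :: "real poly" assume "degree q \<le> n - 1"
    from lagrange_basis_spans[OF y n this] obtain c
      where c: "\<forall>t. poly q t = (\<Sum>i<n. c i * poly (\<Prod>j\<in>{..<n} - {i}. [:- y j, 1:]) t)" ..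
    have "(\<Prod>b\<in>x ` {1..n} - set [y i]. [:- b, 1:]) = (\<Prod>j\<in>{..<n} - {i}. [:- y j, 1:])" if "i < n" for i
    proof -
      have "inj_on y ({..<n} - {i})" by (rule inj_on_subset[OF y]) auto
      then show ?thesis unfolding A using rem[OF that] by (simp add: prod.reindex)
    qed
    then show "\<exists>c. \<forall>t. poly q t = (\<Sum>i<n. c i * poly (\<Prod>b\<in>x ` {1..n} - set [y i]. [:- b, 1:]) t)"
      using c by (intro exI[of _ c]) simp
  next
    fix i assume i: "i < n"
    have "card (y ` ({..<n} - {i})) \<le> n - 1" using card_image_le[of "{..<n} - {i}" y] i by simp
    then show "card (x ` {1..n} - set [y i]) \<le> n - 1" unfolding A using rem[OF i] by simp
    show "distinct [y i] \<and> set [y i] \<subseteq> x ` {1..n}" unfolding A using i by simp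
  qed simp
  then show "psd_mat (Matrix.mat n n (\<lambda>(i, j). divdiff [x (i+1), x (j+1)] f))
      \<longleftrightarrow> (\<forall>q. degree q \<le> n - 1 \<longrightarrow> 0 \<le> dd2 (x ` {1..n}) {} (\<lambda>t. f t * (poly q t)\<^sup>2))"
    by (simp add: y_def)
qed

lemma condition_6_iff:
  assumes C1: "C_k_on 1 I f" and n: "1 \<le> n"
  shows "(\<forall>x :: nat \<Rightarrow> real. strict_mono_on {1..n} x \<and> x ` {1..n} \<subseteq> I \<longrightarrow>
      psd_mat (Matrix.mat n n (\<lambda>(i, j). divdiff (map x [1..<(i+1)+1] @ map x [1..<(j+1)+1]) f)))
    \<longleftrightarrow> doubled_squares n I f"
  unfolding doubled_squares_iff_sequences
proof (intro all_cong1 imp_cong refl, elim conjE)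
  fix x :: "nat \<Rightarrow> real" assume x: "strict_mono_on {1..n} x" "x ` {1..n} \<subseteq> I"
  have inj: "inj_on x {1..n}" by (rule strict_mono_on_imp_inj_on[OF x(1)])
  let ?us = "\<lambda>i. map x [1..<(i+1)+1]"
  have us: "set (?us i) = x ` {1..i+1}" for i
  proof -
    have "{1..<(i+1)+1} = {1..i+1}" by auto
    then show ?thesis by (simp only: set_map set_upt)
  qed
  have rem: "x ` {1..n} - x ` {1..i+1} = x ` {i+2..n}" if "i < n" for i
  proof -
    have "x ` ({1..n} - {1..i+1}) = x ` {1..n} - x ` {1..i+1}"
      by (rule inj_on_image_set_diff[OF inj]) (use that in auto)
    moreover have "{1..n} - {1..i+1} = {i+2..n}" by auto
    ultimately show ?thesis by simp
  qed
  have card: "card (x ` {1..n} - set (?us i)) = n - 1 - i" if "i < n" for i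
  proof -
    have "inj_on x {i+2..n}" by (rule inj_on_subset[OF inj]) auto
    then show ?thesis unfolding us rem[OF that] using that by (simp add: card_image)
  qed
  show "psd_mat (Matrix.mat n n (\<lambda>(i, j). divdiff (?us i @ ?us j) f))
      \<longleftrightarrow> (\<forall>q. degree q \<le> n - 1 \<longrightarrow> 0 \<le> dd2 (x ` {1..n}) {} (\<lambda>t. f t * (poly q t)\<^sup>2))"
  proof (rule doubled_squares_iff_psd_mat[where us = ?us])
    show "f differentiable (at a)" if "a \<in> x ` {1..n}" for a
      by (rule C_1_differentiable[OF C1]) (use that x(2) in blast)
    fix q :: "real poly" assume q: "degree q \<le> n - 1"
    let ?p = "\<lambda>i. \<Prod>b\<in>x ` {1..n} - set (?us i). [:- b, 1:]"
    have p: "degree (?p i) = n - 1 - i" "lead_coeff (?p i) = 1" if "i < n" for i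
      using monic_prod_linear[of "\<lambda>b. b" "x ` {1..n} - set (?us i)"] card[OF that] by simp_all
    \<comment> \<open>The longer the initial segment, the fewer points are missing:
      \<open>?p i\<close> has degree \<open>n - 1 - i\<close>. The order is reversed for
      \<open>newton_basis_spans\<close>.\<close>
    have "\<exists>c. \<forall>t. poly q t = (\<Sum>i<n. c i * poly (?p (n - Suc i)) t)"
    proof (rule newton_basis_spans)
      show "\<forall>i\<ge>n. coeff q i = 0" using q n by (auto intro!: coeff_eq_0)
      show "degree (?p (n - Suc i)) = i" "lead_coeff (?p (n - Suc i)) = 1" if "i < n" for i
        using p[of "n - Suc i"] that by simp_all
    qed
    then obtain c where c: "\<forall>t. poly q t = (\<Sum>i<n. c i * poly (?p (n - Suc i)) t)" ..
    have "poly q t = (\<Sum>i<n. c (n - Suc i) * poly (?p i) t)" for t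
    proof -
      have "(\<Sum>i<n. c i * poly (?p (n - Suc i)) t) = (\<Sum>i<n. c (n - Suc (n - Suc i)) * poly (?p (n - Suc i)) t)"
        by (intro sum.cong refl arg_cong2[where f = times] arg_cong[where f = c]) simp
      also have "\<dots> = (\<Sum>i<n. c (n - Suc i) * poly (?p i) t)"
        by (rule sum.nat_diff_reindex[where g = "\<lambda>i. c (n - Suc i) * poly (?p i) t"])
      finally show ?thesis using c by simp
    qed
    then show "\<exists>c. \<forall>t. poly q t = (\<Sum>i<n. c i * poly (?p i) t)" by (intro exI allI)
  next
    fix i assume i: "i < n"
    show "card (x ` {1..n} - set (?us i)) \<le> n - 1" unfolding card[OF i] by simp
    have "inj_on x {1..i+1}" by (rule inj_on_subset[OF inj]) (use i in auto)
    then have "distinct (?us i)" by (simp only: distinct_map distinct_upt set_upt atLeastLessThanSuc_atLeastAtMost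
          Suc_eq_plus1[symmetric] simp_thms)
    moreover have "set (?us i) \<subseteq> x ` {1..n}" unfolding us using i by auto
    ultimately show "distinct (?us i) \<and> set (?us i) \<subseteq> x ` {1..n}" ..
  qed simp
qed

lemma AE_lborel_on_iff: "(AE t in lborel. t \<in> I \<longrightarrow> P t) \<longleftrightarrow> negligible {t \<in> I. \<not> P t}" for I :: "real set"
  unfolding AE_lborel_iff_negligible by simp

lemma condition_7_iff:
  assumes I: "open I" "is_interval I" and n: "2 \<le> n"
  shows "C_k_on (2*n-3) I f \<and> convex_on I ((deriv ^^ (2*n-3)) f) \<and>
        (\<forall>q :: complex poly. degree q \<le> n - 1 \<longrightarrow>
           (AE t in lborel. t \<in> I \<longrightarrow>
              (\<exists>D. nth_deriv (2*n-1) I (\<lambda>s. f s * poly (poly_N q) s) t = Some D \<and> 0 \<le> D)))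
    \<longleftrightarrow> tone_squares n I f"
proof -
  define k where "k = 2*n-3"
  have k: "2*n-1 = Suc (Suc k)" "2*n-3 = k" "k + 2 = Suc (Suc k)" using n by (simp_all add: k_def)
  show ?thesis
    unfolding AE_lborel_on_iff
  proof (intro iffI conjI allI impI)
    fix q :: "complex poly" assume f: "tone_squares n I f" and q: "degree q \<le> n - 1"
    have "tone (k + 2) I (\<lambda>t. f t * poly (poly_N q) t)" using tone_squares_poly_N[OF f q] by (simp only: k)
    from tone_imp_nth_deriv_nonneg_ae[OF I this]
    show "negligible {t \<in> I. \<not> (\<exists>D. nth_deriv (2*n-1) I (\<lambda>s. f s * poly (poly_N q) s) t = Some D \<and> 0 \<le> D)}"
      by (simp only: k)
  next
    assume L: "C_k_on (2*n-3) I f \<and> convex_on I ((deriv ^^ (2*n-3)) f) \<and>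
        (\<forall>q :: complex poly. degree q \<le> n - 1 \<longrightarrow>
          negligible {t \<in> I. \<not> (\<exists>D. nth_deriv (2*n-1) I (\<lambda>s. f s * poly (poly_N q) s) t = Some D \<and> 0 \<le> D)})"
    show "tone_squares n I f"
      unfolding tone_squares_def
    proof (intro allI impI)
      fix q :: "real poly" assume "degree q \<le> n - 1"
      then have deg: "degree (map_poly complex_of_real q) \<le> n - 1" using degree_map_poly_le order_trans by blast
      have "tone (k + 2) I (\<lambda>t. f t * poly (poly_N (map_poly of_real q)) t)"
      proof (rule tone_if_nth_deriv_nonneg_ae[OF I _ _ poly_poly_N_nonneg])
        show "C_k_on k I f" "convex_on I ((deriv ^^ k) f)" using L unfolding k by auto
        show "negligible {t \<in> I. \<not> (\<exists>D. nth_deriv (Suc (Suc k)) I (\<lambda>s. f s * poly (poly_N (map_poly of_real q)) s) t = Some D \<and> 0 \<le> D)}"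
          using L deg unfolding k by blast
      qed
      then show "tone (2*n-1) I (\<lambda>t. f t * (poly q t)\<^sup>2)" by (simp only: poly_poly_N_of_real k)
    qed
  qed (use tone_squares_imp_smooth[OF I n] in blast)+
qed

lemma condition_8_iff:
  assumes I: "open I" "is_interval I" and n: "2 \<le> n"
  shows "C_k_on (2*n-3) I f \<and> convex_on I ((deriv ^^ (2*n-3)) f) \<and>
        (AE t in lborel. t \<in> I \<longrightarrow>
           (\<forall>k \<in> {1..2*n-1}. t \<in> dom (nth_deriv k I f)) \<and>
           psd_mat (Matrix.mat n n (\<lambda>(i, j).
             let k = (i+1) + (j+1) - 1 in the (nth_deriv k I f t) / fact k)))
    \<longleftrightarrow> tone_squares n I f"
proof -
  have psd: "psd_mat (Matrix.mat n n (\<lambda>(i, j). let k = (i+1) + (j+1) - 1 in the (nth_deriv k I f t) / fact k))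
      \<longleftrightarrow> (\<forall>c. 0 \<le> (\<Sum>i<n. \<Sum>j<n. the (nth_deriv (i + j + 1) I f t) / fact (i + j + 1) * (c i * c j)))" for t
  proof -
    have "(\<lambda>(i, j). let k = (i+1) + (j+1) - 1 in the (nth_deriv k I f t) / fact k)
        = (\<lambda>(i, j). the (nth_deriv (i + j + 1) I f t) / fact (i + j + 1))" by (auto simp: Let_def fun_eq_iff)
    then show ?thesis
      using psd_mat_real_iff[of n "\<lambda>i j. the (nth_deriv (i + j + 1) I f t) / fact (i + j + 1)"]
      by (simp only: add.commute)
  qed
  have square: "poly (q\<^sup>2) t = (poly q t)\<^sup>2" for q :: "real poly" and t by (rule poly_power)
  show ?thesis
    unfolding AE_lborel_on_iff psd
  proof (intro iffI conjI)
    assume f: "tone_squares n I f"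
    show "negligible {t \<in> I. \<not> ((\<forall>k\<in>{1..2*n-1}. t \<in> dom (nth_deriv k I f)) \<and>
      (\<forall>x. 0 \<le> (\<Sum>i<n. \<Sum>j<n. the (nth_deriv (i + j + 1) I f t) / fact (i + j + 1) * (x i * x j))))}"
      by (rule tone_imp_hankel_psd_ae[OF I n]) (use f in \<open>simp only: square tone_squares_def\<close>)
  next
    assume L: "C_k_on (2*n-3) I f \<and> convex_on I ((deriv ^^ (2*n-3)) f) \<and>
      negligible {t \<in> I. \<not> ((\<forall>k\<in>{1..2*n-1}. t \<in> dom (nth_deriv k I f)) \<and>
      (\<forall>x. 0 \<le> (\<Sum>i<n. \<Sum>j<n. the (nth_deriv (i + j + 1) I f t) / fact (i + j + 1) * (x i * x j))))}"
    show "tone_squares n I f"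
      unfolding tone_squares_def
    proof (intro allI impI)
      fix q :: "real poly" assume "degree q \<le> n - 1"
      from tone_if_hankel_psd_ae[OF I n conjunct1[OF L] conjunct1[OF conjunct2[OF L]] conjunct2[OF conjunct2[OF L]] this]
      show "tone (2*n-1) I (\<lambda>t. f t * (poly q t)\<^sup>2)" unfolding square .
    qed
  qed (use tone_squares_imp_smooth[OF I n] in blast)+
qed

lemma n_monotone_iff_tone_squares:
  assumes I: "open I" "is_interval I" and n: "2 \<le> n"
  shows "n_monotone n I f \<longleftrightarrow> tone_squares n I f"
proof
  assume f: "tone_squares n I f"
  have "continuous_on I f"
    using C_1_differentiable[OF tone_squares_imp_smooth(3)[OF I n f]]
    by (intro continuous_at_imp_continuous_on ballI differentiable_imp_continuous_within)
  then show "n_monotone n I f" using tone_squares_imp_n_monotone[OF f _ I] n by simp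
qed (use n_monotone_imp_tone_squares n in simp)

lemma is_interval_einterval: "is_interval (einterval a b)"
  unfolding is_interval_1
proof (intro ballI allI impI, elim conjE)
  fix x y z :: real assume "x \<in> einterval a b" "z \<in> einterval a b" "x \<le> y" "y \<le> z"
  then have "a < ereal x" "ereal x \<le> ereal y" "ereal y \<le> ereal z" "ereal z < b"
    by (auto simp: einterval_def)
  then show "y \<in> einterval a b" unfolding einterval_def using less_le_trans le_less_trans by blast
qed

theorem theorem4p1:
  fixes n :: nat and a b :: ereal and I :: "real set" and f :: "real \<Rightarrow> real"
  assumes "n \<ge> 2" and "a < b" and I: "I = einterval a b"
  shows
    \<comment> \<open>(1) iff (2)\<close>
    "(n_monotone n I f \<longleftrightarrow>
        (\<forall>(x :: nat \<Rightarrow> real) (q :: real poly).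
           strict_mono_on {0..2*n-1} x \<and> x ` {0..2*n-1} \<subseteq> I \<and> degree q \<le> n - 1 \<longrightarrow>
           0 \<le> divdiff (map x [0..<2*n]) (\<lambda>t. f t * (poly q t)\<^sup>2)))
     \<and> \<comment> \<open>(1) iff (3)\<close>
     (n_monotone n I f \<longleftrightarrow>
        (\<forall>(x :: nat \<Rightarrow> real) (q :: complex poly).
           strict_mono_on {0..2*n-1} x \<and> x ` {0..2*n-1} \<subseteq> I \<and> degree q \<le> n - 1 \<longrightarrow>
           0 \<le> divdiff (map x [0..<2*n]) (\<lambda>t. f t * poly (poly_N q) t)))
     \<and> \<comment> \<open>(1) iff (4)\<close>
     (n_monotone n I f \<longleftrightarrow>
        C_k_on 1 I f \<and>
        (\<forall>(x :: nat \<Rightarrow> real) (q :: complex poly).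
           strict_mono_on {1..n} x \<and> x ` {1..n} \<subseteq> I \<and> degree q \<le> n - 1 \<longrightarrow>
           0 \<le> divdiff (concat (map (\<lambda>i. [x i, x i]) [1..<n+1])) (\<lambda>t. f t * poly (poly_N q) t)))
     \<and> \<comment> \<open>(1) iff (5); matrix entries are indexed from 0\<close>
     (n_monotone n I f \<longleftrightarrow>
        C_k_on 1 I f \<and>
        (\<forall>x :: nat \<Rightarrow> real.
           strict_mono_on {1..n} x \<and> x ` {1..n} \<subseteq> I \<longrightarrow>
           psd_mat (Matrix.mat n n (\<lambda>(i, j). divdiff [x (i+1), x (j+1)] f))))
     \<and> \<comment> \<open>(1) iff (6)\<close>
     (n_monotone n I f \<longleftrightarrow>
        C_k_on 1 I f \<and>
        (\<forall>x :: nat \<Rightarrow> real.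
           strict_mono_on {1..n} x \<and> x ` {1..n} \<subseteq> I \<longrightarrow>
           psd_mat (Matrix.mat n n (\<lambda>(i, j).
             divdiff (map x [1..<(i+1)+1] @ map x [1..<(j+1)+1]) f))))
     \<and> \<comment> \<open>(1) iff (7)\<close>
     (n_monotone n I f \<longleftrightarrow>
        C_k_on (2*n-3) I f \<and> convex_on I ((deriv ^^ (2*n-3)) f) \<and>
        (\<forall>q :: complex poly. degree q \<le> n - 1 \<longrightarrow>
           (AE t in lborel. t \<in> I \<longrightarrow>
              (\<exists>D. nth_deriv (2*n-1) I (\<lambda>s. f s * poly (poly_N q) s) t = Some D \<and> 0 \<le> D))))
     \<and> \<comment> \<open>(1) iff (8)\<close>
     (n_monotone n I f \<longleftrightarrow>
        C_k_on (2*n-3) I f \<and> convex_on I ((deriv ^^ (2*n-3)) f) \<and>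
        (AE t in lborel. t \<in> I \<longrightarrow>
           (\<forall>k \<in> {1..2*n-1}. t \<in> dom (nth_deriv k I f)) \<and>
           psd_mat (Matrix.mat n n (\<lambda>(i, j).
             let k = (i+1) + (j+1) - 1 in the (nth_deriv k I f t) / fact k))))"
proof -
  have oI: "open I" "is_interval I" unfolding I by (rule open_einterval, rule is_interval_einterval)
  have n1: "1 \<le> n" using assms(1) by simp
  note mono = n_monotone_iff_tone_squares[OF oI assms(1), of f]
  note doubled = mono[unfolded tone_squares_iff_doubled[OF oI assms(1)]]
  show ?thesis
    unfolding condition_2_iff[OF assms(1)] condition_3_iff[OF assms(1)]
      condition_7_iff[OF oI assms(1)] condition_8_iff[OF oI assms(1)]
    by (intro conjI mono; rule trans[OF doubled]; rule conj_cong[OF refl];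
        (rule condition_4_iff[symmetric] | rule condition_5_iff[symmetric, OF _ n1]
          | rule condition_6_iff[symmetric, OF _ n1]); assumption)
qed

end
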